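(* Let $q\ge 0$ be an integer, let $n\geq 1$ and $m\ge 0$ be integers, and let $f$ be a link invariant with values in an abelian group. If $f$ is a finite-type invariant of order $\le m$, then $f$ is an $(n,q)$-finite invariant of order $\le m$. If $f$ is $(1,q)$-finite of order $\le m$, then $f$ is finite-type of order $\le m$.
   Context: All links are (tame, oriented) links in $S^3$, up to isotopy. Finite type: a link invariant $f$ with values in an abelian group is of finite type of order $\le m$ if for each link diagram $D$ and every collection $(a_1,\dots,a_{m+1})$ of $m+1$ distinct crossings of $D$, one has $\sum_{\vec i}(-1)^{|\vec i|}f(D_{\vec i})=0$, where $\vec i$ ranges over $\mathbb{Z}_2^{m+1}$ (vectors with entries $0,1$), $|\vec i|$ is the number of nonzero coordinates of $\vec i$, and $D_{\vec i}$ is the diagram $D$ with crossing $a_j$ changed whenever the $j$-th coordinate of $\vec i$ is one. $t_{2n,q}$ moves: let $L$ be a link and $D^2$ an embedded disk which $L$ intersects transversely (in its interior), let $U=\partial D^2$ and $q=|\mathrm{lk}(L,U)|$. The complement of $U$ in $S^3$ is a solid torus $T$ with meridional disk $D^2$. A $t_{2,q}$ move on $L$ is the restriction to $L$ of a Dehn twist in $T$ on the disk $D^2$ (of a fixed handedness); that is, it cuts $L$ along $D^2$, inserts a full twist, and reglues. A $t_{2n,q}$ move is the result of $n$ such Dehn twists on $D^2$, i.e. $t_{2n,q}=t_{2,q}^n$. $(n,q)$-finite: for integers $n\ge1$, $q\ge0$, a link invariant $f$ with values in an abelian group is $(n,q)$-finite of order $\le m$ if for all links $L$ and all collections $D^2_1,\dots,D^2_{m+1}$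 of mutually disjoint embedded disks, each meeting $L$ transversely in its interior, with $\partial D_j^2=U_j$ and $q_j=\mathrm{lk}(U_j,L)\equiv 0 \pmod q$ for every $j$ (when $q=0$ this means $q_j=0$), one has $\sum_{\vec i}(-1)^{|\vec i|}f(L_{\vec i})=0$, where $\vec i$ ranges over $\mathbb{Z}_2^{m+1}$ and $L_{\vec i}$ is obtained from $L$ by performing a $t_{2n,q_j}$ move on the disk bounded by $U_j$ for each $j$ such that the $j$-th coordinate of $\vec i$ is one. *)

theory Defs
  imports "HOL-Analysis.Analysis"
begin

text \<open>Tame links are modelled in the \<open>C\<^sup>1\<close> category: every tame link in the 3-sphere is ambient
  isotopic to a regular \<open>C\<^sup>1\<close> link, and every regular \<open>C\<^sup>1\<close> link is tame. Isotopy itself is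
  topological ambient isotopy. The 3-sphere is the unit sphere of 4-space.\<close>

abbreviation S3 :: "(real^4) set" where
  "S3 \<equiv> sphere 0 1"

text \<open>A system of closed curves is a list of 1-periodic functions on the line; a point of the
  underlying union of circles is a pair (component, parameter in \<open>{0..<1}\<close>).\<close>

definition params :: "(real \<Rightarrow> 'b) list \<Rightarrow> (nat \<times> real) set" where
  "params c = {..<length c} \<times> {0..<1}"

definition pt :: "(real \<Rightarrow> 'b) list \<Rightarrow> nat \<times> real \<Rightarrow> 'b" where
  "pt c p = (c ! fst p) (snd p)"

definition velocity :: "(real \<Rightarrow> 'b::real_normed_vector) list \<Rightarrow> nat \<times> real \<Rightarrow> 'b" where
  "velocity c p = vector_derivative (c ! fst p) (at (snd p))"

definition closed_C1 :: "(real \<Rightarrow> 'b::real_normed_vector) \<Rightarrow> bool" where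
  "closed_C1 \<gamma> \<longleftrightarrow> \<gamma> C1_differentiable_on UNIV \<and> (\<forall>t. \<gamma> (t + 1) = \<gamma> t)"

definition immersed :: "(real \<Rightarrow> 'b::real_normed_vector) list \<Rightarrow> bool" where
  "immersed c \<longleftrightarrow> (\<forall>\<gamma>\<in>set c. closed_C1 \<gamma>) \<and> (\<forall>p\<in>params c. velocity c p \<noteq> 0)"

type_synonym link = "(real \<Rightarrow> real^4) list"

definition is_link :: "link \<Rightarrow> bool" where
  "is_link L \<longleftrightarrow> immersed L \<and> pt L ` params L \<subseteq> S3 \<and> inj_on (pt L) (params L)"


definition ambient_isotopy :: "(real \<Rightarrow> real^4 \<Rightarrow> real^4) \<Rightarrow> bool" where
  "ambient_isotopy H \<longleftrightarrow>
     continuous_on ({0..1} \<times> S3) (\<lambda>(s, x). H s x) \<and>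
     (\<forall>s\<in>{0..1}. \<exists>g. homeomorphism S3 S3 (H s) g) \<and>
     (\<forall>x\<in>S3. H 0 x = x)"

text \<open>Lifts to the line of the orientation-preserving homeomorphisms of the circle.\<close>

definition oriented_reparam :: "(real \<Rightarrow> real) \<Rightarrow> bool" where
  "oriented_reparam \<theta> \<longleftrightarrow>
     continuous_on UNIV \<theta> \<and> strict_mono \<theta> \<and> (\<forall>t. \<theta> (t + 1) = \<theta> t + 1)"

text \<open>Components are unordered, hence the permutation.\<close>

definition isotopic :: "link \<Rightarrow> link \<Rightarrow> bool" where
  "isotopic L L' \<longleftrightarrow> length L = length L' \<and>
     (\<exists>H \<sigma>. ambient_isotopy H \<and> bij_betw \<sigma> {..<length L} {..<length L'} \<and>
        (\<forall>i<length L. \<exists>\<theta>. oriented_reparam \<theta> \<and>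
           (\<forall>t. H 1 ((L ! i) t) = (L' ! \<sigma> i) (\<theta> t))))"

definition link_invariant :: "(link \<Rightarrow> 'a) \<Rightarrow> bool" where
  "link_invariant f \<longleftrightarrow>
     (\<forall>L L'. is_link L \<longrightarrow> is_link L' \<longrightarrow> isotopic L L' \<longrightarrow> f L = f L')"

text \<open>A 0-1 vector is represented by the set of indices where it is 1.\<close>

definition alternating_sum :: "'i set \<Rightarrow> ('i set \<Rightarrow> 'a::ab_group_add) \<Rightarrow> 'a" where
  "alternating_sum A F = (\<Sum>S\<in>Pow A. if even (card S) then F S else - F S)"


text \<open>A diagram is an immersed curve system \<open>P\<close> in the plane, whose multiple points are transverse
  double points, together with a function \<open>ov\<close> selecting the over-strand at each double point.
  Finiteness of the set of double points is automatic by compactness.\<close>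

definition regular_projection :: "(real \<Rightarrow> complex) list \<Rightarrow> bool" where
  "regular_projection P \<longleftrightarrow> immersed P \<and>
     (\<forall>p\<in>params P. \<forall>p'\<in>params P. p \<noteq> p' \<longrightarrow> pt P p = pt P p' \<longrightarrow>
        independent {velocity P p, velocity P p'} \<and> velocity P p \<noteq> velocity P p') \<and>
     (\<forall>p\<in>params P. \<forall>p'\<in>params P. \<forall>p''\<in>params P. pt P p = pt P p' \<longrightarrow> pt P p' = pt P p'' \<longrightarrow>
        p = p' \<or> p' = p'' \<or> p = p'')"

definition crossings :: "(real \<Rightarrow> complex) list \<Rightarrow> complex set" where
  "crossings P = {x. \<exists>p\<in>params P. \<exists>p'\<in>params P. p \<noteq> p' \<and> pt P p = x \<and> pt P p' = x}"

definition is_diagram :: "(real \<Rightarrow> complex) list \<Rightarrow> (complex \<Rightarrow> nat \<times> real) \<Rightarrow> bool" where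
  "is_diagram P ov \<longleftrightarrow> regular_projection P \<and>
     (\<forall>x\<in>crossings P. ov x \<in> params P \<and> pt P (ov x) = x)"

definition change_crossings ::
  "(real \<Rightarrow> complex) list \<Rightarrow> complex set \<Rightarrow> (complex \<Rightarrow> nat \<times> real) \<Rightarrow> complex \<Rightarrow> nat \<times> real" where
  "change_crossings P S ov x =
     (if x \<in> S then THE p. p \<in> params P \<and> pt P p = x \<and> p \<noteq> ov x else ov x)"

text \<open>Inverse stereographic projection, identifying 3-space (plane times height) with the
  complement of a point of the 3-sphere.\<close>

definition stereo :: "complex \<times> real \<Rightarrow> real^4" where
  "stereo = (\<lambda>(z, h). let r = (cmod z)\<^sup>2 + h\<^sup>2 in
     (1 / (r + 1)) *\<^sub>R vector [2 * Re z, 2 * Im z, 2 * h, r - 1])"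

definition has_diagram ::
  "link \<Rightarrow> (real \<Rightarrow> complex) list \<Rightarrow> (complex \<Rightarrow> nat \<times> real) \<Rightarrow> bool" where
  "has_diagram L P ov \<longleftrightarrow>
     (\<exists>h. length h = length P \<and> (\<forall>\<eta>\<in>set h. closed_C1 \<eta>) \<and>
        (\<forall>p\<in>params P. pt P p \<in> crossings P \<longrightarrow> p \<noteq> ov (pt P p) \<longrightarrow>
           pt h p < pt h (ov (pt P p))) \<and>
        L = map2 (\<lambda>\<gamma> \<eta> t. stereo (\<gamma> t, \<eta> t)) P h)"

text \<open>The value of an invariant on a diagram is its value on any link having that diagram; all such
  links are isotopic.\<close>

definition finite_type :: "nat \<Rightarrow> (link \<Rightarrow> 'a::ab_group_add) \<Rightarrow> bool" where
  "finite_type m f \<longleftrightarrow>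
     (\<forall>P ov X L. is_diagram P ov \<longrightarrow> X \<subseteq> crossings P \<longrightarrow> card X = m + 1 \<longrightarrow>
        (\<forall>S\<subseteq>X. has_diagram (L S) P (change_crossings P S ov)) \<longrightarrow>
        alternating_sum X (\<lambda>S. f (L S)) = 0)"


definition C1_on :: "'b::euclidean_space set \<Rightarrow> ('b \<Rightarrow> 'c::real_normed_vector) \<Rightarrow> bool" where
  "C1_on W g \<longleftrightarrow> g differentiable_on W \<and>
     (\<forall>v. continuous_on W (\<lambda>x. frechet_derivative g (at x) v))"

definition embedded_disk :: "(complex \<Rightarrow> real^4) \<Rightarrow> bool" where
  "embedded_disk e \<longleftrightarrow>
     (\<exists>W. open W \<and> cball 0 1 \<subseteq> W \<and> e ` W \<subseteq> S3 \<and> inj_on e W \<and> C1_on W e \<and>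
        (\<forall>z\<in>W. inj (frechet_derivative e (at z))))"

text \<open>At a point where \<open>L\<close> passes through \<open>e z\<close>, the determinant of the outward normal of the
  sphere, an oriented basis of the tangent plane of the disk, and the velocity of \<open>L\<close>. It is nonzero
  iff the intersection is transverse, and its sign is then the intersection sign.\<close>

definition intersection_det ::
  "link \<Rightarrow> (complex \<Rightarrow> real^4) \<Rightarrow> nat \<times> real \<Rightarrow> complex \<Rightarrow> real" where
  "intersection_det L e p z = det (vector
     [e z, frechet_derivative e (at z) 1, frechet_derivative e (at z) \<i>, velocity L p] :: real^4^4)"

definition intersections ::
  "link \<Rightarrow> (complex \<Rightarrow> real^4) \<Rightarrow> ((nat \<times> real) \<times> complex) set" where
  "intersections L e = {(p, z). p \<in> params L \<and> z \<in> cball 0 1 \<and> pt L p = e z}"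

definition transverse :: "link \<Rightarrow> (complex \<Rightarrow> real^4) \<Rightarrow> bool" where
  "transverse L e \<longleftrightarrow>
     (\<forall>(p, z)\<in>intersections L e. z \<in> ball 0 1 \<and> intersection_det L e p z \<noteq> 0)"

text \<open>The linking number of \<open>L\<close> with the boundary of a transverse disk, as the algebraic
  intersection number of \<open>L\<close> with that disk. The sum is finite by transversality and compactness.\<close>

definition lk :: "link \<Rightarrow> (complex \<Rightarrow> real^4) \<Rightarrow> int" where
  "lk L e = (\<Sum>(p, z)\<in>intersections L e. if intersection_det L e p z > 0 then 1 else - 1)"

text \<open>A collar is a thickening of the disk, positively oriented for the orientation of the 3-sphere
  as boundary of the ball, so that all twists have the same handedness. \<open>L\<close> must avoid its lateral
  boundary, i.e. lie in the solid torus complementary to the thickened boundary circle.\<close>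

abbreviation cylinder :: "(complex \<times> real) set" where
  "cylinder \<equiv> cball 0 1 \<times> {-1..1}"

definition collar :: "link \<Rightarrow> (complex \<Rightarrow> real^4) \<Rightarrow> (complex \<times> real \<Rightarrow> real^4) \<Rightarrow> bool" where
  "collar L e \<Phi> \<longleftrightarrow>
     (\<exists>W. open W \<and> cylinder \<subseteq> W \<and> \<Phi> ` W \<subseteq> S3 \<and> inj_on \<Phi> W \<and> C1_on W \<Phi> \<and>
        (\<forall>x\<in>W. det (vector
           [\<Phi> x, frechet_derivative \<Phi> (at x) (1, 0), frechet_derivative \<Phi> (at x) (\<i>, 0),
            frechet_derivative \<Phi> (at x) (0, 1)] :: real^4^4) > 0)) \<and>
     (\<forall>z\<in>cball 0 1. \<Phi> (z, 0) = e z) \<and>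
     pt L ` params L \<inter> \<Phi> ` (sphere 0 1 \<times> {-1..1}) = {}"

text \<open>The full twist: the level \<open>t\<close> of the collar is rotated by an angle increasing from \<open>0\<close> at
  \<open>t = -1\<close> to \<open>2\<pi>\<close> at \<open>t = 1\<close>. The cubic has vanishing derivative at both ends, so the twist is
  \<open>C\<^sup>1\<close> away from the lateral boundary of the collar.\<close>

definition dehn_twist :: "(complex \<times> real \<Rightarrow> real^4) \<Rightarrow> real^4 \<Rightarrow> real^4" where
  "dehn_twist \<Phi> x =
     (if x \<in> \<Phi> ` cylinder
      then (case inv_into cylinder \<Phi> x of
              (z, t) \<Rightarrow> \<Phi> (cis (2 * pi * ((2 + 3 * t - t ^ 3) / 4)) * z, t))
      else x)"

definition t_move :: "nat \<Rightarrow> (complex \<times> real \<Rightarrow> real^4) \<Rightarrow> link \<Rightarrow> link" where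
  "t_move n \<Phi> L = map (\<lambda>\<gamma>. (dehn_twist \<Phi> ^^ n) \<circ> \<gamma>) L"

text \<open>The moves in disjoint collars commute, so the order in which they are performed is immaterial.\<close>

definition t_moves ::
  "nat \<Rightarrow> (nat \<Rightarrow> complex \<times> real \<Rightarrow> real^4) \<Rightarrow> nat set \<Rightarrow> link \<Rightarrow> link" where
  "t_moves n \<Phi> S L = fold (\<lambda>j. t_move n (\<Phi> j)) (sorted_list_of_set S) L"

text \<open>Sufficiently thin collars of disjoint disks are disjoint, and up to isotopy the result of the
  moves does not depend on the collars.\<close>

definition nq_finite :: "nat \<Rightarrow> nat \<Rightarrow> nat \<Rightarrow> (link \<Rightarrow> 'a::ab_group_add) \<Rightarrow> bool" where
  "nq_finite n q m f \<longleftrightarrow>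
     (\<forall>L e \<Phi>. is_link L \<longrightarrow>
        (\<forall>j\<in>{..m}. embedded_disk (e j) \<and> transverse L (e j) \<and> int q dvd lk L (e j)) \<longrightarrow>
        disjoint_family_on (\<lambda>j. e j ` cball 0 1) {..m} \<longrightarrow>
        (\<forall>j\<in>{..m}. collar L (e j) (\<Phi> j)) \<longrightarrow>
        disjoint_family_on (\<lambda>j. \<Phi> j ` cylinder) {..m} \<longrightarrow>
        alternating_sum {..m} (\<lambda>S. f (t_moves n \<Phi> S L)) = 0)"

end

theory Submission imports Defs begin

text \<open>
Every comparison of links rests on one isotopy principle. If two \<open>C\<^sup>1\<close> links are \<open>C\<^sup>1\<close> close, the
displacement between them is a Lipschitz map with small constant, since an embedding of circles is
bi-Lipschitz. It extends to space with a small constant, and the identity plus such a map is a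
homeomorphism (\<open>small_perturb_isotopic\<close>). By compactness of the parameter interval an invariant is
constant along a \<open>C\<^sup>1\<close> family of links (\<open>link_invariant_C1_family\<close>).

\<^emph>\<open>A crossing change is a twist.\<close> Let two strands \<open>al\<close>, \<open>be\<close> cross at \<open>x\<close>. The planar chart
\<open>(a, b) \<mapsto> al (s + a) + be (t + b) - x\<close>, with a height coordinate, gives a collar of a vertical
disk that each strand meets once, in opposite directions, so that the linking number is \<open>0\<close>. In the
collar the strands are \<open>(t/2 + \<i>/2, t)\<close> and \<open>(- t/2 - \<i>/2, t)\<close>. The full twist is isotopic, with the
ends of the collar fixed, to the exchange of the two heights: both multiply the disk at level \<open>t\<close> by
\<open>exp (w t)\<close> for functions \<open>w\<close> with the same ends, which a straight line joins
(\<open>collar_mult_invariant\<close>). So an alternating sum over crossing changes is one over twists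
(\<open>finite_type_if_nq_finite\<close>).

\<^emph>\<open>A twist is a set of crossing changes.\<close> Move the link and the collars into 3-space. An isotopy
and a generic shear make each collar affine near its centre with a chosen direction of it vertical, the
centres over different points of the plane, and the strands through one disk at different levels, where
the level is the coordinate of the disk transverse to the vertical direction. Squeeze the strands
towards the cores of the collars. An untwisted strand is isotopic to its twisted image lifted so as
to have the old level: along the straight line between them levels do not change, so strands never
meet. Twist in the collars of \<open>S\<close> and lift in the others. The resulting links have one projection for
all \<open>S\<close>, and their heights over nearby points of the plane depend on one collar only. After a perturbation of the projection to a regular one, passing from the empty set to \<open>S\<close>
changes the crossings of disjoint sets \<open>Y j\<close>, \<open>j \<in> S\<close> (\<open>local_flips_alternating_sum\<close>).
Changing these one at a time telescopes the alternating sum into alternating sums over \<open>m + 1\<close>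
single crossings, which vanish (\<open>finite_type_telescope\<close>, \<open>nq_finite_if_finite_type\<close>).
\<close>

section \<open>Closed curves and embedded systems\<close>

notation scaleR (infixr "*R" 75)
notation has_vector_derivative (infix "has'_vd" 50)

abbreviation vd :: "(real => 'b::real_normed_vector) => real => 'b" where
 "vd ga t == vector_derivative ga (at t)"

type_synonym R3 = "complex * real"

abbreviation (input) "on_sys K y == EX i<length K. EX t. y = (K ! i) t"

abbreviation (input) iff (infixr "<->" 25) where "A <-> B == A = B"

lemmas cintros = continuous_intros and dintros = derivative_eq_intros
 and has_vd_def = has_vector_derivative_def and bl_has_vd = bounded_linear.has_vector_derivative
 and real_has_vd = has_real_derivative_iff_has_vector_derivative
 and has_vd_add = has_vector_derivative_add and has_vd_diff = has_vector_derivative_diff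
 and has_vd_cont = has_vector_derivative_continuous and has_vd_transform = has_vector_derivative_transform_within_open
 and complex_has_vd = has_vector_derivative_complex_iff and vd_eqI = vector_derivative_at
 and cont_comp = continuous_on_compose2 and cont_on_open = continuous_on_eq_continuous_at

lemma compact_uniform_bound:
 fixes Q :: "'a::topological_space => real => bool"
 assumes "compact C"
  and loc: "!!x. x : C ==> EX U e. open U & x : U & e > 0 & (ALL y:U Int C. Q y e)"
  and mono: "!!y d e. Q y e ==> 0 < d ==> d <= e ==> Q y d"
 obtains e where "e > 0" "!!y. y : C ==> Q y e"
proof -
 from loc obtain U e where U: "!!x. x : C ==> open (U x) & x : U x & e x > (0::real) & (ALL y:U x Int C. Q y (e x))"
  by metis
 hence "C <= (UN x:C. U x)" by auto
 then obtain T where T: "T <= C" "finite T" "C <= (UN x:T. U x)"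
  using compactE_image[OF `compact C`, of C U] U by metis
 define d where "d = Min (insert 1 (e ` T))"
 have d0: "d > 0" unfolding d_def using T U by (subst Min_gr_iff) auto
 have "Q y d" if yC: "y : C" for y
 proof -
  obtain x where "x : T" "y : U x" using T(3) yC by blast
  moreover have "d <= e x" unfolding d_def using T `x : T` by (intro Min_le) auto
  ultimately show ?thesis using U T that mono d0 by blast
 qed
 with d0 show ?thesis using that by blast
qed

lemma closed_C1_has_vd:
 "closed_C1 ga ==> (ga has_vd vd ga t) (at t)"
 unfolding closed_C1_def C1_differentiable_on_eq by (auto simp: vector_derivative_works)

lemma closed_C1_vd_cont: "closed_C1 ga ==> continuous_on S (vd ga)"
 unfolding closed_C1_def C1_differentiable_on_eq by (auto intro: continuous_on_subset)

lemma closed_C1_cont: "closed_C1 ga ==> continuous_on S ga"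
 by (intro continuous_at_imp_continuous_on ballI has_vd_cont[OF closed_C1_has_vd])

lemma closed_C1I:
 assumes "!!t. (ga has_vd ga' t) (at t)" "continuous_on UNIV ga'" "!!t. ga (t + 1) = ga t"
 shows "closed_C1 ga"
 unfolding closed_C1_def C1_differentiable_on_def using assms by blast

lemma periodic_of_int:
 fixes g :: "real => 'b"
 assumes "!!t. g (t + 1) = g t"
 shows "g (t + of_int n) = g t"
proof (induction n rule: int_induct[where k = 0])
 case (step1 i)
 thus ?case using assms[of "t + of_int i"] by (simp add: algebra_simps)
next
 case (step2 i)
 thus ?case using assms[of "t + of_int (i - 1)"] by (simp add: algebra_simps)
qed simp

lemma closed_C1_vd_periodic:
 assumes "closed_C1 ga" shows "vd ga (t + 1) = vd ga t"
proof -
 have "((%t. ga (t + 1)) has_vd vd ga (t + 1)) (at t)"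
 proof -
  have "((%t::real. t + 1) has_vd 1) (at t)"
   by (auto intro!: dintros)
  from vector_diff_chain_at[OF this closed_C1_has_vd[OF assms, of "t + 1"]]
  show ?thesis by (simp add: o_def)
 qed
 moreover have "(%t. ga (t + 1)) = ga" using assms unfolding closed_C1_def by auto
 ultimately show ?thesis by (simp add: vd_eqI)
qed

lemma closed_C1_of_int:
 assumes "closed_C1 ga" shows "ga (t + of_int n) = ga t" "vd ga (t + of_int n) = vd ga t"
 using periodic_of_int[of ga] periodic_of_int[of "vd ga"] closed_C1_vd_periodic[OF assms] assms
 unfolding closed_C1_def by auto

lemma closed_C1_frac:
 assumes "closed_C1 ga" shows "ga (frac t) = ga t" "vd ga (frac t) = vd ga t"
 using closed_C1_of_int[OF assms, of "frac t" "\<lfloor>t\<rfloor>"] by (auto simp: frac_def)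

lemma frac_in_params: "i < length c ==> (i, frac t) : params c"
 unfolding params_def by (auto simp: frac_lt_1)

lemma C1_lipschitz:
 assumes "closed_C1 ga" "!!t. norm (vd ga t) <= B"
 shows "norm (ga a - ga b) <= B * abs(a - b)"
proof -
 have "norm (ga a - ga b) <= B * norm (a - b)"
 proof (rule differentiable_bound[where S = UNIV and f' = "%t h. h *R vd ga t"])
  show "!!x. x : UNIV ==> (ga has_derivative (%h. h *R vd ga x)) (at x within UNIV)"
   using closed_C1_has_vd[OF assms(1)] unfolding has_vd_def by auto
  show "!!x. x : UNIV ==> onorm (%h. h *R vd ga x) <= B"
   by (rule onorm_le) (use assms(2) in "simp add: mult.commute[of B] mult_left_mono")
 qed auto
 thus ?thesis by simp
qed

lemma C1_strict_derivative:
 assumes d: "!!t. t : U ==> (ga has_vd ga' t) (at t)" and "continuous_on U ga'"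
  and "open U" "s : U" "wc > 0"
 obtains r where "r > 0" "!!a. abs(a - s) < r ==> a : U"
  "!!a b. abs(a - s) < r ==> abs(b - s) < r ==> norm (ga a - ga b - (a - b) *R ga' s) <= wc * abs(a - b)"
proof -
 have "isCont ga' s" using assms by (simp add: cont_on_open)
 then obtain r1 where r1: "r1 > 0" "!!x. dist x s < r1 ==> dist (ga' x) (ga' s) < wc"
  using `wc > 0` unfolding continuous_at_eps_delta by blast
 obtain r2 where r2: "r2 > 0" "ball s r2 <= U" using assms open_contains_ball by blast
 define r where "r = min r1 r2"
 have bU: "ball s r <= U" using r2 r_def by auto
 show ?thesis
 proof (rule that[of r])
  show "r > 0" using r1 r2 r_def by auto
  show "a : U" if "abs(a - s) < r" for a using bU that by (auto simp: dist_real_def)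
  fix a b assume a: "abs(a - s) < r" and b: "abs(b - s) < r"
  have "norm (ga a - ga b - (a - b) *R ga' s) <= norm (a - b) * wc"
  proof (rule vector_differentiable_bound_linearization[where S = "ball s r"])
   show "!!x. x : ball s r ==> (ga has_vd ga' x) (at x within ball s r)"
    using d bU has_vector_derivative_at_within by blast
   show "closed_segment b a <= ball s r"
    using a b by (intro closed_segment_subset) (auto simp: dist_real_def)
   show "!!x. x : ball s r ==> norm (ga' x - ga' s) <= wc"
    using r1(2) r_def by (simp add: dist_norm abs_minus_commute order_less_imp_le)
   show "s : ball s r" using `r > 0` by simp
  qed
  thus "norm (ga a - ga b - (a - b) *R ga' s) <= wc * abs(a - b)" by (simp add: mult.commute)
 qed
qed

definition embedded :: "(real => 'b::real_normed_vector) list => bool" where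
 "embedded c <-> immersed c & inj_on (pt c) (params c)"

lemma is_link_iff: "is_link L <-> embedded L & pt L ` params L <= S3"
 unfolding is_link_def embedded_def by blast

lemma immersed_nth: "immersed c ==> i < length c ==> closed_C1 (c ! i)"
 unfolding immersed_def by auto

lemma immersed_vd: "immersed c ==> i < length c ==> vd (c ! i) t ~= 0"
 using frac_in_params[of i c t] closed_C1_frac[OF immersed_nth, of c i t]
 unfolding immersed_def velocity_def by (metis fst_conv snd_conv)

lemma immersedI:
 assumes "!!i. i < length c ==> closed_C1 (c ! i)" "!!i t. i < length c ==> vd (c ! i) t ~= 0"
 shows "immersed c"
 unfolding immersed_def velocity_def params_def using assms by (auto simp: in_set_conv_nth)

lemma embedded_inj: "embedded c ==> p : params c ==> p' : params c ==> pt c p = pt c p' ==> p = p'"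
 unfolding embedded_def by (meson inj_onD)

lemma embedded_C1: "embedded c ==> i < length c ==> closed_C1 (c ! i)"
 unfolding embedded_def by (simp add: immersed_nth)

lemma embedded_vd: "embedded c ==> i < length c ==> vd (c ! i) t ~= 0"
 unfolding embedded_def by (simp add: immersed_vd)

lemma embedded_nth_eq:
 assumes "embedded c" "i < length c" "j < length c" "(c ! i) s = (c ! j) t"
 obtains n where "i = j" "s = t + of_int n"
proof -
 have "pt c (i, frac s) = pt c (j, frac t)"
  using assms closed_C1_frac(1)[of "c ! i" s] closed_C1_frac(1)[of "c ! j" t]
   immersed_nth[of c i] immersed_nth[of c j]
  unfolding pt_def embedded_def by simp
 hence "(i, frac s) = (j, frac t)"
  using assms frac_in_params unfolding embedded_def inj_on_def by blast
 moreover hence "s = t + of_int (\<lfloor>s\<rfloor> - \<lfloor>t\<rfloor>)" unfolding frac_def by simp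
 ultimately show ?thesis using that[of "\<lfloor>s\<rfloor> - \<lfloor>t\<rfloor>"] by simp
qed

lemma embedded_systemI:
 assumes "!!i. i < length c ==> closed_C1 (c ! i)" "!!i t. i < length c ==> vd (c ! i) t ~= 0"
  and "!!i j s t. i < length c ==> j < length c ==> s : {0..<1} ==> t : {0..<1} ==>
      (c ! i) s = (c ! j) t ==> i = j & s = t"
 shows "embedded c"
 unfolding embedded_def
proof
 show "immersed c" by (rule immersedI[OF assms(1,2)])
 show "inj_on (pt c) (params c)"
 proof (rule inj_onI)
  fix p p' assume "p : params c" "p' : params c" "pt c p = pt c p'"
  thus "p = p'" using assms(3)[of "fst p" "fst p'" "snd p" "snd p'"]
   unfolding params_def pt_def by (cases p; cases p') auto
 qed
qed

lemma embedded_over: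
 assumes K: "embedded K" and len: "length c = length K"
  and C1: "!!i. i < length K ==> closed_C1 (c ! i)" and nz: "!!i t. i < length K ==> vd (c ! i) t ~= 0"
  and inj: "!!i j s t. i < length K ==> j < length K ==> (c ! i) s = (c ! j) t ==> (K ! i) s = (K ! j) t"
 shows "embedded c"
proof (rule embedded_systemI)
 fix i j s t assume a: "i < length c" "j < length c" "s : {0..<1::real}" "t : {0..<1::real}" "(c ! i) s = (c ! j) t"
 hence "pt K (i, s) = pt K (j, t)" using inj[of i j s t] a len unfolding pt_def by simp
 hence "(i, s) = (j, t)" by (intro embedded_inj[OF K]) (use a len in "auto simp: params_def")
 thus "i = j & s = t" by simp
qed (use C1 nz len in auto)

definition small_perturb :: "real => (real => 'b::real_normed_vector) list => (real => 'b) list => bool" where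
 "small_perturb e c c' <-> length c' = length c & (ALL i<length c. closed_C1 (c' ! i) &
  (ALL t. norm ((c' ! i) t - (c ! i) t) <= e & norm (vd (c' ! i) t - vd (c ! i) t) <= e))"

lemma small_perturbD:
 assumes "small_perturb e c c'"
 shows "length c' = length c" "i < length c ==> closed_C1 (c' ! i)"
  "i < length c ==> norm ((c' ! i) t - (c ! i) t) <= e"
  "i < length c ==> norm (vd (c' ! i) t - vd (c ! i) t) <= e"
 using assms unfolding small_perturb_def by simp_all

lemma closed_C1_diff:
 assumes "closed_C1 f" "closed_C1 g"
 shows "closed_C1 (%t. f t - g t)" "vd (%t. f t - g t) t = vd f t - vd g t"
proof -
 have *: "((%t. f t - g t) has_vd vd f t - vd g t) (at t)" for t
  by (intro has_vd_diff closed_C1_has_vd assms)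
 show "closed_C1 (%t. f t - g t)"
  by (rule closed_C1I[OF *]) (use assms in "auto intro!: cintros closed_C1_vd_cont simp: closed_C1_def")
 show "vd (%t. f t - g t) t = vd f t - vd g t" by (rule vd_eqI[OF *])
qed

text \<open>For close parameters the strict derivative of \<open>c\<close> bounds the chord below by the parameter
distance; for parameters that are apart the chord is bounded below by compactness.\<close>
lemma embedded_bilipschitz:
 fixes c :: "(real => 'b::real_normed_vector) list"
 assumes c: "embedded c" and k: "k > 0"
 obtains e where "e > 0"
  "!!(c'::(real => 'b) list) i j s t. small_perturb e c c' ==> i < length c ==> j < length c ==>
   norm (((c' ! i) s - (c ! i) s) - ((c' ! j) t - (c ! j) t)) <= k * norm ((c ! i) s - (c ! j) t)"
  "!!(c'::(real => 'b) list) i t. small_perturb e c c' ==> i < length c ==>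
   norm (vd (c' ! i) t - vd (c ! i) t) <= k * norm (vd (c ! i) t)"
proof -
 define Q where "Q = (%i j (st::real \<times> real) e. ALL c'::(real => 'b) list. small_perturb e c c' -->
   norm (((c' ! i) (fst st) - (c ! i) (fst st)) - ((c' ! j) (snd st) - (c ! j) (snd st)))
    <= k * norm ((c ! i) (fst st) - (c ! j) (snd st)))"
 have mono: "small_perturb d c c' ==> d <= e ==> small_perturb e c c'" for d e and c' :: "(real => 'b) list"
  unfolding small_perturb_def by (meson order_trans)
 have C1: "closed_C1 (c ! i)" if "i < length c" for i using embedded_C1[OF c that] .
 have loc: "EX U e. open U & x : U & e > 0 & (ALL y:U Int ({0..1} \<times> {0..1}). Q i j y e)"
  if ij: "i < length c" "j < length c" for i j and x :: "real \<times> real"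
 proof -
  obtain s t where x: "x = (s, t)" by fastforce
  show ?thesis
  proof (cases "(c ! i) s = (c ! j) t")
   case False
   define m where "m = norm ((c ! i) s - (c ! j) t)"
   have m: "m > 0" using False m_def by simp
   define U where "U = {y. norm ((c ! i) (fst y) - (c ! j) (snd y)) > m / 2}"
   have "open U" unfolding U_def
    by (intro open_Collect_less cintros cont_comp[OF closed_C1_cont[OF C1[OF ij(1)], of UNIV]]
      cont_comp[OF closed_C1_cont[OF C1[OF ij(2)], of UNIV]]) auto
   moreover have "x : U" unfolding U_def x using m m_def by simp
   moreover have "Q i j y (k * m / 4)" if "y : U" for y unfolding Q_def
   proof (intro allI impI)
    fix c' :: "(real => 'b) list" assume sp: "small_perturb (k * m / 4) c c'"
    have "norm (((c' ! i) (fst y) - (c ! i) (fst y)) - ((c' ! j) (snd y) - (c ! j) (snd y))) <= k * m / 4 + k * m / 4"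
     by (rule order_trans[OF norm_triangle_ineq4 add_mono[OF small_perturbD(3)[OF sp ij(1)] small_perturbD(3)[OF sp ij(2)]]])
    also have "... <= k * norm ((c ! i) (fst y) - (c ! j) (snd y))"
     using that k unfolding U_def by (simp add: field_simps)
    finally show "norm (((c' ! i) (fst y) - (c ! i) (fst y)) - ((c' ! j) (snd y) - (c ! j) (snd y)))
     <= k * norm ((c ! i) (fst y) - (c ! j) (snd y))" .
   qed
   moreover have "k * m / 4 > 0" using k m by simp
   ultimately show ?thesis by (intro exI[of _ U] exI[of _ "k * m / 4"]) auto
  next
   case True
   obtain n where n: "i = j" "s = t + of_int n" by (rule embedded_nth_eq[OF c ij True])
   define v where "v = norm (vd (c ! j) t)"
   have v: "v > 0" unfolding v_def using embedded_vd[OF c ij(2)] by simp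
   obtain r where r: "r > 0" "!!a b. abs(a - t) < r ==> abs(b - t) < r ==>
     norm ((c ! j) a - (c ! j) b - (a - b) *R vd (c ! j) t) <= v / 2 * abs(a - b)"
   proof (rule C1_strict_derivative[of UNIV "c ! j" "vd (c ! j)" t "v / 2"])
    show "v / 2 > 0" using v by simp
   qed (use that closed_C1_has_vd[OF C1[OF ij(2)]] closed_C1_vd_cont[OF C1[OF ij(2)]] in auto)
   define U where "U = ball s r \<times> ball t r"
   have "open U" "x : U" unfolding U_def x using r by (auto intro: open_Times)
   moreover have "Q i j y (k * v / 2)" if "y : U" for y unfolding Q_def
   proof (intro allI impI)
    fix c' :: "(real => 'b) list" assume sp: "small_perturb (k * v / 2) c c'"
    obtain a b where y: "y = (a, b)" by fastforce
    define a' where "a' = a - of_int n"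
    have a': "abs(a' - t) < r" "abs(b - t) < r" using that n unfolding y U_def a'_def by (auto simp: dist_real_def abs_minus_commute)
    have cj': "closed_C1 (c' ! j)" using small_perturbD(2)[OF sp ij(2)] .
    have ca: "(c ! j) a = (c ! j) a'" "(c' ! j) a = (c' ! j) a'"
     using closed_C1_of_int[OF C1[OF ij(2)], of a' n] closed_C1_of_int[OF cj', of a' n] unfolding a'_def by auto
    have "norm (((c' ! j) a' - (c ! j) a') - ((c' ! j) b - (c ! j) b)) <= (k * v / 2) * abs(a' - b)"
     by (rule C1_lipschitz[OF closed_C1_diff(1)[OF cj' C1[OF ij(2)]]])
      (unfold closed_C1_diff(2)[OF cj' C1[OF ij(2)]], rule small_perturbD(4)[OF sp ij(2)])
    also have "v / 2 * abs(a' - b) <= norm ((c ! j) a' - (c ! j) b)"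
    proof -
     have "norm ((a' - b) *R vd (c ! j) t) <= norm ((c ! j) a' - (c ! j) b) + norm ((a' - b) *R vd (c ! j) t - ((c ! j) a' - (c ! j) b))"
      by (rule norm_triangle_sub)
     moreover have "norm ((a' - b) *R vd (c ! j) t - ((c ! j) a' - (c ! j) b)) <= v / 2 * abs(a' - b)"
      by (subst norm_minus_commute) (rule r(2)[OF a'])
     moreover have "norm ((a' - b) *R vd (c ! j) t) = v * abs(a' - b)" unfolding v_def by simp
     ultimately show ?thesis by linarith
    qed
    hence "(k * v / 2) * abs(a' - b) <= k * norm ((c ! j) a' - (c ! j) b)"
     using k mult_left_mono[of "v / 2 * abs(a' - b)" _ k] by (simp add: mult.assoc)
    finally show "norm (((c' ! i) (fst y) - (c ! i) (fst y)) - ((c' ! j) (snd y) - (c ! j) (snd y)))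
     <= k * norm ((c ! i) (fst y) - (c ! j) (snd y))" using n ca y by simp
   qed
   moreover have "k * v / 2 > 0" using k v by simp
   ultimately show ?thesis by (intro exI[of _ U] exI[of _ "k * v / 2"]) auto
  qed
 qed
 have "EX e>0. ALL y:{0..1} \<times> {0..1}. Q i j y e" if ij: "i < length c" "j < length c" for i j
 proof -
  obtain e where "e > 0" "!!y. y : {0..1::real} \<times> {0..1::real} ==> Q i j y e"
  proof (rule compact_uniform_bound[of "{0..1::real} \<times> {0..1::real}" "Q i j"])
   show "compact ({0..1::real} \<times> {0..1::real})" by (intro compact_Times) auto
   show "!!x. x : {0..1} \<times> {0..1} ==> EX U e. open U & x : U & 0 < e & (ALL y:U Int {0..1} \<times> {0..1}. Q i j y e)"
    by (rule loc[OF ij])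
   show "!!y d e. Q i j y e ==> 0 < d ==> d <= e ==> Q i j y d"
    unfolding Q_def using mono by blast
  qed auto
  thus ?thesis by blast
 qed
 then obtain ee where ee: "!!i j. i < length c ==> j < length c ==> ee i j > 0 & (ALL y:{0..1} \<times> {0..1}. Q i j y (ee i j))"
  by metis
 have "EX v>0. ALL t. norm (vd (c ! i) t) >= v" if i: "i < length c" for i
 proof -
  have "continuous_on {0..1} (%t. norm (vd (c ! i) t))"
   by (intro cintros closed_C1_vd_cont C1 i)
  then obtain t0 where t0: "t0 : {0..1}" "!!t. t : {0..1} ==> norm (vd (c ! i) t0) <= norm (vd (c ! i) t)"
   using continuous_attains_inf[of "{0..1::real}" "%t. norm (vd (c ! i) t)"] by auto
  have "norm (vd (c ! i) t0) <= norm (vd (c ! i) t)" for t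
   using t0(2)[of "frac t"] closed_C1_frac[OF C1[OF i]] frac_lt_1[of t] by (auto intro: less_imp_le)
  moreover have "norm (vd (c ! i) t0) > 0" using embedded_vd[OF c i] by simp
  ultimately show ?thesis by blast
 qed
 then obtain vv where vv: "!!i. i < length c ==> vv i > 0 & (ALL t. norm (vd (c ! i) t) >= vv i)" by metis
 define e where "e = Min (insert 1 ((%(i,j). ee i j) ` ({..<length c} \<times> {..<length c}) Un (%i. k * vv i) ` {..<length c}))"
 have fin: "finite (insert 1 ((%(i,j). ee i j) ` ({..<length c} \<times> {..<length c}) Un (%i. k * vv i) ` {..<length c}))" by auto
 have e0: "e > 0" unfolding e_def using ee vv k by (subst Min_gr_iff) auto
 have el: "e <= ee i j" "e <= k * vv i" if "i < length c" "j < length c" for i j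
  unfolding e_def using that by (intro Min_le fin; force)+
 show ?thesis
 proof (rule that[OF e0])
  fix c' :: "(real => 'b) list" and i j and s t :: real
  assume sp: "small_perturb e c c'" and ij: "i < length c" "j < length c"
  have cc: "closed_C1 (c' ! i)" "closed_C1 (c' ! j)" using small_perturbD(2)[OF sp] ij by auto
  have "frac s : {0..1}" "frac t : {0..1}" using frac_lt_1[of t] frac_lt_1[of s] by (auto intro: less_imp_le)
  hence "Q i j (frac s, frac t) (ee i j)" using ee[OF ij] by auto
  moreover have "small_perturb (ee i j) c c'" using sp el(1)[OF ij] mono by blast
  ultimately show "norm (((c' ! i) s - (c ! i) s) - ((c' ! j) t - (c ! j) t)) <= k * norm ((c ! i) s - (c ! j) t)"
   unfolding Q_def using closed_C1_frac[OF cc(1)] closed_C1_frac[OF cc(2)] closed_C1_frac[OF C1[OF ij(1)]] closed_C1_frac[OF C1[OF ij(2)]] by auto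
 next
  fix c' :: "(real => 'b) list" and i t
  assume sp: "small_perturb e c c'" and i: "i < length c"
  have "norm (vd (c' ! i) t - vd (c ! i) t) <= e" using small_perturbD(4)[OF sp i] .
  also have "... <= k * vv i" using el(2)[OF i i] .
  also have "... <= k * norm (vd (c ! i) t)" using vv[OF i] k by auto
  finally show "norm (vd (c' ! i) t - vd (c ! i) t) <= k * norm (vd (c ! i) t)" .
 qed
qed

lemma embedded_perturb:
 fixes c :: "(real => 'b::real_normed_vector) list"
 assumes c: "embedded c"
 obtains e where "e > 0" "!!(c'::(real => 'b) list). small_perturb e c c' ==> embedded c'"
proof -
 have half: "(1/2::real) > 0" by simp
 obtain e where e: "e > 0"
  "!!(c'::(real => 'b) list) i j s t. small_perturb e c c' ==> i < length c ==> j < length c ==>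
   norm (((c' ! i) s - (c ! i) s) - ((c' ! j) t - (c ! j) t)) <= (1/2) * norm ((c ! i) s - (c ! j) t)"
  "!!(c'::(real => 'b) list) i t. small_perturb e c c' ==> i < length c ==>
   norm (vd (c' ! i) t - vd (c ! i) t) <= (1/2) * norm (vd (c ! i) t)"
  by (rule embedded_bilipschitz[OF c half]) (rule that; assumption)
 show ?thesis
 proof (rule that[OF e(1)])
  fix c' :: "(real => 'b) list" assume sp: "small_perturb e c c'"
  have len: "length c' = length c" using small_perturbD(1)[OF sp] .
  show "embedded c'"
  proof (rule embedded_systemI)
   show "closed_C1 (c' ! i)" if "i < length c'" for i using small_perturbD(2)[OF sp] that len by simp
   show "vd (c' ! i) t ~= 0" if "i < length c'" for i t
   proof
    assume "vd (c' ! i) t = 0"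
    hence "vd (c ! i) t = 0" using e(3)[OF sp, of i t] that len by simp
    thus False using embedded_vd[OF c, of i t] that len by simp
   qed
   show "i = j & s = t" if ij: "i < length c'" "j < length c'" and st: "s : {0..<1}" "t : {0..<1}"
    and eq: "(c' ! i) s = (c' ! j) t" for i j s t
   proof -
    have "(c ! i) s = (c ! j) t"
     using e(2)[OF sp, of i j s t] ij len eq by (simp add: norm_minus_commute)
    hence "pt c (i, s) = pt c (j, t)" unfolding pt_def by simp
    moreover have "(i, s) : params c" "(j, t) : params c" using ij len st unfolding params_def by auto
    ultimately have "(i, s) = (j, t)" using embedded_inj[OF c, of "(i, s)" "(j, t)"] by simp
    thus ?thesis by simp
   qed
  qed
 qed
qed

section \<open>Small perturbations are ambient isotopies\<close>

text \<open>The extension is the infimum of the cones of slope \<open>k\<close> over the given values.\<close>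
lemma mcshane_extension:
 fixes g :: "'a::metric_space => real"
 assumes "S ~= {}" "k >= 0" and g: "!!x y. x : S ==> y : S ==> abs(g x - g y) <= k * dist x y"
 obtains E where "!!x. x : S ==> E x = g x" "!!x y. abs(E x - E y) <= k * dist x y"
proof -
 define E where "E = (%x. INF y\<in>S. g y + k * dist x y)"
 obtain y0 where y0: "y0 : S" using assms by auto
 have bdd: "bdd_below ((%y. g y + k * dist x y) ` S)" for x
 proof (rule bdd_belowI2)
  fix y assume y: "y : S"
  have "k * dist y0 y <= k * (dist x y0 + dist x y)"
   by (rule mult_left_mono) (use assms dist_triangle3[of y0 y x] in auto)
  thus "g y0 - k * dist x y0 <= g y + k * dist x y"
   using g[OF y0 y] by (simp add: distrib_left)
 qed
 have up: "E x <= E y + k * dist x y" for x y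
 proof -
  have "E x - k * dist x y <= E y" unfolding E_def[of]
  proof (rule cINF_greatest[OF assms(1)])
   fix z assume z: "z : S"
   have "(INF y\<in>S. g y + k * dist x y) <= g z + k * dist x z" by (rule cINF_lower[OF bdd z])
   also have "k * dist x z <= k * (dist x y + dist y z)"
    by (rule mult_left_mono) (use assms dist_triangle[of x z y] in auto)
   finally show "(INF y\<in>S. g y + k * dist x y) - k * dist x y <= g z + k * dist y z"
    by (simp add: distrib_left)
  qed
  thus ?thesis by simp
 qed
 show ?thesis
 proof (rule that[of E])
  fix x assume x: "x : S"
  have "E x <= g x + k * dist x x" unfolding E_def by (rule cINF_lower[OF bdd x])
  moreover have "g x <= E x" unfolding E_def
  proof (rule cINF_greatest[OF assms(1)])
   fix y assume "y : S" thus "g x <= g y + k * dist x y" using g[OF x, of y] by simp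
  qed
  ultimately show "E x = g x" by simp
 next
  fix x y show "abs(E x - E y) <= k * dist x y" using up[of x y] up[of y x] by (simp add: dist_commute abs_le_iff)
 qed
qed

lemma lipschitz_extension:
 fixes g :: "'a::metric_space => 'b::euclidean_space" and k :: real
 assumes "k >= 0" and g: "!!x y. x : S ==> y : S ==> norm (g x - g y) <= k * dist x y"
 obtains E where "!!x. x : S ==> E x = g x" "!!x y. norm (E x - E y) <= DIM('b) * k * dist x y"
proof (cases "S = {}")
 case True
 show ?thesis by (rule that[of "%_. 0"]) (use True assms in auto)
next
 case False
 have "EX E. (ALL x:S. E x = g x \<bullet> b) & (ALL x y. abs(E x - E y) <= k * dist x y)" if b: "b : Basis" for b
 proof (rule mcshane_extension[OF False assms(1), of "%x. g x \<bullet> b"])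
  fix x y assume "x : S" "y : S"
  hence "norm (g x - g y) <= k * dist x y" by (rule g)
  moreover have "abs((g x - g y) \<bullet> b) <= norm (g x - g y)" by (rule Basis_le_norm[OF b])
  ultimately show "abs(g x \<bullet> b - g y \<bullet> b) <= k * dist x y" by (simp add: inner_diff_left)
 qed blast
 then obtain E where E: "!!b x. b : Basis ==> x : S ==> E b x = g x \<bullet> b"
   "!!b x y. b : Basis ==> abs(E b x - E b y) <= k * dist x y" by metis
 show ?thesis
 proof (rule that[of "%x. SUM b:Basis. E b x *R b"])
  fix x assume "x : S"
  thus "(SUM b:Basis. E b x *R b) = g x" using E(1) by (simp add: euclidean_representation)
 next
  fix x y
  have "norm ((SUM b:Basis. E b x *R b) - (SUM b:Basis. E b y *R b)) = norm (SUM b:Basis. (E b x - E b y) *R b)"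
   by (simp add: sum_subtractf scaleR_diff_left)
  also have "... <= (SUM b:(Basis::'b set). k * dist x y)"
   by (rule sum_norm_le) (use E(2) in auto)
  finally show "norm ((SUM b:Basis. E b x *R b) - (SUM b:Basis. E b y *R b)) <= DIM('b) * k * dist x y"
   by (simp add: mult.assoc)
 qed
qed

text \<open>Displace and project radially back to the sphere. Surjectivity is a fixed point argument on a ball around the
target, with \<open>E\<close> made homogeneous of degree one.\<close>
lemma small_displacement_isotopy:
 fixes E :: "real^4 => real^4"
 assumes k: "k <= 1/10" and lip: "!!x y. norm (E x - E y) <= k * norm (x - y)"
  and bd: "!!x. x : S3 ==> norm (E x) <= k"
 defines "H == %s x. (1 / norm (x + s *R E x)) *R (x + s *R E x)"
 shows "ambient_isotopy H"
proof -
 have contE: "continuous_on S E" for S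
 proof (rule continuous_onI)
  fix x and e :: real assume "e > 0"
  show "EX d>0. ALL x':S. dist x' x < d --> dist (E x') (E x) <= e"
  proof (intro exI[of _ e] conjI ballI impI `e > 0`)
   fix x' assume "x' : S" and d: "dist x' x < e"
   have "norm (E x' - E x) <= k * norm (x' - x)" by (rule lip)
   also have "... <= 1 * norm (x' - x)" using k by (intro mult_right_mono) auto
   finally show "dist (E x') (E x) <= e" using d by (simp add: dist_norm)
  qed
 qed
 have nz: "norm (x + s *R E x) >= 9/10" if "s : {0..1}" "x : S3" for s x
 proof -
  have "norm (s *R E x) <= 1 * (1/10)" unfolding norm_scaleR
   using that bd[OF that(2)] k by (intro mult_mono) auto
  moreover have "norm x = 1" using that by simp
  ultimately show ?thesis using norm_diff_ineq[of x "s *R E x"] by simp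
 qed
 have contE2: "continuous_on ({0..1} \<times> S3) (%x. E (snd x))"
  by (rule cont_comp[OF contE[of UNIV]]) (auto intro: cintros)
 have cont: "continuous_on ({0..1} \<times> S3) (%(s, x). H s x)"
  unfolding H_def case_prod_unfold
  by (intro cintros contE2) (use nz in force)
 have hom: "EX g. homeomorphism S3 S3 (H s) g" if s: "s : {0..1}" for s
 proof (rule homeomorphism_compact)
  show "compact S3" by simp
  show "continuous_on S3 (H s)" unfolding H_def
   by (intro cintros contE) (use nz[OF s] in force)
  show "inj_on (H s) S3"
  proof (rule inj_onI)
   fix x y assume x: "x : S3" and y: "y : S3" and eq: "H s x = H s y"
   define X Y where "X = x + s *R E x" and "Y = y + s *R E y"
   have XY: "norm X > 0" "norm Y > 0" using nz[OF s x] nz[OF s y] unfolding X_def Y_def by auto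
   define l where "l = norm X / norm Y"
   have l: "l > 0" using XY l_def by simp
   have "X = l *R Y"
   proof -
    have "norm X *R (H s x) = norm X *R (H s y)" using eq by simp
    thus ?thesis unfolding H_def X_def[symmetric] Y_def[symmetric] l_def using XY by simp
   qed
   hence e1: "x - l *R y = (l * s) *R E y - s *R E x"
    unfolding X_def Y_def by (simp add: algebra_simps)
   have e2: "(l * s) *R E y - s *R E x = ((l - 1) * s) *R E y + s *R (E y - E x)"
    by (simp add: algebra_simps)
   have nx: "norm x = 1" "norm y = 1" using x y by auto
   have "abs(1 - l) <= norm (x - l *R y)" using norm_triangle_ineq3[of x "l *R y"] nx l by simp
   moreover have "norm (x - y) <= norm (x - l *R y) + abs(1 - l)"
   proof -
    have "x - y = (x - l *R y) + (l - 1) *R y" by (simp add: algebra_simps)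
    hence "norm (x - y) <= norm (x - l *R y) + norm ((l - 1) *R y)"
     by (metis norm_triangle_ineq)
    thus ?thesis using nx by (simp add: abs_minus_commute)
   qed
   moreover have "norm (x - l *R y) <= abs(1 - l) * (1/10) + (1/10) * norm (x - y)"
   proof -
    have "norm (((l - 1) * s) *R E y) <= abs(1 - l) * 1 * (1/10)"
     unfolding norm_scaleR abs_mult using s bd[OF y] k
     by (intro mult_mono) (auto simp: abs_minus_commute)
    moreover have "norm (s *R (E y - E x)) <= 1 * ((1/10) * norm (x - y))"
     unfolding norm_scaleR using s lip[of y x] k mult_right_mono[OF k, of "norm (x - y)"]
     by (intro mult_mono) (auto simp: norm_minus_commute)
    ultimately show ?thesis unfolding e1 e2 using norm_triangle_ineq[of "((l - 1) * s) *R E y" "s *R (E y - E x)"] by simp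
   qed
   moreover have "N <= 0" if "A <= N" "M <= N + A" "N <= A * (1/10) + (1/10) * M" for A M N :: real
    using that by linarith
   ultimately have "norm (x - l *R y) <= 0" by blast
   hence xl: "x = l *R y" by simp
   hence "l = 1" using nx l by simp
   thus "x = y" using xl by simp
  qed
  show "H s ` S3 = S3"
  proof
   show "H s ` S3 <= S3"
   proof
    fix y assume "y : H s ` S3"
    then obtain x where x: "x : S3" "y = H s x" by blast
    have "x + s *R E x ~= 0" using nz[OF s x(1)] by auto
    thus "y : S3" unfolding x(2) H_def by simp
   qed
   show "S3 <= H s ` S3"
   proof
    fix y :: "real^4" assume y: "y : S3"
    define F where "F = (%v. v + (s * norm v) *R E (sgn v))"
    have v0: "v ~= 0" "norm v <= 3/2" if "v : cball y (1/2)" for v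
    proof -
     have "norm (y - v) <= 1/2" using that by (simp add: dist_norm)
     thus "v ~= 0" "norm v <= 3/2" using y norm_triangle_ineq2[of v y] by (auto simp: norm_minus_commute)
    qed
    have "EX v:cball y (1/2). F v = y"
    proof (rule brouwer_surjective_cball[where S = "{y}"])
     have "continuous_on (cball y (1/2)) (%v. E (sgn v))"
      by (rule cont_comp[OF contE[of UNIV]]) (auto intro!: continuous_on_sgn continuous_on_id dest: v0(1))
     thus "continuous_on (cball y (1/2)) F" unfolding F_def by (intro cintros)
     fix x v assume "x : {y}" and v: "v : cball y (1/2)"
     have "norm ((s * norm v) *R E (sgn v)) <= (1 * (3/2)) * (1/10)"
      unfolding norm_scaleR abs_mult using s v0[OF v] bd[of "sgn v"] k
      by (intro mult_mono) (auto simp: norm_sgn)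
     thus "x + (v - F v) : cball y (1/2)" using `x : {y}` unfolding F_def by (simp add: dist_norm)
    qed auto
    then obtain v where v: "v : cball y (1/2)" "F v = y" by blast
    define x where "x = sgn v"
    have nv: "norm v > 0" using v0[OF v(1)] by simp
    have x: "x : S3" unfolding x_def using v0[OF v(1)] by (simp add: norm_sgn)
    define r where "r = norm v"
    have vr: "v = r *R x" unfolding x_def sgn_div_norm r_def using nv by simp
    have "y = v + (s * r) *R E x" using v(2) unfolding F_def x_def r_def by simp
    hence yr: "y = r *R (x + s *R E x)" by (simp add: vr algebra_simps)
    have "norm (r *R (x + s *R E x)) = 1" using y unfolding yr[symmetric] by simp
    hence "r * norm (x + s *R E x) = 1" using nv unfolding norm_scaleR r_def by simp
    hence "1 / norm (x + s *R E x) = r"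
     by (metis divide_self_if mult_zero_right nonzero_mult_div_cancel_right zero_neq_one)
    hence "H s x = y" unfolding H_def yr by simp
    thus "y : H s ` S3" using x by blast
   qed
  qed
 qed
 show ?thesis unfolding ambient_isotopy_def using cont hom
  by (auto simp: H_def)
qed

lemma isotopicI_id:
 assumes "length L = length L'" "ambient_isotopy H" "!!i t. i < length L ==> H 1 ((L ! i) t) = (L' ! i) t"
 shows "isotopic L L'"
proof -
 have "EX \<theta>. oriented_reparam \<theta> & (ALL t. H 1 ((L ! i) t) = (L' ! id i) (\<theta> t))" if "i < length L" for i
  using assms(3)[OF that] by (intro exI[of _ "%t. t"]) (auto simp: oriented_reparam_def strict_mono_def)
 moreover have "bij_betw id {..<length L} {..<length L'}" using assms(1) by simp
 ultimately show ?thesis unfolding isotopic_def using assms(1,2) by blast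
qed

lemma link_nth_in_S3: "is_link L ==> i < length L ==> (L ! i) t : S3"
proof -
 assume L: "is_link L" and i: "i < length L"
 have "pt L (i, frac t) : S3" using L frac_in_params[OF i] unfolding is_link_def by blast
 thus "(L ! i) t : S3" unfolding pt_def
  using closed_C1_frac(1)[OF embedded_C1[of L i], of t] L i is_link_iff by auto
qed

text \<open>The constant \<open>1/400\<close> becomes \<open>1/100\<close> after the extension, which loses the dimension
as a factor.\<close>
lemma small_perturb_isotopic:
 assumes L: "is_link L"
 obtains e where "e > 0" "!!L'. is_link L' ==> small_perturb e L L' ==> isotopic L L'"
proof -
 have emb: "embedded L" using L is_link_iff by auto
 obtain e0 where e0: "e0 > 0" and bil: "!!(c'::(real => real^4) list) i j s t. small_perturb e0 L c' ==> i < length L ==> j < length L ==>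
   norm (((c' ! i) s - (L ! i) s) - ((c' ! j) t - (L ! j) t)) <= (1/400) * norm ((L ! i) s - (L ! j) t)"
  by (rule embedded_bilipschitz[OF emb, of "1/400"]) (auto)
 define e where "e = min e0 (1/400)"
 show ?thesis
 proof (rule that[of e])
  show "e > 0" using e0 e_def by simp
  fix L' assume L': "is_link L'" and sp: "small_perturb e L L'"
  have sp0: "small_perturb e0 L L'" using sp unfolding small_perturb_def e_def by simp
  have len: "length L' = length L" using small_perturbD(1)[OF sp] .
  define S where "S = {x. on_sys L x}"
  define g where "g = (%x. SOME d. EX i<length L. EX t. x = (L ! i) t & d = (L' ! i) t - (L ! i) t)"
  have g: "g ((L ! i) t) = (L' ! i) t - (L ! i) t" if i: "i < length L" for i t
  proof -
   have "EX j<length L. EX u. (L ! i) t = (L ! j) u & g ((L ! i) t) = (L' ! j) u - (L ! j) u"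
    unfolding g_def by (rule someI_ex) (use i in blast)
   then obtain j u where j: "j < length L" "(L ! i) t = (L ! j) u" "g ((L ! i) t) = (L' ! j) u - (L ! j) u" by blast
   thus ?thesis using bil[OF sp0 i j(1), of t u] by simp
  qed
  obtain E where E: "!!x. x : S ==> E x = g x" "!!x y. norm (E x - E y) <= DIM(real^4) * (1/400) * dist x y"
  proof (rule lipschitz_extension[of "1/400" S g])
   fix x y assume "x : S" "y : S"
   then obtain i j s t where "i < length L" "j < length L" "x = (L ! i) s" "y = (L ! j) t" unfolding S_def by blast
   thus "norm (g x - g y) <= 1/400 * dist x y" using bil[OF sp0] g by (simp add: dist_norm)
  qed auto
  show "isotopic L L'"
  proof (cases "length L = 0")
   case True
   have "ambient_isotopy (%s x. (1 / norm (x + s *R 0)) *R (x + s *R (0::real^4)))"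
    by (rule small_displacement_isotopy[where k = 0]) auto
   thus ?thesis by (rule isotopicI_id[rotated]) (use True len in auto)
  next
   case False
   hence i0: "0 < length L" by simp
   have lip: "norm (E x - E y) <= 1/100 * norm (x - y)" for x y using E(2)[of x y] by (simp add: dist_norm)
   have bd: "norm (E x) <= 1/10" if x: "x : S3" for x
   proof -
    let ?p = "(L ! 0) 0"
    have p: "?p : S" "?p : S3" using i0 link_nth_in_S3[OF L i0] unfolding S_def by auto
    have "norm (E ?p) <= 1/400" using E(1)[OF p(1)] g[OF i0] small_perturbD(3)[OF sp i0, of 0] unfolding e_def by simp
    moreover have "norm (x - ?p) <= 2" using norm_triangle_ineq4[of x ?p] x p(2) by simp
    moreover have "norm (E x) <= norm (E ?p) + norm (E x - E ?p)" by (rule norm_triangle_sub)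
    ultimately show ?thesis using lip[of x ?p] by linarith
   qed
   have lip': "norm (E x - E y) <= 1/10 * norm (x - y)" for x y using lip[of x y] norm_ge_zero[of "x - y"] by linarith
   show ?thesis
   proof (rule isotopicI_id[OF _ small_displacement_isotopy[where k = "1/10", OF _ lip' bd]])
    fix i t assume i: "i < length L"
    have "(L ! i) t : S" unfolding S_def using i by blast
    hence "(L ! i) t + 1 *R E ((L ! i) t) = (L' ! i) t" using E(1) g[OF i] by simp
    moreover have "norm ((L' ! i) t) = 1" using link_nth_in_S3[OF L', of i t] i len by simp
    ultimately show "(1 / norm ((L ! i) t + 1 *R E ((L ! i) t))) *R ((L ! i) t + 1 *R E ((L ! i) t)) = (L' ! i) t" by simp
   qed (use len in auto)
  qed
 qed
qed

definition C1_family :: "(real => real => 'b::real_normed_vector) => bool" where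
 "C1_family F <-> (ALL s:{0..1}. closed_C1 (F s)) & continuous_on ({0..1} \<times> UNIV) (%(s, t). F s t) &
  continuous_on ({0..1} \<times> UNIV) (%(s, t). vd (F s) t)"

lemma family_locally_uniform:
 fixes h :: "real \<times> real => 'b::real_normed_vector"
 assumes "continuous_on ({0..1} \<times> UNIV) h" "s0 : {0..1}" "e > 0"
 obtains d where "d > 0" "!!s t. s : {0..1} ==> abs(s - s0) < d ==> t : {0..1} ==> norm (h (s, t) - h (s0, t)) <= e"
proof -
 have "uniformly_continuous_on ({0..1} \<times> {0..1}) h"
  by (rule compact_uniformly_continuous) (use assms in "auto intro: continuous_on_subset compact_Times")
 then obtain d where d: "d > 0" "!!x x'. x : {0..1} \<times> {0..1} ==> x' : {0..1} \<times> {0..1} ==> dist x' x < d ==> dist (h x') (h x) < e"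
  using assms(3) unfolding uniformly_continuous_on_def by metis
 show ?thesis
 proof (rule that[OF d(1)])
  fix s t :: real assume "s : {0..1}" "abs(s - s0) < d" "t : {0..1}"
  hence "dist (h (s, t)) (h (s0, t)) < e" using assms(2) by (intro d(2)) (auto simp: dist_Pair_Pair dist_real_def)
  thus "norm (h (s, t) - h (s0, t)) <= e" by (simp add: dist_norm)
 qed
qed

theorem link_invariant_C1_family:
 assumes f: "link_invariant f"
  and len: "!!s. length (G s) = n"
  and fam: "!!i. i < n ==> C1_family (%s. G s ! i)"
  and lk: "!!s. s : {0..1} ==> is_link (G s)"
 shows "f (G 0) = f (G 1)"
proof (rule connected_local_const[where A = "{0..1}" and f = "%s. f (G s)"])
 show "ALL a:{0..1}. \<forall>\<^sub>F b in at a within {0..1}. f (G a) = f (G b)"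
 proof
  fix a :: real assume a: "a : {0..1}"
  obtain e where e: "e > 0" "!!L'. is_link L' ==> small_perturb e (G a) L' ==> isotopic (G a) L'"
   by (rule small_perturb_isotopic[OF lk[OF a]]) (rule that; assumption)
  have "EX d>0. ALL s:{0..1}. abs(s - a) < d --> (ALL t:{0..1}. norm ((G s ! i) t - (G a ! i) t) <= e &
    norm (vd (G s ! i) t - vd (G a ! i) t) <= e)" if i: "i < n" for i
  proof -
   have c: "continuous_on ({0..1} \<times> UNIV) (%(s, t). (G s ! i) t)" "continuous_on ({0..1} \<times> UNIV) (%(s, t). vd (G s ! i) t)"
    using fam[OF i] unfolding C1_family_def by auto
   obtain d1 where d1: "d1 > 0" "!!s t. s : {0..1} ==> abs(s - a) < d1 ==> t : {0..1} ==> norm ((%(s, t). (G s ! i) t) (s, t) - (%(s, t). (G s ! i) t) (a, t)) <= e"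
    by (rule family_locally_uniform[OF c(1) a e(1)]) (rule that; assumption)
   obtain d2 where d2: "d2 > 0" "!!s t. s : {0..1} ==> abs(s - a) < d2 ==> t : {0..1} ==> norm ((%(s, t). vd (G s ! i) t) (s, t) - (%(s, t). vd (G s ! i) t) (a, t)) <= e"
    by (rule family_locally_uniform[OF c(2) a e(1)]) (rule that; assumption)
   show ?thesis by (rule exI[of _ "min d1 d2"]) (use d1 d2 in auto)
  qed
  then obtain d where d: "!!i. i < n ==> d i > (0::real)" "!!i s t. i < n ==> s : {0..1} ==> abs(s - a) < d i ==> t : {0..1} ==> norm ((G s ! i) t - (G a ! i) t) <= e &
    norm (vd (G s ! i) t - vd (G a ! i) t) <= e" by metis
  define D where "D = Min (insert 1 (d ` {..<n}))"
  have D: "D > 0" unfolding D_def using d(1) by (subst Min_gr_iff) auto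
  have Dle: "D <= d i" if "i < n" for i unfolding D_def using that by (intro Min_le) auto
  have "f (G a) = f (G b)" if b: "b : {0..1}" "abs(b - a) < D" for b
  proof -
   have "small_perturb e (G a) (G b)" unfolding small_perturb_def
   proof (intro conjI allI impI)
    fix i and t :: real assume "i < length (G a)"
    hence i: "i < n" using len by simp
    have cl: "closed_C1 (G a ! i)" "closed_C1 (G b ! i)" using fam[OF i] a b unfolding C1_family_def by auto
    thus "closed_C1 (G b ! i)" by simp
    have "frac t : {0..1}" using frac_lt_1[of t] by (auto intro: less_imp_le)
    hence "norm ((G b ! i) (frac t) - (G a ! i) (frac t)) <= e & norm (vd (G b ! i) (frac t) - vd (G a ! i) (frac t)) <= e"
     using d(2)[OF i b(1)] b(2) Dle[OF i] by auto
    thus "norm ((G b ! i) t - (G a ! i) t) <= e" "norm (vd (G b ! i) t - vd (G a ! i) t) <= e"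
     unfolding closed_C1_frac[OF cl(1)] closed_C1_frac[OF cl(2)] by auto
   qed (use len in auto)
   hence "isotopic (G a) (G b)" using e(2) lk[OF b(1)] by blast
   thus ?thesis using f lk a b unfolding link_invariant_def by blast
  qed
  thus "\<forall>\<^sub>F b in at a within {0..1}. f (G a) = f (G b)"
   unfolding eventually_at using D by (intro exI[of _ D]) (auto simp: dist_real_def)
 qed
qed auto

section \<open>Families of curves in 3-space\<close>

text \<open>The derivative as a bounded linear map, so that it is continuous in the operator norm.\<close>
definition dd :: "('a::euclidean_space => 'b::real_normed_vector) => 'a => 'a \<Rightarrow>\<^sub>L 'b" where
 "dd g x = Blinfun (frechet_derivative g (at x))"

lemma C1_onD:
 assumes "open W" "C1_on W g"
 shows "x : W ==> (g has_derivative blinfun_apply (dd g x)) (at x)"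
  and "x : W ==> blinfun_apply (dd g x) = frechet_derivative g (at x)"
  and "continuous_on W (dd g)" "continuous_on W g"
proof -
 have *: "(g has_derivative frechet_derivative g (at x)) (at x)" if "x : W" for x
  using assms that unfolding C1_on_def differentiable_on_def
  by (metis at_within_open frechet_derivative_works)
 show eq: "blinfun_apply (dd g x) = frechet_derivative g (at x)" if "x : W" for x
  unfolding dd_def by (rule bounded_linear_Blinfun_apply) (rule has_derivative_bounded_linear[OF *[OF that]])
 show "(g has_derivative blinfun_apply (dd g x)) (at x)" if "x : W" for x
  unfolding eq[OF that] by (rule *[OF that])
 show "continuous_on W (dd g)"
 proof (rule continuous_on_blinfun_componentwise)
  fix i :: 'a assume "i : Basis"
  have "continuous_on W (%x. frechet_derivative g (at x) i)" using assms unfolding C1_on_def by blast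
  thus "continuous_on W (%x. blinfun_apply (dd g x) i)" by (rule continuous_on_eq) (simp add: eq)
 qed
 show "continuous_on W g" using assms unfolding C1_on_def by (intro differentiable_imp_continuous_on) auto
qed

lemma C1_onI:
 assumes "open W" "!!x. x : W ==> (g has_derivative g' x) (at x)"
  "!!v. continuous_on W (%x. g' x v)"
 shows "C1_on W g" "x : W ==> frechet_derivative g (at x) = g' x"
proof -
 have eq: "frechet_derivative g (at x) = g' x" if "x : W" for x
  using assms(2)[OF that] by (rule frechet_derivative_at[symmetric])
 thus "x : W ==> frechet_derivative g (at x) = g' x" .
 show "C1_on W g" unfolding C1_on_def
 proof (intro conjI allI)
  show "g differentiable_on W" unfolding differentiable_on_def
   using assms(2) differentiable_at_withinI differentiable_def by blast
  fix v show "continuous_on W (%x. frechet_derivative g (at x) v)"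
   by (rule continuous_on_eq[OF assms(3)[of v]]) (simp add: eq)
 qed
qed

lemma dd_eqI:
 assumes "(g has_derivative g') (at x)" shows "blinfun_apply (dd g x) = g'"
 unfolding dd_def using frechet_derivative_at[OF assms] has_derivative_bounded_linear[OF assms]
 by (simp add: bounded_linear_Blinfun_apply)

lemma C1_on_compose:
 assumes "open W" "C1_on W g" "open V" "C1_on V h" "!!x. x : W ==> g x : V"
 shows "C1_on W (%x. h (g x))" "x : W ==> blinfun_apply (dd (%x. h (g x)) x) = (%v. dd h (g x) (dd g x v))"
proof -
 have *: "((%x. h (g x)) has_derivative (%v. dd h (g x) (dd g x v))) (at x)" if "x : W" for x
  using has_derivative_compose[OF C1_onD(1)[OF assms(1,2) that] C1_onD(1)[OF assms(3,4) assms(5)[OF that]]] .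
 show "x : W ==> blinfun_apply (dd (%x. h (g x)) x) = (%v. dd h (g x) (dd g x v))"
  by (rule dd_eqI[OF *])
 show "C1_on W (%x. h (g x))"
 proof (rule C1_onI(1)[OF assms(1) *])
  fix v
  have "continuous_on W (%x. dd h (g x))"
   by (rule cont_comp[OF C1_onD(3)[OF assms(3,4)] C1_onD(4)[OF assms(1,2)]]) (use assms(5) in auto)
  thus "continuous_on W (%x. dd h (g x) (dd g x v))"
   by (intro cintros C1_onD(3)[OF assms(1,2)])
 qed
qed

lemma C1_on_subset:
 assumes "open W" "C1_on W g" "V <= W" shows "C1_on V g"
 using assms unfolding C1_on_def
 by (meson continuous_on_subset differentiable_on_subset)

text \<open>The local form of \<open>C1_family\<close>, for families assembled from pieces in collar coordinates.\<close>
definition C1_fam_on :: "real set => (real => real => 'b::real_normed_vector) => bool" where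
 "C1_fam_on N F <-> (ALL s:{0..1}. ALL t:N. F s differentiable at t) &
  continuous_on ({0..1} \<times> N) (%(s, t). F s t) & continuous_on ({0..1} \<times> N) (%(s, t). vd (F s) t)"

lemma C1_fam_onI:
 assumes "!!s t. s : {0..1} ==> t : N ==> (F s has_vd F' s t) (at t)"
  "continuous_on ({0..1} \<times> N) (%(s, t). F s t)" "continuous_on ({0..1} \<times> N) (%(s, t). F' s t)"
 shows "C1_fam_on N F"
 unfolding C1_fam_on_def
proof (intro conjI ballI)
 show "F s differentiable at t" if "s : {0..1}" "t : N" for s t
  using assms(1)[OF that] by (rule differentiableI_vector)
 show "continuous_on ({0..1} \<times> N) (%(s, t). vd (F s) t)"
  by (rule continuous_on_eq[OF assms(3)]) (auto simp: vd_eqI[OF assms(1)])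
qed (rule assms(2))

lemma C1_fam_onD:
 assumes "C1_fam_on N F"
 shows "s : {0..1} ==> t : N ==> (F s has_vd vd (F s) t) (at t)"
  "continuous_on ({0..1} \<times> N) (%x. F (fst x) (snd x))" "continuous_on ({0..1} \<times> N) (%x. vd (F (fst x)) (snd x))"
 using assms unfolding C1_fam_on_def by (auto simp: vector_derivative_works case_prod_unfold)

lemma C1_fam_on_cong:
 assumes "C1_fam_on N G" "open N" "!!s t. s : {0..1} ==> t : N ==> F s t = G s t"
 shows "C1_fam_on N F"
proof (rule C1_fam_onI[where F' = "%s t. vd (G s) t"])
 show "(F s has_vd vd (G s) t) (at t)" if "s : {0..1}" "t : N" for s t
  by (rule has_vd_transform[OF C1_fam_onD(1)[OF assms(1) that] assms(2) that(2)])
   (use assms(3) that in auto)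
 show "continuous_on ({0..1} \<times> N) (%(s, t). F s t)"
  by (rule continuous_on_eq[OF C1_fam_onD(2)[OF assms(1)]]) (use assms(3) in auto)
 show "continuous_on ({0..1} \<times> N) (%(s, t). vd (G s) t)"
  using C1_fam_onD(3)[OF assms(1)] by (simp add: case_prod_unfold)
qed

lemma C1_fam_on_compose:
 assumes F: "C1_fam_on N F" and g: "open W" "C1_on W g" and W: "!!s t. s : {0..1} ==> t : N ==> F s t : W"
 shows "C1_fam_on N (%s t. g (F s t))"
  "s : {0..1} ==> t : N ==> vd (%t. g (F s t)) t = dd g (F s t) (vd (F s) t)"
proof -
 have *: "((%t. g (F s t)) has_vd dd g (F s t) (vd (F s) t)) (at t)" if "s : {0..1}" "t : N" for s t
  using vector_derivative_diff_chain_within[of "F s" "vd (F s) t" t UNIV g "blinfun_apply (dd g (F s t))"]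
   C1_fam_onD(1)[OF F that] C1_onD(1)[OF g W[OF that]] has_derivative_at_withinI
  by (auto simp: o_def)
 thus "s : {0..1} ==> t : N ==> vd (%t. g (F s t)) t = dd g (F s t) (vd (F s) t)"
  by (simp add: vd_eqI)
 show "C1_fam_on N (%s t. g (F s t))"
 proof (rule C1_fam_onI[OF *])
  show "continuous_on ({0..1} \<times> N) (%(s, t). g (F s t))" unfolding case_prod_unfold
   by (rule cont_comp[OF C1_onD(4)[OF g] C1_fam_onD(2)[OF F]]) (use W in auto)
  have "continuous_on ({0..1} \<times> N) (%x. dd g (F (fst x) (snd x)))"
   by (rule cont_comp[OF C1_onD(3)[OF g] C1_fam_onD(2)[OF F]]) (use W in auto)
  thus "continuous_on ({0..1} \<times> N) (%(s, t). dd g (F s t) (vd (F s) t))" unfolding case_prod_unfold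
   by (intro cintros C1_fam_onD(3)[OF F])
 qed
qed

lemma C1_fam_on_const: "closed_C1 ga ==> C1_fam_on N (%_. ga)"
 by (rule C1_fam_onI[where F' = "%_. vd ga"])
  (auto simp: case_prod_unfold closed_C1_has_vd intro!: cont_comp[OF closed_C1_cont[of ga UNIV]]
   cont_comp[OF closed_C1_vd_cont[of ga UNIV]] cintros)

lemma C1_family_iff: "C1_family F <-> C1_fam_on UNIV F & (ALL s:{0..1}. ALL t. F s (t + 1) = F s t)"
proof
 assume F: "C1_family F"
 thus "C1_fam_on UNIV F & (ALL s:{0..1}. ALL t. F s (t + 1) = F s t)"
  unfolding C1_family_def C1_fam_on_def closed_C1_def C1_differentiable_on_eq by auto
next
 assume F: "C1_fam_on UNIV F & (ALL s:{0..1}. ALL t. F s (t + 1) = F s t)"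
 have "closed_C1 (F s)" if s: "s : {0..1}" for s
 proof (rule closed_C1I[where ga' = "vd (F s)"])
  show "!!t. (F s has_vd vd (F s) t) (at t)" by (rule C1_fam_onD(1)[of UNIV]) (use F s in auto)
  have "continuous_on UNIV (%t. (%x. vd (F (fst x)) (snd x)) (s, t))"
   by (rule cont_comp[OF C1_fam_onD(3)[of UNIV F]]) (use F s in "auto intro!: cintros")
  thus "continuous_on UNIV (vd (F s))" by simp
 qed (use F s in auto)
 thus "C1_family F" using F unfolding C1_family_def C1_fam_on_def by auto
qed

lemma C1_family_local:
 assumes loc: "!!t0. EX N. open N & t0 : N & C1_fam_on N F"
  and per: "!!s t. s : {0..1} ==> F s (t + 1) = F s t"
 shows "C1_family F"
proof -
 obtain N where N: "!!t. open (N t)" "!!t. t : N t" "!!t. C1_fam_on (N t) F" using loc by metis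
 have cont: "continuous_on ({0..1} \<times> UNIV) h" if h: "!!t. continuous_on ({0..1} \<times> N t) h" for h :: "real \<times> real => 'a"
  unfolding continuous_on_def
 proof
  fix x :: "real \<times> real" assume x: "x : {0..1} \<times> UNIV"
  have "(h \<longlongrightarrow> h x) (at x within {0..1} \<times> N (snd x))"
   using h[of "snd x"] x N(2)[of "snd x"] unfolding continuous_on_def by (cases x) auto
  moreover have "at x within {0..1} \<times> N (snd x) = at x within {0..1} \<times> UNIV"
   by (rule at_within_nhd[where S = "UNIV \<times> N (snd x)"])
    (use N(1,2)[of "snd x"] in \<open>auto intro!: open_Times simp: mem_Times_iff\<close>)
  ultimately show "(h \<longlongrightarrow> h x) (at x within {0..1} \<times> UNIV)" by simp
 qed
 have "C1_fam_on UNIV F"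
  unfolding C1_fam_on_def
 proof (intro conjI ballI cont)
  fix t s :: real assume "s : {0..1}"
  thus "F s differentiable at t" using N(2,3)[of t] unfolding C1_fam_on_def by blast
 next
  fix t show "continuous_on ({0..1} \<times> N t) (%(s, t). F s t)" "continuous_on ({0..1} \<times> N t) (%(s, t). vd (F s) t)"
   using N(3)[of t] unfolding C1_fam_on_def by auto
 qed
 thus ?thesis unfolding C1_family_iff using per by blast
qed

lemma C1_fam_on_linear:
 assumes "C1_fam_on N F" "C1_fam_on N G"
 shows "C1_fam_on N (%s t. F s t + s *R (G s t - F s t))"
proof (rule C1_fam_onI[where F' = "%s t. vd (F s) t + s *R (vd (G s) t - vd (F s) t)"])
 show "((%t. F s t + s *R (G s t - F s t)) has_vd vd (F s) t + s *R (vd (G s) t - vd (F s) t)) (at t)"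
  if "s : {0..1}" "t : N" for s t
  by (intro has_vd_add has_vd_diff C1_fam_onD(1)[OF assms(1) that] C1_fam_onD(1)[OF assms(2) that]
   has_vd_diff bl_has_vd[OF bounded_linear_scaleR_right])
qed (unfold case_prod_unfold, (intro cintros C1_fam_onD(2,3) assms)+)

lemma C1_family_linear:
 assumes "closed_C1 al" "closed_C1 be"
 shows "C1_family (%s t. al t + s *R (be t - al t))"
 unfolding C1_family_iff
 using C1_fam_on_linear[OF C1_fam_on_const[OF assms(1)] C1_fam_on_const[OF assms(2)]] assms
 unfolding closed_C1_def by auto

definition emb3 :: "R3 => real^4" where
 "emb3 p = vector [Re (fst p), Im (fst p), snd p, 0]"

definition prj3 :: "real^4 => R3" where
 "prj3 x = (Complex (x $ 1) (x $ 2), x $ 3)"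

definition pole :: "real^4" where "pole = vector [0, 0, 0, 1]"

lemma vec4_nth [simp]:
 "(vector [a, b, c, d] :: 'a::zero^4) $ 1 = a" "(vector [a, b, c, d] :: 'a^4) $ 2 = b"
 "(vector [a, b, c, d] :: 'a^4) $ 3 = c" "(vector [a, b, c, d] :: 'a^4) $ 4 = d"
 unfolding vector_def by simp_all

lemma vec4_eq_iff: "(x :: 'a^4) = y <-> x $ 1 = y $ 1 & x $ 2 = y $ 2 & x $ 3 = y $ 3 & x $ 4 = y $ 4"
 unfolding vec_eq_iff forall_4 by simp

lemma bounded_linear_emb3: "bounded_linear emb3"
 unfolding emb3_def linear_conv_bounded_linear[symmetric]
 by (rule linearI) (auto simp: vec4_eq_iff)

lemma bounded_linear_prj3: "bounded_linear prj3"
 unfolding prj3_def linear_conv_bounded_linear[symmetric]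
 by (rule linearI) (auto simp: complex_eq_iff)

lemma stereo_eq: "stereo p = pole + (2 / (p \<bullet> p + 1)) *R (emb3 p - pole)"
proof -
 obtain z h where p: "p = (z, h)" by fastforce
 have r: "p \<bullet> p = (cmod z)^2 + h^2" unfolding p by (simp add: inner_prod_def power2_norm_eq_inner) (simp add: power2_eq_square)
 have "(cmod z)^2 + h^2 + 1 > 0" by (simp add: add_nonneg_pos)
 hence nz: "(cmod z)^2 + h^2 + 1 ~= 0" by simp
 show ?thesis unfolding r unfolding p stereo_def Let_def emb3_def pole_def vec4_eq_iff using nz
  by (auto simp: divide_simps)
qed

lemma inner_plus_one_pos: "p \<bullet> p + 1 > (0::real)" for p :: "'a::real_inner"
 by (simp add: add_nonneg_pos)

lemma norm4: "(norm (x :: real^4))^2 = (x $ 1)^2 + (x $ 2)^2 + (x $ 3)^2 + (x $ 4)^2"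
 unfolding power2_norm_eq_inner inner_vec_def sum_4 by (simp add: power2_eq_square)

lemma stereo_nth4: "stereo p $ 4 = 1 - 2 / (p \<bullet> p + 1)"
 unfolding stereo_eq by (simp add: pole_def emb3_def)

lemma stereo_nth4_neq: "stereo p $ 4 ~= 1"
 unfolding stereo_nth4 using inner_plus_one_pos[of p] by simp

lemma stereo_in_S3: "stereo p : S3"
proof -
 define c where "c = 2 / (p \<bullet> p + 1)"
 obtain z h where p: "p = (z, h)" by fastforce
 have r: "p \<bullet> p = (Re z)^2 + (Im z)^2 + h^2" unfolding p by (simp add: inner_prod_def inner_complex_def power2_eq_square)
 have "p \<bullet> p + 1 ~= 0" using inner_plus_one_pos[of p] by simp
 hence "2 / (p \<bullet> p + 1) * (p \<bullet> p + 1) = 2" by (metis nonzero_eq_divide_eq)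
 hence c: "c * ((Re z)^2 + (Im z)^2 + h^2 + 1) = 2" unfolding c_def r[symmetric] .
 have "(norm (stereo p))^2 = (c * Re z)^2 + (c * Im z)^2 + (c * h)^2 + (1 - c)^2"
  unfolding norm4 stereo_eq c_def[symmetric] by (simp add: p pole_def emb3_def)
 also have "... = c * (c * ((Re z)^2 + (Im z)^2 + h^2 + 1)) + 1 - 2 * c" by (simp add: algebra_simps power2_eq_square)
 also have "... = 1" unfolding c by simp
 finally show ?thesis by (simp add: power2_eq_1_iff) (use norm_ge_zero[of "stereo p"] in linarith)
qed

definition stinv :: "real^4 => R3" where
 "stinv x = (1 / (1 - x $ 4)) *R prj3 x"

lemma prj3_emb3: "prj3 (emb3 p) = p"
 by (cases p) (simp add: prj3_def emb3_def)

lemma stinv_stereo [simp]: "stinv (stereo p) = p"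
proof -
 have "prj3 pole = 0" by (simp add: prj3_def pole_def zero_prod_def complex_eq_iff)
 hence "prj3 (stereo p) = (2 / (p \<bullet> p + 1)) *R p"
  unfolding stereo_eq using prj3_emb3[of p] bounded_linear_prj3
  by (simp add: linear_simps)
 moreover have "1 / (1 - stereo p $ 4) = (p \<bullet> p + 1) / 2" unfolding stereo_nth4 by simp
 moreover have "(p \<bullet> p + 1) / 2 * (2 / (p \<bullet> p + 1)) = 1" using inner_plus_one_pos[of p] by (simp only: times_divide_times_eq mult.commute[of _ 2]) auto
 ultimately show ?thesis unfolding stinv_def by (metis scaleR_one scaleR_scaleR)
qed

lemma stereo_inj: "inj stereo" by (rule inj_on_inverseI[of _ stinv]) simp

lemma stereo_stinv:
 assumes "x : S3" "x $ 4 ~= 1" shows "stereo (stinv x) = x"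
proof -
 have n: "(x $ 1)^2 + (x $ 2)^2 + (x $ 3)^2 + (x $ 4)^2 = 1" using assms(1) norm4[of x] by simp
 define d where "d = 1 - x $ 4"
 have d: "d ~= 0" using assms d_def by simp
 have s: "stinv x = (Complex (x $ 1 / d) (x $ 2 / d), x $ 3 / d)"
  unfolding stinv_def prj3_def d_def by (simp add: complex_eq_iff)
 have "stinv x \<bullet> stinv x = ((x $ 1)^2 + (x $ 2)^2 + (x $ 3)^2) / d^2"
  unfolding s by (simp add: inner_prod_def inner_complex_def power2_eq_square add_divide_distrib)
 also have "(x $ 1)^2 + (x $ 2)^2 + (x $ 3)^2 = d * (2 - d)" using n unfolding d_def by (simp add: power2_eq_square algebra_simps)
 finally have "stinv x \<bullet> stinv x + 1 = d * (2 - d) / d^2 + 1" by simp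
 also have "... = 2 / d" using d by (simp add: field_simps power2_eq_square)
 finally have "stinv x \<bullet> stinv x + 1 = 2 / d" .
 hence c: "2 / (stinv x \<bullet> stinv x + 1) = d" using d by simp
 show ?thesis unfolding stereo_eq c unfolding s vec4_eq_iff using d by (simp add: emb3_def pole_def) (simp add: d_def)
qed

lemma has_derivative_stereo:
 "(stereo has_derivative (%v. (2 / (p \<bullet> p + 1)) *R emb3 v + (- (2 * (2 * (p \<bullet> v)) / (p \<bullet> p + 1)^2)) *R (emb3 p - pole))) (at p)"
 unfolding stereo_eq[abs_def] using inner_plus_one_pos[of p]
 by (auto intro!: dintros bounded_linear.has_derivative[OF bounded_linear_emb3] simp: inner_commute power2_eq_square field_simps)

lemma C1_on_stereo: "C1_on UNIV stereo"
proof (rule C1_onI(1)[OF _ has_derivative_stereo])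
 fix v :: "R3"
 have nz: "p \<bullet> p + 1 ~= 0" for p :: "R3" using inner_plus_one_pos[of p] by simp
 show "continuous_on UNIV (%p. (2 / (p \<bullet> p + 1)) *R emb3 v + (- (2 * (2 * (p \<bullet> v)) / (p \<bullet> p + 1)^2)) *R (emb3 p - pole))"
  by (intro cintros linear_continuous_on bounded_linear_emb3) (use nz in auto)
qed simp

lemma C1_on_stinv: "C1_on {x. x $ 4 ~= 1} stinv" and open_stinv_dom: "open {x :: real^4. x $ 4 ~= 1}"
proof -
 show op: "open {x :: real^4. x $ 4 ~= 1}"
  by (intro open_Collect_neq cintros)
 show "C1_on {x. x $ 4 ~= 1} stinv"
 proof (rule C1_onI(1)[OF op])
  fix x :: "real^4" assume x: "x : {x. x $ 4 ~= 1}"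
  have b: "((%x::real^4. x $ 4) has_derivative (%v. v $ 4)) (at x)"
   by (intro bounded_linear.has_derivative[OF bounded_linear_vec_nth] has_derivative_ident)
  show "(stinv has_derivative (%v. (1 / (1 - x $ 4)) *R prj3 v + (v $ 4 / (1 - x $ 4)^2) *R prj3 x)) (at x)"
   unfolding stinv_def[abs_def] using x
   by (auto intro!: dintros b bounded_linear.has_derivative[OF bounded_linear_prj3]
    simp: power2_eq_square field_simps)
 next
  fix v :: "real^4"
  show "continuous_on {x. x $ 4 ~= 1} (%x. (1 / (1 - x $ 4)) *R prj3 v + (v $ 4 / (1 - x $ 4)^2) *R prj3 x)"
   by (intro cintros linear_continuous_on bounded_linear_prj3) auto
 qed
qed

lemma stereo_derivative_left_inverse: "dd stinv (stereo p) (dd stereo p v) = v"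
proof -
 have "blinfun_apply (dd (%p. stinv (stereo p)) p) = (%v. dd stinv (stereo p) (dd stereo p v))"
  by (rule C1_on_compose(2)[OF open_UNIV C1_on_stereo open_stinv_dom C1_on_stinv]) (simp_all add: stereo_nth4_neq)
 moreover have "blinfun_apply (dd (%p. stinv (stereo p)) p) = (%v. v)"
  by (rule dd_eqI) simp
 ultimately show ?thesis by metis
qed

lemma dd_stereo_eq_0: "dd stereo p v = 0 ==> v = 0"
 using stereo_derivative_left_inverse[of p v] by (simp add: blinfun.bilinear_simps)

definition st :: "(real => R3) list => link" where
 "st K = map (%ga t. stereo (ga t)) K"

lemma length_st [simp]: "length (st K) = length K" by (simp add: st_def)
lemma nth_st [simp]: "i < length K ==> st K ! i = (%t. stereo ((K ! i) t))" by (simp add: st_def)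

lemma C1_family_stereo:
 assumes "C1_family F"
 shows "C1_family (%s t. stereo (F s t))" "s : {0..1} ==> vd (%t. stereo (F s t)) t = dd stereo (F s t) (vd (F s) t)"
 using C1_fam_on_compose[OF _ open_UNIV C1_on_stereo, of UNIV F] assms unfolding C1_family_iff by auto

lemma closed_C1_stereo:
 assumes "closed_C1 ga"
 shows "closed_C1 (%t. stereo (ga t))" "vd (%t. stereo (ga t)) t = dd stereo (ga t) (vd ga t)"
proof -
 have "C1_family (%s::real. ga)" unfolding C1_family_iff using C1_fam_on_const[OF assms] assms closed_C1_def by auto
 from C1_family_stereo(1)[OF this] C1_family_stereo(2)[OF this, of 0]
 show "closed_C1 (%t. stereo (ga t))" "vd (%t. stereo (ga t)) t = dd stereo (ga t) (vd ga t)"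
  unfolding C1_family_def by auto
qed

lemma is_link_st:
 assumes K: "embedded K" shows "is_link (st K)"
 unfolding is_link_iff
proof
 show "embedded (st K)"
 proof (rule embedded_systemI)
  show "closed_C1 (st K ! i)" if "i < length (st K)" for i
   using that embedded_C1[OF K] by (simp add: closed_C1_stereo)
  show "vd (st K ! i) t ~= 0" if "i < length (st K)" for i t
   using that embedded_C1[OF K, of i] embedded_vd[OF K, of i t] dd_stereo_eq_0[of "(K ! i) t" "vd (K ! i) t"]
   by (auto simp: closed_C1_stereo(2))
  show "i = j & s = t" if ij: "i < length (st K)" "j < length (st K)" "s : {0..<1}" "t : {0..<1}"
   "(st K ! i) s = (st K ! j) t" for i j s t
  proof -
   have "pt K (i, s) = pt K (j, t)" using ij stereo_inj unfolding pt_def by (simp add: inj_eq)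
   hence "(i, s) = (j, t)" using embedded_inj[OF K, of "(i, s)" "(j, t)"] ij unfolding params_def by simp
   thus ?thesis by simp
  qed
 qed
 show "pt (st K) ` params (st K) <= S3"
 proof (rule image_subsetI)
  fix p assume "p : params (st K)"
  hence "pt (st K) p = stereo (pt K p)" unfolding pt_def params_def by auto
  thus "pt (st K) p : S3" by (simp only: stereo_in_S3)
 qed
qed

theorem invariant_C1_family_R3:
 assumes "link_invariant f" "!!s. length (G s) = n"
  and "!!i. i < n ==> C1_family (%s. G s ! i)"
  and "!!s. s : {0..1} ==> embedded (G s)"
 shows "f (st (G 0)) = f (st (G 1))"
proof (rule link_invariant_C1_family[OF assms(1), where G = "%s. st (G s)" and n = n])
 fix i assume i: "i < n"
 have "(%s. st (G s) ! i) = (%s t. stereo ((G s ! i) t))" using assms(2) i by (intro ext) simp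
 thus "C1_family (%s. st (G s) ! i)" using C1_family_stereo(1)[OF assms(3)[OF i]] by simp
qed (use assms is_link_st in auto)

lemma invariant_small_perturb_R3:
 assumes f: "link_invariant f" and K: "embedded K"
 obtains e where "e > 0" "!!K'. small_perturb e K K' ==> embedded K' & f (st K') = f (st K)"
proof -
 obtain e where e: "e > 0" "!!K'. small_perturb e K K' ==> embedded K'"
  by (rule embedded_perturb[OF K]) (rule that; assumption)
 show ?thesis
 proof (rule that[OF e(1)])
  fix K' assume sp: "small_perturb e K K'"
  define G where "G = (%s. map (%i t. (K ! i) t + s *R ((K' ! i) t - (K ! i) t)) [0..<length K])"
  have Gi: "G s ! i = (%t. (K ! i) t + s *R ((K' ! i) t - (K ! i) t))" if "i < length K" for i s
   unfolding G_def using that by simp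
  have len: "length K' = length K" by (rule small_perturbD(1)[OF sp])
  have fam: "C1_family (%s. G s ! i)" if i: "i < length K" for i
   unfolding Gi[OF i] by (rule C1_family_linear[OF embedded_C1[OF K i] small_perturbD(2)[OF sp i]])
  have vdG: "vd (G s ! i) t = vd (K ! i) t + s *R (vd (K' ! i) t - vd (K ! i) t)" if i: "i < length K" for s i t
   unfolding Gi[OF i]
   by (rule vd_eqI) (intro has_vd_add has_vd_diff
    bl_has_vd[OF bounded_linear_scaleR_right]
    closed_C1_has_vd embedded_C1[OF K i] small_perturbD(2)[OF sp i])
  have "f (st (G 0)) = f (st (G 1))"
  proof (rule invariant_C1_family_R3[OF f, where n = "length K"])
   show "length (G s) = length K" for s unfolding G_def by simp
   show "embedded (G s)" if s: "s : {0..1}" for s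
   proof (rule e(2), unfold small_perturb_def, intro conjI allI impI)
    show "length (G s) = length K" unfolding G_def by simp
    fix i t assume i: "i < length K"
    show "closed_C1 (G s ! i)" using fam[OF i] s unfolding C1_family_def by blast
    have sc: "norm (s *R v) <= e" if "norm v <= e" for v :: "R3"
     using that s mult_mono[of "abs s" 1 "norm v" e] by auto
    show "norm ((G s ! i) t - (K ! i) t) <= e" unfolding Gi[OF i] using sc[OF small_perturbD(3)[OF sp i]] by simp
    show "norm (vd (G s ! i) t - vd (K ! i) t) <= e" unfolding vdG[OF i] using sc[OF small_perturbD(4)[OF sp i]] by simp
   qed
  qed (use fam in auto)
  moreover have "G 0 = K" "G 1 = K'" by (auto intro!: nth_equalityI simp: G_def len)
  ultimately show "embedded K' & f (st K') = f (st K)" using e(2)[OF sp] by simp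
 qed
qed

section \<open>Alternating sums and crossings\<close>

lemma alt_sum_insert:
 assumes "finite A" "j ~: A"
 shows "alternating_sum (insert j A) F = alternating_sum A (%S. F S - F (insert j S))"
proof -
 define s where "s = (%S (x::'b). if even (card (S :: 'a set)) then x else - x)"
 have "alternating_sum (insert j A) F = (SUM S:Pow A Un insert j ` Pow A. s S (F S))"
  unfolding alternating_sum_def Pow_insert s_def by simp
 also have "... = (SUM S:Pow A. s S (F S)) + (SUM S:insert j ` Pow A. s S (F S))"
  by (rule sum.union_disjoint) (use assms in auto)
 also have "(SUM S:insert j ` Pow A. s S (F S)) = (SUM S:Pow A. s (insert j S) (F (insert j S)))"
  by (rule sum.reindex_cong[where l = "insert j"]) (use assms in "auto simp: inj_on_def")
 also have "... = (SUM S:Pow A. - s S (F (insert j S)))"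
 proof (rule sum.cong)
  fix S assume "S : Pow A"
  hence "card (insert j S) = Suc (card S)" using assms finite_subset by (subst card_insert_disjoint) auto
  thus "s (insert j S) (F (insert j S)) = - s S (F (insert j S))" unfolding s_def by auto
 qed simp
 also have "(SUM S:Pow A. s S (F S)) + ... = (SUM S:Pow A. s S (F S - F (insert j S)))"
  unfolding sum.distrib[symmetric] by (rule sum.cong) (auto simp: s_def)
 finally show ?thesis unfolding alternating_sum_def s_def .
qed

lemma alt_sum_add: "alternating_sum A (%S. F S + G S) = alternating_sum A F + alternating_sum A G"
 unfolding alternating_sum_def sum.distrib[symmetric] by (rule sum.cong) auto

lemma alt_sum_neg: "alternating_sum A (%S. - F S) = - alternating_sum A F"
 unfolding alternating_sum_def sum_negf[symmetric] by (rule sum.cong) auto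

lemma alt_sum_cong: "(!!S. S <= A ==> F S = G S) ==> alternating_sum A F = alternating_sum A G"
 unfolding alternating_sum_def by (rule sum.cong) auto

lemma alt_sum_image:
 assumes "inj_on g J"
 shows "alternating_sum (g ` J) F = alternating_sum J (%S. F (g ` S))"
 unfolding alternating_sum_def
proof (rule sum.reindex_cong[where l = "image g"])
 show "inj_on ((`) g) (Pow J)" by (rule inj_on_image_Pow[OF assms])
 show "Pow (g ` J) = (`) g ` Pow J" by (rule image_Pow_surj[symmetric]) simp
 fix S assume "S : Pow J"
 hence "card (g ` S) = card S" using assms by (intro card_image) (auto intro: inj_on_subset)
 thus "(if even (card (g ` S)) then F (g ` S) else - F (g ` S)) = (if even (card S) then F (g ` S) else - F (g ` S))" by simp
qed

text \<open>A change of base point of the cube of crossing changes multiplies the sum by a sign, so over-strands may be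
chosen at will.\<close>
lemma alt_sum_shift_zero:
 assumes "finite X" "S0 <= X" "alternating_sum X (%S. F (sym_diff S S0)) = 0"
 shows "alternating_sum X F = 0"
proof -
 have one: "alternating_sum X (%S. G (sym_diff S {x})) = - alternating_sum X G" if "x : X" for x and G :: "'a set => 'b"
 proof -
  define A where "A = X - {x}"
  have A: "finite A" "x ~: A" "X = insert x A" using that assms(1) unfolding A_def by auto
  show ?thesis unfolding A(3) alt_sum_insert[OF A(1,2)] alt_sum_neg[symmetric]
  proof (rule alt_sum_cong)
   fix S assume "S <= A"
   hence "sym_diff S {x} = insert x S" "sym_diff (insert x S) {x} = S" using A by auto
   thus "G (sym_diff S {x}) - G (sym_diff (insert x S) {x}) = - (G S - G (insert x S))" by simp
  qed
 qed
 have "finite S0" using assms finite_subset by auto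
 hence "alternating_sum X (%S. G (sym_diff S S0)) = alternating_sum X G |
   alternating_sum X (%S. G (sym_diff S S0)) = - alternating_sum X G" for G :: "'a set => 'b"
  using assms(2)
 proof (induction S0 arbitrary: G)
  case (insert x S0)
  have "alternating_sum X (%S. G (sym_diff S (insert x S0))) = alternating_sum X (%S. (%S. G (sym_diff S {x})) (sym_diff S S0))"
  proof (rule alt_sum_cong)
   fix S
   have "sym_diff S (insert x S0) = sym_diff (sym_diff S S0) {x}" using insert.hyps by auto
   thus "G (sym_diff S (insert x S0)) = (%S. G (sym_diff S {x})) (sym_diff S S0)" by simp
  qed
  thus ?case using insert.IH[of "%S. G (sym_diff S {x})"] one[of x G] insert.prems by auto
 qed simp
 from this[of F] show ?thesis using assms(3) by auto
qed

text \<open>Changing all of \<open>Y j\<close> is changing all but one of its elements followed by changing that one.\<close>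
lemma alt_sum_telescope:
 fixes F :: "'x set => 'a::ab_group_add"
 assumes van: "!!X B. X <= C ==> B <= C ==> X Int B = {} ==> finite X ==> card X = m ==> alternating_sum X (%S. F (B Un S)) = 0"
  and J: "finite J" "card J = m"
 shows "(!!j. j : J ==> finite (Y j) & Y j <= C & Y j Int B = {}) ==> disjoint_family_on Y J ==> B <= C ==>
  alternating_sum J (%S. F (B Un \<Union> (Y ` S))) = 0"
proof (induction "SUM j:J. card (Y j)" arbitrary: Y B rule: less_induct)
 case less
 note Y = less.prems(1) and disj = less.prems(2)
 have split: "finite (J - {j})" "j ~: J - {j}" "J = insert j (J - {j})" if "j : J" for j
  using that J by auto
 consider (empty) j where "j : J" "Y j = {}" | (two) j where "j : J" "card (Y j) >= 2"
  | (one) "ALL j:J. card (Y j) = 1"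
 proof -
  have "Y j = {} | card (Y j) >= 2 | card (Y j) = 1" if "j : J" for j
   using Y[OF that] by (cases "card (Y j)") (auto simp: Suc_le_eq)
  thus ?thesis using that by metis
 qed
 thus ?case
 proof cases
  case empty
  have "alternating_sum J (%S. F (B Un \<Union> (Y ` S))) = alternating_sum (J - {j}) (%S. 0)"
   unfolding alt_sum_insert[OF split(1,2)[OF empty(1)], folded split(3)[OF empty(1)]]
   by (rule alt_sum_cong) (simp add: empty)
  moreover have "alternating_sum (J - {j}) (%S. 0 :: 'a) = 0"
   unfolding alternating_sum_def by (rule sum.neutral) simp
  ultimately show ?thesis by simp
 next
  case two
  then obtain y where y: "y : Y j" by fastforce
  define Y1 where "Y1 = Y(j := {y})"
  define Y2 where "Y2 = Y(j := Y j - {y})"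
  define B2 where "B2 = insert y B"
  note spl = split[OF two(1)]
  have sumsplit: "(SUM i:J. card (Z i)) = card (Z j) + (SUM i:J - {j}. card (Z i))" for Z :: "'b => 'x set"
   using sum.remove[OF J(1) two(1)] .
  have eqs: "(SUM i:J - {j}. card (Y1 i)) = (SUM i:J - {j}. card (Y i))" "(SUM i:J - {j}. card (Y2 i)) = (SUM i:J - {j}. card (Y i))"
   unfolding Y1_def Y2_def by (auto intro!: sum.cong)
  have dj: "Y i Int Y k = {}" if "i : J" "k : J" "i ~= k" for i k using disj that unfolding disjoint_family_on_def by blast
  have y_notin: "y ~: Y i" if "i : J" "i ~= j" for i using dj[OF that(1) two(1) that(2)] y by blast
  have 1: "alternating_sum J (%S. F (B Un \<Union> (Y1 ` S))) = 0"
  proof (rule less.hyps)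
   show "(SUM i:J. card (Y1 i)) < (SUM i:J. card (Y i))" unfolding sumsplit eqs using two(2) by (simp add: Y1_def)
   show "!!i. i : J ==> finite (Y1 i) & Y1 i <= C & Y1 i Int B = {}"
    subgoal for i using Y[of i] Y[OF two(1)] y unfolding Y1_def by auto
    done
   show "disjoint_family_on Y1 J" unfolding disjoint_family_on_def Y1_def using dj y_notin by auto
  qed (rule less.prems(3))
  have 2: "alternating_sum J (%S. F (B2 Un \<Union> (Y2 ` S))) = 0"
  proof (rule less.hyps)
   have "card (Y2 j) < card (Y j)" using y Y[OF two(1)] two(2) unfolding Y2_def by simp
   thus "(SUM i:J. card (Y2 i)) < (SUM i:J. card (Y i))" unfolding sumsplit eqs by simp
   show "!!i. i : J ==> finite (Y2 i) & Y2 i <= C & Y2 i Int B2 = {}"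
    using Y y_notin unfolding Y2_def B2_def by auto
   show "disjoint_family_on Y2 J" unfolding disjoint_family_on_def Y2_def using dj by auto
   show "B2 <= C" unfolding B2_def using less.prems(3) Y[OF two(1)] y by auto
  qed
  have "alternating_sum J (%S. F (B Un \<Union> (Y ` S))) =
   alternating_sum J (%S. F (B Un \<Union> (Y1 ` S))) + alternating_sum J (%S. F (B2 Un \<Union> (Y2 ` S)))"
   unfolding alt_sum_insert[OF spl(1,2), folded spl(3)] alt_sum_add[symmetric]
  proof (rule alt_sum_cong)
   fix S assume S: "S <= J - {j}"
   have "\<Union> (Y1 ` S) = \<Union> (Y ` S)" "\<Union> (Y2 ` S) = \<Union> (Y ` S)"
    using S unfolding Y1_def Y2_def by auto
   moreover have "B Un \<Union> (Y1 ` insert j S) = B2 Un \<Union> (Y ` S)"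
    unfolding B2_def image_insert Union_insert calculation(1) by (simp add: Y1_def)
   moreover have "B2 Un \<Union> (Y2 ` insert j S) = B Un \<Union> (Y ` insert j S)"
    unfolding B2_def image_insert Union_insert calculation(2) using y by (auto simp: Y2_def)
   ultimately show "F (B Un \<Union> (Y ` S)) - F (B Un \<Union> (Y ` insert j S)) =
    F (B Un \<Union> (Y1 ` S)) - F (B Un \<Union> (Y1 ` insert j S)) + (F (B2 Un \<Union> (Y2 ` S)) - F (B2 Un \<Union> (Y2 ` insert j S)))"
    by simp
  qed
  thus ?thesis using 1 2 by simp
 next
  case one
  hence "ALL j:J. EX y. Y j = {y}" by (simp add: card_1_singleton_iff)
  then obtain y where y: "!!j. j : J ==> Y j = {y j}" by metis
  have inj: "inj_on y J"
  proof (rule inj_onI, rule ccontr)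
   fix i k assume "i : J" "k : J" "y i = y k" "i ~= k"
   thus False using disj y unfolding disjoint_family_on_def by fastforce
  qed
  have "alternating_sum (y ` J) (%S. F (B Un S)) = 0"
   by (rule van) (use Y y less.prems J inj card_image in "auto simp: card_image")
  hence "alternating_sum J (%S. F (B Un y ` S)) = 0" unfolding alt_sum_image[OF inj] .
  moreover have "alternating_sum J (%S. F (B Un y ` S)) = alternating_sum J (%S. F (B Un \<Union> (Y ` S)))"
  proof (rule alt_sum_cong)
   fix S assume "S <= J"
   hence "\<Union> (Y ` S) = y ` S" using y by auto
   thus "F (B Un y ` S) = F (B Un \<Union> (Y ` S))" by simp
  qed
  ultimately show ?thesis by simp
 qed
qed

lemma closed_C1_const: "closed_C1 (%t. a)"
 by (rule closed_C1I[where ga' = "%_. 0"]) auto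

lemma closed_C1_Pair:
 assumes "closed_C1 f" "closed_C1 g"
 shows "closed_C1 (%t. (f t, g t))" "vd (%t. (f t, g t)) t = (vd f t, vd g t)"
proof -
 have *: "((%t. (f t, g t)) has_vd (vd f t, vd g t)) (at t)" for t
  by (intro has_vector_derivative_Pair closed_C1_has_vd assms)
 show "closed_C1 (%t. (f t, g t))"
  by (rule closed_C1I[OF *]) (use assms in "auto intro!: cintros closed_C1_vd_cont simp: closed_C1_def")
 show "vd (%t. (f t, g t)) t = (vd f t, vd g t)" by (rule vd_eqI[OF *])
qed

lemma closed_C1_add:
 assumes "closed_C1 f" "closed_C1 g"
 shows "closed_C1 (%t. f t + g t)" "vd (%t. f t + g t) t = vd f t + vd g t"
proof -
 have *: "((%t. f t + g t) has_vd vd f t + vd g t) (at t)" for t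
  by (intro has_vd_add closed_C1_has_vd assms)
 show "closed_C1 (%t. f t + g t)"
  by (rule closed_C1I[OF *]) (use assms in "auto intro!: cintros closed_C1_vd_cont simp: closed_C1_def")
 show "vd (%t. f t + g t) t = vd f t + vd g t" by (rule vd_eqI[OF *])
qed

lemma closed_C1_mult:
 fixes f g :: "real => 'a::real_normed_algebra"
 assumes "closed_C1 f" "closed_C1 g"
 shows "closed_C1 (%t. f t * g t)"
proof -
 have *: "((%t. f t * g t) has_vd f t * vd g t + vd f t * g t) (at t)" for t
  by (intro has_vector_derivative_mult closed_C1_has_vd assms)
 show ?thesis
 proof (rule closed_C1I[OF *])
  show "continuous_on UNIV (%t. f t * vd g t + vd f t * g t)"
   by (intro cintros closed_C1_vd_cont closed_C1_cont assms)
  show "f (t + 1) * g (t + 1) = f t * g t" for t using assms unfolding closed_C1_def by simp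
 qed
qed

lemma closed_C1_sum: "finite A ==> (!!a. a : A ==> closed_C1 (f a)) ==> closed_C1 (%t. SUM a:A. f a t)"
 by (induction A rule: finite_induct) (auto intro: closed_C1_const closed_C1_add)

lemma closed_C1_prod:
 fixes f :: "'b => real => 'a::{real_normed_algebra,comm_monoid_mult}"
 shows "finite A ==> (!!a. a : A ==> closed_C1 (f a)) ==> closed_C1 (%t. PROD a:A. f a t)"
 by (induction A rule: finite_induct) (auto intro: closed_C1_const closed_C1_mult)

lemma closed_C1_sin_sq: "closed_C1 (%t. (sin (pi * (t - a)))\<^sup>2 :: real)"
proof (rule closed_C1I)
 show "((%t. (sin (pi * (t - a)))\<^sup>2) has_vd 2 * sin (pi * (t - a)) * (cos (pi * (t - a)) * pi)) (at t)" for t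
  unfolding real_has_vd[symmetric] by (auto intro!: dintros)
 show "continuous_on UNIV (%t. 2 * sin (pi * (t - a)) * (cos (pi * (t - a)) * pi))" by (intro cintros)
 fix t
 have "pi * (t + 1 - a) = pi * (t - a) + pi" by (simp add: algebra_simps)
 thus "(sin (pi * (t + 1 - a)))^2 = (sin (pi * (t - a)))^2" by simp
qed

definition det2 :: "complex => complex => real" where "det2 a b = Re a * Im b - Im a * Re b"

lemma det2_bound: "(abs x + abs y) * abs(det2 a b) <= (norm a + norm b) * norm (x *R a - y *R b)"
proof -
 let ?w = "x *R a - y *R b"
 have c: "abs(det2 u v) <= norm u * norm v" for u v
 proof -
  have "det2 u v = Im (cnj u * v)" unfolding det2_def by simp
  thus ?thesis using abs_Im_le_cmod[of "cnj u * v"] by (simp add: norm_mult)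
 qed
 have "det2 ?w b = x * det2 a b" "det2 a ?w = - (y * det2 a b)" unfolding det2_def by (simp_all add: algebra_simps)
 hence "abs x * abs(det2 a b) <= norm b * norm ?w" "abs y * abs(det2 a b) <= norm a * norm ?w"
  using c[of ?w b] c[of a ?w] by (simp_all add: abs_mult mult.commute)
 thus ?thesis by (simp add: algebra_simps)
qed

lemma independent_complex_iff: "independent {a, b} & a ~= b <-> det2 a b ~= 0"
proof
 assume ind: "independent {a, b} & a ~= b"
 show "det2 a b ~= 0"
 proof
  assume d: "det2 a b = 0"
  have b0: "b ~= 0" using ind dependent_zero[of "{a, b}"] by auto
  have "a = (Re (a * cnj b) / (cmod b)^2) *R b"
  proof -
   have n: "(cmod b)^2 = Re b * Re b + Im b * Im b" unfolding cmod_power2 by (simp add: power2_eq_square)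
   have n0: "(cmod b)^2 ~= 0" using b0 by simp
   have "(cmod b)^2 *R a = Re (a * cnj b) *R b"
    using d unfolding n det2_def complex_eq_iff by (auto simp: algebra_simps)
   hence "(1 / (cmod b)^2) *R ((cmod b)^2 *R a) = (1 / (cmod b)^2) *R (Re (a * cnj b) *R b)" by simp
   thus ?thesis using n0 by simp
  qed
  hence "a : span {b}" by (metis span_base span_scale singletonI)
  thus False using ind by (simp add: independent_insert)
 qed
next
 assume d: "det2 a b ~= 0"
 have ab: "a ~= b" using d unfolding det2_def by auto
 have "b ~= 0" using d unfolding det2_def by auto
 moreover have "a ~: span {b}"
 proof
  assume "a : span {b}"
  then obtain k where "a = k *R b" unfolding span_singleton by auto
  thus False using d unfolding det2_def by simp
 qed
 ultimately show "independent {a, b} & a ~= b" using ab by (simp add: independent_insert)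
qed

lemma regular_projectionD:
 assumes "regular_projection P"
 shows "immersed P"
  and "p : params P ==> p' : params P ==> p ~= p' ==> pt P p = pt P p' ==> det2 (velocity P p) (velocity P p') ~= 0"
  and "p : params P ==> p' : params P ==> p'' : params P ==> pt P p = pt P p' ==> pt P p' = pt P p'' ==>
    p = p' | p' = p'' | p = p''"
 using assms unfolding regular_projection_def independent_complex_iff[symmetric] by blast+

definition double_params :: "(real => complex) list => (nat * real) set" where
 "double_params P = {p : params P. pt P p : crossings P}"

text \<open>Transverse double points are isolated, hence finite in number by compactness.\<close>
lemma finite_crossing_params:
 assumes P: "regular_projection P"
 shows "finite (double_params P)" "finite (crossings P)"
proof -
 have im: "immersed P" using regular_projectionD(1)[OF P] .
 have C1: "closed_C1 (P ! i)" if "i < length P" for i using immersed_nth[OF im that] .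
 define Z where "Z = (%i j. {x : {0..1} \<times> {0..1::real}. (P ! i) (fst x) = (P ! j) (snd x) & ~ (i = j & fst x - snd x : \<int>)})"
 have fin: "finite (Z i j)" if ij: "i < length P" "j < length P" for i j
 proof (rule ccontr)
  assume inf: "infinite (Z i j)"
  have cpt: "compact ({0..1::real} \<times> {0..1::real})" by (intro compact_Times) auto
  have "Z i j <= {0..1} \<times> {0..1}" unfolding Z_def by auto
  then obtain x where x: "x islimpt Z i j"
   using compact_eq_Bolzano_Weierstrass[THEN iffD1, OF cpt, rule_format, of "Z i j"] inf by auto
  obtain s t where st: "x = (s, t)" by fastforce
  have "continuous_on UNIV (%x. (P ! i) (fst x))" "continuous_on UNIV (%x. (P ! j) (snd x))"
   by (rule cont_comp[OF closed_C1_cont[OF C1[OF ij(1)], of UNIV] continuous_on_fst[OF continuous_on_id]], simp)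
    (rule cont_comp[OF closed_C1_cont[OF C1[OF ij(2)], of UNIV] continuous_on_snd[OF continuous_on_id]], simp)
  hence "closed {x. (P ! i) (fst x) = (P ! j) (snd x)}" by (rule closed_Collect_eq)
  moreover have "x islimpt {x. (P ! i) (fst x) = (P ! j) (snd x)}"
   by (rule islimpt_subset[OF x]) (auto simp: Z_def)
  ultimately have "x : {x. (P ! i) (fst x) = (P ! j) (snd x)}" by (rule closed_limpt[THEN iffD1, rule_format])
  hence eq: "(P ! i) s = (P ! j) t" unfolding st by simp
  have strict: "EX r>0. ALL a b. abs(a - u) < r --> abs(b - u) < r --> norm ((P ! k) a - (P ! k) b - (a - b) *R vd (P ! k) u) <= w * abs(a - b)"
   if k: "k < length P" and w: "w > 0" for k u w
  proof (rule C1_strict_derivative[of UNIV "P ! k" "vd (P ! k)" u w])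
   show "continuous_on UNIV (vd (P ! k))" by (rule closed_C1_vd_cont[OF C1[OF k]])
  qed (use closed_C1_has_vd[OF C1[OF k]] w in auto)
  have "EX r>0. ALL y:Z i j. dist y x < r --> y = x"
  proof (cases "i = j & s - t : \<int>")
   case True
   then obtain n where n: "s = t + of_int n" "i = j" by (metis Ints_cases add.commute diff_add_cancel)
   have v: "norm (vd (P ! j) t) > 0" using immersed_vd[OF im ij(2)] by simp
   obtain r where r: "r > 0" "!!a b. abs(a - t) < r ==> abs(b - t) < r ==>
     norm ((P ! j) a - (P ! j) b - (a - b) *R vd (P ! j) t) <= norm (vd (P ! j) t) / 2 * abs(a - b)"
    using strict[OF ij(2), of "norm (vd (P ! j) t) / 2" t] v by auto
   have "y = x" if y: "y : Z i j" "dist y x < r" for y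
   proof -
    obtain a b where ab: "y = (a, b)" by fastforce
    have d: "abs((a - of_int n) - t) < r" "abs(b - t) < r"
     using le_less_trans[OF dist_fst_le y(2)] le_less_trans[OF dist_snd_le y(2)] unfolding ab st n by (auto simp: dist_real_def)
    have "(P ! j) (a - of_int n) = (P ! j) b"
     using y(1) closed_C1_of_int(1)[OF C1[OF ij(2)], of "a - of_int n" n] unfolding Z_def ab n by simp
    hence "abs(a - of_int n - b) * norm (vd (P ! j) t) <= norm (vd (P ! j) t) / 2 * abs(a - of_int n - b)"
     using r(2)[OF d] by simp
    hence "abs(a - of_int n - b) * norm (vd (P ! j) t) <= 0" by (simp add: mult.commute)
    hence "abs(a - of_int n - b) = 0" using v by (simp add: mult_le_0_iff)
    hence "a - b = of_int n" by simp
    hence "a - b : \<int>" by simp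
    thus ?thesis using y(1) n unfolding Z_def ab by simp
   qed
   thus ?thesis using r(1) by blast
  next
   case False
   define a b where "a = vd (P ! i) s" and "b = vd (P ! j) t"
   have "(i, frac s) ~= (j, frac t)"
   proof
    assume "(i, frac s) = (j, frac t)"
    hence "i = j" "s - t = of_int (\<lfloor>s\<rfloor> - \<lfloor>t\<rfloor>)" unfolding frac_def by auto
    thus False using False Ints_of_int by metis
   qed
   hence "det2 (velocity P (i, frac s)) (velocity P (j, frac t)) ~= 0"
    by (intro regular_projectionD(2)[OF P] frac_in_params ij) (simp_all add: pt_def closed_C1_frac C1 ij eq)
   hence D: "abs(det2 a b) > 0" unfolding a_def b_def velocity_def by (simp add: closed_C1_frac C1 ij)
   have nab: "norm a + norm b > 0" using immersed_vd[OF im ij(2), of t] unfolding b_def by (simp add: add_nonneg_pos)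
   define w where "w = abs(det2 a b) / 2 / (norm a + norm b)"
   have w: "w > 0" unfolding w_def using D nab by simp
   obtain r1 where r1: "r1 > 0" "!!u v. abs(u - s) < r1 ==> abs(v - s) < r1 ==> norm ((P ! i) u - (P ! i) v - (u - v) *R a) <= w * abs(u - v)"
    using strict[OF ij(1) w, of s] unfolding a_def by blast
   obtain r2 where r2: "r2 > 0" "!!u v. abs(u - t) < r2 ==> abs(v - t) < r2 ==> norm ((P ! j) u - (P ! j) v - (u - v) *R b) <= w * abs(u - v)"
    using strict[OF ij(2) w, of t] unfolding b_def by blast
   have "y = x" if y: "y : Z i j" "dist y x < min r1 r2" for y
   proof -
    obtain u v where uv: "y = (u, v)" by fastforce
    have d: "abs(u - s) < r1" "abs(v - t) < r2"
     using le_less_trans[OF dist_fst_le y(2)] le_less_trans[OF dist_snd_le y(2)] unfolding uv st by (auto simp: dist_real_def)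
    have e: "(P ! i) u = (P ! j) v" using y(1) unfolding Z_def uv by simp
    have n1: "norm ((P ! i) u - (P ! i) s - (u - s) *R a) <= w * abs(u - s)" using r1(2)[OF d(1), of s] r1(1) by simp
    have n2: "norm ((P ! j) v - (P ! j) t - (v - t) *R b) <= w * abs(v - t)" using r2(2)[OF d(2), of t] r2(1) by simp
    have "(u - s) *R a - (v - t) *R b = ((P ! j) v - (P ! j) t - (v - t) *R b) - ((P ! i) u - (P ! i) s - (u - s) *R a)"
     using e eq by simp
    hence "norm ((u - s) *R a - (v - t) *R b) <= w * abs(u - s) + w * abs(v - t)"
     using n1 n2 norm_triangle_ineq4 by (smt (verit))
    hence "(norm a + norm b) * norm ((u - s) *R a - (v - t) *R b) <= (norm a + norm b) * (w * (abs(u - s) + abs(v - t)))"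
     using nab by (intro mult_left_mono) (auto simp: distrib_left)
    also have "... = abs(det2 a b) / 2 * (abs(u - s) + abs(v - t))"
    proof -
     have "(norm a + norm b) * w = abs(det2 a b) / 2" unfolding w_def
      by (rule nonzero_mult_div_cancel_left[of "norm a + norm b", unfolded times_divide_eq_right[symmetric]]) (use nab in simp)
     thus ?thesis by (simp only: mult.assoc[symmetric])
    qed
    finally have "(abs(u - s) + abs(v - t)) * abs(det2 a b) <= abs(det2 a b) / 2 * (abs(u - s) + abs(v - t))"
     using det2_bound[of "u - s" "v - t" a b] by linarith
    hence "(abs(u - s) + abs(v - t)) * abs(det2 a b) <= 0" by (simp add: mult.commute)
    hence "abs(u - s) + abs(v - t) <= 0" using D by (simp add: mult_le_0_iff)
    thus ?thesis unfolding uv st by auto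
   qed
   thus ?thesis using r1(1) r2(1) by (intro exI[of _ "min r1 r2"]) auto
  qed
  thus False using x unfolding islimpt_approachable by metis
 qed
 have "double_params P <= (UN i<length P. UN j<length P. (%x. (i, fst x)) ` Z i j)"
 proof
  fix p assume p: "p : double_params P"
  then obtain q where q: "q : params P" "q ~= p" "pt P q = pt P p" "p : params P"
   unfolding double_params_def crossings_def by auto
  obtain i s where ps: "p = (i, s)" by fastforce
  obtain j t where qt: "q = (j, t)" by fastforce
  have r: "i < length P" "j < length P" "s : {0..<1}" "t : {0..<1}" using q unfolding ps qt params_def by auto
  have "~ (i = j & s - t : \<int>)"
  proof
   assume h: "i = j & s - t : \<int>"
   then obtain n where "s - t = of_int n" using Ints_cases by metis
   moreover have "abs(s - t) < 1" using r by auto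
   ultimately have "n = 0" by auto
   thus False using `s - t = of_int n` h q(2) unfolding ps qt by simp
  qed
  hence "(s, t) : Z i j" using r q(3) unfolding Z_def ps qt pt_def by auto
  thus "p : (UN i<length P. UN j<length P. (%x. (i, fst x)) ` Z i j)"
   unfolding ps using r by force
 qed
 thus f: "finite (double_params P)" by (rule finite_subset) (use fin in auto)
 have "crossings P <= pt P ` double_params P"
 proof
  fix x assume x: "x : crossings P"
  then obtain p where "p : params P" "pt P p = x" unfolding crossings_def by blast
  thus "x : pt P ` double_params P" using x unfolding double_params_def by blast
 qed
 thus "finite (crossings P)" using f finite_surj by blast
qed

section \<open>Diagrams and sets of crossing changes\<close>

definition lifted :: "(real => complex) list => (real => real) list => (real => R3) list" where
 "lifted P h = map2 (%ga et t. (ga t, et t)) P h"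

lemma length_graph_system [simp]: "length h = length P ==> length (lifted P h) = length P"
 unfolding lifted_def by simp

lemma nth_graph_system [simp]:
 "length h = length P ==> i < length P ==> lifted P h ! i = (%t. ((P ! i) t, (h ! i) t))"
 unfolding lifted_def by simp

definition heights_ok :: "(real => complex) list => (complex => nat * real) => (real => real) list => bool" where
 "heights_ok P ov h <-> length h = length P & (ALL et:set h. closed_C1 et) &
  (ALL p:params P. pt P p : crossings P --> p ~= ov (pt P p) --> pt h p < pt h (ov (pt P p)))"

lemma has_diagram_iff: "has_diagram L P ov <-> (EX h. heights_ok P ov h & L = st (lifted P h))"
proof -
 have "st (lifted P h) = map2 (%ga et t. stereo (ga t, et t)) P h" for h
  unfolding st_def lifted_def by (simp add: case_prod_unfold comp_def)
 thus ?thesis unfolding has_diagram_def heights_ok_def by auto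
qed

lemma embedded_graph_system:
 assumes P: "immersed P" and h: "length h = length P" "!!i. i < length P ==> closed_C1 (h ! i)"
  and sep: "!!p p'. p : params P ==> p' : params P ==> p ~= p' ==> pt P p = pt P p' ==> pt h p ~= pt h p'"
 shows "embedded (lifted P h)"
proof (rule embedded_systemI)
 fix i assume "i < length (lifted P h)"
 hence i: "i < length P" using h by simp
 thus "closed_C1 (lifted P h ! i)" using h by (simp add: closed_C1_Pair immersed_nth[OF P])
 show "vd (lifted P h ! i) t ~= 0" for t
  using i h immersed_vd[OF P i, of t] by (simp add: closed_C1_Pair(2) immersed_nth[OF P] zero_prod_def)
next
 fix i j and s t :: real
 assume ij: "i < length (lifted P h)" "j < length (lifted P h)" "s : {0..<1}" "t : {0..<1}"
  "(lifted P h ! i) s = (lifted P h ! j) t"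
 hence "pt P (i, s) = pt P (j, t)" "pt h (i, s) = pt h (j, t)" "(i, s) : params P" "(j, t) : params P"
  using h unfolding pt_def params_def by auto
 thus "i = j & s = t" using sep[of "(i, s)" "(j, t)"] by auto
qed

lemma diagram_over_cases:
 assumes D: "is_diagram P ov" and p: "p : params P" "p' : params P" "p ~= p'" "pt P p = pt P p'"
 shows "pt P p : crossings P" "p = ov (pt P p) & p' ~= ov (pt P p) | p' = ov (pt P p) & p ~= ov (pt P p)"
proof -
 show c: "pt P p : crossings P" unfolding crossings_def using p by auto
 hence "ov (pt P p) : params P" "pt P (ov (pt P p)) = pt P p" using D unfolding is_diagram_def by auto
 thus "p = ov (pt P p) & p' ~= ov (pt P p) | p' = ov (pt P p) & p ~= ov (pt P p)"
  using regular_projectionD(3)[of P p p' "ov (pt P p)"] D p(1,2,3,4) unfolding is_diagram_def by metis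
qed

lemma heights_ok_sep:
 assumes "is_diagram P ov" "heights_ok P ov h"
  and p: "p : params P" "p' : params P" "p ~= p'" "pt P p = pt P p'"
 shows "if p = ov (pt P p) then pt h p' < pt h p else pt h p < pt h p'"
 using diagram_over_cases[OF assms(1) p] assms(2) p unfolding heights_ok_def by auto

lemma heights_ok_embedded:
 assumes "is_diagram P ov" "heights_ok P ov h"
 shows "embedded (lifted P h)"
proof (rule embedded_graph_system)
 show "immersed P" using assms regular_projectionD(1) unfolding is_diagram_def by blast
 show "pt h p ~= pt h p'" if "p : params P" "p' : params P" "p ~= p'" "pt P p = pt P p'" for p p'
  using heights_ok_sep[OF assms that] by (auto split: if_splits)
qed (use assms in "auto simp: heights_ok_def")

lemma same_diagram_invariant:
 assumes f: "link_invariant f" and D: "is_diagram P ov" and L: "has_diagram L P ov" "has_diagram L' P ov"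
 shows "f L = f L'"
proof -
 obtain h h' where h: "heights_ok P ov h" "L = st (lifted P h)" "heights_ok P ov h'" "L' = st (lifted P h')"
  using L unfolding has_diagram_iff by blast
 define k where "k = (%s::real. map2 (%et et' t. et t + s *R (et' t - et t)) h h')"
 have len: "length h = length P" "length h' = length P" "!!s. length (k s) = length P"
  using h unfolding heights_ok_def k_def by auto
 have ki: "k s ! i = (%t. (h ! i) t + s *R ((h' ! i) t - (h ! i) t))" if "i < length P" for i s
  unfolding k_def using that len by simp
 have C1: "closed_C1 (h ! i)" "closed_C1 (h' ! i)" "closed_C1 (P ! i)" if "i < length P" for i
  using h that immersed_nth[OF regular_projectionD(1), of P i] D unfolding heights_ok_def is_diagram_def by auto
 have "f (st (lifted P (k 0))) = f (st (lifted P (k 1)))"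
 proof (rule invariant_C1_family_R3[OF f])
  show "length (lifted P (k s)) = length P" for s using len by simp
  fix i assume i: "i < length P"
  have "(%s. lifted P (k s) ! i) = (%s t. ((P ! i) t, (h ! i) t) + s *R (((P ! i) t, (h' ! i) t) - ((P ! i) t, (h ! i) t)))"
   using i len by (intro ext) (simp add: ki)
  thus "C1_family (%s. lifted P (k s) ! i)"
   using C1_family_linear[OF closed_C1_Pair(1)[OF C1(3,1)[OF i]] closed_C1_Pair(1)[OF C1(3,2)[OF i]]] by (simp add: C1 i closed_C1_Pair)
 next
  fix s :: real assume s: "s : {0..1}"
  have "heights_ok P ov (k s)" unfolding heights_ok_def
  proof (intro conjI ballI impI)
   show "closed_C1 et" if eta: "et : set (k s)" for et
   proof -
    obtain i where i: "i < length P" "et = k s ! i" using eta len by (metis in_set_conv_nth)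
    thus ?thesis unfolding ki[OF i(1)] i(2)
     using C1_family_linear[OF C1(1,2)[OF i(1)]] s unfolding C1_family_def by auto
   qed
   fix p assume p: "p : params P" "pt P p : crossings P" "p ~= ov (pt P p)"
   define q where "q = ov (pt P p)"
   have q: "q : params P" using D p unfolding is_diagram_def q_def by auto
   have lt: "pt h p < pt h q" "pt h' p < pt h' q" using h p unfolding heights_ok_def q_def by auto
   have kp: "pt (k s) p = (1 - s) * pt h p + s * pt h' p" if "p : params P" for p
    using that ki[of "fst p" s] unfolding pt_def params_def by (auto simp: algebra_simps)
   have "(1 - s) * pt h p + s * pt h' p < (1 - s) * pt h q + s * pt h' q"
    using s lt convex_bound_lt[of "pt h p - pt h q" 0 "pt h' p - pt h' q" "1 - s" s] by (simp add: algebra_simps)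
   thus "pt (k s) p < pt (k s) (ov (pt P p))" unfolding q_def[symmetric] kp[OF p(1)] kp[OF q] .
  qed (use len in auto)
  thus "embedded (lifted P (k s))" by (rule heights_ok_embedded[OF D])
 qed
 moreover have "k 0 = h" "k 1 = h'" by (auto intro!: nth_equalityI simp: ki len)
 ultimately show ?thesis using h by simp
qed

lemma diagram_realizable:
 assumes D: "is_diagram P ov"
 obtains h where "heights_ok P ov h"
proof -
 have P: "regular_projection P" using D unfolding is_diagram_def by blast
 define T where "T = (%i. {t. (i, t) : double_params P})"
 have finT: "finite (T i)" for i
 proof -
  have "T i <= snd ` double_params P" unfolding T_def by force
  thus ?thesis using finite_crossing_params(1)[OF P] finite_surj by blast
 qed
 define Ov where "Ov = (%i. {t : T i. ov (pt P (i, t)) = (i, t)})"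
 define b where "b = (%i u t. PROD v:T i - {u}. (sin (pi * (t - v)))\<^sup>2 :: real)"
 define h where "h = map (%i t. SUM u:Ov i. b i u t) [0..<length P]"
 have fOv: "finite (Ov i)" for i unfolding Ov_def using finT[of i] by simp
 have hi: "h ! i = (%t. SUM u:Ov i. b i u t)" if "i < length P" for i unfolding h_def using that by simp
 have len: "length h = length P" unfolding h_def by simp
 have bnn: "b i u t >= 0" for i u t unfolding b_def by (intro prod_nonneg) simp
 have sin0: "sin (pi * (u - v)) ~= 0" if "u : {0..<1}" "v : {0..<1}" "u ~= v" for u v :: real
 proof
  assume "sin (pi * (u - v)) = 0"
  then obtain n where "pi * (u - v) = of_int n * pi" unfolding sin_zero_iff_int2 by blast
  hence e: "u - v = of_int n" by (simp add: mult.commute)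
  moreover have "abs(u - v) < 1" using that by auto
  ultimately have "n = 0" by auto
  thus False using e that by simp
 qed
 have T01: "t : {0..<1} & i < length P" if "t : T i" for t i
  using that unfolding T_def double_params_def params_def by auto
 have "heights_ok P ov h" unfolding heights_ok_def
 proof (intro conjI ballI impI)
  show "closed_C1 et" if eta: "et : set h" for et
  proof -
   obtain i where i: "i < length P" "et = h ! i" using eta len by (metis in_set_conv_nth)
   show ?thesis unfolding i(2) hi[OF i(1)] b_def
    by (intro closed_C1_sum fOv closed_C1_prod closed_C1_sin_sq) (use finT in auto)
  qed
  fix p assume p: "p : params P" "pt P p : crossings P" "p ~= ov (pt P p)"
  define q where "q = ov (pt P p)"
  have q: "q : params P" "pt P q = pt P p" using D p unfolding is_diagram_def q_def by auto
  have pT: "snd p : T (fst p)" "fst p < length P" using p unfolding T_def double_params_def params_def by auto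
  have qT: "snd q : T (fst q)" "fst q < length P" using p q unfolding T_def double_params_def params_def by auto
  have qO: "snd q : Ov (fst q)" unfolding Ov_def using qT q q_def by simp
  have pO: "snd p ~: Ov (fst p)" unfolding Ov_def using p by auto
  have "b (fst p) u (snd p) = 0" if "u : Ov (fst p)" for u
  proof -
   have "snd p : T (fst p) - {u}" using that pO pT by auto
   thus ?thesis unfolding b_def using finT[of "fst p"] by (intro prod_zero bexI[of _ "snd p"]) auto
  qed
  hence hp: "pt h p = 0" unfolding pt_def hi[OF pT(2)] by simp
  have "b (fst q) (snd q) (snd q) ~= 0" unfolding b_def
   using finT[of "fst q"] sin0 T01 qT by (auto simp: prod_zero_iff)
  hence "b (fst q) (snd q) (snd q) > 0" using bnn by (simp add: less_le)
  hence "pt h q > 0" unfolding pt_def hi[OF qT(2)]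
   using sum_pos2[OF fOv qO, of "%u. b (fst q) u (snd q)"] bnn by simp
  thus "pt h p < pt h (ov (pt P p))" unfolding q_def[symmetric] hp .
 qed (rule len)
 thus ?thesis by (rule that)
qed

lemma changed_diagram:
 assumes D: "is_diagram P ov"
 shows "is_diagram P (change_crossings P S ov)"
  and "x : crossings P ==> x : S ==> change_crossings P S ov x : params P &
   pt P (change_crossings P S ov x) = x & change_crossings P S ov x ~= ov x"
  and "x ~: S ==> change_crossings P S ov x = ov x"
proof -
 show c: "change_crossings P S ov x : params P &
   pt P (change_crossings P S ov x) = x & change_crossings P S ov x ~= ov x" if x: "x : crossings P" "x : S" for x
 proof -
  obtain p p' where p: "p : params P" "p' : params P" "p ~= p'" "pt P p = x" "pt P p' = x"
   using x unfolding crossings_def by blast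
  define q where "q = (if p = ov x then p' else p)"
  have "EX! q. q : params P & pt P q = x & q ~= ov x"
  proof (rule ex1I[of _ q])
   show "q : params P & pt P q = x & q ~= ov x" unfolding q_def using p by auto
   thus "r = q" if "r : params P & pt P r = x & r ~= ov x" for r
    using that diagram_over_cases(2)[OF D, of r q] by (cases "r = q") auto
  qed
  thus ?thesis unfolding change_crossings_def using theI'[of "%q. q : params P & pt P q = x & q ~= ov x"] x by simp
 qed
 show nc: "x ~: S ==> change_crossings P S ov x = ov x" for x unfolding change_crossings_def by simp
 show "is_diagram P (change_crossings P S ov)"
  using D c nc unfolding is_diagram_def by metis
qed

lemma other_strand_eq:
 assumes D: "is_diagram P ov" and "p : params P" "p' : params P" "pt P p = x" "pt P p' = x" "p ~= ov x" "p' ~= ov x"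
 shows "p = p'"
 using diagram_over_cases(2)[OF D, of p p'] assms by (cases "p = p'") auto

lemma change_crossings_compose:
 assumes D: "is_diagram P ov" and x: "x : crossings P"
 shows "change_crossings P S (change_crossings P T ov) x = change_crossings P (sym_diff S T) ov x"
proof -
 note D' = changed_diagram(1)[OF D]
 have ovx: "ov x : params P" "pt P (ov x) = x" using D x unfolding is_diagram_def by auto
 note c1 = changed_diagram(2,3)[OF D]
 note c2 = changed_diagram(2,3)[OF D'[of T]]
 consider "x : S" "x : T" | "x : S" "x ~: T" | "x ~: S" by blast
 thus ?thesis
 proof cases
  case 1
  hence "change_crossings P S (change_crossings P T ov) x = ov x"
   using other_strand_eq[OF D'[of T], of "change_crossings P S (change_crossings P T ov) x" "ov x" x]
    c1(1)[of x T] c2(1)[of x S] x ovx by auto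
  moreover have "x ~: sym_diff S T" using 1 by auto
  ultimately show ?thesis using c1(2) by simp
 next
  case 2
  hence "change_crossings P S (change_crossings P T ov) x = change_crossings P (sym_diff S T) ov x"
   using other_strand_eq[OF D, of "change_crossings P S (change_crossings P T ov) x" "change_crossings P (sym_diff S T) ov x" x]
    c1(1)[of x "sym_diff S T"] c2(1)[of x S] c1(2)[of x T] x by auto
  thus ?thesis .
 next
  case 3
  hence "change_crossings P S (change_crossings P T ov) x = change_crossings P T ov x" by (rule c2(2))
  moreover have "x : sym_diff S T <-> x : T" using 3 by auto
  ultimately show ?thesis unfolding change_crossings_def by simp
 qed
qed

lemma has_diagram_cong:
 assumes "!!x. x : crossings P ==> ov x = ov' x" shows "has_diagram L P ov <-> has_diagram L P ov'"
proof -
 have "heights_ok P ov h <-> heights_ok P ov' h" for h unfolding heights_ok_def using assms by auto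
 thus ?thesis unfolding has_diagram_iff by simp
qed

theorem finite_type_telescope:
 assumes f: "link_invariant f" "finite_type m f" and D: "is_diagram P ov"
  and Y: "!!j. j : J ==> Y j <= crossings P" "disjoint_family_on Y J" "finite J" "card J = m + 1"
  and L: "!!S. S <= J ==> has_diagram (L S) P (change_crossings P (\<Union> (Y ` S)) ov)"
 shows "alternating_sum J (%S. f (L S)) = 0"
proof -
 have fin: "finite (crossings P)" using finite_crossing_params(2) D unfolding is_diagram_def by blast
 have "EX L. has_diagram L P (change_crossings P Z ov)" for Z
  unfolding has_diagram_iff using diagram_realizable[OF changed_diagram(1)[OF D]] by metis
 then obtain M where M: "!!Z. has_diagram (M Z) P (change_crossings P Z ov)" by metis
 have "alternating_sum J (%S. f (M ({} Un \<Union> (Y ` S)))) = 0"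
 proof (rule alt_sum_telescope[where C = "crossings P"])
  fix X B assume XB: "X <= crossings P" "B <= crossings P" "X Int B = {}" "finite X" "card X = m + 1"
  have "has_diagram (M (B Un S)) P (change_crossings P S (change_crossings P B ov))" if "S <= X" for S
  proof (subst has_diagram_cong)
   show "change_crossings P S (change_crossings P B ov) x = change_crossings P (B Un S) ov x" if "x : crossings P" for x
   proof -
    have "sym_diff S B = B Un S" using XB `S <= X` by auto
    thus ?thesis using change_crossings_compose[OF D that, of S B] by simp
   qed
  qed (rule M)
  thus "alternating_sum X (%S. f (M (B Un S))) = 0"
   using f(2)[unfolded finite_type_def, rule_format, of P "change_crossings P B ov" X "%S. M (B Un S)"]
    changed_diagram(1)[OF D] XB by blast
 qed (use Y finite_subset[OF Y(1) fin] in auto)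
 moreover have "alternating_sum J (%S. f (L S)) = alternating_sum J (%S. f (M ({} Un \<Union> (Y ` S))))"
  using same_diagram_invariant[OF f(1) changed_diagram(1)[OF D] L M]
  by (intro alt_sum_cong) simp
 ultimately show ?thesis by simp
qed

section \<open>General position of planar projections\<close>

lemma periodic_uniform:
 fixes g :: "real => 'b::real_normed_vector"
 assumes c: "continuous_on UNIV g" and per: "!!t. g (t + 1) = g t" and e: "e > 0"
 obtains d where "d > 0" "d <= 1" "!!x t. abs(x - t) <= d ==> norm (g x - g t) <= e"
proof -
 have "uniformly_continuous_on {-1..2} g"
  by (rule compact_uniformly_continuous) (use c in "auto intro: continuous_on_subset")
 then obtain d where d: "d > 0" "!!x x'. x : {-1..2} ==> x' : {-1..2} ==> dist x' x < d ==> dist (g x') (g x) < e"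
  using e unfolding uniformly_continuous_on_def by metis
 show ?thesis
 proof (rule that[of "min (d / 2) 1"])
  fix x t assume xt: "abs(x - t) <= min (d / 2) 1"
  define n where "n = \<lfloor>t\<rfloor>"
  have t: "t - of_int n : {-1..2}" unfolding n_def by (auto simp: floor_le_iff) linarith+
  have "t - of_int n : {0..1}" unfolding n_def by (auto simp: floor_le_iff) linarith+
  hence x: "x - of_int n : {-1..2}" using xt by auto
  have "dist (g (x - of_int n)) (g (t - of_int n)) < e"
   by (rule d(2)[OF t x]) (use xt d(1) in "auto simp: dist_real_def")
  thus "norm (g x - g t) <= e"
   using periodic_of_int[of g "x - of_int n" n] periodic_of_int[of g "t - of_int n" n] per by (simp add: dist_norm)
 qed (use d in auto)
qed

lemma forward_difference_bound:
 fixes F :: "real => 'b::real_normed_vector"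
 assumes F: "!!t. (F has_vd g t) (at t)" and g: "!!x. abs(x - t) <= d ==> norm (g x - g t) <= e" and d: "d > 0"
 shows "norm ((1 / d) *R (F (t + d) - F t) - g t) <= e"
proof -
 have "norm (F (t + d) - F t - (t + d - t) *R g t) <= norm (t + d - t) * e"
 proof (rule vector_differentiable_bound_linearization[where S = "{t..t+d}"])
  show "!!x. x : {t..t + d} ==> (F has_vd g x) (at x within {t..t + d})"
   using F has_vector_derivative_at_within by blast
  show "closed_segment t (t + d) <= {t..t + d}" using d by (simp add: closed_segment_eq_real_ivl)
  show "!!x. x : {t..t + d} ==> norm (g x - g t) <= e" by (rule g) auto
  show "t : {t..t + d}" using d by simp
 qed
 hence "norm (F (t + d) - F t - d *R g t) <= d * e" using d by simp
 moreover have "(1 / d) *R (F (t + d) - F t) - g t = (1 / d) *R (F (t + d) - F t - d *R g t)"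
  using d by (simp add: scaleR_diff_right)
 hence "norm ((1 / d) *R (F (t + d) - F t) - g t) = norm (F (t + d) - F t - d *R g t) / d"
  using d by simp
 ultimately show ?thesis using d pos_divide_le_eq[OF d] by (simp add: mult.commute)
qed

lemma has_vd_shift:
 assumes "(f has_vd v) (at (t + d))"
 shows "((%t. f (t + d)) has_vd v) (at t)"
proof -
 have "((%t::real. t + d) has_vd 1) (at t)" by (auto intro!: dintros)
 from vector_diff_chain_at[OF this assms] show ?thesis by (simp add: o_def)
qed

text \<open>Averaging over a short window gains one derivative. General position needs differentiable velocities, because
images of lower-dimensional sets are negligible only under differentiable maps.\<close>
lemma C2_approximation:
 fixes ga :: "real => complex"
 assumes ga: "closed_C1 ga" and e: "e > 0"
 obtains rh where "closed_C1 rh" "closed_C1 (vd rh)" "!!t. norm (rh t - ga t) <= e" "!!t. norm (vd rh t - vd ga t) <= e"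
proof -
 have per: "ga (t + 1) = ga t" for t using ga unfolding closed_C1_def by auto
 obtain d1 where d1: "d1 > 0" "!!x t. abs(x - t) <= d1 ==> norm (ga x - ga t) <= e"
  by (rule periodic_uniform[OF closed_C1_cont[OF ga] per e]) (rule that; assumption)
 obtain d2 where d2: "d2 > 0" "!!x t. abs(x - t) <= d2 ==> norm (vd ga x - vd ga t) <= e"
  by (rule periodic_uniform[OF closed_C1_vd_cont[OF ga] closed_C1_vd_periodic[OF ga] e]) (rule that; assumption)
 define d where "d = min d1 d2"
 have d: "d > 0" "d <= d1" "d <= d2" unfolding d_def using d1 d2 by auto
 obtain F where F: "!!t. (F has_vd ga t) (at t)"
  using einterval_antiderivative[of "-\<infinity>" "\<infinity>" ga] closed_C1_cont[OF ga, of UNIV]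
  by (auto simp: cont_on_open)
 define rh where "rh = (%t. (1 / d) *R (F (t + d) - F t))"
 have der: "(rh has_vd (1 / d) *R (ga (t + d) - ga t)) (at t)" for t
  unfolding rh_def by (intro bl_has_vd[OF bounded_linear_scaleR_right] has_vd_diff
    has_vd_shift F)
 have vdrh: "vd rh = (%t. (1 / d) *R (ga (t + d) - ga t))" using vd_eqI[OF der] by auto
 have perga: "ga (t + 1) = ga t" for t using ga unfolding closed_C1_def by auto
 obtain c where c: "!!t. F (t + 1) - F t = c"
 proof (rule has_vector_derivative_zero_constant[of UNIV "%t. F (t + 1) - F t"])
  show "((%t. F (t + 1) - F t) has_vd 0) (at x within UNIV)" for x
   using has_vd_diff[OF has_vd_shift[OF F[of "x + 1"]] F[of x]] perga by simp
 qed auto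
 have "rh (t + 1) = rh t" for t
 proof -
  have "F (t + 1 + d) - F (t + 1) = (F (t + d) + c) - (F t + c)" using c[of "t + d"] c[of t] by (simp add: algebra_simps)
  thus ?thesis unfolding rh_def by simp
 qed
 hence C1: "closed_C1 rh"
  by (intro closed_C1I[OF der]) (auto intro!: cintros cont_comp[OF closed_C1_cont[OF ga, of UNIV]])
 have C2: "closed_C1 (vd rh)" unfolding vdrh
 proof (rule closed_C1I)
  show "((%t. (1 / d) *R (ga (t + d) - ga t)) has_vd (1 / d) *R (vd ga (t + d) - vd ga t)) (at t)" for t
   by (intro bl_has_vd[OF bounded_linear_scaleR_right] has_vd_diff
    has_vd_shift closed_C1_has_vd ga)
  show "continuous_on UNIV (%t. (1 / d) *R (vd ga (t + d) - vd ga t))"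
   by (auto intro!: cintros cont_comp[OF closed_C1_vd_cont[OF ga, of UNIV]])
  show "(1 / d) *R (ga (t + 1 + d) - ga (t + 1)) = (1 / d) *R (ga (t + d) - ga t)" for t
   using perga[of t] perga[of "t + d"] by (simp add: algebra_simps)
 qed
 show ?thesis
 proof (rule that[OF C1 C2])
  show "norm (rh t - ga t) <= e" for t unfolding rh_def
   by (rule forward_difference_bound[OF F _ d(1)]) (use d1 d in auto)
  show "norm (vd rh t - vd ga t) <= e" for t unfolding vd_eqI[OF der]
   by (rule forward_difference_bound[OF closed_C1_has_vd[OF ga] _ d(1)]) (use d2 d in auto)
 qed
qed

text \<open>Disjoint unit circles, one for each component, which separate parameters.\<close>
definition tcirc :: "nat => real => complex" where
 "tcirc i t = 3 * of_nat i + cis (2 * pi * t)"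

definition tcirc' :: "real => complex" where
 "tcirc' t = of_real (2 * pi) * (\<i> * cis (2 * pi * t))"

lemma cis_2pi_add_one: "cis (2 * pi * (t + 1)) = cis (2 * pi * t)"
 by (simp add: distrib_left cis_mult[symmetric])

lemma has_vd_cis:
 "((%t. cis (2 * pi * t)) has_vd of_real (2 * pi) * (\<i> * cis (2 * pi * t))) (at t)"
proof -
 have "((%t. Complex (cos (2 * pi * t)) (sin (2 * pi * t))) has_vd
  Complex (- (sin (2 * pi * t) * (2 * pi))) (cos (2 * pi * t) * (2 * pi))) (at t)"
  unfolding complex_has_vd[symmetric]
  by (auto simp: complex_has_vd intro!: dintros)
 moreover have "Complex (- (sin (2 * pi * t) * (2 * pi))) (cos (2 * pi * t) * (2 * pi)) = of_real (2 * pi) * (\<i> * cis (2 * pi * t))"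
  by (simp add: complex_eq_iff)
 ultimately show ?thesis unfolding cis_conv_exp[symmetric] by (simp add: cis.ctr)
qed

lemma closed_C1_tcirc: "closed_C1 (tcirc i)" and vd_tcirc: "vd (tcirc i) t = tcirc' t"
proof -
 have d: "(tcirc i has_vd tcirc' t) (at t)" for t
  unfolding tcirc_def[abs_def] tcirc'_def
  using has_vd_add[OF has_vector_derivative_const has_vd_cis] by simp
 show "closed_C1 (tcirc i)"
  by (rule closed_C1I[OF d]) (auto simp: tcirc_def tcirc'_def[abs_def] cis_2pi_add_one intro!: cintros)
 show "vd (tcirc i) t = tcirc' t" by (rule vd_eqI[OF d])
qed

lemma closed_C1_tcirc': "closed_C1 tcirc'"
proof (rule closed_C1I)
 show "(tcirc' has_vd of_real (2 * pi) * (\<i> * (of_real (2 * pi) * (\<i> * cis (2 * pi * t))))) (at t)" for t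
  unfolding tcirc'_def[abs_def]
  by (intro has_vector_derivative_mult_right has_vd_cis)
qed (auto simp: tcirc'_def cis_2pi_add_one intro!: cintros)

lemma tcirc'_nonzero: "tcirc' t ~= 0" unfolding tcirc'_def by simp
lemma norm_tcirc': "norm (tcirc' t) = 2 * pi" unfolding tcirc'_def by (simp add: norm_mult)

lemma cis_2pi_eq: "cis (2 * pi * s) = cis (2 * pi * t) ==> EX n::int. s = t + of_int n"
proof -
 assume "cis (2 * pi * s) = cis (2 * pi * t)"
 hence "cis (2 * pi * s) / cis (2 * pi * t) = 1" by simp
 hence "cis (2 * pi * s - 2 * pi * t) = 1" by (simp add: cis_divide)
 then obtain n :: int where "2 * pi * s - 2 * pi * t = 2 * pi * of_int n"
  unfolding complex_eq_iff using cos_one_2pi_int by (auto simp: mult.commute)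
 hence "2 * pi * (s - t) = 2 * pi * of_int n" by (simp add: algebra_simps)
 hence "s - t = of_int n" by simp
 thus ?thesis by (metis add.commute diff_add_cancel)
qed

lemma tcirc_inj:
 assumes "s : {0..<1}" "t : {0..<1}" "tcirc i s = tcirc j t" shows "i = j & s = t"
proof -
 have "i = j"
 proof (rule ccontr)
  assume "i ~= j"
  hence "abs(real i - real j) >= 1" by linarith
  have "3 * (of_nat i - of_nat j :: complex) = cis (2 * pi * t) - cis (2 * pi * s)"
   using assms(3) unfolding tcirc_def by (simp add: algebra_simps)
  hence "norm (of_real (3 * (real i - real j)) :: complex) = norm (cis (2 * pi * t) - cis (2 * pi * s))" by simp
  also have "... <= 2" using norm_triangle_ineq4[of "cis (2 * pi * t)" "cis (2 * pi * s)"] by simp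
  finally have "3 * abs(real i - real j) <= 2" unfolding norm_of_real by (simp add: abs_mult)
  moreover have "~ 3 * x <= 2" if "x >= 1" for x :: real using that by simp
  ultimately show False using `(abs(real i - real j)) >= 1` by blast
 qed
 hence "cis (2 * pi * s) = cis (2 * pi * t)" using assms(3) unfolding tcirc_def by simp
 then obtain n :: int where n: "s = t + of_int n" using cis_2pi_eq by blast
 have "abs(s - t) < 1" using assms by auto
 hence "n = 0" using n by auto
 thus ?thesis using n `i = j` by simp
qed

lemma diff_on_closed_C1:
 assumes "closed_C1 ga" "f differentiable_on S"
 shows "(%x. ga (f x)) differentiable_on S"
proof (rule differentiable_on_compose[of f S ga, OF assms(2)])
 show "ga differentiable_on f ` S"
  using closed_C1_has_vd[OF assms(1)] unfolding has_vd_def differentiable_on_def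
  by (meson differentiableI differentiable_at_withinI)
qed

lemma differentiable_on_fst: "f differentiable_on S ==> (%x. fst (f x)) differentiable_on S"
 unfolding differentiable_on_def differentiable_def using has_derivative_fst by blast
lemma differentiable_on_snd: "f differentiable_on S ==> (%x. snd (f x)) differentiable_on S"
 unfolding differentiable_on_def differentiable_def using has_derivative_snd by blast
lemma differentiable_on_Pair': "f differentiable_on S ==> g differentiable_on S ==> (%x. (f x, g x)) differentiable_on S"
 unfolding differentiable_on_def by (auto intro: differentiable_Pair)
lemma diff_on_of_real: "f differentiable_on S ==> (%x. of_real (f x) :: complex) differentiable_on S"
 unfolding differentiable_on_def differentiable_def using has_derivative_of_real by blast

lemmas diff_intros = diff_on_closed_C1[OF closed_C1_tcirc] diff_on_closed_C1[OF closed_C1_tcirc'] differentiable_on_fst differentiable_on_snd differentiable_on_Pair'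
 diff_on_of_real differentiable_on_mult differentiable_on_inverse differentiable_on_diff differentiable_on_add
 differentiable_on_minus differentiable_on_id differentiable_on_const differentiable_on_ident

lemma cramer:
 fixes a b c d r1 r2 w u :: complex
 assumes "a * w + b * u = r1" "c * w + d * u = r2" "a * d - b * c ~= 0"
 shows "(w, u) = ((r1 * d - b * r2) * inverse (a * d - b * c), (a * r2 - c * r1) * inverse (a * d - b * c))"
proof -
 have "r1 * d - b * r2 = w * (a * d - b * c)" "a * r2 - c * r1 = u * (a * d - b * c)"
  unfolding assms(1,2)[symmetric] by (simp_all add: algebra_simps)
 thus ?thesis using assms(3) by (metis mult.assoc mult.right_neutral right_inverse)
qed

lemma det2_eq_0:
 assumes "det2 a b = 0" "b ~= 0" obtains k where "a = k *R b"
proof (cases "a = b")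
 case True thus ?thesis using that[of 1] by simp
next
 case False
 hence "~ independent {a, b}" using assms independent_complex_iff by blast
 hence "a : span {b}" using assms(2) False by (simp add: independent_insert)
 thus ?thesis using that unfolding span_singleton by auto
qed

lemma negligible_3_to_4:
 fixes g :: "'a::euclidean_space => complex \<times> complex"
 assumes "DIM('a) = 3" "g differentiable_on S" shows "negligible (g ` S)"
 by (rule negligible_differentiable_image_lowdim) (use assms in auto)

lemma negligible_finite_UN:
 assumes "finite I" "!!i. i : I ==> negligible (B i)" shows "negligible (UN i:I. B i)"
 by (rule negligible_Union) (use assms in auto)

text \<open>Add \<open>w * a + u * a * a\<close> to each component, where \<open>a = tcirc i\<close> and \<open>(w,
u)\<close> ranges over a space of real dimension \<open>4\<close>. A tangency or a triple point imposes two
complex equations on \<open>(w, u)\<close>, whose solution by Cramer's rule is a differentiable function of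
three real parameters, and a zero velocity one equation, which gives \<open>w\<close> as a function of
\<open>u\<close> and one real parameter. So the bad \<open>(w, u)\<close> are negligible. The tangency
equations are dependent when the tangents of the circles are parallel; then the parameters differ by
\<open>0\<close> or \<open>1/2\<close> modulo \<open>1\<close>, and \<open>X2\<close> excludes coincidence for
such pairs.\<close>
theorem regular_projection_approx:
 assumes P: "!!i. i < length P ==> closed_C1 (P ! i)" and e: "e > 0"
 obtains P' where "regular_projection P'" "small_perturb e P P'"
proof -
 have "EX rh. closed_C1 rh & closed_C1 (vd rh) & (ALL t. norm (rh t - (P ! i) t) <= e / 2 & norm (vd rh t - vd (P ! i) t) <= e / 2)"
  if i: "i < length P" for i
  by (rule C2_approximation[OF P[OF i], of "e / 2"]) (use e in auto)
 then obtain Q where Q: "!!i. i < length P ==> closed_C1 (Q i)" "!!i. i < length P ==> closed_C1 (vd (Q i))"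
  "!!i t. i < length P ==> norm (Q i t - (P ! i) t) <= e / 2 & norm (vd (Q i) t - vd (P ! i) t) <= e / 2"
  by metis
 define n where "n = length P"
 let ?a = tcirc and ?a' = tcirc'
 define X1 where "X1 = (%i (x::real \<times> complex). (- (vd (Q i) (fst x) + 2 * (snd x * (?a i (fst x) * ?a' (fst x)))) * inverse (?a' (fst x)), snd x))"
 define S2 where "S2 = (%i j c. {x :: real \<times> complex. ?a i (fst x) - ?a j (fst x + c) ~= 0})"
 define X2 where "X2 = (%i j c (x::real \<times> complex). (- (Q i (fst x) - Q j (fst x + c) + snd x * (?a i (fst x) * ?a i (fst x) - ?a j (fst x + c) * ?a j (fst x + c)))
   * inverse (?a i (fst x) - ?a j (fst x + c)), snd x))"
 define solve where "solve = (%a b c d r1 r2 :: complex. ((r1 * d - b * r2) * inverse (a * d - b * c), (a * r2 - c * r1) * inverse (a * d - b * c)))"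
 define A where "A = (%i j s t. ?a i s - ?a j t)"
 define B where "B = (%i j s t. ?a i s * ?a i s - ?a j t * ?a j t)"
 define R where "R = (%i j s t. - (Q i s - Q j t))"
 define A' where "A' = (%s t (l::real). ?a' s - of_real l * ?a' t)"
 define B' where "B' = (%i j s t (l::real). 2 * (?a i s * ?a' s) - of_real l * (2 * (?a j t * ?a' t)))"
 define R' where "R' = (%i j s t (l::real). - (vd (Q i) s - of_real l * vd (Q j) t))"
 define S3 where "S3 = (%i j. {x :: real \<times> real \<times> real. A i j (fst x) (fst (snd x)) * B' i j (fst x) (fst (snd x)) (snd (snd x)) -
   B i j (fst x) (fst (snd x)) * A' (fst x) (fst (snd x)) (snd (snd x)) ~= 0})"
 define X3 where "X3 = (%i j (x :: real \<times> real \<times> real). solve (A i j (fst x) (fst (snd x))) (B i j (fst x) (fst (snd x)))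
   (A' (fst x) (fst (snd x)) (snd (snd x))) (B' i j (fst x) (fst (snd x)) (snd (snd x))) (R i j (fst x) (fst (snd x))) (R' i j (fst x) (fst (snd x)) (snd (snd x))))"
 define S4 where "S4 = (%i j k. {x :: real \<times> real \<times> real. A i j (fst x) (fst (snd x)) * B i k (fst x) (snd (snd x)) -
   B i j (fst x) (fst (snd x)) * A i k (fst x) (snd (snd x)) ~= 0})"
 define X4 where "X4 = (%i j k (x :: real \<times> real \<times> real). solve (A i j (fst x) (fst (snd x))) (B i j (fst x) (fst (snd x)))
   (A i k (fst x) (snd (snd x))) (B i k (fst x) (snd (snd x))) (R i j (fst x) (fst (snd x))) (R i k (fst x) (snd (snd x))))"
 note dQ = diff_on_closed_C1[OF Q(1)[folded n_def]] diff_on_closed_C1[OF Q(2)[folded n_def]]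
 have n1: "negligible (X1 i ` UNIV)" if "i < n" for i
  unfolding X1_def by (intro negligible_3_to_4 diff_intros dQ that) (auto simp: tcirc'_nonzero)
 have n2: "negligible (X2 i j c ` S2 i j c)" if "i < n" "j < n" for i j c
  unfolding X2_def S2_def by (intro negligible_3_to_4 diff_intros dQ that) auto
 have n3: "negligible (X3 i j ` S3 i j)" if "i < n" "j < n" for i j
  unfolding X3_def S3_def solve_def A_def B_def A'_def B'_def R_def R'_def
  by (intro negligible_3_to_4 diff_intros dQ that) auto
 have n4: "negligible (X4 i j k ` S4 i j k)" if "i < n" "j < n" "k < n" for i j k
  unfolding X4_def S4_def solve_def A_def B_def R_def
  by (intro negligible_3_to_4 diff_intros dQ that) auto
 define Bad where "Bad = (UN i<n. X1 i ` UNIV) Un (UN i<n. UN j<n. UN c:{0, 1/2}. X2 i j c ` S2 i j c) Un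
  (UN i<n. UN j<n. X3 i j ` S3 i j) Un (UN i<n. UN j<n. UN k<n. X4 i j k ` S4 i j k)"
 have negl: "negligible Bad" unfolding Bad_def
  by (intro negligible_Un negligible_finite_UN) (auto intro: n1 n2 n3 n4)
 define K where "K = 3 * real n + 1"
 have K: "K >= 1" unfolding K_def by simp
 define et where "et = (e / 2) / (K + K^2 + 2 * pi + 2 * (K * (2 * pi)))"
 have den: "K + K^2 + 2 * pi + 2 * (K * (2 * pi)) > 0" using K pi_gt_zero by (intro add_pos_pos mult_pos_pos add_pos_nonneg) auto
 have eta: "et > 0" unfolding et_def using e den by simp
 have "~ ball 0 et <= Bad"
 proof
  assume "ball 0 et <= Bad"
  hence "negligible (ball (0 :: complex \<times> complex) et)" using negl negligible_subset by blast
  thus False using open_not_negligible[of "ball (0 :: complex \<times> complex) et"] eta by auto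
 qed
 then obtain x where "x : ball 0 et" "x ~: Bad" by blast
 then obtain w u where wu: "(w, u) : ball 0 et" "(w, u) ~: Bad" by (cases x) simp
 have nw: "norm w <= et" "norm u <= et"
  using wu(1) norm_fst_le[of w u] norm_snd_le[of u w] by auto
 define p where "p = (%i t. Q i t + (w * ?a i t + u * (?a i t * ?a i t)))"
 define P' where "P' = map p [0..<n]"
 have P'i: "P' ! i = p i" if "i < n" for i unfolding P'_def using that by simp
 have len: "length P' = n" unfolding P'_def by simp
 have C1p: "closed_C1 (p i)" if i: "i < n" for i
  unfolding p_def using Q(1) i unfolding n_def by (intro closed_C1_add(1) closed_C1_mult closed_C1_const closed_C1_tcirc) auto
 have vdp: "vd (p i) t = vd (Q i) t + (w * ?a' t + u * (2 * (?a i t * ?a' t)))" if i: "i < n" for i t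
 proof -
  have da: "(?a i has_vd ?a' t) (at t)" using closed_C1_has_vd[OF closed_C1_tcirc] vd_tcirc by metis
  have "(p i has_vd vd (Q i) t + (w * ?a' t + u * (?a i t * ?a' t + ?a' t * ?a i t))) (at t)"
   unfolding p_def using Q(1) i unfolding n_def
   by (intro has_vd_add has_vector_derivative_mult_right has_vector_derivative_mult da closed_C1_has_vd) auto
  thus ?thesis by (simp add: vd_eqI mult.commute)
 qed
 have na: "norm (?a i t) <= K" if "i < n" for i t
 proof -
  have "norm (?a i t) <= norm (3 * of_nat i :: complex) + norm (cis (2 * pi * t))" unfolding tcirc_def by (rule norm_triangle_ineq)
  also have "... <= K" using that unfolding K_def by (simp add: norm_mult)
  finally show ?thesis .
 qed
 have small: "small_perturb e P P'" unfolding small_perturb_def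
 proof (intro conjI allI impI)
  show "length P' = length P" using len n_def by simp
  fix i t assume "i < length P"
  hence i: "i < n" unfolding n_def .
  show "closed_C1 (P' ! i)" using P'i[OF i] C1p[OF i] by simp
  have "et * (K + K^2 + 2 * pi + 2 * (K * (2 * pi))) = e / 2"
   by (rule nonzero_eq_divide_eq[THEN iffD1, OF _ et_def]) (use den in simp)
  hence E: "et * K + et * K^2 + et * (2 * pi) + et * (2 * (K * (2 * pi))) = e / 2" by (simp only: distrib_left)
  have pos: "et * K >= 0" "et * K^2 >= 0" "et * (2 * pi) >= 0" "et * (2 * (K * (2 * pi))) >= 0" using eta K by auto
  have "norm (w * ?a i t) <= et * K" unfolding norm_mult using nw na[OF i] eta by (intro mult_mono) auto
  moreover have "norm (u * (?a i t * ?a i t)) <= et * K^2" unfolding norm_mult power2_eq_square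
   using nw na[OF i] eta K by (intro mult_mono) auto
  moreover have "p i t - Q i t = w * ?a i t + u * (?a i t * ?a i t)" unfolding p_def by simp
  hence "norm (p i t - Q i t) <= norm (w * ?a i t) + norm (u * (?a i t * ?a i t))"
   by (simp only: norm_triangle_ineq)
  ultimately have "norm (p i t - Q i t) <= e / 2" using E pos by linarith
  moreover have "norm (Q i t - (P ! i) t) <= e / 2" using Q(3) i n_def by simp
  ultimately show "norm ((P' ! i) t - (P ! i) t) <= e" unfolding P'i[OF i]
   using norm_triangle_ineq[of "p i t - Q i t" "Q i t - (P ! i) t"] by simp
  have "norm (w * ?a' t) <= et * (2 * pi)" unfolding norm_mult norm_tcirc' using nw eta by (intro mult_mono) auto
  moreover have "norm (u * (2 * (?a i t * ?a' t))) <= et * (2 * (K * (2 * pi)))" unfolding norm_mult norm_tcirc'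
   using nw na[OF i] eta K by (intro mult_mono) auto
  moreover have "vd (p i) t - vd (Q i) t = w * ?a' t + u * (2 * (?a i t * ?a' t))" unfolding vdp[OF i] by simp
  hence "norm (vd (p i) t - vd (Q i) t) <= norm (w * ?a' t) + norm (u * (2 * (?a i t * ?a' t)))"
   by (simp only: norm_triangle_ineq)
  ultimately have "norm (vd (p i) t - vd (Q i) t) <= e / 2" using E pos by linarith
  moreover have "norm (vd (Q i) t - vd (P ! i) t) <= e / 2" using Q(3) i n_def by simp
  ultimately show "norm (vd (P' ! i) t - vd (P ! i) t) <= e" unfolding P'i[OF i]
   using norm_triangle_ineq[of "vd (p i) t - vd (Q i) t" "vd (Q i) t - vd (P ! i) t"] by simp
 qed
 have vd0: "vd (p i) t ~= 0" if i: "i < n" for i t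
 proof
  assume "vd (p i) t = 0"
  hence "w * ?a' t = - (vd (Q i) t + 2 * (u * (?a i t * ?a' t)))" unfolding vdp[OF i] by (simp add: algebra_simps eq_neg_iff_add_eq_0)
  hence "w = - (vd (Q i) t + 2 * (u * (?a i t * ?a' t))) * inverse (?a' t)" using tcirc'_nonzero[of t]
   by (metis mult.assoc mult.right_neutral right_inverse)
  hence "(w, u) = X1 i (t, u)" unfolding X1_def by simp
  hence "(w, u) : X1 i ` UNIV" by simp
  hence "(w, u) : Bad" unfolding Bad_def
   by (rule UnI1[OF UnI1[OF UnI1[OF UN_I[of i]]], rotated]) (use i in simp)
  thus False using wu by simp
 qed
 have coinc: "w * A i j s t + u * B i j s t = R i j s t" if "p i s = p j t" for i j s t
  using that unfolding p_def A_def B_def R_def by (simp add: algebra_simps)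
 have par: "~ (p i t = p j (t + c))" if ij: "i < n" "j < n" and c: "c : {0, 1/2}" and ne: "?a i t - ?a j (t + c) ~= 0" for i j t c
 proof
  assume "p i t = p j (t + c)"
  from coinc[OF this] have "w * (?a i t - ?a j (t + c)) = - (Q i t - Q j (t + c) + u * (?a i t * ?a i t - ?a j (t + c) * ?a j (t + c)))"
   unfolding A_def B_def R_def by (simp add: algebra_simps)
  hence "w = - (Q i t - Q j (t + c) + u * (?a i t * ?a i t - ?a j (t + c) * ?a j (t + c))) * inverse (?a i t - ?a j (t + c))"
   using ne by (metis mult.assoc mult.right_neutral right_inverse)
  hence "(w, u) = X2 i j c (t, u)" "(t, u) : S2 i j c" unfolding X2_def S2_def using ne by auto
  hence "(w, u) : X2 i j c ` S2 i j c" by simp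
  hence "(w, u) : Bad" unfolding Bad_def
   by (rule UnI1[OF UnI1[OF UnI2[OF UN_I[of i, OF _ UN_I[of j, OF _ UN_I[of c]]]]], rotated 3]) (use ij c in simp_all)
  thus False using wu by simp
 qed
 have reg: "regular_projection P'" unfolding regular_projection_def independent_complex_iff
 proof (intro conjI ballI impI)
  show "immersed P'" by (rule immersedI) (use len P'i C1p vd0 in auto)
 next
  fix q q' assume q: "q : params P'" "q' : params P'" "q ~= q'" "pt P' q = pt P' q'"
  obtain i s j t where qs: "q = (i, s)" "q' = (j, t)" by fastforce
  have b: "i < n" "j < n" "s : {0..<1}" "t : {0..<1}" using q unfolding qs params_def len by auto
  have pe: "p i s = p j t" using q(4) b unfolding qs pt_def by (simp add: P'i)
  have ne: "?a i s ~= ?a j t" using tcirc_inj[OF b(3,4), of i j] q(3) unfolding qs by auto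
  show "det2 (velocity P' q) (velocity P' q') ~= 0"
  proof
   assume "det2 (velocity P' q) (velocity P' q') = 0"
   hence "det2 (vd (p i) s) (vd (p j) t) = 0" unfolding velocity_def qs using b P'i by simp
   then obtain l where l: "vd (p i) s = l *R vd (p j) t" using det2_eq_0 vd0[OF b(2)] by metis
   have e1: "A i j s t * w + B i j s t * u = R i j s t" using coinc[OF pe] by (simp add: mult.commute)
   have e2: "A' s t l * w + B' i j s t l * u = R' i j s t l"
    using l unfolding vdp[OF b(1)] vdp[OF b(2)] A'_def B'_def R'_def scaleR_conv_of_real by (simp add: algebra_simps)
   have dt: "A i j s t * B' i j s t l - B i j s t * A' s t l = (?a i s - ?a j t)^2 * (?a' s + of_real l * ?a' t)"
    unfolding A_def B_def A'_def B'_def by (simp add: algebra_simps power2_eq_square)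
   show False
   proof (cases "?a' s + of_real l * ?a' t = 0")
    case False
    hence D: "A i j s t * B' i j s t l - B i j s t * A' s t l ~= 0" unfolding dt using ne by simp
    have "(w, u) = X3 i j (s, t, l)" unfolding X3_def solve_def using cramer[OF e1 e2 D] by simp
    moreover have "(s, t, l) : S3 i j" unfolding S3_def using D by simp
    ultimately have "(w, u) : X3 i j ` S3 i j" by simp
    hence "(w, u) : Bad" unfolding Bad_def
     by (rule UnI1[OF UnI2[OF UN_I[of i, OF _ UN_I[of j]]], rotated 2]) (use b in simp_all)
    thus False using wu by simp
   next
    case True
    hence "of_real (2 * pi) * \<i> * (cis (2 * pi * s) + of_real l * cis (2 * pi * t)) = 0" unfolding tcirc'_def by (simp add: algebra_simps)
    hence z: "cis (2 * pi * s) = - of_real l * cis (2 * pi * t)" by (simp add: eq_neg_iff_add_eq_0)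
    hence "norm (cis (2 * pi * s)) = norm (- of_real l * cis (2 * pi * t))" by simp
    hence "abs l = 1" by (simp add: norm_mult)
    hence "l = 1 | l = -1" by auto
    hence "EX c:{0, 1/2}. cis (2 * pi * t) = cis (2 * pi * (s + c))"
    proof
     assume "l = 1"
     hence "cis (2 * pi * t) = - cis (2 * pi * s)" using z by simp
     also have "... = cis (2 * pi * (s + 1/2))" by (simp add: distrib_left cis_mult[symmetric])
     finally show ?thesis by blast
    next
     assume "l = -1"
     hence "cis (2 * pi * t) = cis (2 * pi * (s + 0))" using z by simp
     thus ?thesis by blast
    qed
    then obtain c m where c: "c : {0, 1/2}" "t = s + c + of_int m" using cis_2pi_eq by metis
    have "p j t = p j (s + c)" "?a j t = ?a j (s + c)" unfolding c(2)
     by (rule closed_C1_of_int(1)[OF C1p[OF b(2)]], rule closed_C1_of_int(1)[OF closed_C1_tcirc])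
    thus False using par[OF b(1,2) c(1), of s] pe ne by simp
   qed
  qed
 next
  fix q q' q'' assume q: "q : params P'" "q' : params P'" "q'' : params P'" "pt P' q = pt P' q'" "pt P' q' = pt P' q''"
  show "q = q' | q' = q'' | q = q''"
  proof (rule ccontr)
   assume "~ ?thesis"
   hence ne: "q ~= q'" "q' ~= q''" "q ~= q''" by auto
   obtain i s j t k r where qs: "q = (i, s)" "q' = (j, t)" "q'' = (k, r)" by (metis surj_pair)
   have b: "i < n" "j < n" "k < n" "s : {0..<1}" "t : {0..<1}" "r : {0..<1}" using q unfolding qs params_def len by auto
   have pe: "p i s = p j t" "p i s = p k r" using q(4,5) b unfolding qs pt_def by (simp_all add: P'i)
   have na: "?a i s ~= ?a j t" "?a j t ~= ?a k r" "?a i s ~= ?a k r"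
    using tcirc_inj[OF b(4,5), of i j] tcirc_inj[OF b(5,6), of j k] tcirc_inj[OF b(4,6), of i k] ne unfolding qs by auto
   have e1: "A i j s t * w + B i j s t * u = R i j s t" using coinc[OF pe(1)] by (simp add: mult.commute)
   have e2: "A i k s r * w + B i k s r * u = R i k s r" using coinc[OF pe(2)] by (simp add: mult.commute)
   have "A i j s t * B i k s r - B i j s t * A i k s r = (?a i s - ?a j t) * (?a i s - ?a k r) * (?a k r - ?a j t)"
    unfolding A_def B_def by (simp add: algebra_simps)
   hence D: "A i j s t * B i k s r - B i j s t * A i k s r ~= 0" using na by simp
   have "(w, u) = X4 i j k (s, t, r)" unfolding X4_def solve_def using cramer[OF e1 e2 D] by simp
   moreover have "(s, t, r) : S4 i j k" unfolding S4_def using D by simp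
   ultimately have "(w, u) : X4 i j k ` S4 i j k" by simp
   hence "(w, u) : Bad" unfolding Bad_def
    by (rule UnI2[OF UN_I[of i, OF _ UN_I[of j, OF _ UN_I[of k]]], rotated 3]) (use b in simp_all)
   thus False using wu by simp
  qed
 qed
 show ?thesis by (rule that[OF reg small])
qed

section \<open>Moves supported in collars\<close>

lemma inj_blinfun_inverse:
 fixes A :: "'a::euclidean_space \<Rightarrow>\<^sub>L 'a"
 assumes "inj (blinfun_apply A)"
 shows "bounded_linear (inv (blinfun_apply A))" "blinfun_apply A (inv (blinfun_apply A) v) = v" "inv (blinfun_apply A) (blinfun_apply A v) = v"
proof -
 have lin: "linear (blinfun_apply A)" by (simp add: blinfun.bounded_linear_right bounded_linear.linear)
 hence surj: "surj (blinfun_apply A)" using linear_injective_imp_surjective assms by blast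
 show "blinfun_apply A (inv (blinfun_apply A) v) = v" using surj by (simp add: surj_f_inv_f)
 show "inv (blinfun_apply A) (blinfun_apply A v) = v" using assms by simp
 have "linear (inv (blinfun_apply A))" using inj_linear_imp_inv_linear[OF lin assms] .
 thus "bounded_linear (inv (blinfun_apply A))" by (simp add: linear_conv_bounded_linear)
qed

lemma continuous_on_inverse_apply:
 fixes A :: "'x::metric_space => 'a::euclidean_space \<Rightarrow>\<^sub>L 'a"
 assumes A: "continuous_on S A" and inj: "!!x. x : S ==> inj (A x)"
 shows "continuous_on S (%x. inv (A x) v)"
 unfolding continuous_on_iff
proof (intro ballI allI impI)
 fix x0 and e :: real assume x0: "x0 : S" and e: "e > 0"
 obtain B where B: "B > 0" "!!u. B * norm u <= norm (A x0 u)"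
  by (rule linear_inj_bounded_below_pos[OF _ inj[OF x0]])
   (auto simp: blinfun.bounded_linear_right bounded_linear.linear)
 define w0 where "w0 = inv (A x0) v"
 define et where "et = min (B / 2) (B * e / (4 * (norm w0 + 1)))"
 have nn: "4 * (norm w0 + 1) > 0" by (simp add: add_nonneg_pos)
 have eta: "et > 0" unfolding et_def using B e nn by simp
 obtain d where d: "d > 0" "!!x. x : S ==> dist x x0 < d ==> dist (A x) (A x0) < et"
  using A x0 eta unfolding continuous_on_iff by metis
 show "EX d>0. ALL x':S. dist x' x0 < d --> dist (inv (blinfun_apply (A x')) v) (inv (A x0) v) < e"
 proof (intro exI[of _ d] conjI ballI impI d(1))
  fix x assume x: "x : S" "dist x x0 < d"
  define w where "w = inv (A x) v"
  have Aw: "A x w = v" "A x0 w0 = v" unfolding w_def w0_def using inj_blinfun_inverse(2)[OF inj] x x0 by auto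
  have nA: "norm (A x - A x0) < et" using d(2)[OF x] by (simp add: dist_norm)
  have "A x0 (w - w0) = - ((A x - A x0) w)" using Aw by (simp add: blinfun.bilinear_simps)
  hence "B * norm (w - w0) <= norm (A x - A x0) * norm w"
   using B(2)[of "w - w0"] norm_blinfun[of "A x - A x0" w] by simp
  also have "... <= et * norm w" using nA by (intro mult_right_mono) auto
  finally have h: "B * norm (w - w0) <= et * norm w" .
  also have "et * norm w <= (B / 2) * norm w" unfolding et_def by (intro mult_right_mono min.cobounded1) auto
  finally have "norm (w - w0) <= norm w / 2" using B(1) by simp
  hence nw: "norm w <= 2 * norm w0" using norm_triangle_sub[of w w0] by simp
  have "et * norm w <= (B * e / (4 * (norm w0 + 1))) * (2 * norm w0)"
   unfolding et_def using nw B e nn by (intro mult_mono) auto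
  also have "... < B * e"
  proof -
   have "B * e / (4 * (norm w0 + 1)) * (2 * norm w0) = B * e * (2 * norm w0 / (4 * (norm w0 + 1)))" by simp
   also have "... < B * e * 1" using B e nn by (intro mult_strict_left_mono) (auto simp: divide_less_eq)
   finally show ?thesis by simp
  qed
  finally have "B * norm (w - w0) < B * e" using h by simp
  hence "norm (w - w0) < e" using B by simp
  thus "dist (inv (A x) v) (inv (A x0) v) < e"
   unfolding w_def w0_def by (simp add: dist_norm)
 qed
qed

text \<open>Invariance of domain gives the continuity of the inverse, so only its derivative has to be computed.\<close>
lemma C1_inverse:
 fixes Ph :: "'a::euclidean_space => 'a"
 assumes W: "open W" "C1_on W Ph" and inj: "inj_on Ph W" and dinj: "!!x. x : W ==> inj (dd Ph x)"
 shows "open (Ph ` W)" "C1_on (Ph ` W) (inv_into W Ph)"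
  "y : Ph ` W ==> dd Ph (inv_into W Ph y) (dd (inv_into W Ph) y v) = v"
proof -
 let ?g = "inv_into W Ph"
 show op: "open (Ph ` W)" by (rule invariance_of_domain[OF C1_onD(4)[OF W] W(1) inj])
 obtain g where g: "homeomorphism W (Ph ` W) Ph g"
  by (rule invariance_of_domain_homeomorphism[OF W(1) C1_onD(4)[OF W] _ inj]) auto
 have contg: "continuous_on (Ph ` W) ?g"
 proof (rule continuous_on_eq[OF homeomorphism_cont2[OF g]])
  fix y assume "y : Ph ` W"
  thus "g y = ?g y" using inj homeomorphism_apply1[OF g] by (auto simp: inv_into_f_f)
 qed
 have gW: "?g y : W" "Ph (?g y) = y" if "y : Ph ` W" for y
  using that by (auto simp: inv_into_into f_inv_into_f)
 have der: "(?g has_derivative inv (dd Ph (?g y))) (at y)" if y: "y : Ph ` W" for y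
 proof (rule has_derivative_inverse_basic[where f = Ph and T = "Ph ` W"])
  show "(Ph has_derivative blinfun_apply (dd Ph (?g y))) (at (?g y))" by (rule C1_onD(1)[OF W gW(1)[OF y]])
  show "bounded_linear (inv (dd Ph (?g y)))" by (rule inj_blinfun_inverse(1)[OF dinj[OF gW(1)[OF y]]])
  show "inv (dd Ph (?g y)) \<circ> blinfun_apply (dd Ph (?g y)) = id"
   using inj_blinfun_inverse(3)[OF dinj[OF gW(1)[OF y]]] by auto
  show "continuous (at y) ?g" using contg y cont_on_open[OF op] by blast
 qed (use op y gW in auto)
 show "C1_on (Ph ` W) ?g"
 proof (rule C1_onI(1)[OF op der])
  fix v show "continuous_on (Ph ` W) (%y. inv (dd Ph (?g y)) v)"
   by (rule continuous_on_inverse_apply)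
    (use gW dinj in "auto intro!: cont_comp[OF C1_onD(3)[OF W] contg]")
 qed
 show "dd Ph (?g y) (dd ?g y v) = v" if y: "y : Ph ` W"
  unfolding dd_eqI[OF der[OF y]] by (rule inj_blinfun_inverse(2)[OF dinj[OF gW(1)[OF y]]])
qed

text \<open>The cubic of the twist, flattened to a \<open>C\<^sup>1\<close> function on the line. It also supplies all
cut-off functions.\<close>
definition stepf :: "real => real" where
 "stepf x = (if x <= 0 then 0 else if x >= 1 then 1 else 3 * x^2 - 2 * x ^ 3)"

definition stepf' :: "real => real" where
 "stepf' x = (if x <= 0 | x >= 1 then 0 else 6 * x - 6 * x^2)"

lemma DERIV_quadratic_zero:
 assumes "!!x. abs(f x - f a) <= C * (x - a)^2" shows "(f has_real_derivative 0) (at a)"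
 unfolding has_field_derivative_iff
proof (rule Lim_null_comparison)
 show "\<forall>\<^sub>F x in at a. norm ((f x - f a) / (x - a)) <= C * abs(x - a)"
  unfolding eventually_at
 proof (intro exI[of _ 1] conjI ballI impI)
  fix x assume "x ~= a & dist x a < 1"
  thus "norm ((f x - f a) / (x - a)) <= C * abs(x - a)"
   using assms[of x] by (simp add: divide_le_eq power2_eq_square abs_mult_self_eq mult.assoc)
 qed simp
 have "((%x. C * abs(x - a)) \<longlongrightarrow> C * abs(a - a)) (at a)" by (intro tendsto_intros)
 thus "((%x. C * abs(x - a)) \<longlongrightarrow> 0) (at a)" by simp
qed

lemma stepf_bounds: "0 <= stepf x" "stepf x <= 1"
proof -
 have "0 <= 3 * x^2 - 2 * x ^ 3" if "0 < x" "x < 1"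
 proof -
  have "3 * x^2 - 2 * x ^ 3 = x^2 * (3 - 2 * x)" by (simp add: algebra_simps power2_eq_square power3_eq_cube)
  thus ?thesis using that by simp
 qed
 moreover have "3 * x^2 - 2 * x ^ 3 <= 1" if "0 < x" "x < 1"
 proof -
  have "1 - (3 * x^2 - 2 * x ^ 3) = (1 - x)^2 * (1 + 2 * x)" by (simp add: algebra_simps power2_eq_square power3_eq_cube)
  moreover have "... >= 0" using that by simp
  ultimately show ?thesis by simp
 qed
 ultimately show "0 <= stepf x" "stepf x <= 1" unfolding stepf_def by auto
qed

lemma stepf_reflect: "stepf (1 - x) = 1 - stepf x"
 unfolding stepf_def by (auto simp: power2_eq_square power3_eq_cube algebra_simps)

lemma stepf_quadratic: "abs(stepf x) <= 3 * x^2"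
proof (cases "x >= 1")
 case True
 hence "1 <= x^2" by simp
 moreover have "stepf x = 1" using True unfolding stepf_def by simp
 ultimately show ?thesis by linarith
next
 case False
 thus ?thesis using stepf_bounds(1)[of x] unfolding stepf_def by (auto split: if_splits)
qed

lemma DERIV_stepf: "(stepf has_real_derivative stepf' x) (at x)"
proof -
 consider "x < 0" | "x = 0" | "0 < x" "x < 1" | "x = 1" | "x > 1" by linarith
 thus ?thesis
 proof cases
  case 1
  have "((%_. 0) has_real_derivative 0) (at x)" by simp
  hence "(stepf has_real_derivative 0) (at x)"
   by (rule has_field_derivative_transform_within_open[where S = "{..<0}"]) (use 1 in "auto simp: stepf_def")
  thus ?thesis using 1 by (simp add: stepf'_def)
 next
  case 2
  have "(stepf has_real_derivative 0) (at 0)"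
  proof (rule DERIV_quadratic_zero[where C = 3])
   have s0: "stepf 0 = 0" by (simp add: stepf_def)
   show "abs(stepf x - stepf 0) <= 3 * (x - 0)^2" for x using stepf_quadratic[of x] unfolding s0 by simp
  qed
  thus ?thesis using 2 by (simp add: stepf'_def)
 next
  case 3
  have "((%x. 3 * x^2 - 2 * x ^ 3) has_real_derivative 6 * x - 6 * x^2) (at x)"
   by (auto intro!: dintros)
  hence "(stepf has_real_derivative 6 * x - 6 * x^2) (at x)"
   by (rule has_field_derivative_transform_within_open[where S = "{0<..<1}"]) (use 3 in "auto simp: stepf_def")
  thus ?thesis using 3 by (simp add: stepf'_def)
 next
  case 4
  have "(stepf has_real_derivative 0) (at 1)"
  proof (rule DERIV_quadratic_zero[where C = 3])
   fix x
   have "stepf x - stepf 1 = - stepf (1 - x)" unfolding stepf_reflect by (simp add: stepf_def)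
   thus "abs(stepf x - stepf 1) <= 3 * (x - 1)^2" using stepf_quadratic[of "1 - x"] by (simp add: power2_commute)
  qed
  thus ?thesis using 4 by (simp add: stepf'_def)
 next
  case 5
  have "((%_. 1) has_real_derivative 0) (at x)" by simp
  hence "(stepf has_real_derivative 0) (at x)"
   by (rule has_field_derivative_transform_within_open[where S = "{1<..}"]) (use 5 in "auto simp: stepf_def")
  thus ?thesis using 5 by (simp add: stepf'_def)
 qed
qed

lemma continuous_on_stepf': "continuous_on S stepf'"
proof -
 have eq: "stepf' = (%x. 6 * max 0 (min 1 x) - 6 * (max 0 (min 1 x))^2)"
  unfolding stepf'_def by (intro ext) (auto simp: max_def min_def)
 show ?thesis unfolding eq by (intro cintros)
qed

lemma stepf'_bound: "abs(stepf' x) <= 2"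
proof -
 have "0 <= 6 * x - 6 * x^2" "6 * x - 6 * x^2 <= 2" if "0 < x" "x < 1"
 proof -
  have "6 * x - 6 * x^2 = 6 * (x * (1 - x))" by (simp add: algebra_simps power2_eq_square)
  thus "0 <= 6 * x - 6 * x^2" using that by simp
  have "2 - (6 * x - 6 * x^2) = 6 * (x - 1/2)^2 + 1/2" by (simp add: algebra_simps power2_eq_square)
  moreover have "... >= 0" by simp
  ultimately show "6 * x - 6 * x^2 <= 2" by linarith
 qed
 thus ?thesis unfolding stepf'_def by auto
qed

lemma C1_on_real:
 fixes g :: "real => 'b::real_normed_vector"
 assumes "open S" "!!t. t : S ==> (g has_vd g' t) (at t)" "continuous_on S g'"
 shows "C1_on S g" "t : S ==> dd g t h = h *R g' t"
proof -
 show "C1_on S g"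
  by (rule C1_onI(1)[OF assms(1), where g' = "%t h. h *R g' t"])
   (use assms in "auto simp: has_vd_def intro!: cintros")
 show "t : S ==> dd g t h = h *R g' t"
  using dd_eqI[OF assms(2)[unfolded has_vd_def]] by simp
qed

lemma C1_on_stepf: "C1_on UNIV stepf"
 by (rule C1_on_real(1)[where g' = stepf'])
  (use DERIV_stepf in "auto simp: real_has_vd[symmetric] continuous_on_stepf'")

lemma C1_fam_on_Pair:
 assumes F: "C1_fam_on N F" and G: "C1_fam_on N G"
 shows "C1_fam_on N (%s t. (F s t, G s t))"
  "s : {0..1} ==> t : N ==> vd (%t. (F s t, G s t)) t = (vd (F s) t, vd (G s) t)"
proof -
 have *: "((%t. (F s t, G s t)) has_vd (vd (F s) t, vd (G s) t)) (at t)" if "s : {0..1}" "t : N" for s t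
  by (intro has_vector_derivative_Pair C1_fam_onD(1)[OF F that] C1_fam_onD(1)[OF G that])
 show "C1_fam_on N (%s t. (F s t, G s t))"
  by (rule C1_fam_onI[OF *], assumption, assumption)
   (unfold case_prod_unfold, (intro cintros C1_fam_onD(2,3)[OF F] C1_fam_onD(2,3)[OF G])+)
 show "s : {0..1} ==> t : N ==> vd (%t. (F s t, G s t)) t = (vd (F s) t, vd (G s) t)"
  by (rule vd_eqI[OF *])
qed

lemma C1_fam_on_mult:
 fixes F G :: "real => real => 'b::real_normed_algebra"
 assumes F: "C1_fam_on N F" and G: "C1_fam_on N G"
 shows "C1_fam_on N (%s t. F s t * G s t)"
  "s : {0..1} ==> t : N ==> vd (%t. F s t * G s t) t = F s t * vd (G s) t + vd (F s) t * G s t"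
proof -
 have *: "((%t. F s t * G s t) has_vd F s t * vd (G s) t + vd (F s) t * G s t) (at t)" if "s : {0..1}" "t : N" for s t
  by (intro has_vector_derivative_mult C1_fam_onD(1)[OF F that] C1_fam_onD(1)[OF G that])
 show "C1_fam_on N (%s t. F s t * G s t)"
  by (rule C1_fam_onI[OF *], assumption, assumption)
   (unfold case_prod_unfold, (intro cintros C1_fam_onD(2,3)[OF F] C1_fam_onD(2,3)[OF G])+)
 show "s : {0..1} ==> t : N ==> vd (%t. F s t * G s t) t = F s t * vd (G s) t + vd (F s) t * G s t"
  by (rule vd_eqI[OF *])
qed

lemma C1_on_bounded_linear: "bounded_linear f ==> C1_on UNIV f" "bounded_linear f ==> blinfun_apply (dd f x) = f"
 by (rule C1_onI(1)[where g' = "%_. f"]) (auto simp: bounded_linear_imp_has_derivative dd_eqI)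

lemma C1_fam_on_bounded_linear:
 assumes g: "bounded_linear g" and F: "C1_fam_on N F"
 shows "C1_fam_on N (%s t. g (F s t))" "s : {0..1} ==> t : N ==> vd (%t. g (F s t)) t = g (vd (F s) t)"
proof -
 have *: "((%t. g (F s t)) has_vd g (vd (F s) t)) (at t)" if "s : {0..1}" "t : N" for s t
  by (rule bl_has_vd[OF g C1_fam_onD(1)[OF F that]])
 show "C1_fam_on N (%s t. g (F s t))"
  by (rule C1_fam_onI[OF *], assumption, assumption)
   (unfold case_prod_unfold, (intro bounded_linear.continuous_on[OF g] C1_fam_onD(2,3)[OF F])+)
 show "s : {0..1} ==> t : N ==> vd (%t. g (F s t)) t = g (vd (F s) t)" by (rule vd_eqI[OF *])
qed

lemmas C1_fam_on_fst = C1_fam_on_bounded_linear[OF bounded_linear_fst]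
lemmas C1_fam_on_snd = C1_fam_on_bounded_linear[OF bounded_linear_snd]

lemma C1_on_exp: "C1_on UNIV (exp :: complex => complex)"
 by (rule C1_onI(1)[where g' = "%z h. exp z * h"])
  (auto intro!: cintros DERIV_exp simp flip: has_field_derivative_def)

abbreviation lateral :: "R3 set" where "lateral == sphere 0 1 \<times> {-1..1}"

definition collar3 :: "(R3 => R3) => R3 set => bool" where
 "collar3 Ph W <-> open W & cylinder <= W & C1_on W Ph & inj_on Ph W & (ALL x:W. inj (dd Ph x))"

lemma collar3D:
 assumes "collar3 Ph W"
 shows "open W" "cylinder <= W" "C1_on W Ph" "inj_on Ph W" "!!x. x : W ==> inj (dd Ph x)"
  "compact (Ph ` cylinder)" "inj_on Ph cylinder"
proof -
 show *: "open W" "cylinder <= W" "C1_on W Ph" "inj_on Ph W" "!!x. x : W ==> inj (dd Ph x)"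
  using assms unfolding collar3_def by auto
 have "compact cylinder" by (intro compact_Times) auto
 thus "compact (Ph ` cylinder)"
  by (rule compact_continuous_image[OF continuous_on_subset[OF C1_onD(4)[OF *(1,3)] *(2)]])
 show "inj_on Ph cylinder" using *(2,4) inj_on_subset by blast
qed

definition collar_move :: "nat set => (nat => R3 => 'c) => (nat => R3 => R3) => 'c => 'c" where
 "collar_move J Ph T y = (if EX j:J. y : Ph j ` cylinder
  then let j = (THE j. j : J & y : Ph j ` cylinder) in Ph j (T j (inv_into cylinder (Ph j) y))
  else y)"

abbreviation (input) disj_cyl :: "(nat => R3 => 'c) => nat set => bool" where
 "disj_cyl Ph J == disjoint_family_on (%j. Ph j ` cylinder) J"

lemma disj_cylD: "disj_cyl Ph J ==> i : J ==> j : J ==> y : Ph i ` cylinder ==> y : Ph j ` cylinder ==> i = j"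
 unfolding disjoint_family_on_def by blast

lemma disj_cyl_mono: "disj_cyl Ph J ==> S <= J ==> disj_cyl Ph S" by (rule disjoint_family_on_mono[rotated])

lemma disj_cyl_image:
 assumes g: "inj g" and Ps: "!!j x. j : J ==> x : cylinder ==> Ps j x = g (Ph j x)" and disj: "disj_cyl Ph J"
 shows "disj_cyl Ps J"
 unfolding disjoint_family_on_def
proof (intro ballI impI)
 fix i j assume ij: "i : J" "j : J" "i ~= j"
 have im: "Ps k ` cylinder = g ` (Ph k ` cylinder)" if "k : J" for k
  unfolding image_image by (rule image_cong[OF refl]) (rule Ps[OF that])
 have "Ph i ` cylinder Int Ph j ` cylinder = {}" using disj ij unfolding disjoint_family_on_def by metis
 thus "Ps i ` cylinder Int Ps j ` cylinder = {}" unfolding im[OF ij(1)] im[OF ij(2)] image_Int[OF g, symmetric] by simp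
qed

lemma collar_cases: obtains "!!j. j : J ==> y ~: Ph j ` cylinder" | j x where "j : J" "x : cylinder" "y = Ph j x"
proof (cases "EX j:J. y : Ph j ` cylinder")
 case True
 then obtain j where "j : J" "y : Ph j ` cylinder" by (rule bexE)
 thus ?thesis using that(2) by (elim imageE)
next
 case False
 show ?thesis by (rule that(1)) (use False in metis)
qed

lemma collar_move_in:
 assumes "disj_cyl Ph J" "inj_on (Ph j) cylinder" "j : J" "x : cylinder"
 shows "collar_move J Ph T (Ph j x) = Ph j (T j x)"
proof -
 have "(THE i. i : J & Ph j x : Ph i ` cylinder) = j"
  by (rule the_equality) (use assms disj_cylD[OF assms(1)] in blast)+
 moreover have "EX j':J. Ph j x : Ph j' ` cylinder" using assms by blast
 moreover have "inv_into cylinder (Ph j) (Ph j x) = x" using assms by (intro inv_into_f_f)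
 ultimately show ?thesis unfolding collar_move_def by (simp add: Let_def)
qed

lemma collar_move_out: "(!!j. j : J ==> y ~: Ph j ` cylinder) ==> collar_move J Ph T y = y"
 unfolding collar_move_def by auto

definition collar_mult :: "nat set => (nat => R3 => 'c) => (nat => real => complex) => 'c => 'c" where
 "collar_mult J Ph \<mu> = collar_move J Ph (%j x. (\<mu> j (snd x) * fst x, snd x))"

abbreviation (input) "exp_mult J Ph w == collar_mult J Ph (%j t. exp (w j t))"

lemmas collar_mult_in = collar_move_in[where T = "%j x. (\<mu> j (snd x) * fst x, snd x)" for \<mu>, folded collar_mult_def]

lemmas collar_mult_out = collar_move_out[where T = "%j x. (\<mu> j (snd x) * fst x, snd x)" for \<mu>, folded collar_mult_def]

definition curve_map :: "('b => 'c) => (real => 'b) list => (real => 'c) list" where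
 "curve_map T K = map (%ga t. T (ga t)) K"

lemma length_curve_map [simp]: "length (curve_map T K) = length K" by (simp add: curve_map_def)
lemma nth_curve_map [simp]: "i < length K ==> curve_map T K ! i = (%t. T ((K ! i) t))" by (simp add: curve_map_def)

text \<open>Logarithms of the factors by which the levels of a collar may be multiplied: disks are mapped into themselves,
and the ends are fixed.\<close>
definition log_profile :: "(real => complex) => bool" where
 "log_profile w <-> C1_on UNIV w & (ALL t. Re (w t) <= 0) & (ALL t. abs t >= 1 --> exp (w t) = 1)"

lemma cyl_mult: "x : cylinder ==> norm m <= 1 ==> (m * fst x, snd x) : cylinder"
 by (cases x) (auto simp: norm_mult intro: mult_le_one)

lemma collar_coordinates:
 assumes C: "collar3 Ph W" and ga: "closed_C1 ga" and N: "open N" "!!t. t : N ==> ga t : Ph ` W"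
 obtains q where "!!t. t : N ==> q t : W & Ph (q t) = ga t" "C1_fam_on N (%_. q)"
  "!!t. t : N ==> dd Ph (q t) (vd q t) = vd ga t"
proof -
 let ?g = "inv_into W Ph"
 have dinj: "x : W ==> inj (dd Ph x)" for x by (rule collar3D(5)[OF C])
 have inv: "open (Ph ` W)" "C1_on (Ph ` W) ?g" "!!y v. y : Ph ` W ==> dd Ph (?g y) (dd ?g y v) = v"
  by (rule C1_inverse[OF collar3D(1,3,4)[OF C]], (erule dinj | assumption))+
 define q where "q = (%t. ?g (ga t))"
 note comp = C1_fam_on_compose[OF C1_fam_on_const[OF ga, of N] inv(1,2) N(2)]
 show ?thesis
 proof (rule that[of q])
  show "t : N ==> q t : W & Ph (q t) = ga t" for t
   unfolding q_def using N(2) by (auto simp: inv_into_into f_inv_into_f)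
  show "C1_fam_on N (%_. q)" unfolding q_def using comp(1) by auto
  fix t assume t: "t : N"
  have "vd q t = dd ?g (ga t) (vd ga t)" unfolding q_def using comp(2)[of 0 t] t by auto
  thus "dd Ph (q t) (vd q t) = vd ga t" unfolding q_def using inv(3)[OF N(2)[OF t]] by simp
 qed
qed

text \<open>A homotopy inside the collars that fixes their ends and is injective and immersive on the link gives an
isotopic link. Near a point in a collar the moved link is smooth in collar coordinates, also beyond the ends,
because the link avoids the lateral boundary.\<close>
theorem collar_move_invariant:
 fixes K :: "(real => R3) list"
 defines "on == %y. on_sys K y"
 assumes f: "link_invariant f" and K: "embedded K" and J: "finite J"
  and C: "!!j. j : J ==> collar3 (Ph j) (W j)"
  and disj: "disj_cyl Ph J"
  and avoid: "!!i j t. i < length K ==> j : J ==> (K ! i) t ~: Ph j ` lateral"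
  and cyl: "!!s j x. s : {0..1} ==> j : J ==> x : cylinder ==> on (Ph j x) ==> H s j x : cylinder"
  and ends: "!!s j x. j : J ==> abs(snd x) >= 1 ==> H s j x = x"
  and inj: "!!s j x x'. s : {0..1} ==> j : J ==> x : cylinder ==> x' : cylinder ==> on (Ph j x) ==> on (Ph j x') ==>
    H s j x = H s j x' ==> x = x'"
  and fam: "!!j N q. j : J ==> C1_fam_on N (%_. q) ==> C1_fam_on N (%s t. H s j (q t))"
  and vd: "!!j N q s t. j : J ==> open N ==> C1_fam_on N (%_. q) ==> (!!t. t : N ==> norm (fst (q t)) < 1 & on (Ph j (q t))) ==>
    s : {0..1} ==> t : N ==> vd (%t. H s j (q t)) t = 0 ==> vd q t = 0"
 shows "f (st (curve_map (collar_move J Ph (H 0)) K)) = f (st (curve_map (collar_move J Ph (H 1)) K))"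
  and "s : {0..1} ==> embedded (curve_map (collar_move J Ph (H s)) K)"
proof -
 define T where "T = (%s. collar_move J Ph (H s))"
 define G where "G = (%s. curve_map (T s) K)"
 have T_in: "T s (Ph j x) = Ph j (H s j x)" if "j : J" "x : cylinder" for s j x
  unfolding T_def by (rule collar_move_in[OF disj collar3D(7)[OF C[OF that(1)]] that])
 have T_out: "T s y = y" if "!!j. j : J ==> y ~: Ph j ` cylinder" for s y
  unfolding T_def by (rule collar_move_out[OF that])
 have T_img: "T s y : Ph j ` cylinder" if "j : J" "y : Ph j ` cylinder" "s : {0..1}" "on y" for s j y
 proof -
  obtain x where x: "x : cylinder" "y = Ph j x" using \<open>y : Ph j ` cylinder\<close> by blast
  show ?thesis unfolding x(2) T_in[OF that(1) x(1)]
   by (rule imageI[OF cyl[OF that(3,1) x(1)]]) (use that(4) x(2) in simp)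
 qed
 have T_inj: "y = y'" if eq: "T s y = T s y'" and s: "s : {0..1}" and on: "on y" "on y'" for s y y'
 proof (cases "EX j:J. y : Ph j ` cylinder | y' : Ph j ` cylinder")
  case False
  have "y = T s y" by (rule sym, rule T_out, rule notI, rule notE[OF False], rule bexI, rule disjI1)
  also note eq
  also have "T s y' = y'" by (rule T_out, rule notI, rule notE[OF False], rule bexI, rule disjI2)
  finally show ?thesis .
 next
  case True
  then obtain j where j0: "j : J" "y : Ph j ` cylinder | y' : Ph j ` cylinder" by metis
  from j0(2) have "T s y : Ph j ` cylinder"
  proof
   assume "y : Ph j ` cylinder" thus ?thesis by (rule T_img[OF j0(1) _ s on(1)])
  next
   assume "y' : Ph j ` cylinder" from T_img[OF j0(1) this s on(2)] show ?thesis unfolding eq .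
  qed
  note j = j0(1) this
  have img: "z : Ph j ` cylinder" if z: "T s z : Ph j ` cylinder" and oz: "on z" for z
  proof (cases rule: collar_cases[of J z Ph])
   case 1
   thus ?thesis using T_out[of z s] z by simp
  next
   case (2 i x)
   hence i: "z : Ph i ` cylinder" by blast
   thus ?thesis using disj_cylD[OF disj 2(1) j(1) T_img[OF 2(1) i s oz] z] by simp
  qed
  obtain x where x: "x : cylinder" "y = Ph j x" using img[OF j(2) on(1)] by blast
  obtain x' where x': "x' : cylinder" "y' = Ph j x'" using img[of y', OF _ on(2)] j(2) unfolding eq by blast
  have "Ph j (H s j x) = Ph j (H s j x')" using eq T_in[OF j(1)] x x' by simp
  hence "H s j x = H s j x'"
   by (rule inj_onD[OF collar3D(7)[OF C[OF j(1)]]]) (intro cyl s j x x' on[unfolded x(2) x'(2)])+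
  hence "x = x'" by (rule inj[OF s j(1) x(1) x'(1) on[unfolded x(2) x'(2)]])
  thus ?thesis using x x' by simp
 qed
 have local: "EX N. open N & t0 : N & C1_fam_on N (%s t. T s ((K ! i) t)) & (ALL s:{0..1}. ALL t:N. vd (%t. T s ((K ! i) t)) t ~= 0)"
  if i: "i < length K" for i t0
 proof -
  define ga where "ga = K ! i"
  have ga: "closed_C1 ga" "!!t. vd ga t ~= 0" unfolding ga_def using embedded_C1[OF K i] embedded_vd[OF K i] by auto
  have op: "open (ga -` U)" if "open U" for U
   using continuous_on_open_vimage[of UNIV ga] closed_C1_cont[OF ga(1), of UNIV] that by auto
  have clo: "closed (UN j:J'. Ph j ` cylinder)" if "J' <= J" for J'
   using that J collar3D(6)[OF C] finite_subset[OF that J] by (intro closed_UN) (auto intro: compact_imp_closed)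
  show ?thesis
  proof (cases "EX j:J. ga t0 : Ph j ` cylinder")
   case False
   define N where "N = ga -` (- (UN j:J. Ph j ` cylinder))"
   have N: "open N" "t0 : N" unfolding N_def using op[OF open_Compl[OF clo[OF order_refl]]] False by auto
   have eq: "T s (ga t) = ga t" if "t : N" for s t using that unfolding N_def by (intro T_out) auto
   have "vd (%t. T s (ga t)) t = vd ga t" if "t : N" for s t
    by (rule vd_eqI, rule has_vd_transform[OF closed_C1_has_vd[OF ga(1)] N(1) that])
     (simp add: eq)
   thus ?thesis using N C1_fam_on_cong[OF C1_fam_on_const[OF ga(1)] N(1), of "%s t. T s (ga t)"] eq ga(2)
    unfolding ga_def[symmetric] by (intro exI[of _ N]) auto
  next
   case True
   then obtain j where j: "j : J" "ga t0 : Ph j ` cylinder" by metis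
   note Cj = collar3D[OF C[OF j(1)]]
   define V where "V = W j Int ball 0 1 \<times> UNIV"
   have V: "open V" "V <= W j" unfolding V_def using Cj(1) by (auto intro!: open_Int open_Times)
   have opV: "open (Ph j ` V)"
    by (rule C1_inverse(1)) (use V Cj C1_on_subset inj_on_subset in blast)+
   define U where "U = Ph j ` V - (UN i:J - {j}. Ph i ` cylinder)"
   have opU: "open U" unfolding U_def using opV clo[of "J - {j}"] by (auto intro: open_Diff)
   define N where "N = ga -` U"
   have N: "open N" unfolding N_def by (rule op[OF opU])
   have t0N: "t0 : N"
   proof -
    obtain x where x: "x : cylinder" "ga t0 = Ph j x" using j(2) by blast
    have "fst x ~: sphere 0 1" using avoid[OF i j(1), of t0] x unfolding ga_def by (cases x) auto
    hence "x : V" unfolding V_def using x Cj(2) by (cases x) auto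
    moreover have "ga t0 ~: Ph k ` cylinder" if "k : J - {j}" for k
     using disj_cylD[OF disj j(1) _ j(2)] that by blast
    ultimately show ?thesis unfolding N_def U_def using x by auto
   qed
   obtain q where q: "!!t. t : N ==> q t : W j & Ph j (q t) = ga t" "C1_fam_on N (%_. q)"
     "!!t. t : N ==> dd (Ph j) (q t) (vd q t) = vd ga t"
    by (rule collar_coordinates[OF C[OF j(1)] ga(1) N]) (use V(2) in "auto simp: N_def U_def")
   have qV: "q t : V" if tN: "t : N" for t
   proof -
    obtain x where "x : V" "ga t = Ph j x" using tN unfolding N_def U_def by blast
    thus ?thesis using q(1)[OF tN] Cj(4) V(2) unfolding inj_on_def by (metis subsetD)
   qed
   have onq: "on (Ph j (q t))" and nq: "norm (fst (q t)) < 1" if tN: "t : N" for t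
    using q(1)[OF tN] i qV[OF tN] unfolding on_def ga_def V_def by (auto simp: mem_Times_iff)
   have HW: "H s j (q t) : W j" if st: "s : {0..1}" "t : N" for s t
   proof (cases "abs(snd (q t)) >= 1")
    case True
    thus ?thesis unfolding ends[OF j(1) True] using q(1)[OF st(2)] by simp
   next
    case False
    hence "q t : cylinder" using nq[OF st(2)] by (auto simp: mem_Times_iff)
    thus ?thesis by (rule subsetD[OF Cj(2) cyl[OF st(1) j(1) _ onq[OF st(2)]]])
   qed
   have eq: "T s (ga t) = Ph j (H s j (q t))" if st: "s : {0..1}" "t : N" for s t
   proof (cases "q t : cylinder")
    case True
    thus ?thesis using T_in[OF j(1) True] q(1)[OF st(2)] by simp
   next
    case False
    hence ge: "abs(snd (q t)) >= 1" using nq[OF st(2)] by (auto simp: mem_Times_iff)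
    have "ga t ~: Ph k ` cylinder" if k: "k : J" for k
    proof (cases "k = j")
     case True
     show ?thesis
     proof
      assume "ga t : Ph k ` cylinder"
      then obtain x where x: "x : cylinder" "Ph j (q t) = Ph j x" using q(1)[OF st(2)] True by auto
      have "q t = x" by (rule inj_onD[OF Cj(4) x(2)]) (use q(1)[OF st(2)] Cj(2) x(1) in auto)
      thus False using x(1) `q t ~: cylinder` by simp
     qed
    next
     case False
     thus ?thesis using st(2) k unfolding N_def U_def by auto
    qed
    hence "T s (ga t) = ga t" by (rule T_out)
    thus ?thesis unfolding ends[OF j(1) ge] using q(1)[OF st(2)] by simp
   qed
   note Hfam = fam[OF j(1) q(2)]
   have PH: "C1_fam_on N (%s t. Ph j (H s j (q t)))"
    "!!s t. s : {0..1} ==> t : N ==> vd (%t. Ph j (H s j (q t))) t = dd (Ph j) (H s j (q t)) (vd (%t. H s j (q t)) t)"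
    by (rule C1_fam_on_compose(1)[OF Hfam Cj(1) Cj(3) HW]; assumption)
     (rule C1_fam_on_compose(2)[OF Hfam Cj(1) Cj(3) HW]; assumption)
   have "C1_fam_on N (%s t. T s (ga t))" by (rule C1_fam_on_cong[OF PH(1) N eq]; assumption)
   moreover have "vd (%t. T s (ga t)) t ~= 0" if "s : {0..1}" "t : N" for s t
   proof
    assume z: "vd (%t. T s (ga t)) t = 0"
    have "vd (%t. T s (ga t)) t = dd (Ph j) (H s j (q t)) (vd (%t. H s j (q t)) t)"
     unfolding PH(2)[OF that, symmetric]
     by (rule vd_eqI, rule has_vd_transform[OF C1_fam_onD(1)[OF PH(1) that] N that(2)])
      (rule eq[OF that(1), symmetric])
    hence "vd (%t. H s j (q t)) t = 0"
     using z Cj(5)[OF HW[OF that]] unfolding inj_on_def by (metis UNIV_I blinfun.zero_right)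
    hence "vd ga t = 0" using vd[OF j(1) N q(2) conjI[OF nq onq] that] q(3)[OF that(2)] by (simp add: blinfun.bilinear_simps)
    thus False using ga(2) by blast
   qed
   ultimately show ?thesis using N t0N unfolding ga_def by blast
  qed
 qed
 have fam: "C1_family (%s. G s ! i)" if i: "i < length K" for i
 proof -
  have "C1_family (%s t. T s ((K ! i) t))"
  proof (rule C1_family_local)
   show "EX N. open N & t0 : N & C1_fam_on N (%s t. T s ((K ! i) t))" for t0 using local[OF i, of t0] by blast
   show "T s ((K ! i) (t + 1)) = T s ((K ! i) t)" for s t using embedded_C1[OF K i] unfolding closed_C1_def by simp
  qed
  thus ?thesis unfolding G_def using i by simp
 qed
 have emb: "embedded (G s)" if s: "s : {0..1}" for s
 proof (rule embedded_over[OF K])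
  show "closed_C1 (G s ! i)" if "i < length K" for i using fam[OF that] s unfolding C1_family_def by auto
  show "vd (G s ! i) t ~= 0" if "i < length K" for i t using local[OF that, of t] that s unfolding G_def by auto
  show "(K ! i) u = (K ! j) v" if "i < length K" "j < length K" "(G s ! i) u = (G s ! j) v" for i j u v
   using T_inj[OF _ s, of "(K ! i) u" "(K ! j) v"] that unfolding G_def on_def by auto
 qed (simp add: G_def)
 have "f (st (G 0)) = f (st (G 1))"
  by (rule invariant_C1_family_R3[OF f _ fam emb]) (auto simp: G_def)
 thus "f (st (curve_map (collar_move J Ph (H 0)) K)) = f (st (curve_map (collar_move J Ph (H 1)) K))"
  unfolding G_def T_def .
 show "embedded (curve_map (collar_move J Ph (H s)) K)" if "s : {0..1}"
  using emb[OF that] unfolding G_def T_def .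
qed

text \<open>The logarithms form a convex set, so two profiles with the same ends are joined by a segment.\<close>
theorem collar_mult_invariant:
 assumes f: "link_invariant f" and K: "embedded K" and J: "finite J"
  and C: "!!j. j : J ==> collar3 (Ph j) (W j)"
  and disj: "disj_cyl Ph J"
  and avoid: "!!i j t. i < length K ==> j : J ==> (K ! i) t ~: Ph j ` lateral"
  and w: "!!j. j : J ==> log_profile (w0 j)" "!!j. j : J ==> log_profile (w1 j)"
  and ends: "!!j t. j : J ==> abs t >= 1 ==> w0 j t = w1 j t"
 shows "f (st (curve_map (exp_mult J Ph w0) K)) = f (st (curve_map (exp_mult J Ph w1) K))"
  and "embedded (curve_map (exp_mult J Ph w0) K)"
proof -
 define \<mu> where "\<mu> = (%s j t. exp (w0 j t + s *R (w1 j t - w0 j t)))"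
 define H where "H = (%s j x. (\<mu> s j (snd x) * fst x, snd x) :: R3)"
 have mu0: "\<mu> 0 = (%j t. exp (w0 j t))" and mu1: "\<mu> 1 = (%j t. exp (w1 j t))" unfolding \<mu>_def by auto
 have mu_nz: "\<mu> s j t ~= 0" for s j t unfolding \<mu>_def by simp
 have mu_le: "norm (\<mu> s j t) <= 1" if "s : {0..1}" "j : J" for s j t
 proof -
  have "Re (w0 j t) <= 0" "Re (w1 j t) <= 0" using w that(2) unfolding log_profile_def by auto
  hence "(1 - s) * Re (w0 j t) + s * Re (w1 j t) <= 0" using that(1) by (intro add_nonpos_nonpos mult_nonneg_nonpos) auto
  thus ?thesis unfolding \<mu>_def by (simp add: algebra_simps)
 qed
 have mu_end: "\<mu> s j t = 1" if "j : J" "abs t >= 1" for s j t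
  using ends[OF that] w(1)[OF that(1)] that(2) unfolding \<mu>_def log_profile_def by auto
 define on where "on = (%y. on_sys K y)"
 have fam: "C1_fam_on N (%s t. H s j (q t))" and vd: "!!s t. s : {0..1} ==> t : N ==> vd (%t. H s j (q t)) t = 0 ==> vd q t = 0"
  if j: "j : J" and q: "C1_fam_on N (%_. q)" for j N q
 proof -
  define wl where "wl = (%s t. w0 j (snd (q t)) + s *R (w1 j (snd (q t)) - w0 j (snd (q t))))"
   have C1w: "C1_on UNIV (w0 j)" "C1_on UNIV (w1 j)" using w j unfolding log_profile_def by auto
   note qs = C1_fam_on_snd[OF q] and qf = C1_fam_on_fst[OF q]
   have wl: "C1_fam_on N wl" unfolding wl_def
    by (intro C1_fam_on_linear C1_fam_on_compose(1)[OF qs(1) open_UNIV C1w(1)] C1_fam_on_compose(1)[OF qs(1) open_UNIV C1w(2)]) auto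
   have vdwl: "EX c. vd (wl s) t = snd (vd q t) *R c" if st: "s : {0..1}" "t : N" for s t
   proof -
    have h: "((%t. w j (snd (q t))) has_vd snd (vd q t) *R dd (w j) (snd (q t)) 1) (at t)"
     if "C1_on UNIV (w j)" for w :: "nat => real => complex"
    proof -
     have "vd (%t. w j (snd (q t))) t = dd (w j) (snd (q t)) (snd (vd q t) *R 1)"
      using C1_fam_on_compose(2)[OF qs(1) open_UNIV that, of s t] qs(2)[OF st] st by simp
     also have "... = snd (vd q t) *R dd (w j) (snd (q t)) 1" by (rule blinfun.scaleR_right)
     finally show ?thesis using C1_fam_onD(1)[OF C1_fam_on_compose(1)[OF qs(1) open_UNIV that] st] by simp
    qed
    have "(wl s has_vd snd (vd q t) *R dd (w0 j) (snd (q t)) 1 + s *R (snd (vd q t) *R dd (w1 j) (snd (q t)) 1 - snd (vd q t) *R dd (w0 j) (snd (q t)) 1)) (at t)"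
     unfolding wl_def
     by (intro has_vd_add has_vd_diff h C1w bl_has_vd[OF bounded_linear_scaleR_right])
    from vd_eqI[OF this] show ?thesis
     by (intro exI[of _ "dd (w0 j) (snd (q t)) 1 + s *R (dd (w1 j) (snd (q t)) 1 - dd (w0 j) (snd (q t)) 1)"]) (simp add: algebra_simps)
   qed
   have mu_wl: "\<mu> s j (snd (q t)) = exp (wl s t)" for s t unfolding \<mu>_def wl_def by simp
   note ex = C1_fam_on_compose[OF wl open_UNIV C1_on_exp UNIV_I]
   show "C1_fam_on N (%s t. H s j (q t))" unfolding H_def mu_wl
    by (intro C1_fam_on_Pair(1) C1_fam_on_mult(1) qs qf ex)
   show "vd q t = 0" if st: "s : {0..1}" "t : N" and h: "vd (%t. H s j (q t)) t = 0" for s t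
   proof -
    have "vd (%t. H s j (q t)) t = (exp (wl s t) * fst (vd q t) + dd exp (wl s t) (vd (wl s) t) * fst (q t), snd (vd q t))"
     unfolding H_def mu_wl
     using C1_fam_on_Pair(2)[OF C1_fam_on_mult(1)[OF ex(1) qf(1)] qs(1) st]
      C1_fam_on_mult(2)[OF ex(1) qf(1) st] ex(2)[OF st] qs(2)[OF st] qf(2)[OF st] by simp
    with h have e: "exp (wl s t) * fst (vd q t) + dd exp (wl s t) (vd (wl s) t) * fst (q t) = 0" "snd (vd q t) = 0"
     by (auto simp: zero_prod_def)
    hence "vd (wl s) t = 0" using vdwl[OF st] by auto
    hence "fst (vd q t) = 0" using e(1) by (simp add: blinfun.bilinear_simps)
    thus "vd q t = 0" using e(2) by (simp add: prod_eq_iff)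
   qed
 qed
 note M = collar_move_invariant[OF f K J C disj avoid, of H, folded on_def]
 have inj: "x = x'" if "s : {0..1}" "j : J" "H s j x = H s j x'" for s j and x x' :: "R3"
  using that(3) mu_nz unfolding H_def by (cases x; cases x') auto
 have ends': "H s j x = x" if "j : J" "abs(snd x) >= 1" for s j and x :: "R3"
  unfolding H_def mu_end[OF that] by simp
 have cm: "collar_mult J Ph (\<mu> s) = collar_move J Ph (H s)" for s unfolding collar_mult_def H_def ..
 have cyl: "H s j x : cylinder" if "s : {0..1}" "j : J" "x : cylinder" for s j x
  unfolding H_def by (rule cyl_mult[OF that(3) mu_le[OF that(1,2)]])
 show "f (st (curve_map (exp_mult J Ph w0) K)) = f (st (curve_map (exp_mult J Ph w1) K))"
  unfolding mu0[symmetric] mu1[symmetric] cm by (rule M(1)) (assumption | rule cyl ends'; assumption | rule inj; assumption | rule fam; assumption | rule vd; assumption)+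
 show "embedded (curve_map (exp_mult J Ph w0) K)"
  unfolding mu0[symmetric] cm by (rule M(2)) (assumption | rule cyl ends'; assumption | rule inj; assumption | rule fam; assumption | rule vd; assumption | simp)+
qed

section \<open>Dehn twists and orientations\<close>

definition ang :: "real => real" where "ang t = 2 * pi * stepf ((t + 1) / 2)"

abbreviation (input) "twists n S Ph == collar_mult S Ph (%_ t. cis (of_nat n * ang t))"

lemma ang_inside: "abs t <= 1 ==> ang t = 2 * pi * ((2 + 3 * t - t ^ 3) / 4)"
proof -
 assume t: "abs t <= 1"
 have c: "3 * ((t + 1) / 2)^2 - 2 * ((t + 1) / 2) ^ 3 = (2 + 3 * t - t ^ 3) / 4"
  by (simp add: field_simps power2_eq_square power3_eq_cube)
 have "stepf ((t + 1) / 2) = 3 * ((t + 1) / 2)^2 - 2 * ((t + 1) / 2) ^ 3"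
 proof -
  consider "t = -1" | "t = 1" | "-1 < t" "t < 1" using t by linarith
  thus ?thesis by cases (auto simp: stepf_def)
 qed
 thus ?thesis unfolding ang_def c by simp
qed

lemma ang_outside: "t <= -1 ==> ang t = 0" "t >= 1 ==> ang t = 2 * pi"
 unfolding ang_def stepf_def by auto

lemma has_vd_ang: "(ang has_vd 2 * pi * (stepf' ((t + 1) / 2) / 2)) (at t)"
 unfolding ang_def[abs_def] real_has_vd[symmetric]
 by (auto intro!: dintros DERIV_chain2[OF DERIV_stepf])

lemma continuous_on_ang': "continuous_on S (%t. 2 * pi * (stepf' ((t + 1) / 2) / 2))"
 by (intro cintros cont_comp[OF continuous_on_stepf'[of UNIV]]) auto

lemma log_profile_twist: "log_profile (%t. \<i> * of_real (of_nat n * ang t))"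
proof -
 have d: "((%t. \<i> * of_real (of_nat n * ang t)) has_vd
   \<i> * of_real (of_nat n * (2 * pi * (stepf' ((t + 1) / 2) / 2)))) (at t)" for t
  by (intro has_vector_derivative_mult_right has_vector_derivative_of_real
    DERIV_cmult[OF has_vd_ang[unfolded real_has_vd[symmetric]]])
 have "C1_on UNIV (%t. \<i> * of_real (of_nat n * ang t))"
  by (rule C1_on_real(1)[OF open_UNIV d]) (intro cintros continuous_on_ang')
 moreover have "exp (\<i> * of_real (of_nat n * ang t)) = 1" if "abs t >= 1" for t
 proof -
  have "ang t = 0 | ang t = 2 * pi" using that ang_outside[of t] by linarith
  hence "EX k::nat. \<i> * of_real (of_nat n * ang t) = of_nat k * (2 * of_real pi * \<i>)"
  proof
   assume "ang t = 0" thus ?thesis by (intro exI[of _ 0]) simp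
  next
   assume "ang t = 2 * pi" thus ?thesis by (intro exI[of _ n]) simp
  qed
  then obtain k :: nat where "\<i> * of_real (of_nat n * ang t) = of_nat k * (2 * of_real pi * \<i>)" by blast
  thus ?thesis by (simp only: exp_of_nat_mult exp_two_pi_i power_one)
 qed
 ultimately show ?thesis unfolding log_profile_def by auto
qed

lemma log_profile_zero: "log_profile (%t. 0)"
 unfolding log_profile_def by (auto intro!: C1_on_real(1)[where g' = "%_. 0"])

lemma dehn_twist_in:
 assumes "inj_on Ph cylinder" "x : cylinder"
 shows "dehn_twist Ph (Ph x) = Ph (cis (ang (snd x)) * fst x, snd x)"
proof -
 have "inv_into cylinder Ph (Ph x) = x" using assms by (intro inv_into_f_f)
 moreover have "Ph x : Ph ` cylinder" using assms by blast
 moreover have "ang (snd x) = 2 * pi * ((2 + 3 * snd x - snd x ^ 3) / 4)" using assms(2) by (intro ang_inside) (auto simp: mem_Times_iff)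
 ultimately show ?thesis unfolding dehn_twist_def by (simp only: case_prod_unfold if_True)
qed

lemma dehn_twist_out: "y ~: Ph ` cylinder ==> dehn_twist Ph y = y"
 unfolding dehn_twist_def by simp

lemma dehn_twist_pow_in:
 assumes "inj_on Ph cylinder" "x : cylinder"
 shows "(dehn_twist Ph ^^ n) (Ph x) = Ph (cis (of_nat n * ang (snd x)) * fst x, snd x)"
proof (induction n)
 case (Suc n)
 have c: "(cis (of_nat n * ang (snd x)) * fst x, snd x) : cylinder" by (rule cyl_mult[OF assms(2)]) simp
 show ?case unfolding funpow.simps comp_def Suc dehn_twist_in[OF assms(1) c]
  by (simp add: mult.assoc[symmetric] cis_mult) (simp add: algebra_simps)
qed simp

lemma dehn_twist_pow_out: "y ~: Ph ` cylinder ==> (dehn_twist Ph ^^ n) y = y"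
 by (induction n) (auto simp: dehn_twist_out)

text \<open>Moves in disjoint collars do not interact, so their composition is one simultaneous move.\<close>
lemma t_moves_eq:
 assumes S: "finite S" and disj: "disj_cyl Ph S"
  and inj: "!!j. j : S ==> inj_on (Ph j) cylinder"
 shows "t_moves n Ph S L = curve_map (twists n S Ph) L"
proof -
 define T where "T = (%xs y. fold (%j. dehn_twist (Ph j) ^^ n) xs y)"
 have fold_eq: "fold (%j. t_move n (Ph j)) xs L = curve_map (T xs) L" for xs and L
 proof (induction xs arbitrary: L)
  case (Cons a xs)
  show ?case unfolding fold_simps(2) Cons unfolding T_def curve_map_def t_move_def by (simp add: comp_def)
 qed (simp add: T_def curve_map_def)
 have out: "T xs y = y" if "!!j. j : set xs ==> y ~: Ph j ` cylinder" for xs y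
  using that
 proof (induction xs)
  case (Cons a xs)
  have "(dehn_twist (Ph a) ^^ n) y = y" by (rule dehn_twist_pow_out) (use Cons.prems in simp)
  moreover have "T xs y = y" by (rule Cons.IH) (use Cons.prems in simp)
  ultimately show ?case unfolding T_def by simp
 qed (simp add: T_def)
 have sep: "Ph j x ~: Ph k ` cylinder" if "j : S" "k : S" "j ~= k" "x : cylinder" for j k x
  using disj_cylD[OF disj that(1,2) imageI[OF that(4)]] that(3) by blast
 have inn: "T xs (Ph j x) = Ph j (cis (of_nat n * ang (snd x)) * fst x, snd x)"
  if "set xs <= S" "distinct xs" "j : set xs" "x : cylinder" for xs j x
  using that
 proof (induction xs)
  case (Cons a xs)
  have jS: "j : S" and aS: "a : S" using Cons.prems by auto
  let ?x' = "(cis (of_nat n * ang (snd x)) * fst x, snd x)"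
  have x': "?x' : cylinder" by (rule cyl_mult[OF Cons.prems(4)]) simp
  show ?case
  proof (cases "a = j")
   case True
   have "T (a # xs) (Ph j x) = T xs (Ph j ?x')" unfolding T_def using True dehn_twist_pow_in[OF inj[OF jS] Cons.prems(4)] by simp
   also have "... = Ph j ?x'"
   proof (rule out)
    fix k assume "k : set xs"
    thus "Ph j ?x' ~: Ph k ` cylinder" using Cons.prems True by (intro sep[OF jS _ _ x']) auto
   qed
   finally show ?thesis .
  next
   case False
   have "(dehn_twist (Ph a) ^^ n) (Ph j x) = Ph j x" by (rule dehn_twist_pow_out, rule sep[OF jS aS _ Cons.prems(4)]) (use False in simp)
   hence "T (a # xs) (Ph j x) = T xs (Ph j x)" unfolding T_def by simp
   also have "... = Ph j ?x'" by (rule Cons.IH) (use Cons.prems False in auto)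
   finally show ?thesis .
  qed
 qed simp
 have "T (sorted_list_of_set S) y = twists n S Ph y" for y
 proof (cases rule: collar_cases[of S y Ph])
  case 1
  thus ?thesis using out[of "sorted_list_of_set S" y] collar_mult_out[of S y Ph, OF 1] S by simp
 next
  case j: (2 j x)
  show ?thesis unfolding j(3) collar_mult_in[OF disj inj[OF j(1)] j(1,2)]
   by (rule inn) (use S j in auto)
 qed
 hence "T (sorted_list_of_set S) = twists n S Ph" by (rule ext)
 thus ?thesis unfolding t_moves_def fold_eq by simp
qed

lemma collar_mult_transfer:
 assumes disj: "disj_cyl Ph J" and inj: "!!j. j : J ==> inj_on (Ph j) cylinder"
  and g: "inj g" and Ps: "!!j x. j : J ==> x : cylinder ==> Ps j x = g (Ph j x)"
  and \<mu>: "!!j t. j : J ==> norm (\<mu> j t) <= 1"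
 shows "collar_mult J Ps \<mu> (g y) = g (collar_mult J Ph \<mu> y)"
proof -
 have im: "Ps j ` cylinder = g ` (Ph j ` cylinder)" if "j : J" for j
  unfolding image_image by (rule image_cong) (use Ps that in auto)
 have disj': "disj_cyl Ps J" by (rule disj_cyl_image[OF g Ps disj])
 have inj': "inj_on (Ps j) cylinder" if "j : J" for j
 proof (rule inj_onI)
  fix x y assume xy: "x : cylinder" "y : cylinder" "Ps j x = Ps j y"
  hence "Ph j x = Ph j y" using g Ps[OF that] by (metis injD)
  thus "x = y" by (rule inj_onD[OF inj[OF that] _ xy(1,2)])
 qed
 show ?thesis
 proof (cases rule: collar_cases[of J y Ph])
  case nin: 1
  hence "!!j. j : J ==> g y ~: Ps j ` cylinder" by (simp add: im inj_image_mem_iff[OF g])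
  thus ?thesis using collar_mult_out[of J y Ph, OF nin] collar_mult_out[of J "g y" Ps] by simp
 next
  case j: (2 j x)
  have "(\<mu> j (snd x) * fst x, snd x) : cylinder" by (rule cyl_mult[OF j(2) \<mu>[OF j(1)]])
  thus ?thesis unfolding j(3) collar_mult_in[OF disj inj[OF j(1)] j(1,2)] Ps[OF j(1,2), symmetric]
   collar_mult_in[OF disj' inj'[OF j(1)] j(1,2)] by (rule Ps[OF j(1)])
 qed
qed

lemma collar_mult_extend:
 assumes disj: "disj_cyl Ph J" and inj: "!!j. j : J ==> inj_on (Ph j) cylinder"
  and S: "S <= J"
 shows "collar_mult S Ph \<mu> = collar_mult J Ph (%j t. if j : S then \<mu> j t else 1)"
proof
 fix y
 have disjS: "disj_cyl Ph S" by (rule disj_cyl_mono[OF disj S])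
 show "collar_mult S Ph \<mu> y = collar_mult J Ph (%j t. if j : S then \<mu> j t else 1) y"
 proof (cases rule: collar_cases[of J y Ph])
  case nin: 1
  have ninS: "!!j. j : S ==> y ~: Ph j ` cylinder" by (rule nin[OF subsetD[OF S]])
  show ?thesis by (rule trans[OF collar_mult_out collar_mult_out[symmetric]]) (erule ninS, erule nin)
 next
  case j: (2 j x)
  show ?thesis
  proof (cases "j : S")
   case True
   thus ?thesis unfolding j(3) using collar_mult_in[OF disj inj[OF j(1)] j(1,2)] collar_mult_in[OF disjS inj[OF j(1)] True j(2)] by simp
  next
   case False
   have "y ~: Ph k ` cylinder" if "k : S" for k
    using disj_cylD[OF disj j(1) subsetD[OF S that] _] that False j(2,3) by blast
   hence "collar_mult S Ph \<mu> y = y" by (rule collar_mult_out)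
   thus ?thesis unfolding j(3) using collar_mult_in[OF disj inj[OF j(1)] j(1,2)] False by simp
  qed
 qed
qed

definition twist_log :: "nat => nat set => nat => real => complex" where
 "twist_log n S j t = (if j : S then \<i> * of_real (of_nat n * ang t) else 0)"

lemma log_profile_twist_log: "log_profile (twist_log n S j)"
 unfolding twist_log_def[abs_def] by (cases "j : S") (simp_all add: log_profile_twist log_profile_zero del: of_real_mult)

lemma twists_eq_exp_mult:
 assumes "disj_cyl Ph J" "!!j. j : J ==> inj_on (Ph j) cylinder" "S <= J"
 shows "twists n S Ph = exp_mult J Ph (twist_log n S)"
proof -
 have "(%j t. if j : S then cis (of_nat n * ang t) else 1) = (%j t. exp (twist_log n S j t))"
  unfolding twist_log_def by (intro ext) (simp add: cis_conv_exp)
 thus ?thesis using collar_mult_extend[OF assms, of "%_ t. cis (of_nat n * ang t)"] by simp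
qed

lemma embedded_twists:
 assumes "link_invariant f" and K: "embedded K" and J: "finite J" and C: "!!j. j : J ==> collar3 (Ph j) (W j)"
  and disj: "disj_cyl Ph J" and avoid: "!!i j t. i < length K ==> j : J ==> (K ! i) t ~: Ph j ` lateral" and S: "S <= J"
 shows "embedded (curve_map (twists n S Ph) K)"
proof -
 have "twists n S Ph = exp_mult J Ph (twist_log n S)" by (rule twists_eq_exp_mult[OF disj collar3D(7)[OF C] S])
 moreover have "embedded (curve_map (exp_mult J Ph (twist_log n S)) K)"
  by (rule collar_mult_invariant(2)[OF assms(1-3) C disj avoid log_profile_twist_log log_profile_twist_log refl])
 ultimately show ?thesis by simp
qed

abbreviation (input) "twisted n S Ph K == st (curve_map (twists n S Ph) K)"

lemma det_4:
 fixes A :: "'a::comm_ring_1^4^4"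
 shows "det A =
  A$1$1 * (A$2$2 * (A$3$3 * A$4$4 - A$3$4 * A$4$3) - A$2$3 * (A$3$2 * A$4$4 - A$3$4 * A$4$2) + A$2$4 * (A$3$2 * A$4$3 - A$3$3 * A$4$2))
 - A$1$2 * (A$2$1 * (A$3$3 * A$4$4 - A$3$4 * A$4$3) - A$2$3 * (A$3$1 * A$4$4 - A$3$4 * A$4$1) + A$2$4 * (A$3$1 * A$4$3 - A$3$3 * A$4$1))
 + A$1$3 * (A$2$1 * (A$3$2 * A$4$4 - A$3$4 * A$4$2) - A$2$2 * (A$3$1 * A$4$4 - A$3$4 * A$4$1) + A$2$4 * (A$3$1 * A$4$2 - A$3$2 * A$4$1))
 - A$1$4 * (A$2$1 * (A$3$2 * A$4$3 - A$3$3 * A$4$2) - A$2$2 * (A$3$1 * A$4$3 - A$3$3 * A$4$1) + A$2$3 * (A$3$1 * A$4$2 - A$3$2 * A$4$1))"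
proof -
 have f1234: "finite {2::4, 3, 4}" "1 ~: {2::4, 3, 4}" by auto
 have f234: "finite {3::4, 4}" "2 ~: {3::4, 4}" by auto
 have f34: "finite {4::4}" "3 ~: {4::4}" by auto
 show ?thesis
  unfolding det_def UNIV_4 sum_over_permutations_insert[OF f1234] sum_over_permutations_insert[OF f234] sum_over_permutations_insert[OF f34]
   permutes_sing
  by (simp add: sign_swap_id permutation_swap_id permutation_compose sign_compose sign_id swap_id_eq algebra_simps)
qed

definition det3 :: "R3 => R3 => R3 => real" where
 "det3 a b c = Re (fst a) * (Im (fst b) * snd c - snd b * Im (fst c))
  - Im (fst a) * (Re (fst b) * snd c - snd b * Re (fst c)) + snd a * (Re (fst b) * Im (fst c) - Im (fst b) * Re (fst c))"

lemma dd_stereo: "dd stereo p v = (2 / (p \<bullet> p + 1)) *R emb3 v + (- ((2 / (p \<bullet> p + 1))^2 * (p \<bullet> v))) *R (emb3 p - pole)"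
 unfolding dd_eqI[OF has_derivative_stereo] by (simp add: power_divide)

text \<open>Inverse stereographic projection is conformal and preserves the orientations used here.\<close>
lemma det_stereo_frame:
 "det (vector [stereo p, dd stereo p u, dd stereo p v, dd stereo p w] :: real^4^4) = (2 / (p \<bullet> p + 1)) ^ 3 * det3 u v w"
proof -
 obtain p1 p2 p3 where p: "p = (Complex p1 p2, p3)" by (metis complex.collapse surj_pair)
 obtain u1 u2 u3 where u: "u = (Complex u1 u2, u3)" by (metis complex.collapse surj_pair)
 obtain v1 v2 v3 where v: "v = (Complex v1 v2, v3)" by (metis complex.collapse surj_pair)
 obtain w1 w2 w3 where w: "w = (Complex w1 w2, w3)" by (metis complex.collapse surj_pair)
 define c where "c = 2 / (p \<bullet> p + 1)"
 have cc: "c * (p1 * p1 + p2 * p2 + p3 * p3 + 1) = 2"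
 proof -
  have "p \<bullet> p + 1 ~= 0" using inner_plus_one_pos[of p] by simp
  hence "c * (p \<bullet> p + 1) = 2" unfolding c_def by (metis nonzero_eq_divide_eq)
  thus ?thesis unfolding p by (simp add: inner_prod_def inner_complex_def)
 qed
 have st: "stereo p = vector [c * p1, c * p2, c * p3, 1 - c]"
  unfolding stereo_eq c_def[symmetric] by (simp add: vec4_eq_iff emb3_def pole_def p)
 have D: "dd stereo p (Complex a b, d) = vector [c * a - c^2 * s * p1, c * b - c^2 * s * p2, c * d - c^2 * s * p3, c^2 * s]"
  if "s = p1 * a + p2 * b + p3 * d" for a b d s
 proof -
  have "p \<bullet> (Complex a b, d) = s" unfolding p that by (simp add: inner_prod_def inner_complex_def)
  thus ?thesis unfolding dd_stereo c_def[symmetric] by (simp add: vec4_eq_iff emb3_def pole_def p)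
 qed
 define su where "su = p1 * u1 + p2 * u2 + p3 * u3"
 define sv where "sv = p1 * v1 + p2 * v2 + p3 * v3"
 define sw where "sw = p1 * w1 + p2 * w2 + p3 * w3"
 define d where "d = (%a1 a2 a3 b1 b2 b3 c1 c2 c3 :: real. a1 * (b2 * c3 - b3 * c2) - a2 * (b1 * c3 - b3 * c1) + a3 * (b1 * c2 - b2 * c1))"
 have d3: "det3 u v w = d u1 u2 u3 v1 v2 v3 w1 w2 w3" unfolding det3_def d_def u v w by simp
 have cram: "su * d p1 p2 p3 v1 v2 v3 w1 w2 w3 + sv * d u1 u2 u3 p1 p2 p3 w1 w2 w3 + sw * d u1 u2 u3 v1 v2 v3 p1 p2 p3
   = (p1 * p1 + p2 * p2 + p3 * p3) * d u1 u2 u3 v1 v2 v3 w1 w2 w3"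
  unfolding su_def sv_def sw_def d_def by (simp add: algebra_simps)
 have "det (vector [stereo p, dd stereo p u, dd stereo p v, dd stereo p w] :: real^4^4) =
   c ^ 3 * (- (1 - c) * d u1 u2 u3 v1 v2 v3 w1 w2 w3 + c * (su * d p1 p2 p3 v1 v2 v3 w1 w2 w3 + sv * d u1 u2 u3 p1 p2 p3 w1 w2 w3 + sw * d u1 u2 u3 v1 v2 v3 p1 p2 p3))"
  unfolding st u v w D[OF su_def] D[OF sv_def] D[OF sw_def] det_4 vec4_nth d_def
  by (simp add: algebra_simps power2_eq_square power3_eq_cube)
 also have "... = c ^ 3 * ((c * (p1 * p1 + p2 * p2 + p3 * p3 + 1) - 1) * d u1 u2 u3 v1 v2 v3 w1 w2 w3)"
  unfolding cram by (simp add: algebra_simps)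
 also have "... = c ^ 3 * det3 u v w" unfolding cc d3 by simp
 finally show ?thesis unfolding c_def .
qed

section \<open>The collar at a crossing\<close>

text \<open>The representative in \<open>[-1/2, 1/2]\<close> modulo \<open>1\<close>; its absolute value is the distance
on the circle.\<close>
definition rep :: "real => real" where "rep u = u - of_int (round u)"

abbreviation (input) "along P p u == (P ! fst p) (snd p + u)"
abbreviation (input) "vel P p u == vd (P ! fst p) (snd p + u)"
abbreviation (input) "off p u == rep (u - snd p)"

lemma rep_bound: "abs(rep u) <= 1/2"
 unfolding rep_def using of_int_round_abs_le[of u] by (simp add: abs_minus_commute)

lemma rep_le_abs: "abs(rep u) <= abs(u - of_int n)"
 unfolding rep_def using round_diff_minimal[of u n] by simp

lemma rep_triangle: "abs(rep (x + y)) <= abs(rep x) + abs(rep y)"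
proof -
 have "abs(rep (x + y)) <= abs(x + y - of_int (round x + round y))" by (rule rep_le_abs)
 also have "... <= abs(rep x) + abs(rep y)" unfolding rep_def by (simp only: of_int_add)
 finally show ?thesis .
qed

lemma rep_minus: "abs(rep (- x)) = abs(rep x)"
proof -
 have "abs(rep (- x)) <= abs(rep x)" for x
 proof -
  have "abs(rep (- x)) <= abs(- x - of_int (- round x))" by (rule rep_le_abs)
  also have "... = abs(rep x)" unfolding rep_def by simp
  finally show ?thesis .
 qed
 from this[of x] this[of "- x"] show ?thesis by simp
qed

lemma rep_unique: "abs(u - of_int n) < 1/2 ==> rep u = u - of_int n"
 unfolding rep_def using round_unique'[of u n] by simp

lemma rep_add_one: "rep (u + 1) = rep u"
proof -
 have "\<lfloor>u + 1 + 1 / 2\<rfloor> = \<lfloor>(u + 1 / 2) + of_int 1\<rfloor>" by (rule arg_cong[of _ _ floor]) simp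
 also have "... = \<lfloor>u + 1 / 2\<rfloor> + 1" by (rule floor_add_int[symmetric])
 finally show ?thesis unfolding rep_def round_def by simp
qed

lemma closed_C1_rep:
 assumes "closed_C1 ga" shows "ga (s + rep (u - s)) = ga u" "vd ga (s + rep (u - s)) = vd ga u"
 using closed_C1_of_int[OF assms, of u "- round (u - s)"] unfolding rep_def by (simp_all add: algebra_simps)

lemma rep_eq_0_params:
 assumes "u : {0..<1}" "s : {0..<1}" "rep (u - s) = 0" shows "u = s"
proof -
 have e: "u - s = of_int (round (u - s))" using assms(3) unfolding rep_def by simp
 have "abs(u - s) < 1" using assms by auto
 hence "round (u - s) = 0" using e by (smt (verit) of_int_less_iff of_int_1 of_int_minus)
 thus ?thesis using e by simp
qed

lemma closed_C1_periodize:
 fixes g :: "real => 'b::real_normed_vector"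
 assumes g: "!!t. (g has_vd g' t) (at t)" "continuous_on UNIV g'"
  and supp: "!!t. abs t >= r ==> g t = 0" and r: "r < 1/2"
 shows "closed_C1 (%u. g (rep (u - s)))"
proof -
 have "C1_family (%(_::real) u. g (rep (u - s)))"
 proof (rule C1_family_local)
  fix u0
  show "EX N. open N & u0 : N & C1_fam_on N (%(_::real) u. g (rep (u - s)))"
  proof (cases "abs(rep (u0 - s)) < 1/2")
   case True
   define n where "n = round (u0 - s)"
   define N where "N = {u. abs(u - s - of_int n) < 1/2}"
   have N: "open N" "u0 : N" unfolding N_def using True unfolding rep_def n_def
    by (auto intro!: open_Collect_less cintros)
   have "C1_fam_on N (%(_::real) u. g (u + (- s - of_int n)))"
   proof (rule C1_fam_onI[where F' = "%_ u. g' (u + (- s - of_int n))"])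
    show "((%u. g (u + (- s - of_int n))) has_vd g' (t + (- s - of_int n))) (at t)" for t
     by (rule has_vd_shift[OF g(1)])
    have cg: "continuous_on UNIV g" by (intro continuous_at_imp_continuous_on ballI has_vd_cont[OF g(1)])
    show "continuous_on ({0..1} \<times> N) (%(x, u). g (u + (- s - of_int n)))" "continuous_on ({0..1} \<times> N) (%(x, u). g' (u + (- s - of_int n)))"
     unfolding case_prod_unfold
     by (auto intro!: cont_comp[OF cg] cont_comp[OF g(2)] cintros)
   qed
   hence "C1_fam_on N (%(_::real) u. g (rep (u - s)))"
    by (rule C1_fam_on_cong[OF _ N(1)]) (auto simp: N_def rep_unique algebra_simps)
   thus ?thesis using N by blast
  next
   case False
   hence f: "abs(rep (u0 - s)) = 1/2" using rep_bound[of "u0 - s"] by simp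
   define N where "N = {u. abs(u - u0) < 1/2 - r}"
   have N: "open N" "u0 : N" unfolding N_def using r by (auto intro!: open_Collect_less cintros)
   have "g (rep (u - s)) = 0" if "u : N" for u
   proof (rule supp)
    have "abs(rep (u0 - u)) <= abs(u - u0)" using rep_le_abs[of "u0 - u" 0] by simp
    moreover have "abs(rep (u0 - s)) <= abs(rep (u - s)) + abs(rep (u0 - u))" using rep_triangle[of "u - s" "u0 - u"] by simp
    ultimately show "r <= abs(rep (u - s))" using f that unfolding N_def by simp
   qed
   hence "C1_fam_on N (%(_::real) u. g (rep (u - s)))"
    by (intro C1_fam_on_cong[OF C1_fam_on_const[OF closed_C1_const[of 0]] N(1)]) auto
   thus ?thesis using N by blast
  qed
 next
  show "g (rep (u + 1 - s)) = g (rep (u - s))" for u using rep_add_one[of "u - s"] by (simp add: algebra_simps)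
 qed
 thus ?thesis unfolding C1_family_def by auto
qed

definition cap :: "real => real => real" where "cap e t = stepf (e - t^2)"

lemma has_real_derivative_cap: "(cap e has_real_derivative stepf' (e - t^2) * (- (2 * t))) (at t)"
 unfolding cap_def[abs_def] by (rule DERIV_chain2[OF DERIV_stepf]) (auto intro!: dintros)

lemma cap_even: "cap e (- t) = cap e t" by (simp add: cap_def)
lemma cap_zero: "e <= t^2 ==> cap e t = 0" by (simp add: cap_def stepf_def)
lemma cap_one: "t^2 <= e - 1 ==> cap e t = 1" by (simp add: cap_def stepf_def)

lemma le_abs_square: "0 <= a ==> a <= abs x ==> a^2 <= (x::real)^2"
 using abs_le_square_iff[of a x] by simp

lemma abs_le_square: "abs x <= a ==> (x::real)^2 <= a^2"
 using abs_le_square_iff[of x a] by simp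

text \<open>A bump on the circle centred at \<open>s\<close>. For \<open>e = 1\<close> it vanishes beyond distance
\<open>r\<close>; for \<open>e = 2\<close> it is \<open>1\<close> up to distance \<open>r\<close> and vanishes
beyond \<open>2 * r\<close>.\<close>
definition arc_bump :: "real => real => real => real => real" where
 "arc_bump e r s u = cap e (rep (u - s) / r)"

lemma closed_C1_arc_bump:
 assumes "r > 0" "e <= 4" "2 * r < 1/2" shows "closed_C1 (arc_bump e r s)"
 unfolding arc_bump_def[abs_def]
proof (rule closed_C1_periodize[where r = "2 * r" and g' = "%t. stepf' (e - (t / r)^2) * (- (2 * (t / r))) * (1 / r)"])
 fix t
 show "((%t. cap e (t / r)) has_vd stepf' (e - (t / r)^2) * (- (2 * (t / r))) * (1 / r)) (at t)"
  unfolding real_has_vd[symmetric]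
  by (rule DERIV_chain2[OF has_real_derivative_cap]) (use assms in "auto intro!: dintros")
 show "continuous_on UNIV (%t. stepf' (e - (t / r)^2) * (- (2 * (t / r))) * (1 / r))"
  by (intro cintros cont_comp[OF continuous_on_stepf'[of UNIV]]) (use assms in auto)
 assume "abs t >= 2 * r"
 hence "2 <= abs(t / r)" unfolding abs_div_pos[OF assms(1), symmetric] pos_le_divide_eq[OF assms(1)] .
 hence "2^2 <= (t / r)^2" by (intro le_abs_square) simp_all
 thus "cap e (t / r) = 0" using assms by (intro cap_zero) auto
qed (use assms in auto)

lemma arc_bump_zero: "r > 0 ==> e <= 4 ==> abs(rep (u - s)) >= 2 * r ==> arc_bump e r s u = 0"
proof -
 assume a: "r > 0" "e <= 4" "abs(rep (u - s)) >= 2 * r"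
 hence "2 <= abs(rep (u - s) / r)" unfolding abs_div_pos[OF a(1), symmetric] pos_le_divide_eq[OF a(1)] by simp
 hence "2^2 <= (rep (u - s) / r)^2" by (intro le_abs_square) simp_all
 thus ?thesis using a(2) unfolding arc_bump_def by (intro cap_zero) auto
qed

lemma arc_bump_zero1: "r > 0 ==> abs(rep (u - s)) >= r ==> arc_bump 1 r s u = 0"
proof -
 assume a: "r > 0" "abs(rep (u - s)) >= r"
 hence "1 <= abs(rep (u - s) / r)" unfolding abs_div_pos[OF a(1), symmetric] pos_le_divide_eq[OF a(1)] by simp
 hence "1^2 <= (rep (u - s) / r)^2" by (intro le_abs_square) simp_all
 thus ?thesis unfolding arc_bump_def by (intro cap_zero) auto
qed

lemma arc_bump_one2: "r > 0 ==> abs(rep (u - s)) <= r ==> arc_bump 2 r s u = 1"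
proof -
 assume a: "r > 0" "abs(rep (u - s)) <= r"
 hence "abs(rep (u - s) / r) <= 1" unfolding abs_div_pos[OF a(1), symmetric] pos_divide_le_eq[OF a(1)] by simp
 hence "(rep (u - s) / r)^2 <= 1^2" by (intro abs_le_square)
 thus ?thesis unfolding arc_bump_def by (intro cap_one) auto
qed

lemma arc_bump_center: "r > 0 ==> e >= 1 ==> arc_bump e r s s = 1"
 unfolding arc_bump_def by (intro cap_one) (simp add: rep_def)

text \<open>The sum of two transverse curves is a local diffeomorphism.\<close>
lemma crossing_chart:
 fixes al be :: "real => complex"
 assumes C1: "closed_C1 al" "closed_C1 be" and D: "det2 (vd al s) (vd be t) > 0"
 obtains r where "r > 0"
  "!!a b a' b'. abs a < r ==> abs b < r ==> abs a' < r ==> abs b' < r ==> al (s + a) + be (t + b) = al (s + a') + be (t + b') ==> a = a' & b = b'"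
  "!!a b. abs a < r ==> abs b < r ==> det2 (vd al (s + a)) (vd be (t + b)) > 0"
proof -
 define u v where "u = vd al s" and "v = vd be t"
 define d where "d = det2 u v"
 have d0: "d > 0" using D unfolding d_def u_def v_def .
 have "u ~= 0" using d0 unfolding d_def det2_def by auto
 hence nuv: "norm u + norm v > 0" by (simp add: add_pos_nonneg)
 define w where "w = d / 2 / (norm u + norm v)"
 have w: "w > 0" unfolding w_def using d0 nuv by simp
 have wn: "(norm u + norm v) * w = d / 2" unfolding w_def
  by (rule nonzero_mult_div_cancel_left[of "norm u + norm v", unfolded times_divide_eq_right[symmetric]]) (use nuv in simp)
 obtain r1 where r1: "r1 > 0" "!!a b. abs(a - s) < r1 ==> abs(b - s) < r1 ==> norm (al a - al b - (a - b) *R u) <= w * abs(a - b)"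
  unfolding u_def
  by (rule C1_strict_derivative[of UNIV al "vd al" s w])
   (use w closed_C1_has_vd[OF C1(1)] closed_C1_vd_cont[OF C1(1)] in auto)
 obtain r2 where r2: "r2 > 0" "!!a b. abs(a - t) < r2 ==> abs(b - t) < r2 ==> norm (be a - be b - (a - b) *R v) <= w * abs(a - b)"
  unfolding v_def
  by (rule C1_strict_derivative[of UNIV be "vd be" t w])
   (use w closed_C1_has_vd[OF C1(2)] closed_C1_vd_cont[OF C1(2)] in auto)
 define U where "U = {x :: real \<times> real. 0 < det2 (vd al (s + fst x)) (vd be (t + snd x))}"
 have ca: "continuous_on UNIV (%x::real \<times> real. vd al (s + fst x))"
  by (rule cont_comp[OF closed_C1_vd_cont[OF C1(1), of UNIV]]) (auto intro!: cintros)
 have cb: "continuous_on UNIV (%x::real \<times> real. vd be (t + snd x))"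
  by (rule cont_comp[OF closed_C1_vd_cont[OF C1(2), of UNIV]]) (auto intro!: cintros)
 have "open U" unfolding U_def det2_def by (intro open_Collect_less cintros ca cb)
 moreover have "(0, 0) : U" unfolding U_def using D by simp
 ultimately obtain r3 where r3: "r3 > 0" "ball (0, 0) r3 <= U" using open_contains_ball by blast
 define r where "r = min (min r1 r2) (r3 / 2)"
 show ?thesis
 proof (rule that[of r])
  show "r > 0" unfolding r_def using r1 r2 r3 by simp
  show "det2 (vd al (s + a)) (vd be (t + b)) > 0" if "abs a < r" "abs b < r" for a b
  proof -
   have "norm (a, b) <= norm a + norm b" by (rule norm_Pair_le)
   also have "... < r3" using that unfolding r_def by simp
   finally have "(a, b) : ball (0, 0) r3" by (simp add: dist_norm norm_Pair)
   thus ?thesis using r3(2) unfolding U_def by auto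
  qed
  fix a b a' b' assume ab: "abs a < r" "abs b < r" "abs a' < r" "abs b' < r"
   and eq: "al (s + a) + be (t + b) = al (s + a') + be (t + b')"
  have n1: "norm (al (s + a) - al (s + a') - (a - a') *R u) <= w * abs(a - a')"
   using r1(2)[of "s + a" "s + a'"] ab unfolding r_def by simp
  have n2: "norm (be (t + b) - be (t + b') - (b - b') *R v) <= w * abs(b - b')"
   using r2(2)[of "t + b" "t + b'"] ab unfolding r_def by simp
  have "(a - a') *R u - (b' - b) *R v = - ((al (s + a) - al (s + a') - (a - a') *R u) + (be (t + b) - be (t + b') - (b - b') *R v))"
   using eq by (simp add: algebra_simps)
  hence "norm ((a - a') *R u - (b' - b) *R v) = norm ((al (s + a) - al (s + a') - (a - a') *R u) + (be (t + b) - be (t + b') - (b - b') *R v))"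
   by (simp only: norm_minus_cancel)
  also have "... <= w * abs(a - a') + w * abs(b - b')" by (rule order_trans[OF norm_triangle_ineq add_mono[OF n1 n2]])
  finally have le: "norm ((a - a') *R u - (b' - b) *R v) <= w * (abs(a - a') + abs(b' - b))" by (simp add: distrib_left abs_minus_commute)
  have "(abs(a - a') + abs(b' - b)) * abs d <= (norm u + norm v) * norm ((a - a') *R u - (b' - b) *R v)"
   unfolding d_def by (rule det2_bound)
  also have "... <= (norm u + norm v) * (w * (abs(a - a') + abs(b' - b)))" using nuv by (intro mult_left_mono le) auto
  also have "... = d / 2 * (abs(a - a') + abs(b' - b))" unfolding mult.assoc[symmetric] wn ..
  finally have Z: "(abs(a - a') + abs(b' - b)) * abs d <= d / 2 * (abs(a - a') + abs(b' - b))" .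
  have "z <= 0" if "z * abs d <= d / 2 * z" for z
   using that d0 by (simp add: mult.commute mult_le_0_iff)
  from this[OF Z] have "abs(a - a') + abs(b' - b) <= 0" .
  thus "a = a' & b = b'" by auto
 qed
qed

abbreviation (input) "lp rh w == rh * (2 * Re (fst w) + snd w)"
abbreviation (input) "lm rh w == rh * (2 * Re (fst w) - snd w)"

abbreviation (input) frame_det :: "(R3 => real^4) => R3 => real" where
 "frame_det F x == det (vector [F x, frechet_derivative F (at x) (1, 0), frechet_derivative F (at x) (\<i>, 0),
  frechet_derivative F (at x) (0, 1)])"
abbreviation (input) "jac3 F w == det3 (dd F w (1, 0)) (dd F w (\<i>, 0)) (dd F w (0, 1))"

text \<open>The axis of the collar is the difference of the two chart coordinates; the disk is spanned by their sum and
the height.\<close>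
definition xcollar :: "real => (real => complex) => real => (real => complex) => real => R3 => R3" where
 "xcollar rh al s be t w = (al (s + lp rh w) + be (t + lm rh w) - be t, 2 * Im (fst w))"

definition xbox :: "R3 set" where
 "xbox = {w. abs(Re (fst w)) < 2 & abs(Im (fst w)) < 2 & abs(snd w) < 2}"

lemma open_xbox: "open xbox"
 unfolding xbox_def by (intro open_Collect_conj open_Collect_less cintros)

lemma cylinder_xbox: "cylinder <= xbox"
proof
 fix w assume w: "w : cylinder"
 have "abs(Re (fst w)) <= norm (fst w)" "abs(Im (fst w)) <= norm (fst w)" by (rule abs_Re_le_cmod, rule abs_Im_le_cmod)
 thus "w : xbox" using w unfolding xbox_def by (auto simp: mem_Times_iff)
qed

lemma has_derivative_curve_comp:
 assumes "closed_C1 ga" "(f has_derivative f') (at x)"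
 shows "((%x. ga (f x)) has_derivative (%v. f' v *R vd ga (f x))) (at x)"
 using has_derivative_compose[OF assms(2), of ga "%h. h *R vd ga (f x)"]
  closed_C1_has_vd[OF assms(1), of "f x"] unfolding has_vd_def by simp

lemma xcollar_C1:
 assumes "closed_C1 al" "closed_C1 be"
 shows "C1_on UNIV (xcollar rh al s be t)"
  "blinfun_apply (dd (xcollar rh al s be t) w) = (%v. ((lp rh v) *R vd al (s + lp rh w)
    + (lm rh v) *R vd be (t + lm rh w), 2 * Im (fst v)))"
proof -
 have d: "(xcollar rh al s be t has_derivative (%v. ((lp rh v) *R vd al (s + lp rh w)
    + (lm rh v) *R vd be (t + lm rh w), 2 * Im (fst v)))) (at w)" for w
 proof -
  have "((%w::R3. s + lp rh w) has_derivative (%v. lp rh v)) (at w)"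
   "((%w::R3. t + lm rh w) has_derivative (%v. lm rh v)) (at w)"
   by (auto intro!: dintros)
  from has_derivative_curve_comp[OF assms(1) this(1)] has_derivative_curve_comp[OF assms(2) this(2)]
  show ?thesis unfolding xcollar_def[abs_def] by (auto intro!: dintros)
 qed
 show "blinfun_apply (dd (xcollar rh al s be t) w) = (%v. ((lp rh v) *R vd al (s + lp rh w)
    + (lm rh v) *R vd be (t + lm rh w), 2 * Im (fst v)))"
  by (rule dd_eqI[OF d])
 show "C1_on UNIV (xcollar rh al s be t)"
 proof (rule C1_onI(1)[OF open_UNIV d])
  fix v :: "R3"
  have "continuous_on UNIV (%w::R3. vd al (s + lp rh w))"
   by (rule cont_comp[OF closed_C1_vd_cont[OF assms(1), of UNIV]]) (auto intro!: cintros)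
  moreover have "continuous_on UNIV (%w::R3. vd be (t + lm rh w))"
   by (rule cont_comp[OF closed_C1_vd_cont[OF assms(2), of UNIV]]) (auto intro!: cintros)
  ultimately show "continuous_on UNIV (%w. ((lp rh v) *R vd al (s + lp rh w)
    + (lm rh v) *R vd be (t + lm rh w), 2 * Im (fst v)))"
   by (intro cintros)
 qed
qed

lemma det3_planar: "det3 (A, 0) (0, 2) (C, 0) = - 2 * det2 A C"
 unfolding det3_def det2_def by simp

lemma xcollar_det3:
 fixes rh s t :: real and w :: "R3"
 assumes "closed_C1 al" "closed_C1 be"
 defines "D == dd (xcollar rh al s be t) w"
 shows "det3 (D (1, 0)) (D (\<i>, 0)) (D (0, 1)) =
  8 * rh^2 * det2 (vd al (s + lp rh w)) (vd be (t + lm rh w))"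
proof -
 define a where "a = vd al (s + lp rh w)"
 define b where "b = vd be (t + lm rh w)"
 have D: "D (1, 0) = ((rh * 2) *R a + (rh * 2) *R b, 0)" "D (\<i>, 0) = (0, 2)" "D (0, 1) = (rh *R a - rh *R b, 0)"
  unfolding D_def xcollar_C1(2)[OF assms(1,2)] a_def b_def by simp_all
 show ?thesis unfolding D det3_planar a_def[symmetric] b_def[symmetric] det2_def
  by (simp add: algebra_simps power2_eq_square)
qed

lemma blinfun_coordinates:
 fixes D :: "R3 \<Rightarrow>\<^sub>L 'b::real_normed_vector"
 shows "blinfun_apply D v = Re (fst v) *R D (1, 0) + Im (fst v) *R D (\<i>, 0) + snd v *R D (0, 1)"
proof -
 have "v = Re (fst v) *R (1, 0) + Im (fst v) *R (\<i>, 0) + snd v *R (0, 1::real)" by (simp add: prod_eq_iff complex_eq_iff)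
 from arg_cong[OF this, of "blinfun_apply D"] show ?thesis by (simp only: blinfun.add_right blinfun.scaleR_right)
qed

lemma det3_injective:
 fixes F :: "R3 \<Rightarrow>\<^sub>L R3"
 assumes "det3 (F (1, 0)) (F (\<i>, 0)) (F (0, 1)) ~= 0"
 shows "inj (blinfun_apply F)"
proof -
 have "v = 0" if v: "F v = 0" for v
 proof -
  note Fv = blinfun_coordinates[of F v]
  have d: "det3 (F v) (F (\<i>, 0)) (F (0, 1)) = Re (fst v) * det3 (F (1, 0)) (F (\<i>, 0)) (F (0, 1))"
   "det3 (F (1, 0)) (F v) (F (0, 1)) = Im (fst v) * det3 (F (1, 0)) (F (\<i>, 0)) (F (0, 1))"
   "det3 (F (1, 0)) (F (\<i>, 0)) (F v) = snd v * det3 (F (1, 0)) (F (\<i>, 0)) (F (0, 1))"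
   unfolding Fv det3_def by (simp_all add: algebra_simps)
  have z: "det3 0 b c = 0" "det3 b 0 c = 0" "det3 b c 0 = 0" for b c unfolding det3_def by simp_all
  have "Re (fst v) = 0" "Im (fst v) = 0" "snd v = 0" using d assms unfolding v z by simp_all
  thus "v = 0" by (simp add: prod_eq_iff complex_eq_iff)
 qed
 thus ?thesis
  by (simp add: linear_injective_0 blinfun.bounded_linear_right bounded_linear.linear)
qed

lemma xbox_bounds:
 assumes "w : xbox" "rh > 0"
 shows "abs(lp rh w) < 6 * rh" "abs(lm rh w) < 6 * rh"
proof -
 have a: "abs(2 * Re (fst w) + snd w) < 6" "abs(2 * Re (fst w) - snd w) < 6" using assms(1) unfolding xbox_def by auto
 show "abs(lp rh w) < 6 * rh" "abs(lm rh w) < 6 * rh"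
  using mult_strict_left_mono[OF a(1) assms(2)] mult_strict_left_mono[OF a(2) assms(2)] assms(2)
  unfolding abs_mult by simp_all
qed

lemma xcollar_collar3:
 assumes C1: "closed_C1 al" "closed_C1 be" and r: "6 * rh <= r" "rh > 0"
  and inj: "!!a b a' b'. abs a < r ==> abs b < r ==> abs a' < r ==> abs b' < r ==> al (s + a) + be (t + b) = al (s + a') + be (t + b') ==> a = a' & b = b'"
  and pos: "!!a b. abs a < r ==> abs b < r ==> det2 (vd al (s + a)) (vd be (t + b)) > 0"
 shows "collar3 (xcollar rh al s be t) xbox"
  and "w : xbox ==> jac3 (xcollar rh al s be t) w > 0"
proof -
 have b: "abs(lp rh w) < r" "abs(lm rh w) < r" if "w : xbox" for w
  using xbox_bounds[OF that r(2)] r(1) by linarith+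
 show dp: "jac3 (xcollar rh al s be t) w > 0"
  if "w : xbox" for w
  unfolding xcollar_det3[OF C1] using pos[OF b[OF that]] r(2) by simp
 show "collar3 (xcollar rh al s be t) xbox" unfolding collar3_def
 proof (intro conjI ballI)
  show "open xbox" by (rule open_xbox)
  show "cylinder <= xbox" by (rule cylinder_xbox)
  show "C1_on xbox (xcollar rh al s be t)" by (rule C1_on_subset[OF open_UNIV xcollar_C1(1)[OF C1]]) simp
  show "inj (dd (xcollar rh al s be t) w)" if "w : xbox" for w
   by (rule det3_injective) (use dp[OF that] in simp)
  show "inj_on (xcollar rh al s be t) xbox"
  proof (rule inj_onI)
   fix v w assume vw: "v : xbox" "w : xbox" "xcollar rh al s be t v = xcollar rh al s be t w"
   hence "lp rh v = lp rh w & lm rh v = lm rh w"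
    by (intro inj b) (auto simp: xcollar_def)
   hence "2 * Re (fst v) + snd v = 2 * Re (fst w) + snd w" "2 * Re (fst v) - snd v = 2 * Re (fst w) - snd w" using r(2) by auto
   moreover have "Im (fst v) = Im (fst w)" using vw(3) by (simp add: xcollar_def)
   ultimately show "v = w" by (simp add: prod_eq_iff complex_eq_iff)
  qed
 qed
qed

text \<open>The upper strand with its height lowered in the middle of the collar. The lower strand is the antipode.\<close>
definition zstar :: "real => complex" where "zstar t = Complex (t / 2) (1/2 - cap 1 t)"

text \<open>A logarithm of \<open>zstar t / (t/2 + \<i>/2)\<close> that is continuous in \<open>t\<close>: the curve
\<open>zstar\<close> passes below the origin, so it is rotated by \<open>\<i>\<close> away from the cut of
\<open>Ln\<close>. The constant makes the ends those of the full twist.\<close>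
definition wstar :: "real => complex" where
 "wstar t = Ln (\<i> * zstar t) - Ln (Complex (t / 2) (1/2)) + 3 * of_real pi / 2 * \<i>"

lemma izstar: "\<i> * zstar t = Complex (cap 1 t - 1/2) (t / 2)"
 unfolding zstar_def by (simp add: complex_eq_iff)

lemma cap1_bounds: "0 <= cap 1 t" "cap 1 t <= 1" unfolding cap_def by (rule stepf_bounds)+

lemma izstar_slit: "\<i> * zstar t ~: \<real>\<^sub>\<le>\<^sub>0"
proof (cases "t = 0")
 case True
 have "cap 1 0 = 1" by (rule cap_one) simp
 thus ?thesis unfolding izstar True by (simp add: complex_nonpos_Reals_iff)
next
 case False thus ?thesis unfolding izstar by (simp add: complex_nonpos_Reals_iff)
qed

lemma zhalf_slit: "Complex (t / 2) (1/2) ~: \<real>\<^sub>\<le>\<^sub>0" by (simp add: complex_nonpos_Reals_iff)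

lemma exp_wstar: "exp (wstar t) * Complex (t / 2) (1/2) = zstar t"
proof -
 have nz: "\<i> * zstar t ~= 0" "Complex (t / 2) (1/2) ~= 0" using izstar_slit[of t] zhalf_slit[of t] by (auto simp del: mult_eq_0_iff)
 have "exp (3 * of_real pi / 2 * \<i>) = - \<i>"
 proof -
  have "exp (3 * of_real pi / 2 * \<i>) = cis (3 * pi / 2)" unfolding cis_conv_exp by (simp add: mult.commute)
  also have "... = cis (pi + pi / 2)" by (rule arg_cong[of _ _ cis]) simp
  also have "... = - \<i>" by (simp only: cis_mult[symmetric] cis_pi cis_pi_half) simp
  finally show ?thesis .
 qed
 hence "exp (wstar t) = \<i> * zstar t / Complex (t / 2) (1/2) * (- \<i>)"
  unfolding wstar_def exp_add exp_diff using nz by (simp add: exp_Ln)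
 hence "exp (wstar t) * Complex (t / 2) (1/2) = \<i> * zstar t * (- \<i>)" using nz(2) by simp
 also have "... = zstar t" by (simp add: complex_eq_iff)
 finally show ?thesis .
qed

lemma Ln_times_i:
 assumes im: "0 < Im z"
 shows "Re z < 0 ==> Ln (\<i> * z) = Ln z + \<i> * of_real pi / 2 - 2 * of_real pi * \<i>"
  and "0 <= Re z ==> Ln (\<i> * z) = Ln z + \<i> * of_real pi / 2"
proof -
 have z0: "z ~= 0" using im by auto
 have eA: "exp (\<i> * of_real pi / 2) = \<i>" using cis_pi_half unfolding cis_conv_exp by simp
 show "Ln (\<i> * z) = Ln z + \<i> * of_real pi / 2 - 2 * of_real pi * \<i>" if "Re z < 0"
 proof (rule Ln_unique)
  show "exp (Ln z + \<i> * of_real pi / 2 - 2 * of_real pi * \<i>) = \<i> * z"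
   unfolding exp_diff exp_add eA exp_two_pi_i using z0 by (simp add: exp_Ln)
  have "~ abs(Im (Ln z)) <= pi / 2" using Re_Ln_pos_le[OF z0] that by simp
  moreover have "0 < Im (Ln z)" "Im (Ln z) < pi" using Im_Ln_pos_lt[OF z0] im by auto
  ultimately show "- pi < Im (Ln z + \<i> * of_real pi / 2 - 2 * of_real pi * \<i>)" "Im (Ln z + \<i> * of_real pi / 2 - 2 * of_real pi * \<i>) <= pi" by auto
 qed
 show "Ln (\<i> * z) = Ln z + \<i> * of_real pi / 2" if "0 <= Re z"
 proof (rule Ln_unique)
  show "exp (Ln z + \<i> * of_real pi / 2) = \<i> * z"
   unfolding exp_add eA using z0 by (simp add: exp_Ln)
  have "abs(Im (Ln z)) <= pi / 2" using Re_Ln_pos_le[OF z0] that by simp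
  moreover have "0 < Im (Ln z)" using Im_Ln_pos_lt[OF z0] im by auto
  ultimately show "- pi < Im (Ln z + \<i> * of_real pi / 2)" "Im (Ln z + \<i> * of_real pi / 2) <= pi" by auto
 qed
qed

lemma wstar_end: "abs t >= 1 ==> wstar t = \<i> * of_real (ang t)"
proof -
 assume t: "abs t >= 1"
 have "1^2 <= t^2" using t abs_le_square_iff[of 1 t] by simp
 hence "cap 1 t = 0" by (intro cap_zero) simp
 hence z: "zstar t = Complex (t / 2) (1/2)" unfolding zstar_def by simp
 show ?thesis
 proof (cases "t >= 1")
  case True
  thus ?thesis unfolding wstar_def z ang_outside(2)[OF True] using Ln_times_i(2)[of "Complex (t / 2) (1/2)"]
   by (simp add: algebra_simps)
 next
  case False
  hence "t <= -1" using t by auto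
  thus ?thesis unfolding wstar_def z using ang_outside(1)[of t] Ln_times_i(1)[of "Complex (t / 2) (1/2)"]
   by (simp add: algebra_simps)
 qed
qed

lemma norm_zstar_le: "norm (zstar t) <= norm (Complex (t / 2) (1/2))"
proof -
 have "abs(1/2 - cap 1 t) <= 1/2" using cap1_bounds[of t] unfolding abs_le_iff by simp
 hence "(1/2 - cap 1 t)^2 <= (1/2)^2" using abs_le_square_iff[of "1/2 - cap 1 t" "1/2"] by simp
 thus ?thesis unfolding zstar_def by (simp add: complex_norm)
qed

lemma log_profile_wstar: "log_profile wstar"
 unfolding log_profile_def
proof (intro conjI allI impI)
 fix t
 have nz: "Complex (t / 2) (1/2) ~= 0" "zstar t ~= 0" using zhalf_slit[of t] izstar_slit[of t] by auto
 have "exp (Re (wstar t)) * norm (Complex (t / 2) (1/2)) = norm (zstar t)"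
  using arg_cong[OF exp_wstar[of t], of norm] by (simp add: norm_mult)
 also have "... <= 1 * norm (Complex (t / 2) (1/2))" using norm_zstar_le[of t] by simp
 finally have "exp (Re (wstar t)) <= 1" by (rule mult_right_le_imp_le) (use nz(1) in simp)
 thus "Re (wstar t) <= 0" by simp
next
 fix t :: real assume "1 <= abs t"
 thus "exp (wstar t) = 1" using wstar_end[of t] log_profile_twist[of 1] unfolding log_profile_def by simp
next
 have d1: "((%t. \<i> * zstar t) has_vd Complex (stepf' (1 - t^2) * (- (2 * t))) (1/2)) (at t)" for t
  unfolding izstar complex_has_vd real_has_vd[symmetric]
  using has_real_derivative_cap[of 1 t] by (auto intro!: dintros)
 have d2: "((%t. Complex (t / 2) (1/2)) has_vd Complex (1/2) 0) (at t)" for t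
  unfolding complex_has_vd real_has_vd[symmetric]
  by (auto intro!: dintros)
 have dL: "((%t. Ln (g t)) has_vd g' / g t) (at t)"
  if "(g has_vd g') (at t)" "g t ~: \<real>\<^sub>\<le>\<^sub>0" for g :: "real => complex" and g' t
  using field_vector_diff_chain_at[OF that(1) has_field_derivative_Ln[OF that(2)]] by (simp add: o_def field_simps)
 have d: "(wstar has_vd Complex (stepf' (1 - t^2) * (- (2 * t))) (1/2) / (\<i> * zstar t) - Complex (1/2) 0 / Complex (t / 2) (1/2) + 0) (at t)" for t
  unfolding wstar_def[abs_def]
  by (intro has_vd_add has_vd_diff dL d1 d2 izstar_slit zhalf_slit has_vector_derivative_const)
 have c1: "continuous_on UNIV (%t. \<i> * zstar t)" by (intro continuous_at_imp_continuous_on ballI has_vd_cont[OF d1])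
 have c2: "continuous_on UNIV (%t. Complex (t / 2) (1/2))" by (intro continuous_at_imp_continuous_on ballI has_vd_cont[OF d2])
 have c3: "continuous_on UNIV (%t. Complex (stepf' (1 - t^2) * (- (2 * t))) (1/2))"
  by (intro continuous_on_Complex cintros cont_comp[OF continuous_on_stepf'[of UNIV]]) auto
 have nz: "\<i> * zstar t ~= 0" "Complex (t / 2) (1/2) ~= 0" for t
  using izstar_slit[of t] zhalf_slit[of t] by (auto simp del: mult_eq_0_iff)
 show "C1_on UNIV wstar"
  by (rule C1_on_real(1)[OF open_UNIV d])
   (intro cintros c1 c2 c3; use nz in blast)
qed

section \<open>Crossing changes as twists\<close>

text \<open>Disjoint charts at the crossings \<open>x j\<close>, with upper strand \<open>loc (j, True)\<close> and lower
strand \<open>loc (j, False)\<close>. The arcs of the charts have size \<open>r\<close>, the charts size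
\<open>et\<close> in the plane, and the collars inside them size \<open>rh\<close>.\<close>
locale crossing_charts =
 fixes P :: "(real => complex) list" and ov :: "complex => nat * real" and J :: "nat set" and x :: "nat => complex"
  and loc :: "nat \<times> bool => nat * real" and r et rh :: real
 assumes diag: "is_diagram P ov" and J: "finite J" and x: "inj_on x J" "!!j. j : J ==> x j : crossings P"
  and loc: "!!j b. j : J ==> loc (j, b) : params P & pt P (loc (j, b)) = x j"
   "!!j. j : J ==> loc (j, True) = ov (x j)" "!!j. j : J ==> loc (j, False) ~= ov (x j)"
  and r: "r > 0" "4 * r < 1/2"
  and chart_inj: "!!j a b a' b'. j : J ==> abs a < r ==> abs b < r ==> abs a' < r ==> abs b' < r ==>
    along P (loc (j, True)) a + along P (loc (j, False)) b
    = along P (loc (j, True)) a' + along P (loc (j, False)) b' ==> a = a' & b = b'"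
  and chart_pos: "!!j a b. j : J ==> abs a < r ==> abs b < r ==>
    det2 (vel P (loc (j, True)) a) (vel P (loc (j, False)) b) > 0"
  and near: "!!j l u. j : J ==> l < length P ==> norm ((P ! l) u - x j) < et ==> EX b. l = fst (loc (j, b)) & abs(off (loc (j, b)) u) < r"
  and arcs: "!!p p'. p : double_params P ==> p' : double_params P ==> p ~= p' ==> fst p = fst p' ==> abs(rep (snd p - snd p')) >= 4 * r"
  and et: "et > 0" "!!j j'. j : J ==> j' : J ==> j ~= j' ==> 2 * et <= norm (x j - x j')"
  and rh: "rh > 0" "6 * rh <= r"
  and box_small: "!!j a b. j : J ==> abs a < 6 * rh ==> abs b < 6 * rh ==>
    norm (along P (loc (j, True)) a + along P (loc (j, False)) b - x j - x j) < et"
begin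

lemma reg: "regular_projection P" and imm: "immersed P"
 using diag regular_projectionD(1) unfolding is_diagram_def by auto

lemma P_C1: "l < length P ==> closed_C1 (P ! l)" by (rule immersed_nth[OF imm])

lemma loc_len: "j : J ==> fst (loc (j, b)) < length P" "j : J ==> snd (loc (j, b)) : {0..<1}"
 using loc(1)[of j b] unfolding params_def by (auto simp: mem_Times_iff)

lemma P_loc: "j : J ==> (P ! fst (loc (j, b))) (snd (loc (j, b))) = x j"
 using loc(1)[of j b] unfolding pt_def by simp

lemma loc_crossing: "j : J ==> loc (j, b) : double_params P"
 unfolding double_params_def using loc(1)[of j b] x(2)[of j] by simp

lemma loc_inj: "j : J ==> j' : J ==> loc (j, b) = loc (j', b') ==> j = j' & b = b'"
proof -
 assume a: "j : J" "j' : J" "loc (j, b) = loc (j', b')"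
 hence "x j = x j'" using loc(1)[of j b] loc(1)[of j' b'] by metis
 hence j: "j = j'" using x(1) a unfolding inj_on_def by blast
 have "loc (j, True) ~= loc (j, False)" using loc(2,3)[OF a(1)] by metis
 hence "b = b'" using a(3) unfolding j by (cases b; cases b') auto
 thus ?thesis using j by simp
qed

lemma loc_apart: "j : J ==> j' : J ==> (j, b) ~= (j', b') ==> fst (loc (j, b)) = fst (loc (j', b')) ==>
 abs(off (loc (j, b)) u) < 2 * r ==> abs(off (loc (j', b')) u) >= 2 * r"
proof -
 assume a: "j : J" "j' : J" "(j, b) ~= (j', b')" "fst (loc (j, b)) = fst (loc (j', b'))" "abs(off (loc (j, b)) u) < 2 * r"
 have "loc (j, b) ~= loc (j', b')" using loc_inj[OF a(1,2), of b b'] a(3) by blast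
 hence "abs(rep (snd (loc (j, b)) - snd (loc (j', b')))) >= 4 * r" by (intro arcs loc_crossing a)
 moreover have "abs(rep (snd (loc (j, b)) - snd (loc (j', b')))) <= abs(rep (- (u - snd (loc (j, b))))) + abs(off (loc (j', b')) u)"
  using rep_triangle[of "- (u - snd (loc (j, b)))" "u - snd (loc (j', b'))"] by simp
 ultimately show ?thesis using a(5) unfolding rep_minus by linarith
qed

definition bump_sum :: "nat set => (nat * bool => real => real) => nat => real => real" where
 "bump_sum A g l u = (SUM e:A \<times> UNIV. if fst (loc e) = l then g e u else 0)"

lemma bump_sum_one:
 assumes A: "A <= J" and j: "j : J" and u: "abs(off (loc (j, b)) u) < 2 * r"
  and g: "!!e. e : J \<times> UNIV ==> abs(off (loc e) u) >= 2 * r ==> g e u = 0"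
 shows "bump_sum A g (fst (loc (j, b))) u = (if j : A then g (j, b) u else 0)"
proof -
 have fin: "finite (A \<times> (UNIV :: bool set))" by (rule finite_cartesian_product[OF finite_subset[OF A J]]) simp
 have z: "(if fst (loc e) = fst (loc (j, b)) then g e u else 0) = 0" if "e : A \<times> UNIV" "e ~= (j, b)" for e
 proof (cases "fst (loc e) = fst (loc (j, b))")
  case True
  obtain j' b' where e: "e = (j', b')" by fastforce
  have "g e u = 0" by (rule g) (use that A e loc_apart[OF j _ _ _ u, of j' b'] True in auto)
  thus ?thesis by simp
 qed simp
 show ?thesis
 proof (cases "j : A")
  case True
  have "bump_sum A g (fst (loc (j, b))) u = (SUM e:{(j, b)}. if fst (loc e) = fst (loc (j, b)) then g e u else 0)"
   unfolding bump_sum_def by (rule sum.mono_neutral_right[OF fin]) (use True z in auto)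
  thus ?thesis using True by simp
 next
  case False
  have "bump_sum A g (fst (loc (j, b))) u = 0" unfolding bump_sum_def
  proof (rule sum.neutral, rule ballI)
   fix e :: "nat \<times> bool" assume e: "e : A \<times> UNIV"
   hence "e ~= (j, b)" using False by blast
   thus "(if fst (loc e) = fst (loc (j, b)) then g e u else 0) = 0" by (rule z[OF e])
  qed
  thus ?thesis using False by simp
 qed
qed

lemma bump_sum_none:
 assumes A: "A <= J" and g: "!!e. e : A \<times> UNIV ==> fst (loc e) = l ==> g e u = 0"
 shows "bump_sum A g l u = 0"
 unfolding bump_sum_def by (rule sum.neutral) (use g in auto)

lemma closed_C1_bump_sum:
 assumes A: "A <= J" and g: "!!e. e : A \<times> UNIV ==> fst (loc e) = l ==> closed_C1 (g e)"
 shows "closed_C1 (bump_sum A g l)"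
 unfolding bump_sum_def[abs_def]
proof (rule closed_C1_sum)
 show "finite (A \<times> (UNIV :: bool set))" by (rule finite_cartesian_product[OF finite_subset[OF A J]]) simp
 show "closed_C1 (%u. if fst (loc e) = l then g e u else 0)" if "e : A \<times> UNIV" for e
  using g[OF that] by (cases "fst (loc e) = l") (auto simp: closed_C1_const)
qed

definition hb :: "(real => real) list" where "hb = (SOME h. heights_ok P ov h)"

lemma hb: "heights_ok P ov hb"
 unfolding hb_def by (rule someI_ex) (use diagram_realizable[OF diag] in metis)

definition sg :: "nat \<times> bool => real" where "sg e = (if snd e then 1 else -1)"

definition h0 :: "(real => real) list" where
 "h0 = map (%l u. (hb ! l) u + bump_sum J (%e u. arc_bump 2 r (snd (loc e)) u * (sg e - (hb ! l) u)) l u) [0..<length P]"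

text \<open>The two strands at each crossing in \<open>S\<close> exchange their heights.\<close>
definition hS :: "nat set => (real => real) list" where
 "hS S = map (%l u. (h0 ! l) u * (1 - 2 * bump_sum S (%e u. arc_bump 1 (2 * rh) (snd (loc e)) u) l u)) [0..<length P]"

lemma hb_C1: "l < length P ==> closed_C1 (hb ! l)" using hb unfolding heights_ok_def by auto

lemma h0_nth: "l < length P ==> h0 ! l = (%u. (hb ! l) u + bump_sum J (%e u. arc_bump 2 r (snd (loc e)) u * (sg e - (hb ! l) u)) l u)"
 unfolding h0_def by simp
lemma hS_nth: "l < length P ==> hS S ! l = (%u. (h0 ! l) u * (1 - 2 * bump_sum S (%e u. arc_bump 1 (2 * rh) (snd (loc e)) u) l u))"
 unfolding hS_def by simp

lemma h0_C1: "l < length P ==> closed_C1 (h0 ! l)"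
 unfolding h0_nth
 by (intro closed_C1_add(1) hb_C1 closed_C1_bump_sum closed_C1_mult closed_C1_arc_bump closed_C1_diff(1) closed_C1_const) (use r in auto)

lemma hS_C1: "S <= J ==> l < length P ==> closed_C1 (hS S ! l)"
 unfolding hS_nth
 by (intro closed_C1_mult h0_C1 closed_C1_bump_sum closed_C1_arc_bump closed_C1_diff(1) closed_C1_const) (use r rh in auto)

lemma h0_arc: "j : J ==> abs(off (loc (j, b)) u) <= r ==> (h0 ! fst (loc (j, b))) u = sg (j, b)"
proof -
 assume j: "j : J" and u: "abs(off (loc (j, b)) u) <= r"
 have u2: "abs(off (loc (j, b)) u) < 2 * r" using u r by simp
 have "bump_sum J (%e u. arc_bump 2 r (snd (loc e)) u * (sg e - (hb ! fst (loc (j, b))) u)) (fst (loc (j, b))) u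
  = arc_bump 2 r (snd (loc (j, b))) u * (sg (j, b) - (hb ! fst (loc (j, b))) u)"
  by (subst bump_sum_one[OF order_refl j u2]) (use j r in "auto simp: arc_bump_zero")
 thus ?thesis unfolding h0_nth[OF loc_len(1)[OF j]] arc_bump_one2[OF r(1) u] by simp
qed

lemma h0_other:
 assumes "p : double_params P" "!!e. e : J \<times> UNIV ==> loc e ~= p"
 shows "pt h0 p = pt hb p"
proof -
 have l: "fst p < length P" using assms(1) unfolding double_params_def params_def by auto
 have "bump_sum J (%e u. arc_bump 2 r (snd (loc e)) u * (sg e - (hb ! fst p) u)) (fst p) (snd p) = 0"
 proof (rule bump_sum_none[OF order_refl])
  fix e :: "nat \<times> bool" assume e: "e : J \<times> UNIV" "fst (loc e) = fst p"
  have le: "loc e : double_params P" using loc_crossing[of "fst e" "snd e"] e by auto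
  have "abs(rep (snd p - snd (loc e))) >= 4 * r" by (rule arcs[OF assms(1) le]) (use assms(2)[OF e(1)] e in auto)
  hence "arc_bump 2 r (snd (loc e)) (snd p) = 0" by (intro arc_bump_zero) (use r in auto)
  thus "arc_bump 2 r (snd (loc e)) (snd p) * (sg e - (hb ! fst p) (snd p)) = 0" by simp
 qed
 thus ?thesis unfolding pt_def h0_nth[OF l] by simp
qed

lemma hS_arc: "S <= J ==> j : J ==> abs(off (loc (j, b)) u) <= r ==>
 (hS S ! fst (loc (j, b))) u = sg (j, b) * (if j : S then 1 - 2 * arc_bump 1 (2 * rh) (snd (loc (j, b))) u else 1)"
proof -
 assume S: "S <= J" and j: "j : J" and u: "abs(off (loc (j, b)) u) <= r"
 have u2: "abs(off (loc (j, b)) u) < 2 * r" using u r by simp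
 have "bump_sum S (%e u. arc_bump 1 (2 * rh) (snd (loc e)) u) (fst (loc (j, b))) u = (if j : S then arc_bump 1 (2 * rh) (snd (loc (j, b))) u else 0)"
 proof (rule bump_sum_one[OF S j u2])
  fix e :: "nat \<times> bool" assume "2 * r <= abs(off (loc e) u)"
  thus "arc_bump 1 (2 * rh) (snd (loc e)) u = 0" by (intro arc_bump_zero1) (use r rh in auto)
 qed
 thus ?thesis unfolding hS_nth[OF loc_len(1)[OF j]] h0_arc[OF j u] by simp
qed

lemma hS_eq_h0:
 assumes S: "S <= J" and l: "l < length P" and far: "!!e. e : S \<times> UNIV ==> fst (loc e) = l ==> abs(off (loc e) u) >= 2 * rh"
 shows "(hS S ! l) u = (h0 ! l) u"
proof -
 have "bump_sum S (%e u. arc_bump 1 (2 * rh) (snd (loc e)) u) l u = 0"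
  by (rule bump_sum_none[OF S]) (use far rh in "auto intro: arc_bump_zero1")
 thus ?thesis unfolding hS_nth[OF l] by simp
qed

lemma hS_other:
 assumes S: "S <= J" and p: "p : double_params P" "!!e. e : J \<times> UNIV ==> loc e ~= p"
 shows "pt (hS S) p = pt hb p"
proof -
 have l: "fst p < length P" using p(1) unfolding double_params_def params_def by auto
 have "(hS S ! fst p) (snd p) = (h0 ! fst p) (snd p)"
 proof (rule hS_eq_h0[OF S l])
  fix e :: "nat \<times> bool" assume e: "e : S \<times> UNIV" "fst (loc e) = fst p"
  have le: "loc e : double_params P" using loc_crossing[of "fst e" "snd e"] e S by auto
  have "abs(rep (snd p - snd (loc e))) >= 4 * r" by (rule arcs[OF p(1) le]) (use p(2)[of e] e S in auto)
  thus "abs(rep (snd p - snd (loc e))) >= 2 * rh" using r rh by linarith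
 qed
 thus ?thesis using h0_other[OF p] unfolding pt_def by simp
qed

lemma hS_at: "S <= J ==> j : J ==> pt (hS S) (loc (j, b)) = (if j : S then - sg (j, b) else sg (j, b))"
proof -
 assume S: "S <= J" and j: "j : J"
 have "abs(rep (snd (loc (j, b)) - snd (loc (j, b)))) <= r" using r by (simp add: rep_def)
 from hS_arc[OF S j this] show ?thesis unfolding pt_def using arc_bump_center[of "2 * rh" 1 "snd (loc (j, b))"] rh by simp
qed

lemma hS_ok:
 assumes S: "S <= J" shows "heights_ok P (change_crossings P (x ` S) ov) (hS S)"
 unfolding heights_ok_def
proof (intro conjI ballI impI)
 show len: "length (hS S) = length P" unfolding hS_def by simp
 show "closed_C1 et" if eta: "et : set (hS S)" for et
 proof -
  obtain l where "l < length P" "et = hS S ! l" using eta len by (metis in_set_conv_nth)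
  thus ?thesis using hS_C1[OF S] by simp
 qed
 let ?ov = "change_crossings P (x ` S) ov"
 fix p assume p: "p : params P" "pt P p : crossings P" "p ~= ?ov (pt P p)"
 note D' = changed_diagram(1)[OF diag, of "x ` S"]
 have q: "?ov (pt P p) : params P" "pt P (?ov (pt P p)) = pt P p" using D' p unfolding is_diagram_def by auto
 show "pt (hS S) p < pt (hS S) (?ov (pt P p))"
 proof (cases "EX j:J. pt P p = x j")
  case True
  then obtain j where j: "j : J" "pt P p = x j" by blast
  have two: "q = loc (j, True) | q = loc (j, False)" if "q : params P" "pt P q = x j" for q
   using loc(2,3)[OF j(1)] loc(1)[OF j(1), of False] that other_strand_eq[OF diag, of q "loc (j, False)" "x j"] by metis
  show ?thesis
  proof (cases "j : S")
   case True
   hence "?ov (x j) ~= ov (x j)" using changed_diagram(2)[OF diag x(2)[OF j(1)], of "x ` S"] by blast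
   hence o: "?ov (x j) = loc (j, False)" using two[of "?ov (x j)"] q j loc(2)[OF j(1)] by metis
   hence "p = loc (j, True)" using two[OF p(1) j(2)] p(3) j by metis
   thus ?thesis unfolding j(2) o using hS_at[OF S j(1)] True by (simp add: sg_def)
  next
   case False
   hence "x j ~: x ` S" using x(1) S j(1) unfolding inj_on_def by blast
   hence o: "?ov (x j) = loc (j, True)" using changed_diagram(3)[OF diag] loc(2)[OF j(1)] by simp
   hence "p = loc (j, False)" using two[OF p(1) j(2)] p(3) j by metis
   thus ?thesis unfolding j(2) o using hS_at[OF S j(1)] False by (simp add: sg_def)
  qed
 next
  case False
  hence "pt P p ~: x ` S" using S by auto
  hence o: "?ov (pt P p) = ov (pt P p)" by (rule changed_diagram(3)[OF diag])
  have np: "loc e ~= q" if e: "e : J \<times> UNIV" and qp: "pt P q = pt P p" for e q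
  proof
   assume "loc e = q"
   hence "pt P p = x (fst e)" using loc(1)[of "fst e" "snd e"] e qp by (simp add: mem_Times_iff)
   thus False using False e by (auto simp: mem_Times_iff)
  qed
  have h: "pt (hS S) q' = pt hb q'" if "q' : params P" "pt P q' = pt P p" for q'
   by (rule hS_other[OF S]) (use that p np in "simp_all add: double_params_def")
  have "pt (hS S) p = pt hb p" "pt (hS S) (ov (pt P p)) = pt hb (ov (pt P p))"
   by (rule h; use p q o in simp)+
  moreover have "pt hb p < pt hb (ov (pt P p))" using hb p o unfolding heights_ok_def by auto
  ultimately show ?thesis unfolding o by simp
 qed
qed

definition K0 :: "(real => R3) list" where "K0 = lifted P (hS {})"

lemma hS_empty: "l < length P ==> hS {} ! l = h0 ! l"
 using hS_eq_h0[of "{}" l] by auto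

lemma length_hS: "length (hS S) = length P" unfolding hS_def by simp

lemma K0_nth: "l < length P ==> (K0 ! l) u = ((P ! l) u, (h0 ! l) u)"
 unfolding K0_def using length_hS[of "{}"] hS_empty by simp

lemma length_K0: "length K0 = length P" unfolding K0_def using length_hS by simp

lemma change_crossings_empty: "change_crossings P {} ov = ov" unfolding change_crossings_def by auto

lemma K0_embedded: "embedded K0"
 unfolding K0_def using heights_ok_embedded[OF diag] hS_ok[of "{}"] change_crossings_empty by simp

definition Ph :: "nat => R3 => R3" where
 "Ph j = xcollar rh (P ! fst (loc (j, True))) (snd (loc (j, True))) (P ! fst (loc (j, False))) (snd (loc (j, False)))"

abbreviation (input) "SPh j w == stereo (Ph j w)"

lemma Phi_collar3: "j : J ==> collar3 (Ph j) xbox"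
 and Phi_det3: "j : J ==> w : xbox ==> jac3 (Ph j) w > 0"
 unfolding Ph_def
 by (rule xcollar_collar3[OF P_C1[OF loc_len(1)] P_C1[OF loc_len(1)] rh(2,1)]; (assumption | erule (4) chart_inj, assumption | erule (2) chart_pos))+

lemma Phi_fst: "j : J ==> fst (Ph j w) = along P (loc (j, True)) (lp rh w)
  + along P (loc (j, False)) (lm rh w) - x j" "snd (Ph j w) = 2 * Im (fst w)"
 unfolding Ph_def xcollar_def using P_loc[of j False] by simp_all

lemma Phi_near: "j : J ==> w : xbox ==> norm (fst (Ph j w) - x j) < et"
 unfolding Phi_fst by (intro box_small xbox_bounds rh)

lemma Phi_disjoint: "j : J ==> j' : J ==> j ~= j' ==> w : xbox ==> w' : xbox ==> Ph j w ~= Ph j' w'"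
proof
 assume a: "j : J" "j' : J" "j ~= j'" "w : xbox" "w' : xbox" "Ph j w = Ph j' w'"
 have "norm (x j - x j') <= norm (fst (Ph j w) - x j) + norm (fst (Ph j' w') - x j')"
  using norm_triangle_ineq4[of "fst (Ph j' w') - x j'" "fst (Ph j w) - x j"] a(6) by simp
 thus False using Phi_near[OF a(1,4)] Phi_near[OF a(2,5)] et(2)[OF a(1-3)] by linarith
qed

lemma disjoint_cyl: "disj_cyl Ph J"
 unfolding disjoint_family_on_def
proof (intro ballI impI Int_emptyI; elim imageE)
 fix j j' y w w' assume a: "j : J" "j' : J" "j ~= j'" "y = Ph j w" "w : cylinder" "y = Ph j' w'" "w' : cylinder"
 thus False using Phi_disjoint[OF a(1-3) subsetD[OF cylinder_xbox a(5)] subsetD[OF cylinder_xbox a(7)]] by metis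
qed

definition sz :: "bool => real => R3" where
 "sz b a = (if b then (Complex (a / (4 * rh)) (1/2), a / (2 * rh)) else (Complex (a / (4 * rh)) (- (1/2)), - (a / (2 * rh))))"

lemma sz_on_strand:
 assumes j: "j : J" and a: "abs(off (loc (j, b)) u) <= r"
 shows "(K0 ! fst (loc (j, b))) u = Ph j (sz b (off (loc (j, b)) u))"
proof -
 define a where "a = off (loc (j, b)) u"
 have l: "fst (loc (j, b)) < length P" using loc_len j by simp
 have P1: "(P ! fst (loc (j, b))) u = along P (loc (j, b)) a"
  unfolding a_def using closed_C1_rep(1)[OF P_C1[OF l]] by simp
 have h: "(h0 ! fst (loc (j, b))) u = sg (j, b)" by (rule h0_arc[OF j assms(2)])
 have r1: "rh * (2 * (a / (4 * rh)) + a / (2 * rh)) = a" "rh * (2 * (a / (4 * rh)) - a / (2 * rh)) = 0" using rh by (simp_all add: field_simps)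
 show ?thesis unfolding K0_nth[OF l] P1 h a_def[symmetric]
 proof (rule prod_eqI)
  show "snd (along P (loc (j, b)) a, sg (j, b)) = snd (Ph j (sz b a))"
   unfolding Phi_fst(2) sz_def sg_def by simp
  show "fst (along P (loc (j, b)) a, sg (j, b)) = fst (Ph j (sz b a))"
   unfolding Phi_fst(1)[OF j] sz_def using r1 P_loc[OF j, of True] P_loc[OF j, of False] by (cases b) simp_all
 qed
qed

lemma strand_coords:
 assumes j: "j : J" and w: "w : xbox" and l: "l < length P" and eq: "(K0 ! l) u = Ph j w"
 obtains b where "l = fst (loc (j, b))" "abs(off (loc (j, b)) u) < r" "w = sz b (off (loc (j, b)) u)"
proof -
 have f: "(P ! l) u = fst (Ph j w)" "(h0 ! l) u = 2 * Im (fst w)" using eq K0_nth[OF l, of u] Phi_fst(2)[of j w] by (metis fst_conv, metis snd_conv)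
 have "norm ((P ! l) u - x j) < et" unfolding f(1) by (rule Phi_near[OF j w])
 then obtain b where b: "l = fst (loc (j, b))" "abs(off (loc (j, b)) u) < r" using near[OF j l] by blast
 define a where "a = off (loc (j, b)) u"
 have P1: "(P ! l) u = along P (loc (j, b)) a"
  unfolding a_def b(1) using closed_C1_rep(1)[OF P_C1[OF loc_len(1)[OF j]]] by simp
 have h: "2 * Im (fst w) = sg (j, b)" using h0_arc[OF j, of u b] b f(2) by simp
 define A B where "A = lp rh w" and "B = lm rh w"
 have AB: "abs A < r" "abs B < r" using xbox_bounds[OF w rh(1)] rh(2) unfolding A_def B_def by linarith+
 have e: "along P (loc (j, b)) a + x j = along P (loc (j, True)) A + along P (loc (j, False)) B"
  using f(1) unfolding Phi_fst(1)[OF j] P1 A_def B_def by (simp add: algebra_simps)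
 have ab: "A = (if b then a else 0) & B = (if b then 0 else a)"
 proof (cases b)
  case True
  have "A = a & B = 0" by (rule chart_inj[OF j AB]) (use b r e P_loc[OF j, of False] True in "auto simp: a_def")
  thus ?thesis using True by simp
 next
  case False
  have "A = 0 & B = a" by (rule chart_inj[OF j AB]) (use b r e P_loc[OF j, of True] False in "auto simp: a_def add.commute")
  thus ?thesis using False by simp
 qed
 have RS: "Re (fst w) = (A + B) / (4 * rh)" "snd w = (A - B) / (2 * rh)" unfolding A_def B_def using rh by (simp_all add: field_simps)
 have "w = sz b a"
  using ab h RS unfolding sz_def sg_def by (cases b) (auto simp: prod_eq_iff complex_eq_iff)
 thus ?thesis using that b unfolding a_def by blast
qed

lemma sz_lateral: "sz b a : cylinder ==> norm (fst (sz b a)) < 1"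
proof -
 assume "sz b a : cylinder"
 hence "abs(a / (2 * rh)) <= 1" unfolding sz_def by (auto simp: mem_Times_iff split: if_splits)
 hence "(a / (2 * rh))^2 <= 1^2" by (rule abs_le_square)
 moreover have "(norm (fst (sz b a)))^2 = (a / (2 * rh))^2 / 4 + 1 / 4"
  unfolding sz_def cmod_power2 by (simp add: power_divide power_mult_distrib)
 ultimately have "(norm (fst (sz b a)))^2 < 1^2" by simp
 thus ?thesis by (rule power_less_imp_less_base) simp
qed

lemma avoid_lateral: "l < length K0 ==> j : J ==> (K0 ! l) u ~: Ph j ` lateral"
proof
 assume l: "l < length K0" and j: "j : J" and "(K0 ! l) u : Ph j ` lateral"
 then obtain w where w: "w : lateral" "(K0 ! l) u = Ph j w" by (elim imageE)
 have wc: "w : cylinder" using w(1) by (auto simp: mem_Times_iff)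
 obtain b where b: "w = sz b (off (loc (j, b)) u)"
  by (rule strand_coords[OF j subsetD[OF cylinder_xbox wc] _ w(2)]) (use l length_K0 in auto)
 have "norm (fst w) < 1" using sz_lateral[OF wc[unfolded b]] b by simp
 thus False using w(1) by (auto simp: mem_Times_iff)
qed

definition wS :: "nat set => nat => real => complex" where "wS S j = (if j : S then wstar else (%_. 0))"

text \<open>Multiplication by \<open>exp (wstar t)\<close> exchanges the heights: on the upper strand by the choice of
\<open>wstar\<close>, and on the lower one because it is the antipode.\<close>
lemma twisted_strand:
 assumes S: "S <= J" and l: "l < length P"
 shows "exp_mult J Ph (wS S) ((K0 ! l) u) = ((P ! l) u, (hS S ! l) u)"
proof (cases rule: collar_cases[of J "(K0 ! l) u" Ph])
 case (2 j w)
 note j = 2(1) and w = 2(2,3)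
 obtain b where b: "l = fst (loc (j, b))" "abs(off (loc (j, b)) u) < r" "w = sz b (off (loc (j, b)) u)"
  by (rule strand_coords[OF j subsetD[OF cylinder_xbox w(1)] l w(2)])
 define a where "a = off (loc (j, b)) u"
 have wa: "w = sz b a" unfolding a_def by (rule b(3))
 have b2: "abs(off (loc (j, b)) u) <= r" using b(2) by simp
 have hs: "(hS S ! l) u = sg (j, b) * (if j : S then 1 - 2 * cap 1 (a / (2 * rh)) else 1)"
  unfolding b(1) hS_arc[OF S j b2] arc_bump_def a_def ..
 have cm: "exp_mult J Ph (wS S) ((K0 ! l) u) = Ph j (exp (wS S j (snd w)) * fst w, snd w)"
  unfolding w(2) by (rule collar_mult_in[OF disjoint_cyl collar3D(7)[OF Phi_collar3[OF j]] j w(1)])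
 have Pl: "(P ! l) u = fst (Ph j w)" using w(2) K0_nth[OF l, of u] by (metis fst_conv)
 show ?thesis
 proof (cases "j : S")
  case False
  have "(exp (wS S j (snd w)) * fst w, snd w) = w" unfolding wS_def using False by simp
  moreover have "(hS S ! l) u = (h0 ! l) u" using hs False h0_arc[OF j b2] b(1) by simp
  ultimately show ?thesis unfolding cm using w(2) K0_nth[OF l, of u] by simp
 next
  case True
  have e: "exp (wS S j (snd w)) * fst w = (if b then zstar (snd w) else - zstar (snd w))"
  proof -
   have "fst w = (if b then Complex (snd w / 2) (1/2) else - Complex (snd w / 2) (1/2))"
    unfolding wa sz_def by (simp add: complex_eq_iff)
   thus ?thesis unfolding wS_def using True exp_wstar[of "snd w"] by simp
  qed
  have z: "zstar (snd w) = Complex (snd w / 2) (1/2 - cap 1 (a / (2 * rh)))"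
   unfolding zstar_def wa sz_def using cap_even[of 1 "a / (2 * rh)"] by simp
  show ?thesis unfolding cm
  proof (rule prod_eqI)
   have "Re (exp (wS S j (snd w)) * fst w) = Re (fst w)" unfolding e z unfolding wa sz_def by simp
   thus "fst (Ph j (exp (wS S j (snd w)) * fst w, snd w)) = fst ((P ! l) u, (hS S ! l) u)"
    unfolding fst_conv Pl Phi_fst(1)[OF j] snd_conv by simp
   show "snd (Ph j (exp (wS S j (snd w)) * fst w, snd w)) = snd ((P ! l) u, (hS S ! l) u)"
    unfolding Phi_fst(2) fst_conv snd_conv e z hs sg_def using True by simp
  qed
 qed
next
 case 1
 have "(hS S ! l) u = (h0 ! l) u"
 proof (rule hS_eq_h0[OF S l], rule ccontr)
  fix e :: "nat \<times> bool" assume e: "e : S \<times> UNIV" "fst (loc e) = l" "~ 2 * rh <= abs(off (loc e) u)"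
  obtain j b where jb: "e = (j, b)" by fastforce
  have j: "j : J" using e S jb by auto
  define a where "a = off (loc (j, b)) u"
  have a2: "abs a < 2 * rh" using e(3) unfolding jb a_def by simp
  have K: "(K0 ! l) u = Ph j (sz b a)"
   using sz_on_strand[OF j, of u b] a2 rh r e(2) unfolding jb a_def by simp
  have "sz b a : cylinder"
  proof -
   have t: "abs(a / (2 * rh)) <= 1" using a2 rh unfolding abs_div_pos[OF mult_pos_pos[OF zero_less_numeral rh(1)], symmetric]
    by (simp add: divide_le_eq)
   hence "(a / (2 * rh))^2 <= 1^2" by (rule abs_le_square)
   moreover have "(norm (fst (sz b a)))^2 = (a / (2 * rh))^2 / 4 + 1 / 4"
    unfolding sz_def cmod_power2 by (simp add: power_divide power_mult_distrib)
   ultimately have "(norm (fst (sz b a)))^2 <= 1^2" by simp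
   hence "norm (fst (sz b a)) <= 1" by (rule power2_le_imp_le) simp
   moreover have "abs(snd (sz b a)) <= 1" using t unfolding sz_def by simp
   ultimately show ?thesis by (auto simp: mem_Times_iff)
  qed
  hence "(K0 ! l) u : Ph j ` cylinder" unfolding K by (rule imageI)
  thus False using 1 j by blast
 qed
 moreover have "exp_mult J Ph (wS S) ((K0 ! l) u) = (K0 ! l) u"
  by (rule collar_mult_out[OF 1])
 ultimately show ?thesis using K0_nth[OF l, of u] by simp
qed

lemma twist_invariant:
 assumes f: "link_invariant f" and S: "S <= J"
 shows "f (t_moves 1 SPh S (st K0)) = f (st (lifted P (hS S)))"
proof -
 have finS: "finite S" using S J finite_subset by blast
 have disjS: "disj_cyl Ph S" by (rule disj_cyl_mono[OF disjoint_cyl S])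
 have injJ: "!!j. j : J ==> inj_on (Ph j) cylinder" by (rule collar3D(7)[OF Phi_collar3])
 have disj4: "disj_cyl SPh S" by (rule disj_cyl_image[OF stereo_inj refl disjS])
 have inj4: "inj_on (SPh j) cylinder" if "j : S" for j
 proof (rule inj_onI)
  fix v w assume vw: "v : cylinder" "w : cylinder" "stereo (Ph j v) = stereo (Ph j w)"
  hence "Ph j v = Ph j w" using stereo_inj by (metis injD)
  thus "v = w" using inj_onD[OF injJ[OF subsetD[OF S that]] _ vw(1,2)] by blast
 qed
 have "t_moves 1 SPh S (st K0)
   = curve_map (twists 1 S SPh) (st K0)"
  by (rule t_moves_eq[OF finS disj4 inj4])
 also have "... = st (curve_map (exp_mult J Ph (twist_log 1 S)) K0)"
 proof (rule nth_equalityI)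
  fix l assume "l < length (curve_map (twists 1 S SPh) (st K0))"
  hence l: "l < length K0" by simp
  have tr: "twists 1 S SPh (stereo y)
    = stereo (twists 1 S Ph y)" for y
   by (rule collar_mult_transfer[OF disjS _ stereo_inj]) (use injJ S in auto)
  have ex: "twists 1 S Ph = exp_mult J Ph (twist_log 1 S)" by (rule twists_eq_exp_mult[OF disjoint_cyl injJ S])
  show "curve_map (twists 1 S SPh) (st K0) ! l
    = st (curve_map (exp_mult J Ph (twist_log 1 S)) K0) ! l"
   using l tr[unfolded ex] by simp
 qed simp
 finally have tm: "t_moves 1 SPh S (st K0) = st (curve_map (exp_mult J Ph (twist_log 1 S)) K0)" .
 have "f (st (curve_map (exp_mult J Ph (twist_log 1 S)) K0)) = f (st (curve_map (exp_mult J Ph (wS S)) K0))"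
 proof (rule collar_mult_invariant(1)[OF f K0_embedded J Phi_collar3 disjoint_cyl avoid_lateral])
  show "log_profile (twist_log 1 S j)" for j by (rule log_profile_twist_log)
  show "log_profile (wS S j)" for j unfolding wS_def using log_profile_wstar log_profile_zero by simp
  show "twist_log 1 S j t = wS S j t" if "1 <= abs t" for j t unfolding twist_log_def wS_def using wstar_end[OF that] by simp
 qed
 moreover have "curve_map (exp_mult J Ph (wS S)) K0 = lifted P (hS S)"
 proof (rule nth_equalityI)
  show "length (curve_map (exp_mult J Ph (wS S)) K0) = length (lifted P (hS S))"
   using length_K0 length_hS by simp
  fix l assume "l < length (curve_map (exp_mult J Ph (wS S)) K0)"
  hence l: "l < length P" using length_K0 by simp
  show "curve_map (exp_mult J Ph (wS S)) K0 ! l = lifted P (hS S) ! l"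
   using l length_K0 length_hS twisted_strand[OF S l] by simp
 qed
 ultimately show ?thesis unfolding tm by simp
qed

lemma K0_velocity:
 assumes "j : J"
 shows "velocity (st K0) (loc (j, b)) = dd stereo (Ph j (sz b 0)) (vd (P ! fst (loc (j, b))) (snd (loc (j, b))), 0)"
  "pt (st K0) (loc (j, b)) = stereo (Ph j (sz b 0))"
proof -
 let ?l = "fst (loc (j, b))" and ?u = "snd (loc (j, b))"
 have l: "?l < length P" by (rule loc_len(1)[OF assms])
 have r0: "rep (?u - ?u) = 0" by (simp add: rep_def)
 have K: "(K0 ! ?l) ?u = Ph j (sz b 0)" using sz_on_strand[OF assms, of ?u b] r0 r by simp
 thus "pt (st K0) (loc (j, b)) = stereo (Ph j (sz b 0))" unfolding pt_def using l length_K0 by simp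
 have hz: "vd (h0 ! ?l) ?u = 0"
 proof (rule vd_eqI, rule has_vd_transform[of "%_. sg (j, b)" _ _ "ball ?u r"])
  fix u assume "u : ball ?u r"
  hence "abs(rep (u - ?u)) <= r" using rep_le_abs[of "u - ?u" 0] by (simp add: dist_real_def abs_minus_commute)
  thus "sg (j, b) = (h0 ! ?l) u" using h0_arc[OF assms, of u b] by simp
 qed (use r in auto)
 have "vd (K0 ! ?l) ?u = (vd (P ! ?l) ?u, 0)"
 proof -
  have "K0 ! ?l = (%u. ((P ! ?l) u, (h0 ! ?l) u))" using K0_nth[OF l] by auto
  thus ?thesis using closed_C1_Pair(2)[OF P_C1[OF l] h0_C1[OF l]] hz by simp
 qed
 thus "velocity (st K0) (loc (j, b)) = dd stereo (Ph j (sz b 0)) (vd (P ! ?l) ?u, 0)"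
  unfolding velocity_def using l length_K0 closed_C1_stereo(2)[OF embedded_C1[OF K0_embedded], of ?l ?u] K by simp
qed

definition edisk :: "nat => complex => real^4" where "edisk j z = stereo (Ph j (z, 0))"

definition zbox :: "complex set" where "zbox = {z. abs(Re z) < 2 & abs(Im z) < 2}"

lemma edisk_derivative:
 assumes j: "j : J" and z: "z : zbox"
 shows "frechet_derivative (edisk j) (at z) v = dd stereo (Ph j (z, 0)) (dd (Ph j) (z, 0) (v, 0))"
  "(edisk j has_derivative (%v. dd stereo (Ph j (z, 0)) (dd (Ph j) (z, 0) (v, 0)))) (at z)"
proof -
 have zx: "(z, 0) : xbox" using z unfolding zbox_def xbox_def by simp
 note C = collar3D[OF Phi_collar3[OF j]]
 have "((%z::complex. (z, 0::real)) has_derivative (%v. (v, 0))) (at z)" by (auto intro!: dintros)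
 from has_derivative_compose[OF this C1_onD(1)[OF C(1,3) zx]]
 have "((%z. Ph j (z, 0)) has_derivative (%v. dd (Ph j) (z, 0) (v, 0))) (at z)" .
 from has_derivative_compose[OF this C1_onD(1)[OF open_UNIV C1_on_stereo]]
 show d: "(edisk j has_derivative (%v. dd stereo (Ph j (z, 0)) (dd (Ph j) (z, 0) (v, 0)))) (at z)"
  unfolding edisk_def[abs_def] by simp
 show "frechet_derivative (edisk j) (at z) v = dd stereo (Ph j (z, 0)) (dd (Ph j) (z, 0) (v, 0))"
  unfolding frechet_derivative_at[OF d, symmetric] ..
qed

lemma open_zbox: "open zbox" unfolding zbox_def by (intro open_Collect_conj open_Collect_less cintros)

lemma cball_zbox: "cball 0 1 <= zbox"
proof
 fix z :: complex assume "z : cball 0 1"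
 thus "z : zbox" unfolding zbox_def using abs_Re_le_cmod[of z] abs_Im_le_cmod[of z] by auto
qed

lemma zbox_xbox: "z : zbox ==> (z, 0) : xbox" unfolding zbox_def xbox_def by simp

lemma embedded_edisk: "j : J ==> embedded_disk (edisk j)"
 unfolding embedded_disk_def
proof (intro exI[of _ zbox] conjI ballI)
 assume j: "j : J"
 note C = collar3D[OF Phi_collar3[OF j]]
 show "open zbox" by (rule open_zbox)
 show "cball 0 1 <= zbox" by (rule cball_zbox)
 show "edisk j ` zbox <= S3" unfolding edisk_def using stereo_in_S3 by (intro image_subsetI) (simp only:)
 show "inj_on (edisk j) zbox"
 proof (rule inj_onI)
  fix z z' assume z: "z : zbox" "z' : zbox" "edisk j z = edisk j z'"
  hence "Ph j (z, 0) = Ph j (z', 0)" using stereo_inj unfolding edisk_def by (metis injD)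
  hence "(z, 0::real) = (z', 0)" by (rule inj_onD[OF C(4) _ zbox_xbox[OF z(1)] zbox_xbox[OF z(2)]])
  thus "z = z'" by simp
 qed
 show "C1_on zbox (edisk j)"
 proof (rule C1_onI(1)[OF open_zbox edisk_derivative(2)[OF j]])
  fix v :: complex
  have c: "continuous_on zbox (%z. (z, 0::real))" by (intro cintros)
  have c1: "continuous_on zbox (%z. dd (Ph j) (z, 0))"
   by (rule cont_comp[OF C1_onD(3)[OF C(1,3)] c]) (use zbox_xbox in auto)
  have c2: "continuous_on zbox (%z. Ph j (z, 0))"
   by (rule cont_comp[OF C1_onD(4)[OF C(1,3)] c]) (use zbox_xbox in auto)
  have c3: "continuous_on zbox (%z. dd stereo (Ph j (z, 0)))"
   by (rule cont_comp[OF C1_onD(3)[OF open_UNIV C1_on_stereo] c2]) auto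
  show "continuous_on zbox (%z. dd stereo (Ph j (z, 0)) (dd (Ph j) (z, 0) (v, 0)))"
   by (intro cintros c1 c3)
 qed
 fix z assume z: "z : zbox"
 show "inj (frechet_derivative (edisk j) (at z))"
 proof (rule injI)
  fix u v assume "frechet_derivative (edisk j) (at z) u = frechet_derivative (edisk j) (at z) v"
  hence "dd stereo (Ph j (z, 0)) (dd (Ph j) (z, 0) (u, 0) - dd (Ph j) (z, 0) (v, 0)) = 0"
   unfolding edisk_derivative(1)[OF j z] by (simp add: blinfun.diff_right)
  hence "dd (Ph j) (z, 0) (u, 0) = dd (Ph j) (z, 0) (v, 0)" using dd_stereo_eq_0 by fastforce
  hence "(u, 0::real) = (v, 0)" by (rule injD[OF C(5)[OF zbox_xbox[OF z]]])
  thus "u = v" by simp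
 qed
qed

lemma sz0: "sz b 0 = (if b then \<i> / 2 else - \<i> / 2, 0)"
 unfolding sz_def by (auto simp: complex_eq_iff)

lemma intersections_eq:
 assumes j: "j : J"
 shows "intersections (st K0) (edisk j) = {(loc (j, True), \<i> / 2), (loc (j, False), - \<i> / 2)}"
proof -
 have sub: "(p, z) : {(loc (j, True), \<i> / 2), (loc (j, False), - \<i> / 2)}"
  if p: "p : params (st K0)" "z : cball 0 1" "pt (st K0) p = edisk j z" for p z
 proof -
  obtain l u where lu: "p = (l, u)" by fastforce
  have l: "l < length P" "u : {0..<1}" using p(1) length_K0 unfolding lu params_def by auto
  have "stereo ((K0 ! l) u) = stereo (Ph j (z, 0))" using p(3) l length_K0 unfolding lu pt_def edisk_def by simp
  hence "(K0 ! l) u = Ph j (z, 0)" using stereo_inj by (metis injD)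
  from strand_coords[OF j zbox_xbox[OF subsetD[OF cball_zbox p(2)]] l(1) this]
  obtain b where b: "l = fst (loc (j, b))" "(z, 0) = sz b (off (loc (j, b)) u)" by metis
  have z0: "off (loc (j, b)) u = 0" using b(2) rh unfolding sz_def by (auto split: if_splits)
  hence "u = snd (loc (j, b))" by (rule rep_eq_0_params[OF l(2) loc_len(2)[OF j]])
  hence "p = loc (j, b)" using lu b(1) by simp
  moreover have "z = (if b then \<i> / 2 else - \<i> / 2)" using b(2) unfolding z0 sz0 by simp
  ultimately show ?thesis by (cases b) auto
 qed
 have sup: "loc (j, b) : params (st K0) & (if b then \<i> / 2 else - \<i> / 2) : cball 0 1 & pt (st K0) (loc (j, b)) = edisk j (if b then \<i> / 2 else - \<i> / 2)" for b
  using loc(1)[OF j, of b] K0_velocity(2)[OF j, of b] length_K0 unfolding edisk_def sz0 params_def by (auto simp: norm_divide)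
 show ?thesis unfolding intersections_def
 proof (rule set_eqI)
  fix y :: "(nat * real) \<times> complex"
  obtain p z where y: "y = (p, z)" by fastforce
  have "(p, z) : {(loc (j, True), \<i> / 2), (loc (j, False), - \<i> / 2)}
   <-> p = loc (j, True) & z = \<i> / 2 | p = loc (j, False) & z = - \<i> / 2" by blast
  thus "y : {(p, z). p : params (st K0) & z : cball 0 1 & pt (st K0) p = edisk j z}
   <-> y : {(loc (j, True), \<i> / 2), (loc (j, False), - \<i> / 2)}"
   unfolding y mem_Collect_eq prod.case using sub[of p z] sup[of True] sup[of False] by (metis (no_types, lifting))
 qed
qed

lemma intersection_det_sign:
 assumes j: "j : J"
 shows "intersection_det (st K0) (edisk j) (loc (j, True)) (\<i> / 2) > 0"
  "intersection_det (st K0) (edisk j) (loc (j, False)) (- \<i> / 2) < 0"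
proof -
 define a where "a = vd (P ! fst (loc (j, True))) (snd (loc (j, True)))"
 define b where "b = vd (P ! fst (loc (j, False))) (snd (loc (j, False)))"
 have D: "det2 a b > 0" using chart_pos[OF j, of 0 0] r unfolding a_def b_def by simp
 have key: "EX k>0. intersection_det (st K0) (edisk j) (loc (j, c)) (if c then \<i> / 2 else - \<i> / 2) = k * (- 2 * det2 ((2 * rh) *R (a + b)) (if c then a else b))" for c
 proof -
  define z where "z = (if c then \<i> / 2 else - \<i> / 2 :: complex)"
  have zz: "z : zbox" unfolding z_def zbox_def by auto
  have R: "Re z = 0" unfolding z_def by simp
  have C1s: "closed_C1 (P ! fst (loc (j, True)))" "closed_C1 (P ! fst (loc (j, False)))" by (intro P_C1 loc_len j)+
  have d1: "dd (Ph j) (z, 0) (1, 0) = ((2 * rh) *R (a + b), 0)" "dd (Ph j) (z, 0) (\<i>, 0) = (0, 2)"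
   unfolding Ph_def xcollar_C1(2)[OF C1s] a_def b_def using R by (simp_all add: algebra_simps)
  have sz: "sz c 0 = (z, 0)" unfolding sz0 z_def by simp
  have v: "velocity (st K0) (loc (j, c)) = dd stereo (Ph j (z, 0)) (if c then a else b, 0)"
   using K0_velocity(1)[OF j, of c] unfolding sz a_def b_def by (cases c) simp_all
  have "intersection_det (st K0) (edisk j) (loc (j, c)) z = (2 / (Ph j (z, 0) \<bullet> Ph j (z, 0) + 1)) ^ 3 * (- 2 * det2 ((2 * rh) *R (a + b)) (if c then a else b))"
   unfolding intersection_det_def edisk_derivative(1)[OF j zz] v d1 unfolding edisk_def det_stereo_frame det3_planar ..
  thus ?thesis unfolding z_def[symmetric] using inner_plus_one_pos[of "Ph j (z, 0)"]
   by (intro exI[of _ "(2 / (Ph j (z, 0) \<bullet> Ph j (z, 0) + 1)) ^ 3"]) auto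
 qed
 have e: "- 2 * det2 ((2 * rh) *R (a + b)) a = 4 * rh * det2 a b" "- 2 * det2 ((2 * rh) *R (a + b)) b = - (4 * rh * det2 a b)"
  unfolding det2_def by (simp_all add: algebra_simps)
 have pos: "4 * rh * det2 a b > 0" using D rh by simp
 show "intersection_det (st K0) (edisk j) (loc (j, True)) (\<i> / 2) > 0"
 proof -
  obtain k where k: "k > 0" "intersection_det (st K0) (edisk j) (loc (j, True)) (\<i> / 2) = k * (4 * rh * det2 a b)"
   using key[of True] unfolding if_True e(1) by blast
  show ?thesis unfolding k(2) by (rule mult_pos_pos[OF k(1) pos])
 qed
 show "intersection_det (st K0) (edisk j) (loc (j, False)) (- \<i> / 2) < 0"
 proof -
  obtain k where k: "k > 0" "intersection_det (st K0) (edisk j) (loc (j, False)) (- \<i> / 2) = k * - (4 * rh * det2 a b)"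
   using key[of False] unfolding if_False e(2) by blast
  show ?thesis unfolding k(2) by (rule mult_pos_neg[OF k(1)]) (use pos in simp)
 qed
qed

lemma edisk_transverse: "j : J ==> transverse (st K0) (edisk j)" and edisk_lk: "j : J ==> lk (st K0) (edisk j) = 0"
proof -
 assume j: "j : J"
 note I = intersections_eq[OF j] and D = intersection_det_sign[OF j]
 show "transverse (st K0) (edisk j)" unfolding transverse_def I using D by (auto simp: norm_divide)
 have "(loc (j, True), \<i> / 2) ~= (loc (j, False), - \<i> / 2)" using loc(2,3)[OF j] by auto
 thus "lk (st K0) (edisk j) = 0" unfolding lk_def I using D by simp
qed

lemma Phi_collar: "j : J ==> collar (st K0) (edisk j) (SPh j)"
 unfolding collar_def
proof (intro conjI)
 assume j: "j : J"
 note C = collar3D[OF Phi_collar3[OF j]]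
 have comp: "C1_on xbox (SPh j)" "!!w. w : xbox ==> blinfun_apply (dd (SPh j) w) = (%v. dd stereo (Ph j w) (dd (Ph j) w v))"
  using C1_on_compose[OF C(1,3) open_UNIV C1_on_stereo] by auto
 show "EX W. open W & cylinder <= W & (SPh j) ` W <= S3 & inj_on (SPh j) W & C1_on W (SPh j) &
    (ALL w:W. 0 < frame_det (SPh j) w)"
 proof (intro exI[of _ xbox] conjI ballI)
  show "open xbox" "cylinder <= xbox" using C by auto
  show "(SPh j) ` xbox <= S3" using stereo_in_S3 by (intro image_subsetI) (simp only:)
  show "inj_on (SPh j) xbox"
  proof (rule inj_onI)
   fix v w assume vw: "v : xbox" "w : xbox" "stereo (Ph j v) = stereo (Ph j w)"
   hence "Ph j v = Ph j w" using stereo_inj by (metis injD)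
   thus "v = w" by (rule inj_onD[OF C(4) _ vw(1,2)])
  qed
  show "C1_on xbox (SPh j)" by (rule comp(1))
  fix w assume w: "w : xbox"
  have fd: "frechet_derivative (SPh j) (at w) = (%v. dd stereo (Ph j w) (dd (Ph j) w v))"
   using C1_onD(2)[OF C(1) comp(1) w] comp(2)[OF w] by simp
  show "0 < frame_det (SPh j) w"
   unfolding fd det_stereo_frame using Phi_det3[OF j w] inner_plus_one_pos[of "Ph j w"] by simp
 qed
 show "ALL z:cball 0 1. stereo (Ph j (z, 0)) = edisk j z" unfolding edisk_def by simp
 show "pt (st K0) ` params (st K0) Int (SPh j) ` lateral = {}"
  unfolding disjoint_iff
 proof (intro allI impI notI)
  fix y assume "y : pt (st K0) ` params (st K0)" "y : (SPh j) ` lateral"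
  then obtain p w where pw: "p : params (st K0)" "y = pt (st K0) p" "w : lateral" "y = stereo (Ph j w)" by (elim imageE)
  have l: "fst p < length K0" using pw(1) unfolding params_def by auto
  hence "stereo ((K0 ! fst p) (snd p)) = stereo (Ph j w)" using pw(2,4) unfolding pt_def by simp
  hence "(K0 ! fst p) (snd p) = Ph j w" using stereo_inj by (metis injD)
  thus False using avoid_lateral[OF l j, of "snd p"] pw(3) by (metis imageI)
 qed
qed

theorem nq_alternating_sum:
 assumes f: "link_invariant f" "nq_finite 1 q m f" and Jm: "J = {..m}"
  and L: "!!S. S <= J ==> has_diagram (L S) P (change_crossings P (x ` S) ov)"
 shows "alternating_sum J (%S. f (L S)) = 0"
proof -
 have dc: "disj_cyl SPh {..m}" by (rule disj_cyl_image[OF stereo_inj refl disjoint_cyl[unfolded Jm]])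
 have "edisk j ` cball 0 1 <= SPh j ` cylinder" for j unfolding edisk_def by force
 hence de: "disjoint_family_on (%j. edisk j ` cball 0 1) {..m}" using dc unfolding disjoint_family_on_def by blast
 have "alternating_sum {..m} (%S. f (t_moves 1 SPh S (st K0))) = 0"
 proof (rule f(2)[unfolded nq_finite_def, rule_format])
  show "is_link (st K0)" by (rule is_link_st[OF K0_embedded])
  show "!!j. j : {..m} ==> embedded_disk (edisk j) & transverse (st K0) (edisk j) & int q dvd lk (st K0) (edisk j)"
   using embedded_edisk edisk_transverse edisk_lk Jm by simp
  show "!!j. j : {..m} ==> collar (st K0) (edisk j) (SPh j)" using Phi_collar Jm by simp
 qed (rule de dc)+
 moreover have "f (t_moves 1 SPh S (st K0)) = f (L S)" if S: "S <= J" for S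
 proof -
  have "has_diagram (st (lifted P (hS S))) P (change_crossings P (x ` S) ov)"
   unfolding has_diagram_iff using hS_ok[OF S] by blast
  thus ?thesis
   using twist_invariant[OF f(1) S] same_diagram_invariant[OF f(1) changed_diagram(1)[OF diag] _ L[OF S]] by metis
 qed
 ultimately show ?thesis unfolding Jm[symmetric] using alt_sum_cong[of J] by (metis (no_types, lifting))
qed

end

section \<open>From twists to crossing changes\<close>

lemma finite_uniform_bound:
 assumes "finite I" and ex: "!!i. i : I ==> EX e>0. Q i (e::real)"
  and mono: "!!i d e. Q i e ==> 0 < d ==> d <= e ==> Q i d"
 obtains e where "e > 0" "!!i. i : I ==> Q i e"
proof -
 have "EX e>0. ALL i:I. Q i e"
  using assms(1) ex
 proof (induction I rule: finite_induct)
  case (insert i I)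
  obtain d e where de: "d > 0" "Q i d" "e > 0" "ALL i:I. Q i e" using insert by blast
  have p: "min d e > 0" using de by simp
  have "Q i (min d e)" by (rule mono[OF de(2) p]) simp
  moreover have "ALL i:I. Q i (min d e)" using mono[OF _ p] de(4) by (meson min.cobounded2)
  ultimately show ?case using p by (intro exI[of _ "min d e"]) simp
 qed (auto intro: exI[of _ 1])
 thus thesis using that by blast
qed

abbreviation (input) "close_strand P r l x u == EX p:params P. fst p = l & pt P p = x & abs(off p u) < r"

lemma strands_near_point:
 assumes P: "immersed P" and l: "l < length P" and r: "r > 0"
 shows "EX e>0. ALL u. norm ((P ! l) u - x) < e --> (close_strand P r l x u)"
proof -
 note C = immersed_nth[OF P l]
 define Q where "Q = (%u e. norm ((P ! l) u - x) < e --> (close_strand P r l x u))"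
 have cont: "continuous_on UNIV (%u. norm ((P ! l) u - x))" by (intro cintros closed_C1_cont[OF C])
 have shift: "abs(rep (u - s)) <= abs(rep (v - s))" if "u - v = of_int n" for u v s n
 proof -
  have "abs(rep (u - v)) <= 0" using rep_le_abs[of "u - v" n] that by simp
  thus ?thesis using rep_triangle[of "u - v" "v - s"] by simp
 qed
 obtain e where e: "e > 0" "!!u. u : {0..1} ==> Q u e"
 proof (rule compact_uniform_bound[of "{0..1::real}" Q])
  fix u0 :: real assume "u0 : {0..1}"
  show "EX U e. open U & u0 : U & e > 0 & (ALL u:U Int {0..1}. Q u e)"
  proof (cases "(P ! l) u0 = x")
   case True
   have p: "(l, frac u0) : params P" "pt P (l, frac u0) = x"
    using l True closed_C1_frac(1)[OF C, of u0] unfolding params_def pt_def by (auto simp: frac_lt_1)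
   have "abs(rep (u - frac u0)) < r" if "u : ball u0 r" for u
   proof -
    have "abs(rep (u - frac u0)) <= abs(u - frac u0 - of_int \<lfloor>u0\<rfloor>)" by (rule rep_le_abs)
    also have "... = abs(u - u0)" unfolding frac_def by simp
    also have "... < r" using that by (simp add: dist_real_def abs_minus_commute)
    finally show ?thesis .
   qed
   hence "ALL u:ball u0 r Int {0..1}. Q u 1" unfolding Q_def using p by force
   thus ?thesis using r by (intro exI[of _ "ball u0 r"] exI[of _ 1]) simp
  next
   case False
   define k where "k = norm ((P ! l) u0 - x) / 2"
   have k: "k > 0" using False unfolding k_def by simp
   have "open ((%u. norm ((P ! l) u - x)) -` {k<..})"
    by (rule open_vimage[OF open_greaterThan cont])
   moreover have "u0 : (%u. norm ((P ! l) u - x)) -` {k<..}" using k unfolding k_def by simp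
   moreover have "Q u k" if "u : (%u. norm ((P ! l) u - x)) -` {k<..}" for u using that unfolding Q_def by auto
   ultimately show ?thesis using k by blast
  qed
 qed (auto simp: Q_def)
 have "Q u e" for u
 proof -
  have q: "Q (frac u) e" by (rule e(2)) (simp add: frac_lt_1 less_imp_le)
  have "close_strand P r l x u" if nu: "norm ((P ! l) u - x) < e"
  proof -
   obtain p where p: "p : params P" "fst p = l" "pt P p = x" "abs(rep (frac u - snd p)) < r"
    using q nu unfolding Q_def closed_C1_frac(1)[OF C] by blast
   have "abs(off p u) < r" using shift[of u "frac u" "\<lfloor>u\<rfloor>" "snd p"] p(4) by (simp add: frac_def)
   thus ?thesis using p by blast
  qed
  thus ?thesis unfolding Q_def by blast
 qed
 thus ?thesis using e(1) unfolding Q_def by blast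
qed

lemma crossing_params_apart:
 assumes "regular_projection P"
 obtains e where "e > 0" "!!p p'. p : double_params P ==> p' : double_params P ==> p ~= p' ==> fst p = fst p' ==> abs(rep (snd p - snd p')) >= e"
proof -
 let ?C = "double_params P"
 have fin: "finite (?C \<times> ?C)" using finite_crossing_params(1)[OF assms] by blast
 obtain e where e: "e > 0" "!!y. y : ?C \<times> ?C ==> fst y ~= snd y --> fst (fst y) = fst (snd y) --> abs(rep (snd (fst y) - snd (snd y))) >= e"
 proof (rule finite_uniform_bound[OF fin, of "%y e. fst y ~= snd y --> fst (fst y) = fst (snd y) --> abs(rep (snd (fst y) - snd (snd y))) >= e"])
  fix y assume y: "y : ?C \<times> ?C"
  show "EX e>0. fst y ~= snd y --> fst (fst y) = fst (snd y) --> abs(rep (snd (fst y) - snd (snd y))) >= e"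
  proof (cases "fst y ~= snd y & fst (fst y) = fst (snd y)")
   case True
   have in01: "snd (fst y) : {0..<1}" "snd (snd y) : {0..<1}" using y unfolding double_params_def params_def by (auto simp: mem_Times_iff)
   have "rep (snd (fst y) - snd (snd y)) ~= 0"
    using rep_eq_0_params[OF in01] True by (metis prod_eqI)
   thus ?thesis by (intro exI[of _ "abs(rep (snd (fst y) - snd (snd y)))"]) simp
  qed (auto intro: exI[of _ 1])
 qed auto
 show thesis by (rule that[OF e(1)]) (use e(2) in force)
qed

text \<open>Which strand lies above is chosen so that the upper and the lower one form a positive frame, as the
orientation of the collar requires. A change of base point of the alternating sum repairs this.\<close>
theorem finite_type_if_nq_finite:
 fixes f :: "link => 'a::ab_group_add"
 assumes f: "link_invariant f" "nq_finite 1 q m f"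
 shows "finite_type m f"
 unfolding finite_type_def
proof (intro allI impI)
 fix P ov X and L :: "complex set => link"
 assume D: "is_diagram P ov" and X: "X <= crossings P" "card X = m + 1"
  and L: "ALL S<=X. has_diagram (L S) P (change_crossings P S ov)"
 have reg: "regular_projection P" using D unfolding is_diagram_def by blast
 note imm = regular_projectionD(1)[OF reg]
 have C1: "closed_C1 (P ! l)" if "l < length P" for l by (rule immersed_nth[OF imm that])
 have finX: "finite X" using finite_crossing_params(2)[OF reg] X(1) finite_subset by blast
 define ok where "ok = (%x y. fst y : params P & snd y : params P & fst y ~= snd y & pt P (fst y) = x & pt P (snd y) = x
   & det2 (velocity P (fst y)) (velocity P (snd y)) > 0)"
 have "EX y. ok x y" if xX: "x : X" for x
 proof -
  obtain p p' where p: "p : params P" "p' : params P" "p ~= p'" "pt P p = x" "pt P p' = x"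
   using xX X(1) unfolding crossings_def by blast
  have "det2 (velocity P p) (velocity P p') ~= 0" using regular_projectionD(2)[OF reg p(1,2,3)] p by simp
  moreover have "det2 (velocity P p') (velocity P p) = - det2 (velocity P p) (velocity P p')" unfolding det2_def by simp
  ultimately have "ok x (p, p') | ok x (p', p)" unfolding ok_def using p by auto
  thus ?thesis by blast
 qed
 then obtain st where st: "!!x. x : X ==> ok x (st x)" by metis
 have two: "p = fst (st x) | p = snd (st x)" if "x : X" "p : params P" "pt P p = x" for x p
  using st[OF that(1)] that regular_projectionD(3)[OF reg, of p "fst (st x)" "snd (st x)"] unfolding ok_def by metis
 define S0 where "S0 = {x : X. ov x ~= fst (st x)}"
 define ov0 where "ov0 = change_crossings P S0 ov"
 have D0: "is_diagram P ov0" unfolding ov0_def by (rule changed_diagram(1)[OF D])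
 have ov0: "ov0 x = fst (st x)" if x: "x : X" for x
 proof (cases "x : S0")
  case True
  have xc: "x : crossings P" using x X by blast
  have o: "ov x : params P" "pt P (ov x) = x" using D xc unfolding is_diagram_def by auto
  have "ov x = snd (st x)" using two[OF x o] True unfolding S0_def by blast
  moreover have "ov0 x : params P" "pt P (ov0 x) = x" "ov0 x ~= ov x" using changed_diagram(2)[OF D xc True] unfolding ov0_def by auto
  ultimately show ?thesis using two[OF x] by metis
 next
  case False
  hence "ov0 x = ov x" unfolding ov0_def by (rule changed_diagram(3)[OF D])
  thus ?thesis using False x unfolding S0_def by simp
 qed
 obtain x where x0: "bij_betw x {0..<m+1} X" using ex_bij_betw_nat_finite[OF finX] X(2) by metis
 have x: "bij_betw x {..m} X" using x0 by (simp add: atLeast0LessThan lessThan_Suc_atMost)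
 have xX: "x j : X" if "j : {..m}" for j using bij_betw_apply[OF x that] .
 have xim: "x ` {..m} = X" and xinj: "inj_on x {..m}" using x unfolding bij_betw_def by auto
 define loc where "loc = (%(j, b). if b then fst (st (x j)) else snd (st (x j)))"
 have okj: "ok (x j) (loc (j, True), loc (j, False))" if "j : {..m}" for j using st[OF xX[OF that]] unfolding loc_def by simp
 have locD: "loc (j, b) : params P" "pt P (loc (j, b)) = x j" "loc (j, True) ~= loc (j, False)"
   "det2 (velocity P (loc (j, True))) (velocity P (loc (j, False))) > 0" "fst (loc (j, b)) < length P" if "j : {..m}" for j b
  using okj[OF that] unfolding ok_def by (cases b; auto simp: params_def mem_Times_iff)+
 define chart where "chart = (%j r. (ALL a b a' b'. abs a < r --> abs b < r --> abs a' < r --> abs b' < r -->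
    along P (loc (j, True)) a + along P (loc (j, False)) b
    = along P (loc (j, True)) a' + along P (loc (j, False)) b' --> a = a' & b = b') &
   (ALL a b. abs a < r --> abs b < r -->
    det2 (vel P (loc (j, True)) a) (vel P (loc (j, False)) b) > 0))"
 have finJ: "finite {..m}" by simp
 obtain r1 where r1: "r1 > 0" "!!j. j : {..m} ==> chart j r1"
 proof (rule finite_uniform_bound[OF finJ, of chart])
  fix j assume j: "j : {..m}"
  have d: "det2 (vd (P ! fst (loc (j, True))) (snd (loc (j, True)))) (vd (P ! fst (loc (j, False))) (snd (loc (j, False)))) > 0"
   using locD(4)[OF j] unfolding velocity_def .
  show "EX e>0. chart j e"
  proof (rule crossing_chart[OF C1[OF locD(5)[OF j]] C1[OF locD(5)[OF j]] d], goal_cases)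
   case (1 r)
   have "chart j r" unfolding chart_def by (rule conjI; intro allI impI; rule 1(2,3); assumption)
   thus ?case using 1(1) by blast
  qed
 next
  fix j d e assume "chart j e" "0 < d" "d <= (e::real)"
  thus "chart j d" unfolding chart_def by (meson order_less_le_trans)
 qed (blast intro: that)
 obtain r2 where r2: "r2 > 0" "!!p p'. p : double_params P ==> p' : double_params P ==> p ~= p' ==> fst p = fst p' ==> abs(rep (snd p - snd p')) >= r2"
  by (rule crossing_params_apart[OF reg]) (rule that; assumption)
 define r where "r = min r1 (min (r2 / 4) (1 / 16))"
 have r: "r > 0" "4 * r < 1 / 2" "r <= r1" "4 * r <= r2" unfolding r_def using r1 r2 by auto
 have chart: "chart j r" if "j : {..m}" for j
  using r1(2)[OF that] r(1,3) unfolding chart_def by (meson order_less_le_trans)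
 obtain et1 where et1: "et1 > 0" "!!y. y : {..m} \<times> {..<length P} ==> ALL u. norm ((P ! snd y) u - x (fst y)) < et1 -->
   (close_strand P r (snd y) (x (fst y)) u)"
  by (rule finite_uniform_bound[of "{..m} \<times> {..<length P}" "%y e. ALL u. norm ((P ! snd y) u - x (fst y)) < e -->
   (close_strand P r (snd y) (x (fst y)) u)"])
   (use strands_near_point[OF imm _ r(1)] that in "auto simp: mem_Times_iff")
 obtain et2 where et2: "et2 > 0" "!!y. y : {..m} \<times> {..m} ==> fst y ~= snd y --> 2 * et2 <= norm (x (fst y) - x (snd y))"
 proof (rule finite_uniform_bound[of "{..m} \<times> {..m}" "%y e. fst y ~= snd y --> 2 * e <= norm (x (fst y) - x (snd y))"])
  fix y assume y: "y : {..m} \<times> {..m}"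
  show "EX e>0. fst y ~= snd y --> 2 * e <= norm (x (fst y) - x (snd y))"
  proof (cases "fst y = snd y")
   case False
   hence "x (fst y) ~= x (snd y)" using inj_onD[OF xinj, of "fst y" "snd y"] y by (auto simp: mem_Times_iff)
   thus ?thesis by (intro exI[of _ "norm (x (fst y) - x (snd y)) / 2"]) simp
  qed (auto intro: exI[of _ 1])
 qed auto
 define et where "et = min et1 et2"
 have et: "et > 0" "et <= et1" "et <= et2" unfolding et_def using et1 et2 by auto
 define box where "box = (%j e. ALL a b. abs a < e --> abs b < e -->
  norm (along P (loc (j, True)) a + along P (loc (j, False)) b - x j - x j) < et)"
 obtain rh1 where rh1: "rh1 > 0" "!!j. j : {..m} ==> box j rh1"
 proof (rule finite_uniform_bound[OF finJ, of box])
  fix j assume j: "j : {..m}"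
  have near: "EX e>0. ALL a. abs a < e --> norm (along P (loc (j, b)) a - x j) < et / 2" for b
  proof -
   have "isCont (P ! fst (loc (j, b))) (snd (loc (j, b)))"
    using closed_C1_cont[OF C1[OF locD(5)[OF j]]] cont_on_open by blast
   then obtain e where e: "e > 0" "!!v. dist v (snd (loc (j, b))) < e ==> dist ((P ! fst (loc (j, b))) v) ((P ! fst (loc (j, b))) (snd (loc (j, b)))) < et / 2"
    using et(1) unfolding continuous_at_eps_delta by (metis half_gt_zero)
   show ?thesis
   proof (intro exI[of _ e] conjI allI impI)
    fix a assume "abs a < e"
    thus "norm (along P (loc (j, b)) a - x j) < et / 2"
     using e(2)[of "snd (loc (j, b)) + a"] locD(2)[OF j, of b] unfolding pt_def by (simp add: dist_norm)
   qed (rule e(1))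
  qed
  obtain e1 where e1: "e1 > 0" "ALL a. abs a < e1 --> norm (along P (loc (j, True)) a - x j) < et / 2" using near by blast
  obtain e2 where e2: "e2 > 0" "ALL a. abs a < e2 --> norm (along P (loc (j, False)) a - x j) < et / 2" using near by blast
  have sum: "norm (v + w - y - y) < et" if "norm (v - y) < et / 2" "norm (w - y) < et / 2" for v w y :: complex
  proof -
   have "v + w - y - y = (v - y) + (w - y)" by simp
   hence "norm (v + w - y - y) <= norm (v - y) + norm (w - y)" by (simp only: norm_triangle_ineq)
   thus ?thesis using that by simp
  qed
  have "box j (min e1 e2)" unfolding box_def
   by (intro allI impI sum) (use e1(2) e2(2) in auto)
  thus "EX e>0. box j e" using e1 e2 by (intro exI[of _ "min e1 e2"]) simp
 next
  fix j d e assume "box j e" "0 < d" "d <= (e::real)"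
  thus "box j d" unfolding box_def by (meson order_less_le_trans)
 qed (blast intro: that)
 define rh where "rh = min rh1 r / 6"
 have rh: "rh > 0" "6 * rh <= r" "6 * rh <= rh1" unfolding rh_def using rh1 r by auto
 interpret crossing_charts P ov0 "{..m}" x loc r et rh
 proof (unfold_locales)
  show "is_diagram P ov0" "finite {..m}" "inj_on x {..m}" "r > 0" "4 * r < 1/2" "et > 0" "rh > 0" "6 * rh <= r"
   by (rule D0 finJ xinj r et rh)+
  fix j assume j: "j : {..m}"
  show "x j : crossings P" using xX[OF j] X by blast
  show "loc (j, b) : params P & pt P (loc (j, b)) = x j" for b using locD(1,2)[OF j] by blast
  show "loc (j, True) = ov0 (x j)" using ov0[OF xX[OF j]] unfolding loc_def by simp
  thus "loc (j, False) ~= ov0 (x j)" using locD(3)[OF j] by metis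
  note c = chart[OF j, unfolded chart_def]
  fix a b a' b' assume ab: "abs a < r" "abs b < r"
  show "0 < det2 (vel P (loc (j, True)) a) (vel P (loc (j, False)) b)"
   using c ab by blast
  assume ab': "abs a' < r" "abs b' < r"
   "along P (loc (j, True)) a + along P (loc (j, False)) b
    = along P (loc (j, True)) a' + along P (loc (j, False)) b'"
  thus "a = a' & b = b'" using c ab by blast
 next
  fix j l u assume j: "j : {..m}" "l < length P" "norm ((P ! l) u - x j) < et"
  have m: "(j, l) : {..m} \<times> {..<length P}" "norm ((P ! l) u - x j) < et1" using j et(2) by simp_all
  obtain p where p: "p : params P" "fst p = l" "pt P p = x j" "abs(off p u) < r"
   using et1(2)[OF m(1)] m(2) unfolding fst_conv snd_conv by blast
  have "p = loc (j, True) | p = loc (j, False)" using two[OF xX[OF j(1)] p(1,3)] unfolding loc_def by simp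
  thus "EX b. l = fst (loc (j, b)) & abs(off (loc (j, b)) u) < r" using p by metis
 next
  fix p p' assume "p : double_params P" "p' : double_params P" "p ~= p'" "fst p = fst p'"
  from r2(2)[OF this] show "4 * r <= abs(rep (snd p - snd p'))" using r(4) by linarith
 next
  fix j j' assume "j : {..m}" "j' : {..m}" "j ~= j'"
  hence "2 * et2 <= norm (x j - x j')" using et2(2)[of "(j, j')"] by simp
  thus "2 * et <= norm (x j - x j')" using et(3) by linarith
 next
  fix j and a b :: real assume "j : {..m}" "abs a < 6 * rh" "abs b < 6 * rh"
  thus "norm (along P (loc (j, True)) a + along P (loc (j, False)) b - x j - x j) < et"
   using rh1(2)[of j] rh(3) unfolding box_def by (meson order_less_le_trans)
 qed
 have "alternating_sum {..m} (%T. f (L (sym_diff (x ` T) S0))) = 0"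
 proof (rule nq_alternating_sum[OF f refl])
  fix T assume T: "T <= {..m}"
  have sub: "sym_diff (x ` T) S0 <= X" using T xim unfolding S0_def by auto
  have "has_diagram (L (sym_diff (x ` T) S0)) P (change_crossings P (sym_diff (x ` T) S0) ov)" using L sub by blast
  thus "has_diagram (L (sym_diff (x ` T) S0)) P (change_crossings P (x ` T) ov0)"
   using has_diagram_cong change_crossings_compose[OF D] unfolding ov0_def by (metis (no_types, lifting))
 qed
 hence "alternating_sum X (%S. f (L (sym_diff S S0))) = 0"
  using alt_sum_image[OF xinj, of "%S. f (L (sym_diff S S0))"] unfolding xim by simp
 thus "alternating_sum X (%S. f (L S)) = 0"
  by (rule alt_sum_shift_zero[OF finX, rotated]) (simp add: S0_def)
qed

section \<open>Heights that change near one collar at a time\<close>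

theorem local_flips_alternating_sum:
 fixes f :: "link => 'a::ab_group_add"
 assumes f: "link_invariant f" "finite_type m f" and J: "finite J" "card J = m + 1"
  and C1: "!!i. i < length P ==> closed_C1 (P ! i)" "!!S i. S <= J ==> i < length P ==> closed_C1 (h S ! i)"
  and len: "!!S. length (h S) = length P"
  and K: "!!S. S <= J ==> embedded (lifted P (h S))"
  and rh: "rh > 0"
  and loc: "!!p p'. p : params P ==> p' : params P ==> norm (pt P p - pt P p') <= rh ==>
   EX j:J. ALL S<=J. pt (h S) p = pt (h (S Int {j})) p & pt (h S) p' = pt (h (S Int {j})) p'"
 shows "alternating_sum J (%S. f (st (lifted P (h S)))) = 0"
proof -
 define Q where "Q = (%S e. ALL K'. small_perturb e (lifted P (h S)) K' --> embedded K' & f (st K') = f (st (lifted P (h S))))"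
 obtain e where e: "e > 0" "!!S. S : Pow J ==> Q S e"
 proof (rule finite_uniform_bound[of "Pow J" Q])
  show "finite (Pow J)" using J by simp
  show "EX e>0. Q S e" if "S : Pow J" for S
  proof -
   have "S <= J" using that by blast
   from invariant_small_perturb_R3[OF f(1) K[OF this]] show ?thesis unfolding Q_def by metis
  qed
  show "Q S d" if "Q S e" "0 < d" "d <= e" for S d e
   using that unfolding Q_def small_perturb_def by (meson order_trans)
 qed (blast intro: that)
 obtain P' where P': "regular_projection P'" "small_perturb (min e (rh / 2)) P P'"
  by (rule regular_projection_approx[OF C1(1), of "min e (rh / 2)"]) (use e rh that in auto)
 note sp = small_perturbD[OF P'(2)]
 have len': "length (h S) = length P'" for S using len sp(1) by simp
 have par: "params P' = params P" unfolding params_def sp(1) ..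
 have K': "embedded (lifted P' (h S)) & f (st (lifted P' (h S))) = f (st (lifted P (h S)))" if S: "S <= J" for S
 proof -
  have "small_perturb e (lifted P (h S)) (lifted P' (h S))"
   unfolding small_perturb_def
  proof (intro conjI allI impI)
   show "length (lifted P' (h S)) = length (lifted P (h S))" using len len' sp(1) by simp
   fix i t assume "i < length (lifted P (h S))"
   hence i: "i < length P" "i < length P'" using len[of S] sp(1) by simp_all
   note c = C1(1)[OF i(1)] C1(2)[OF S i(1)] sp(2)[OF i(1)]
   show "closed_C1 (lifted P' (h S) ! i)" using i len' by (simp add: closed_C1_Pair c)
   show "norm ((lifted P' (h S) ! i) t - (lifted P (h S) ! i) t) <= e"
    using sp(3)[OF i(1), of t] i len len' by (simp add: norm_Pair)
   show "norm (vd (lifted P' (h S) ! i) t - vd (lifted P (h S) ! i) t) <= e"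
    using sp(4)[OF i(1), of t] i len len' by (simp add: closed_C1_Pair c norm_Pair)
  qed
  thus ?thesis using e(2)[of S] S unfolding Q_def by blast
 qed
 have sep: "pt (h S) p ~= pt (h S) p'" if S: "S <= J" and p: "p : params P'" "p' : params P'" "p ~= p'" "pt P' p = pt P' p'" for S p p'
 proof
  assume a: "pt (h S) p = pt (h S) p'"
  have "pt (lifted P' (h S)) p = pt (lifted P' (h S)) p'"
   using a p(4) p(1,2) len'[of S] unfolding pt_def params_def by (auto simp: mem_Times_iff)
  thus False using embedded_inj[OF conjunct1[OF K'[OF S]], of p p'] p(1,2,3) len'[of S] unfolding params_def by simp
 qed
 have near: "norm (pt P p - pt P p') <= rh" if p: "p : params P'" "p' : params P'" "pt P' p = pt P' p'" for p p'
 proof -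
  have n: "norm (pt P' p - pt P p) <= rh / 2" if "p : params P'" for p
   using sp(3)[of "fst p" "snd p"] that unfolding par unfolding pt_def params_def by auto
  have "pt P p - pt P p' = (pt P' p' - pt P p') - (pt P' p - pt P p)" using p(3) by simp
  hence "norm (pt P p - pt P p') <= norm (pt P' p' - pt P p') + norm (pt P' p - pt P p)" by (metis norm_triangle_ineq4)
  thus ?thesis using n[OF p(1)] n[OF p(2)] by simp
 qed
 have pair: "EX y. fst y : params P' & snd y : params P' & pt P' (fst y) = x & pt P' (snd y) = x & fst y ~= snd y & pt (h {}) (snd y) < pt (h {}) (fst y)"
  if x: "x : crossings P'" for x
 proof -
  obtain p p' where p: "p : params P'" "p' : params P'" "p ~= p'" "pt P' p = x" "pt P' p' = x" using x unfolding crossings_def by blast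
  have "pt (h {}) p ~= pt (h {}) p'" by (rule sep) (use p in auto)
  hence "pt (h {}) p' < pt (h {}) p | pt (h {}) p < pt (h {}) p'" by linarith
  thus ?thesis
  proof
   assume "pt (h {}) p' < pt (h {}) p" thus ?thesis using p by (intro exI[of _ "(p, p')"]) simp
  next
   assume "pt (h {}) p < pt (h {}) p'" thus ?thesis using p by (intro exI[of _ "(p', p)"]) simp
  qed
 qed
 then obtain pr where pr: "!!x. x : crossings P' ==> fst (pr x) : params P' & snd (pr x) : params P' & pt P' (fst (pr x)) = x &
   pt P' (snd (pr x)) = x & fst (pr x) ~= snd (pr x) & pt (h {}) (snd (pr x)) < pt (h {}) (fst (pr x))" by metis
 define ov where "ov = (%x. fst (pr x))"
 have D: "is_diagram P' ov" unfolding is_diagram_def ov_def using P'(1) pr by blast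
 define fl where "fl = (%S x. pt (h S) (fst (pr x)) < pt (h S) (snd (pr x)))"
 define Y where "Y = (%j. {x : crossings P'. fl {j} x})"
 have fl0: "~ fl {} x" if "x : crossings P'" for x using pr[OF that] unfolding fl_def by auto
 have one: "EX k:J. ALL S<=J. fl S x <-> fl (S Int {k}) x" if x: "x : crossings P'" for x
 proof -
  have "norm (pt P (fst (pr x)) - pt P (snd (pr x))) <= rh" by (rule near) (use pr[OF x] in auto)
  from loc[OF _ _ this] pr[OF x] obtain k where "k : J" "ALL S<=J. pt (h S) (fst (pr x)) = pt (h (S Int {k})) (fst (pr x)) & pt (h S) (snd (pr x)) = pt (h (S Int {k})) (snd (pr x))"
   unfolding par by blast
  thus ?thesis unfolding fl_def by metis
 qed
 have flips: "fl S x <-> x : \<Union> (Y ` S)" if x: "x : crossings P'" and S: "S <= J" for x S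
 proof -
  obtain k where k: "k : J" "!!S. S <= J ==> fl S x <-> fl (S Int {k}) x" using one[OF x] by blast
  have only: "j = k" if "j : J" "fl {j} x" for j
   using k(2)[of "{j}"] that fl0[OF x] by (cases "j = k") auto
  have "fl S x <-> k : S & fl {k} x" using k(2)[OF S] fl0[OF x] by (cases "k : S") auto
  thus ?thesis unfolding Y_def using x only S by blast
 qed
 have disjY: "disjoint_family_on Y J"
  unfolding disjoint_family_on_def
 proof (intro ballI impI equals0I)
  fix i j x assume ij: "i : J" "j : J" "i ~= j" "x : Y i Int Y j"
  hence x: "x : crossings P'" "fl {i} x" "fl {j} x" unfolding Y_def by auto
  obtain k where k: "ALL S<=J. fl S x <-> fl (S Int {k}) x" using one[OF x(1)] by blast
  have "l = k" if "l : J" "fl {l} x" for l using k[rule_format, of "{l}"] that fl0[OF x(1)] by (cases "l = k") auto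
  thus False using ij x by metis
 qed
 have "alternating_sum J (%S. f (st (lifted P' (h S)))) = 0"
 proof (rule finite_type_telescope[OF f D])
  show "Y j <= crossings P'" for j unfolding Y_def by blast
  fix S assume S: "S <= J"
  let ?ov = "change_crossings P' (\<Union> (Y ` S)) ov"
  have "heights_ok P' ?ov (h S)" unfolding heights_ok_def
  proof (intro conjI ballI impI)
   show "length (h S) = length P'" by (rule len')
   show "closed_C1 et" if "et : set (h S)" for et using that C1(2)[OF S] len by (metis in_set_conv_nth)
   fix p assume p: "p : params P'" "pt P' p : crossings P'" "p ~= ?ov (pt P' p)"
   define x where "x = pt P' p"
   have x: "x : crossings P'" using p(2) unfolding x_def .
   note s = pr[OF x]
   have pc: "p = fst (pr x) | p = snd (pr x)"
    using regular_projectionD(3)[OF P'(1), of p "fst (pr x)" "snd (pr x)"] p(1) s unfolding x_def by metis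
   show "pt (h S) p < pt (h S) (?ov (pt P' p))" unfolding x_def[symmetric]
   proof (cases "fl S x")
    case True
    hence "x : \<Union> (Y ` S)" using flips[OF x S] by blast
    note c = changed_diagram(2)[OF D x this]
    have o: "?ov x = snd (pr x)"
     using regular_projectionD(3)[OF P'(1), of "?ov x" "fst (pr x)" "snd (pr x)"] c s unfolding ov_def by metis
    hence "p = fst (pr x)" using pc p(3) unfolding x_def[symmetric] by metis
    thus "pt (h S) p < pt (h S) (?ov x)" using True unfolding o fl_def by simp
   next
    case False
    hence "x ~: \<Union> (Y ` S)" using flips[OF x S] by blast
    hence o: "?ov x = fst (pr x)" using changed_diagram(3)[OF D, of x] unfolding ov_def by blast
    hence "p = snd (pr x)" using pc p(3) unfolding x_def[symmetric] by metis
    moreover have "pt (h S) (fst (pr x)) ~= pt (h S) (snd (pr x))" by (rule sep[OF S]) (use s in auto)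
    ultimately show "pt (h S) p < pt (h S) (?ov x)" using False unfolding o fl_def by simp
   qed
  qed
  thus "has_diagram (st (lifted P' (h S))) P' ?ov" unfolding has_diagram_iff by blast
 qed (use disjY J in auto)
 moreover have "f (st (lifted P' (h S))) = f (st (lifted P (h S)))" if "S <= J" for S using K'[OF that] by blast
 ultimately show ?thesis using alt_sum_cong[of J "%S. f (st (lifted P' (h S)))" "%S. f (st (lifted P (h S)))"] by simp
qed

section \<open>Twisting a thin bundle of strands\<close>

lemma norm_prod_bounds:
 fixes x :: "'a::real_normed_vector \<times> 'b::real_normed_vector"
 shows "norm x <= norm (fst x) + norm (snd x)" "norm (fst x) <= norm x" "norm (snd x) <= norm x"
 using norm_Pair_le[of "fst x" "snd x"] norm_fst_le[of "fst x" "snd x"] norm_snd_le[of "snd x" "fst x"] by auto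

lemma closed_C1_bounded_linear:
 assumes L: "bounded_linear L" and ga: "closed_C1 ga" shows "closed_C1 (%t. L (ga t))"
proof (rule closed_C1I)
 show "((%t. L (ga t)) has_vd L (vd ga t)) (at t)" for t
  by (rule bl_has_vd[OF L closed_C1_has_vd[OF ga]])
 show "continuous_on UNIV (%t. L (vd ga t))" by (intro bounded_linear.continuous_on[OF L] closed_C1_vd_cont[OF ga])
 show "L (ga (t + 1)) = L (ga t)" for t using ga unfolding closed_C1_def by simp
qed

lemma vector_derivative_eq_0_transfer:
 fixes q :: "real => 'a::real_normed_vector" and F :: "real => 'b::real_normed_vector"
 assumes q: "(q has_vd q') (at t)" and F: "(F has_vd 0) (at t)"
  and le: "\<forall>\<^sub>F x in at t. norm (q x - q t) <= M * norm (F x - F t)"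
 shows "q' = 0"
proof -
 have lim: "((%x. (1 / norm (x - t)) *R (F x - F t)) \<longlongrightarrow> 0) (at t)"
  using F unfolding has_vd_def has_derivative_within by simp
 have "(q has_vd 0) (at t)"
  unfolding has_vd_def has_derivative_within
 proof (intro conjI)
  have lM: "((%x. M * norm ((1 / norm (x - t)) *R (F x - F t))) \<longlongrightarrow> 0) (at t)"
   using tendsto_mult_right_zero[OF tendsto_norm_zero[OF lim]] .
  have "\<forall>\<^sub>F x in at t. norm ((1 / norm (x - t)) *R (q x - (q t + (x - t) *R 0))) <= M * norm ((1 / norm (x - t)) *R (F x - F t))"
   using le
  proof eventually_elim
   case (elim x)
   from mult_left_mono[OF this, of "1 / norm (x - t)"] show ?case by (simp add: mult.left_commute)
  qed
  thus "((%x. (1 / norm (x - t)) *R (q x - (q t + (x - t) *R 0))) \<longlongrightarrow> 0) (at t)"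
   by (rule Lim_null_comparison[OF _ lM])
 qed (rule bounded_linear_scaleR_left)
 thus ?thesis using vector_derivative_unique_at[OF q] by blast
qed

text \<open>The full twist compressed to the levels \<open>\<bar>t\<bar> \<le> dl / 2\<close>.\<close>
definition spin :: "nat => real => real => complex" where "spin n dl t = \<i> * of_real (of_nat n * ang (2 * t / dl))"

lemma C1_on_spin: "C1_on UNIV (spin n dl)"
proof -
 have "(%t. 2 * t / dl) = (%t. (2 / dl) * t)" by auto
 hence "C1_on UNIV (%t. 2 * t / dl)" using C1_on_bounded_linear(1)[OF bounded_linear_mult_right[of "2 / dl"]] by simp
 from C1_on_compose(1)[OF open_UNIV this open_UNIV] show ?thesis
  using log_profile_twist[of n] unfolding log_profile_def spin_def[abs_def] by blast
qed

lemma Re_spin [simp]: "Re (spin n dl t) = 0" unfolding spin_def by simp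

lemma exp_spin_outer: "dl > 0 ==> abs t >= dl / 2 ==> exp (spin n dl t) = 1"
proof -
 assume "dl > 0" "abs t >= dl / 2"
 hence "abs(2 * t / dl) >= 1" by (simp add: abs_mult field_simps)
 thus ?thesis using log_profile_twist[of n] unfolding log_profile_def spin_def by blast
qed

lemma exp_spin_lipschitz:
 assumes "dl > 0"
 shows "norm (exp (spin n dl t) - exp (spin n dl t')) <= (16 * real n / dl) * abs(t - t')"
proof -
 define a' where "a' = (%t. \<i> * complex_of_real (n * ((2 * pi * (stepf' ((2 * t / dl + 1) / 2) / 2)) * (2 / dl))))"
 have "norm (exp (spin n dl t) - exp (spin n dl t')) <= (16 * real n / dl) * norm (t - t')"
 proof (rule differentiable_bound[where S = UNIV and f' = "%t h. h *R (a' t * exp (spin n dl t))"])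
  fix t :: real
  have "((%t. n * ang (2 * t / dl)) has_real_derivative n * ((2 * pi * (stepf' ((2 * t / dl + 1) / 2) / 2)) * (2 / dl))) (at t)"
   by (intro DERIV_cmult DERIV_chain2[OF has_vd_ang[unfolded real_has_vd[symmetric]]])
    (use assms in "auto intro!: dintros")
  hence "(spin n dl has_vd a' t) (at t)" unfolding spin_def[abs_def] a'_def
   by (intro has_vector_derivative_mult_right has_vector_derivative_of_real)
  hence "((%t. exp (spin n dl t)) has_vd a' t * exp (spin n dl t)) (at t)"
   using field_vector_diff_chain_at[OF _ DERIV_exp, of "spin n dl" "a' t" t] by (simp add: comp_def)
  thus "((%t. exp (spin n dl t)) has_derivative (%h. h *R (a' t * exp (spin n dl t)))) (at t within UNIV)"
   unfolding has_vd_def by simp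
  have "norm (a' t) = n * (pi * abs(stepf' ((2 * t / dl + 1) / 2)) * (2 / dl))"
   unfolding a'_def norm_mult norm_ii norm_of_real using assms by (simp add: abs_mult)
  also have "... <= n * (4 * 2 * (2 / dl))"
   by (intro mult_left_mono mult_mono stepf'_bound less_imp_le[OF pi_less_4]) (use assms in auto)
  finally have "norm (a' t) <= 16 * real n / dl" by (simp add: mult.commute)
  thus "onorm (%h. h *R (a' t * exp (spin n dl t))) <= 16 * real n / dl"
   by (simp add: onorm_scaleR_left[OF bounded_linear_ident] onorm_id norm_mult)
 qed auto
 thus ?thesis by simp
qed

text \<open>Shrinks the disks of the levels \<open>\<bar>t\<bar> \<le> dl\<close> by the factor \<open>ep\<close>.\<close>
definition pinch :: "real => real => real => complex" where
 "pinch ep dl t = of_real (ln ep * (1 - stepf ((t / dl)^2 - 1)))"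

lemma pinch:
 assumes "0 < ep" "ep <= 1" "0 < dl" "2 * dl <= 1"
 shows "abs t <= dl ==> exp (pinch ep dl t) = of_real ep" "C1_on UNIV (pinch ep dl)" "Re (pinch ep dl t) <= 0" "abs t >= 1 ==> pinch ep dl t = 0"
proof -
 show "exp (pinch ep dl t) = of_real ep" if t: "abs t <= dl"
 proof -
  have "abs(t / dl) <= 1" using t assms by (simp add: field_simps)
  hence "(t / dl)^2 <= 1" by (simp only: abs_square_le_1)
  hence "stepf ((t / dl)^2 - 1) = 0" unfolding stepf_def by simp
  thus ?thesis unfolding pinch_def exp_of_real using assms by simp
 qed
 show "Re (pinch ep dl t) <= 0" unfolding pinch_def
  using mult_nonpos_nonneg[of "ln ep" "1 - stepf ((t / dl)^2 - 1)"] stepf_bounds(2)[of "(t / dl)^2 - 1"] assms by simp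
 show "pinch ep dl t = 0" if t: "abs t >= 1"
 proof -
  have "2 <= abs(t / dl)" using t assms by (simp add: field_simps)
  hence "2^2 <= (t / dl)^2" by (metis abs_le_square_iff abs_numeral)
  hence "stepf ((t / dl)^2 - 1) = 1" unfolding stepf_def by simp
  thus ?thesis unfolding pinch_def by simp
 qed
 have "((%t. pinch ep dl t) has_vd of_real (ln ep * (0 - stepf' ((t / dl)^2 - 1) * (2 * (t / dl) * (1 / dl))))) (at t)" for t
  unfolding pinch_def
  by (intro has_vector_derivative_of_real DERIV_cmult DERIV_diff DERIV_const DERIV_chain2[OF DERIV_stepf])
   (use assms in "auto intro!: dintros")
 thus "C1_on UNIV (pinch ep dl)"
  by (rule C1_on_real(1)[OF open_UNIV])
   (intro cintros cont_comp[OF continuous_on_stepf'[of UNIV]]; use assms in auto)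
qed

abbreviation (input) "steep c x x' == norm (fst x - fst x') <= c * abs(snd x - snd x')"

text \<open>Near its centre each collar makes the direction \<open>(u j, sv j)\<close> vertical. By \<open>sep\<close>,
two points of the link near the disk either have different levels or behave like points of one strand, whose
position in the disk is Lipschitz in the height of the collar.\<close>
locale vertical_collars =
 fixes K :: "(real => R3) list" and J :: "nat set" and Ph :: "nat => R3 => R3"
  and W :: "nat => R3 set" and u :: "nat => complex" and sv :: "nat => real" and r rh B C g0 dl0 :: real
 assumes K: "embedded K" and J: "finite J" "J ~= {}"
  and C3: "!!j. j : J ==> collar3 (Ph j) (W j)"
  and disj: "disj_cyl Ph J"
  and avoid: "!!i j t. i < length K ==> j : J ==> (K ! i) t ~: Ph j ` lateral"
  and r: "0 < r" "r <= 1"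
  and vert: "!!j x g. j : J ==> norm x < r ==> norm (x + g *R (u j, sv j)) < r ==> Ph j (x + g *R (u j, sv j)) = Ph j x + (0, g)"
  and far: "!!i j x y. i : J ==> j : J ==> i ~= j ==> norm x < r ==> norm y < r ==> norm (fst (Ph i x) - fst (Ph j y)) > rh"
  and rh: "rh > 0"
  and B: "B >= 1" "!!j. j : J ==> 1 <= B * norm (u j) & norm (u j) <= B & abs(sv j) <= B"
  and Cg: "C >= 0" "g0 > 0" "dl0 > 0"
  and sep: "!!j x x'. j : J ==> x : cylinder ==> x' : cylinder ==> on_sys K (Ph j x) ==> on_sys K (Ph j x') ==>
   abs(snd x) <= dl0 ==> abs(snd x') <= dl0 ==>
   abs(Re (fst x / u j) - Re (fst x' / u j)) >= g0 | norm (fst x - fst x') <= C * abs(snd x - snd x')"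
begin

context
 fixes n :: nat and c0 dl ep :: real
 defines "c0 == 1 / (B^2 * (4 * C + 32 * real n + 8))" and "dl == min dl0 r / 4" and "ep == c0 * dl"
begin

lemma c0: "0 < c0" "c0 * B^2 * (4 * C + 32 * real n + 8) = 1" "8 * (c0 * B^2) <= 1" "c0 <= 1"
proof -
 have p: "B^2 * (4 * C + 32 * real n + 8) > 0" using B(1) Cg(1) by (intro mult_pos_pos) auto
 show "0 < c0" unfolding c0_def using p by simp
 show e: "c0 * B^2 * (4 * C + 32 * real n + 8) = 1" unfolding c0_def using p by (simp add: field_simps)
 have "c0 * B^2 * 8 <= c0 * B^2 * (4 * C + 32 * real n + 8)"
  by (rule mult_left_mono) (use Cg(1) `0 < c0` in auto)
 thus e8: "8 * (c0 * B^2) <= 1" unfolding e by simp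
 have "c0 * 1 <= c0 * B^2" by (rule mult_left_mono) (use B(1) `0 < c0` in auto)
 thus "c0 <= 1" using e8 by linarith
qed

lemma dl: "0 < dl" "dl <= dl0" "4 * dl <= r" "2 * dl <= 1" "dl <= 1" unfolding dl_def using Cg(3) r by auto

lemma ep: "0 < ep" "8 * (ep * B^2) <= dl" "ep <= dl" "ep <= 1"
proof -
 show "0 < ep" unfolding ep_def using c0 dl by simp
 show "8 * (ep * B^2) <= dl" using mult_left_mono[OF c0(3), of dl] dl(1) unfolding ep_def by (simp add: algebra_simps)
 show "ep <= dl" using mult_right_mono[OF c0(4), of dl] dl(1) unfolding ep_def by simp
 thus "ep <= 1" using dl(5) by linarith
qed

definition K1 where "K1 = curve_map (collar_mult J Ph (%j t. exp (pinch ep dl t))) K"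

definition on1 where "on1 y <-> (on_sys K1 y)"

definition Tw :: "R3 => R3" where "Tw x = (exp (spin n dl (snd x)) * fst x, snd x)"

definition lev :: "nat => R3 => real" where "lev j x = Re (fst x / u j)"

definition gap where "gap j x = lev j x - lev j (Tw x)"

text \<open>For \<open>j \<in> S\<close> the strands are twisted at once. Otherwise they move along a straight line to the
twisted strand, lifted so that the level is kept.\<close>
definition Hm :: "nat set => real => nat => R3 => R3" where
 "Hm S s j x = (if j : S then Tw x else x + s *R (Tw x + gap j x *R (u j, sv j) - x))"

lemma u0: "j : J ==> u j ~= 0" using B(2)[of j] by auto

lemma lev_linear: "lev j (x + y) = lev j x + lev j y" "lev j (x - y) = lev j x - lev j y" "lev j (s *R x) = s * lev j x"
 unfolding lev_def by (simp_all add: add_divide_distrib diff_divide_distrib scaleR_conv_of_real flip: times_divide_eq_right)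

lemma lev_Hm: "j : J ==> j ~: S ==> lev j (Hm S s j x) = lev j x"
proof -
 assume j: "j : J" "j ~: S"
 have "lev j (u j, sv j) = 1" unfolding lev_def using u0[OF j(1)] by simp
 thus ?thesis using j unfolding Hm_def by (simp only: if_False lev_linear gap_def) simp
qed

lemma norm_Tw: "norm (fst (Tw x)) = norm (fst x)" "snd (Tw x) = snd x"
 unfolding Tw_def by (simp_all add: norm_mult)

lemma Tw_outer: "abs(snd x) >= dl / 2 ==> Tw x = x"
 unfolding Tw_def using exp_spin_outer[OF dl(1)] by simp

lemma Hm_outer: "abs(snd x) >= dl / 2 ==> Hm S s j x = x"
 unfolding Hm_def gap_def using Tw_outer[of x] by (simp flip: zero_prod_def)

lemma gap_bound: "j : J ==> norm (fst x) <= ep ==> abs(gap j x) <= 2 * ep * B"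
proof -
 assume j: "j : J" and x: "norm (fst x) <= ep"
 have l: "abs(lev j y) <= ep * B" if "norm (fst y) <= ep" for y
 proof -
  have "abs(lev j y) <= norm (fst y) * (1 / norm (u j))"
   unfolding lev_def using abs_Re_le_cmod[of "fst y / u j"] by (simp add: norm_divide)
  also have "... <= ep * B" by (rule mult_mono) (use that ep(1) B(2)[OF j] u0[OF j] in "auto simp: field_simps")
  finally show ?thesis .
 qed
 show ?thesis unfolding gap_def using l[OF x] l[of "Tw x"] x unfolding norm_Tw by linarith
qed

lemma K1_cases:
 assumes j: "j : J" and x: "x : cylinder" "on1 (Ph j x)"
 obtains z where "(z, snd x) : cylinder" "on_sys K (Ph j (z, snd x))" "fst x = exp (pinch ep dl (snd x)) * z"
proof -
 obtain i t where it: "i < length K" "Ph j x = collar_mult J Ph (%j t. exp (pinch ep dl t)) ((K ! i) t)"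
  using x(2) unfolding on1_def K1_def by auto
 show thesis
 proof (cases rule: collar_cases[of J "(K ! i) t" Ph])
  case 1
  have "Ph j x = (K ! i) t" unfolding it(2) by (rule collar_mult_out[OF 1])
  thus thesis using 1[OF j] imageI[OF x(1), of "Ph j"] by simp
 next
  case k: (2 k x0)
  let ?x1 = "(exp (pinch ep dl (snd x0)) * fst x0, snd x0)"
  have e: "Ph j x = Ph k ?x1" using it(2) unfolding k(3) collar_mult_in[OF disj collar3D(7)[OF C3[OF k(1)]] k(1,2)] .
  have x1: "?x1 : cylinder" by (rule cyl_mult[OF k(2)]) (use pinch(3)[OF ep(1,4) dl(1,4)] in simp)
  have kj: "k = j"
   using disj_cylD[OF disj k(1) j, of "Ph j x"] imageI[OF x1, of "Ph k"] imageI[OF x(1), of "Ph j"] unfolding e[symmetric] by blast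
  have "x = ?x1" using inj_onD[OF collar3D(7)[OF C3[OF j]] e[unfolded kj] x(1) x1] .
  hence x0: "fst x = exp (pinch ep dl (snd x)) * fst x0" "(fst x0, snd x) = x0" by simp_all
  show thesis by (rule that[OF _ _ x0(1)], unfold x0(2)) (use k it(1) kj in "blast, metis")
 qed
qed

lemma K1_small: "j : J ==> x : cylinder ==> on1 (Ph j x) ==> abs(snd x) <= dl ==> norm (fst x) <= ep"
proof -
 assume a: "j : J" "x : cylinder" "on1 (Ph j x)" "abs(snd x) <= dl"
 obtain z where z: "(z, snd x) : cylinder" "fst x = exp (pinch ep dl (snd x)) * z" by (rule K1_cases[OF a(1-3)])
 have "norm z <= 1" using z(1) by simp
 thus ?thesis unfolding z(2) pinch(1)[OF ep(1,4) dl(1,4) a(4)] using ep(1) by (simp add: norm_mult mult_left_le)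
qed

text \<open>The lift varies slowly along a strand, since the pinched strand has size \<open>ep\<close> and slope of order
\<open>ep\<close>. The bound fixes the choice of \<open>c0\<close>.\<close>
lemma gap_lipschitz:
 assumes j: "j : J" and x: "norm (fst x) <= ep" "norm (fst x') <= ep" and zz: "steep (ep * C) x x'"
 shows "abs(sv j * (gap j x - gap j x')) <= abs(snd x - snd x') / 2"
proof -
 define d where "d = abs(snd x - snd x')"
 have iu: "1 / norm (u j) <= B" using B(2)[OF j] u0[OF j] by (simp add: field_simps)
 have L: "abs(lev j y - lev j y') <= norm (fst y - fst y') * B" for y y'
 proof -
  have "abs(lev j y - lev j y') <= norm (fst y - fst y') * (1 / norm (u j))"
  proof -
   have "lev j y - lev j y' = Re ((fst y - fst y') / u j)" unfolding lev_def by (simp add: diff_divide_distrib)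
   thus ?thesis using abs_Re_le_cmod[of "(fst y - fst y') / u j"] by (simp only: norm_divide times_divide_eq_right mult_1_right)
  qed
  also have "... <= norm (fst y - fst y') * B" by (intro mult_left_mono iu) simp
  finally show ?thesis .
 qed
 define a a' where "a = exp (spin n dl (snd x))" and "a' = exp (spin n dl (snd x'))"
 have aa: "norm (a - a') <= (16 * real n / dl) * d" unfolding a_def a'_def d_def by (rule exp_spin_lipschitz[OF dl(1)])
 have na: "norm a = 1" unfolding a_def by simp
 have "a * fst x - a' * fst x' = a * (fst x - fst x') + (a - a') * fst x'" by (simp add: algebra_simps)
 hence "norm (a * fst x - a' * fst x') <= norm (fst x - fst x') + norm (a - a') * norm (fst x')"
  using norm_triangle_ineq[of "a * (fst x - fst x')" "(a - a') * fst x'"] by (simp add: norm_mult na)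
 also have "... <= ep * C * d + (16 * real n / dl) * d * ep"
  by (intro add_mono mult_mono zz[folded d_def] aa x) (auto simp: d_def dl(1) less_imp_le)
 also have "(16 * real n / dl) * d * ep = 16 * real n * c0 * d" unfolding ep_def using dl(1) by simp
 finally have t2: "norm (fst (Tw x) - fst (Tw x')) <= ep * C * d + 16 * real n * c0 * d" unfolding Tw_def a_def a'_def by simp
 have eC: "ep * C * d <= c0 * C * d" unfolding ep_def
  by (intro mult_right_mono) (use dl(5) c0(1) Cg(1) in "auto simp: d_def mult_left_le")
 have "abs(gap j x - gap j x') <= abs(lev j x - lev j x') + abs(lev j (Tw x) - lev j (Tw x'))" unfolding gap_def by linarith
 also have "... <= norm (fst x - fst x') * B + norm (fst (Tw x) - fst (Tw x')) * B" by (intro add_mono L)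
 also have "... <= (c0 * C * d) * B + (c0 * C * d + 16 * real n * c0 * d) * B"
  by (intro add_mono mult_right_mono) (use zz[folded d_def] t2 eC B(1) in auto)
 finally have g: "abs(gap j x - gap j x') <= c0 * B * (2 * C + 16 * real n) * d" by (simp add: algebra_simps)
 have "abs(sv j * (gap j x - gap j x')) <= B * (c0 * B * (2 * C + 16 * real n) * d)"
  unfolding abs_mult by (rule mult_mono) (use g B(1) B(2)[OF j] in auto)
 also have "... <= (c0 * B^2 * (4 * C + 32 * real n + 8)) * d / 2"
  using c0(1) B(1) by (simp add: power2_eq_square algebra_simps d_def)
 finally show ?thesis unfolding c0(2) d_def by simp
qed

lemma snd_Hm: "j ~: S ==> snd (Hm S s j x) = snd x + s * (sv j * gap j x)"
 unfolding Hm_def using norm_Tw(2)[of x] by simp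

lemma Hm_inner:
 assumes j: "j : J" and x: "norm (fst x) <= ep" "abs(snd x) <= dl" and s: "s : {0..1}"
 shows "Hm S s j x : cylinder" "abs(snd (Hm S s j x)) <= dl" "abs(snd x) < dl / 2 ==> norm (gap j x *R (u j, sv j)) <= dl / 2"
proof -
 have bu: "norm (u j) <= B" "abs(sv j) <= B" using B(2)[OF j] by auto
 have gb: "abs(gap j x) * b <= dl / 4" if "0 <= b" "b <= B" for b
 proof -
  have "abs(gap j x) * b <= (2 * ep * B) * B" by (rule mult_mono[OF gap_bound[OF j x(1)]]) (use that ep B(1) in auto)
  also have "... <= dl / 4" using ep(2) by (simp add: power2_eq_square)
  finally show ?thesis .
 qed
 have g1: "norm (gap j x *R u j) <= dl / 4" and g2: "abs(sv j * gap j x) <= dl / 4"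
  using gb[of "norm (u j)"] gb[of "abs(sv j)"] bu by (simp_all add: abs_mult mult.commute)
 have "norm (gap j x *R (u j, sv j)) <= norm (gap j x *R u j) + norm (gap j x * sv j)" using norm_Pair_le[of "gap j x *R u j" "gap j x * sv j"] by simp
 thus "norm (gap j x *R (u j, sv j)) <= dl / 2" using g1 g2 by (simp add: mult.commute)
 have s2: "abs(snd (Hm S s j x)) <= dl"
 proof (cases "j : S | abs(snd x) >= dl / 2")
  case True
  have "j : S ==> snd (Hm S s j x) = snd x" using norm_Tw(2)[of x] unfolding Hm_def by simp
  moreover have "abs(snd x) >= dl / 2 ==> snd (Hm S s j x) = snd x" using Hm_outer[of x S s j] by simp
  ultimately have "snd (Hm S s j x) = snd x" using True by blast
  thus ?thesis using x(2) by simp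
 next
  case False
  have "abs(s * (sv j * gap j x)) <= 1 * (dl / 4)" unfolding abs_mult[of s] by (rule mult_mono) (use s g2 in auto)
  thus ?thesis using False snd_Hm[of j S s x] by linarith
 qed
 thus "abs(snd (Hm S s j x)) <= dl" .
 have "norm (fst (Hm S s j x)) <= 1"
 proof (cases "j : S")
  case True
  thus ?thesis unfolding Hm_def using norm_Tw(1)[of x] x(1) ep(4) by simp
 next
  case False
  have "fst (Hm S s j x) = (1 - s) *R fst x + s *R (fst (Tw x) + gap j x *R u j)"
   unfolding Hm_def using False by (simp add: algebra_simps)
  also have "norm ... <= (1 - s) * norm (fst x) + s * norm (fst (Tw x) + gap j x *R u j)"
   using norm_triangle_ineq[of "(1 - s) *R fst x" "s *R (fst (Tw x) + gap j x *R u j)"] s by simp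
  also have "... <= (1 - s) * 1 + s * 1"
  proof (intro add_mono mult_left_mono)
   show "norm (fst x) <= 1" using x(1) ep(4) by linarith
   have "norm (fst (Tw x) + gap j x *R u j) <= norm (fst x) + norm (gap j x *R u j)"
    using norm_triangle_ineq[of "fst (Tw x)" "gap j x *R u j"] norm_Tw(1)[of x] by simp
   also have "... <= dl + dl / 4" using x(1) ep(3) g1 by linarith
   also have "... <= 1" using dl(3) r by linarith
   finally show "norm (fst (Tw x) + gap j x *R u j) <= 1" .
  qed (use s in auto)
  finally show ?thesis by simp
 qed
 thus "Hm S s j x : cylinder" using s2 dl(5) by (auto simp: mem_Times_iff)
qed

lemma Hm_cyl: "j : J ==> x : cylinder ==> on1 (Ph j x) ==> s : {0..1} ==> Hm S s j x : cylinder"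
 using Hm_inner(1)[OF _ K1_small] Hm_outer[of x S s j] dl(1) by (cases "abs(snd x) <= dl") auto

lemma K1_sep:
 assumes j: "j : J" and x: "x : cylinder" "on1 (Ph j x)" "abs(snd x) <= dl" and x': "x' : cylinder" "on1 (Ph j x')" "abs(snd x') <= dl"
  and lev: "abs(lev j x - lev j x') < ep * g0"
 shows "steep (ep * C) x x'"
proof -
 obtain z where z: "(z, snd x) : cylinder" "on_sys K (Ph j (z, snd x))" "fst x = exp (pinch ep dl (snd x)) * z"
  by (rule K1_cases[OF j x(1,2)])
 obtain z' where z': "(z', snd x') : cylinder" "on_sys K (Ph j (z', snd x'))" "fst x' = exp (pinch ep dl (snd x')) * z'"
  by (rule K1_cases[OF j x'(1,2)])
 have e: "fst x = of_real ep * z" "fst x' = of_real ep * z'"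
  using z(3) z'(3) pinch(1)[OF ep(1,4) dl(1,4)] x(3) x'(3) by auto
 have "lev j x - lev j x' = ep * (Re (z / u j) - Re (z' / u j))"
  unfolding lev_def e by (simp add: right_diff_distrib flip: times_divide_eq_right)
 hence "ep * abs(Re (z / u j) - Re (z' / u j)) < ep * g0" using lev ep(1) by (simp add: abs_mult)
 hence "~ g0 <= abs(Re (z / u j) - Re (z' / u j))" using ep(1) by simp
 hence "norm (z - z') <= C * abs(snd x - snd x')"
  using sep[OF j z(1) z'(1) z(2) z'(2)] x(3) x'(3) dl(2) by auto
 hence "ep * norm (z - z') <= ep * (C * abs(snd x - snd x'))" using ep(1) by simp
 moreover have "norm (fst x - fst x') = ep * norm (z - z')" unfolding e right_diff_distrib[symmetric] norm_mult using ep(1) by simp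
 ultimately show ?thesis by simp
qed

lemma Hm_snd_expand:
 assumes j: "j : J" "j ~: S" and s: "s : {0..1}" and x: "norm (fst x) <= ep" "norm (fst x') <= ep"
  and zz: "steep (ep * C) x x'"
 shows "abs(snd x - snd x') <= 2 * abs(snd (Hm S s j x) - snd (Hm S s j x'))"
proof -
 have "abs(s * (sv j * (gap j x - gap j x'))) <= 1 * (abs(snd x - snd x') / 2)"
  unfolding abs_mult[of s] by (rule mult_mono) (use s gap_lipschitz[OF j(1) x zz] in auto)
 moreover have "snd (Hm S s j x) - snd (Hm S s j x') = snd x - snd x' + s * (sv j * (gap j x - gap j x'))"
  unfolding snd_Hm[OF j(2)] by (simp add: algebra_simps)
 moreover have "abs a <= 2 * abs(a + b)" if "abs b <= 1 * (abs a / 2)" for a b :: real using abs_triangle_ineq2[of a "- b"] that by simp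
 ultimately show ?thesis by metis
qed

text \<open>Levels are kept, so points that meet lie on one strand, where the height of the collar stays a strictly
monotone parameter.\<close>
lemma Hm_inj:
 assumes s: "s : {0..1}" and j: "j : J" and x: "x : cylinder" "x' : cylinder" "on1 (Ph j x)" "on1 (Ph j x')"
  and eq: "Hm S s j x = Hm S s j x'"
 shows "x = x'"
proof (cases "j : S")
 case True
 hence "Tw x = Tw x'" using eq unfolding Hm_def by simp
 thus ?thesis unfolding Tw_def by (auto simp: prod_eq_iff)
next
 case False
 have out: "Hm S s j y = y" if "~ abs(snd y) <= dl" for y by (rule Hm_outer) (use that dl(1) in auto)
 have inn: "abs(snd (Hm S s j y)) <= dl" if "y : cylinder" "on1 (Ph j y)" "abs(snd y) <= dl" for y
  by (rule Hm_inner(2)[OF j K1_small[OF j that] that(3) s])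
 show ?thesis
 proof (cases "abs(snd x) <= dl & abs(snd x') <= dl")
  case True
  have "lev j x = lev j x'" using lev_Hm[OF j False] eq by metis
  hence zz: "steep (ep * C) x x'"
   by (intro K1_sep[OF j]) (use x True ep(1) Cg(2) in auto)
  have "abs(snd x - snd x') <= 0"
   using Hm_snd_expand[OF j False s _ _ zz] K1_small[OF j x(1,3)] K1_small[OF j x(2,4)] True eq by simp
  thus ?thesis using zz by (simp add: prod_eq_iff)
 next
  case False
  thus ?thesis using out[of x] out[of x'] inn[OF x(1,3)] inn[OF x(2,4)] eq by metis
 qed
qed

lemma C1_Tw: "C1_fam_on N (%_. q) ==> C1_fam_on N (%_ t. Tw (q t))"
 unfolding Tw_def
 by (intro C1_fam_on_Pair(1) C1_fam_on_mult(1) C1_fam_on_snd(1) C1_fam_on_fst(1)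
   C1_fam_on_compose(1)[OF _ open_UNIV C1_on_exp] C1_fam_on_compose(1)[OF _ open_UNIV C1_on_spin]) auto

lemma Hm_fam:
 assumes q: "C1_fam_on N (%_. q)" shows "C1_fam_on N (%s t. Hm S s j (q t))"
proof (cases "j : S")
 case True
 thus ?thesis unfolding Hm_def using C1_Tw[OF q] by simp
next
 case False
 have l: "bounded_linear (lev j)" unfolding lev_def[abs_def]
  by (intro bounded_linear_compose[OF bounded_linear_Re] bounded_linear_compose[OF bounded_linear_divide] bounded_linear_fst)
 have bl: "bounded_linear (%y. snd y + (lev j (fst y) - lev j (snd y)) *R (u j, sv j))"
  by (intro bounded_linear_add bounded_linear_snd bounded_linear_compose[OF bounded_linear_scaleR_left] bounded_linear_sub
    bounded_linear_compose[OF l] bounded_linear_fst)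
 have "C1_fam_on N (%s t. Tw (q t) + gap j (q t) *R (u j, sv j))"
  using C1_fam_on_compose(1)[OF C1_fam_on_Pair(1)[OF q C1_Tw[OF q]] open_UNIV C1_on_bounded_linear(1)[OF bl]] unfolding gap_def by simp
 from C1_fam_on_linear[OF q this] show ?thesis unfolding Hm_def using False by simp
qed

lemma Hm_vd:
 assumes j: "j : J" and N: "open N" and q: "C1_fam_on N (%_. q)" and on: "!!t. t : N ==> norm (fst (q t)) < 1 & on1 (Ph j (q t))"
  and st: "s : {0..1}" "t : N" and z: "vd (%t. Hm S s j (q t)) t = 0"
 shows "vd q t = 0"
proof -
 have dq: "(q has_vd vd q t) (at t)" by (rule C1_fam_onD(1)[OF q st])
 have dH: "((%t. Hm S s j (q t)) has_vd 0) (at t)" using C1_fam_onD(1)[OF Hm_fam[OF q, of S j] st] z by simp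
 have lim: "q \<midarrow>t\<rightarrow> q t" using has_vd_cont[OF dq] unfolding isCont_def .
 have near: "\<forall>\<^sub>F y in at t. y : N" using N st(2) by (rule eventually_at_in_open')
 have key: "vd q t = 0" if "\<forall>\<^sub>F y in at t. norm (q y - q t) <= M * norm (Hm S s j (q y) - Hm S s j (q t))" for M
  by (rule vector_derivative_eq_0_transfer[OF dq dH that])
 have cyl: "q y : cylinder" if "y : N" "abs(snd (q y)) <= 1" for y using on[OF that(1)] that(2) by (auto simp: mem_Times_iff)
 consider "j : S" | "abs(snd (q t)) > dl / 2" | "j ~: S" "abs(snd (q t)) < dl" using dl(1) by linarith
 thus ?thesis
 proof cases
  case 1
  have b: "norm (x - x') <= (2 + 16 * real n / dl) * norm (Tw x - Tw x')" if x': "norm (fst x') <= 1" for x x'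
  proof -
   define a a' where "a = exp (spin n dl (snd x))" and "a' = exp (spin n dl (snd x'))"
   have na: "norm a = 1" unfolding a_def by simp
   have f: "a * (fst x - fst x') = (a * fst x - a' * fst x') - (a - a') * fst x'" by (simp add: algebra_simps)
   have "norm (a * (fst x - fst x')) <= norm (a * fst x - a' * fst x') + norm (a - a') * norm (fst x')"
    unfolding f norm_mult[symmetric] by (rule norm_triangle_ineq4)
   also have "... <= norm (Tw x - Tw x') + ((16 * real n / dl) * norm (Tw x - Tw x')) * 1"
   proof (intro add_mono mult_mono x')
    show "norm (a * fst x - a' * fst x') <= norm (Tw x - Tw x')" using norm_prod_bounds(2)[of "Tw x - Tw x'"] unfolding Tw_def a_def a'_def by simp
    have "abs(snd x - snd x') <= norm (Tw x - Tw x')" using norm_prod_bounds(3)[of "Tw x - Tw x'"] by (simp add: norm_Tw)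
    hence "(16 * real n / dl) * abs(snd x - snd x') <= (16 * real n / dl) * norm (Tw x - Tw x')" by (intro mult_left_mono) (use dl(1) in auto)
    thus "norm (a - a') <= (16 * real n / dl) * norm (Tw x - Tw x')"
     using exp_spin_lipschitz[OF dl(1), of n "snd x" "snd x'"] unfolding a_def a'_def by linarith
   qed (use dl(1) in auto)
   finally have "norm (fst x - fst x') <= norm (Tw x - Tw x') + (16 * real n / dl) * norm (Tw x - Tw x')" by (simp add: norm_mult na)
   moreover have "norm (x - x') <= norm (fst x - fst x') + norm (snd x - snd x')" using norm_prod_bounds(1)[of "x - x'"] by simp
   moreover have "norm (snd x - snd x') <= norm (Tw x - Tw x')" using norm_prod_bounds(3)[of "Tw x - Tw x'"] by (simp add: norm_Tw)
   ultimately show ?thesis by (simp add: algebra_simps)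
  qed
  show ?thesis by (rule key[of "2 + 16 * real n / dl"]) (use near 1 in "auto simp: Hm_def intro!: always_eventually b less_imp_le[OF conjunct1[OF on[OF st(2)]]]")
 next
  case 2
  have "\<forall>\<^sub>F y in at t. abs(snd (q y)) > dl / 2"
   by (rule order_tendstoD(1)[OF tendsto_rabs[OF tendsto_snd[OF lim]] 2])
  hence "\<forall>\<^sub>F y in at t. norm (q y - q t) <= 1 * norm (Hm S s j (q y) - Hm S s j (q t))"
   by eventually_elim (use 2 in "simp add: Hm_outer")
  thus ?thesis by (rule key)
 next
  case 3
  have ct: "abs(snd (q t)) <= dl" using 3 by simp
  have "continuous (at t) (%y. abs(lev j (q y) - lev j (q t)))" unfolding lev_def
   using has_vd_cont[OF dq] u0[OF j] by (intro cintros) auto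
  hence "((%y. abs(lev j (q y) - lev j (q t))) \<longlongrightarrow> 0) (at t)" unfolding continuous_at by simp
  hence "\<forall>\<^sub>F y in at t. abs(lev j (q y) - lev j (q t)) < ep * g0" by (rule order_tendstoD(2)) (use ep(1) Cg(2) in simp)
  moreover have "\<forall>\<^sub>F y in at t. abs(snd (q y)) < dl"
   by (rule order_tendstoD(2)[OF tendsto_rabs[OF tendsto_snd[OF lim]] 3(2)])
  ultimately have "\<forall>\<^sub>F y in at t. norm (q y - q t) <= (2 * (ep * C + 1)) * norm (Hm S s j (q y) - Hm S s j (q t))" using near
  proof eventually_elim
   case (elim y)
   have cy: "q y : cylinder" "q t : cylinder" using cyl elim(2,3) ct st(2) dl(5) by auto
   have o: "on1 (Ph j (q y))" "on1 (Ph j (q t))" using on elim(3) st(2) by auto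
   have sy: "abs(snd (q y)) <= dl" using elim(2) by simp
   have zz: "norm (fst (q y) - fst (q t)) <= ep * C * abs(snd (q y) - snd (q t))"
    by (rule K1_sep[OF j cy(1) o(1) sy cy(2) o(2) ct elim(1)])
   have "norm (q y - q t) <= norm (fst (q y) - fst (q t)) + abs(snd (q y) - snd (q t))"
    using norm_prod_bounds(1)[of "q y - q t"] by simp
   also have "... <= (ep * C + 1) * abs(snd (q y) - snd (q t))" using zz by (simp add: algebra_simps)
   also have "... <= (ep * C + 1) * (2 * abs(snd (Hm S s j (q y)) - snd (Hm S s j (q t))))"
    by (intro mult_left_mono Hm_snd_expand[OF j 3(1) st(1) _ _ zz] K1_small[OF j cy(1) o(1) sy] K1_small[OF j cy(2) o(2) ct])
     (use ep(1) Cg(1) in simp)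
   also have "... <= (ep * C + 1) * (2 * norm (Hm S s j (q y) - Hm S s j (q t)))"
    by (intro mult_left_mono) (use norm_prod_bounds(3)[of "Hm S s j (q y) - Hm S s j (q t)"] ep(1) Cg(1) in auto)
   finally show ?case by (simp only: mult.assoc mult.left_commute)
  qed
  thus ?thesis by (rule key)
 qed
qed

definition KS where "KS S s = curve_map (collar_move J Ph (Hm S s)) K1"

lemma pinch_profile: "log_profile (%t. pinch ep dl t + (if j : S then spin n dl t else 0))"
proof -
 note p = pinch[OF ep(1,4) dl(1,4)]
 have "C1_on UNIV (%t. pinch ep dl t + spin n dl t)"
 proof (rule C1_on_real(1)[OF open_UNIV])
  have h: "(w has_vd dd w t 1) (at t)" if "C1_on UNIV w" for w :: "real => complex" and t
  proof -
   have "dd w t h = h *R dd w t 1" for h using blinfun.scaleR_right[of "dd w t" h 1] by simp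
   thus ?thesis using C1_onD(1)[OF open_UNIV that, of t] unfolding has_vd_def by (metis (no_types, lifting) UNIV_I ext)
  qed
  show "((%t. pinch ep dl t + spin n dl t) has_vd dd (pinch ep dl) t 1 + dd (spin n dl) t 1) (at t)" for t
   by (intro has_vd_add h p(2) C1_on_spin)
  show "continuous_on UNIV (%t. dd (pinch ep dl) t 1 + dd (spin n dl) t 1)"
   by (intro cintros C1_onD(3)[OF open_UNIV] p(2) C1_on_spin)
 qed
 moreover have "exp (spin n dl t) = 1" if "abs t >= 1" for t by (rule exp_spin_outer[OF dl(1)]) (use that dl(5) in linarith)
 ultimately show ?thesis unfolding log_profile_def using p(2,3,4) by (cases "j : S") (auto simp: exp_add)
qed

lemma twist_to_KS:
 assumes f: "link_invariant f" and S: "S <= J"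
 shows "f (twisted n S Ph K) = f (st (KS S 1))" "embedded (KS S 1)"
proof -
 define w0 where "w0 = twist_log n S"
 define w1 where "w1 = (%j t. pinch ep dl t + (if j : S then spin n dl t else 0))"
 have lp: "log_profile (w0 j)" "log_profile (w1 j)" "log_profile (pinch ep dl)" for j
  unfolding w0_def w1_def using log_profile_twist_log[of n S j] pinch_profile[of j S] pinch_profile[of j "{}"] by (cases "j : S"; simp)+
 have ends: "w0 j t = w1 j t" if t: "abs t >= 1" for j t
 proof -
  have "1 <= 1 / dl" using dl(1,5) by simp
  hence "2 * t / dl <= -1 & t <= -1 | 1 <= 2 * t / dl & 1 <= t" using t dl(1,5) by (auto simp: field_simps abs_if split: if_splits)
  hence "ang (2 * t / dl) = ang t" using ang_outside by metis
  thus ?thesis unfolding w0_def w1_def twist_log_def spin_def pinch(4)[OF ep(1,4) dl(1,4) t] by simp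
 qed
 note inv = collar_mult_invariant[OF f K J(1) C3 disj avoid, of w0 w1] and inv1 = collar_mult_invariant(2)[OF f K J(1) C3 disj avoid, of "%_. pinch ep dl" "%_. pinch ep dl"]
 have K1: "embedded K1" unfolding K1_def by (rule inv1) (use lp in auto)
 have av1: "(K1 ! i) t ~: Ph j ` lateral" if ij: "i < length K1" "j : J" for i j t
 proof
  assume "(K1 ! i) t : Ph j ` lateral"
  then obtain x where x: "x : lateral" "(K1 ! i) t = Ph j x" by (elim imageE)
  have xc: "x : cylinder" "norm (fst x) = 1" using x(1) by (auto simp: mem_Times_iff)
  have o: "on1 (Ph j x)" unfolding on1_def using ij x(2) by metis
  obtain z where z: "(z, snd x) : cylinder" "on_sys K (Ph j (z, snd x))" "fst x = exp (pinch ep dl (snd x)) * z"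
   by (rule K1_cases[OF ij(2) xc(1) o])
  have "norm z = 1"
  proof (rule antisym)
   show "norm z <= 1" using z(1) by simp
   have "1 = norm (exp (pinch ep dl (snd x))) * norm z" using xc(2) unfolding z(3) norm_mult by simp
   also have "... <= 1 * norm z" by (rule mult_right_mono) (use pinch(3)[OF ep(1,4) dl(1,4)] in auto)
   finally show "1 <= norm z" by simp
  qed
  hence "(z, snd x) : lateral" using z(1) by auto
  thus False using z(2) avoid[OF _ ij(2)] by (metis imageI)
 qed
 note M = collar_move_invariant[OF f K1 J(1) C3 disj av1, of "Hm S", folded on1_def]
 have outer: "Hm S s j x = x" if "abs(snd x) >= 1" for s j x by (rule Hm_outer) (use that dl(5) in linarith)
 have *: "f (st (KS S 0)) = f (st (KS S 1))" "embedded (KS S 1)"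
  unfolding KS_def
  by (rule M(1), (assumption | rule Hm_cyl; assumption | rule outer; assumption | rule Hm_inj; assumption | rule Hm_fam; assumption | rule Hm_vd; (assumption | blast))+)
   (rule M(2), (assumption | rule Hm_cyl; assumption | rule outer; assumption | rule Hm_inj; assumption | rule Hm_fam; assumption | rule Hm_vd; (assumption | blast) | simp)+)
 have injJ: "inj_on (Ph j) cylinder" if "j : J" for j by (rule collar3D(7)[OF C3[OF that]])
 have "twists n S Ph = exp_mult J Ph w0" unfolding w0_def by (rule twists_eq_exp_mult[OF disj injJ S])
 hence "curve_map (twists n S Ph) K = curve_map (exp_mult J Ph w0) K" by simp
 moreover have "exp_mult J Ph w1 y = collar_move J Ph (Hm S 0) (collar_mult J Ph (%j t. exp (pinch ep dl t)) y)" for y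
 proof (cases rule: collar_cases[of J y Ph])
  case 1
  thus ?thesis using collar_mult_out[of J y Ph] collar_move_out[of J y Ph] by metis
 next
  case j: (2 j x)
  have c: "(exp (pinch ep dl (snd x)) * fst x, snd x) : cylinder"
   by (rule cyl_mult[OF j(2)]) (use pinch(3)[OF ep(1,4) dl(1,4)] in simp)
  show ?thesis unfolding j(3) collar_mult_in[OF disj injJ[OF j(1)] j(1,2)] collar_move_in[OF disj injJ[OF j(1)] j(1) c]
   by (simp add: w1_def Hm_def Tw_def exp_add mult.assoc mult.left_commute)
 qed
 hence "curve_map (exp_mult J Ph w1) K = KS S 0"
  unfolding KS_def K1_def curve_map_def by (simp add: comp_def)
 moreover have "f (st (curve_map (exp_mult J Ph w0) K)) = f (st (curve_map (exp_mult J Ph w1) K))"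
  by (rule inv(1)) (use lp ends in auto)
 ultimately show "f (twisted n S Ph K) = f (st (KS S 1))" using * by simp
 show "embedded (KS S 1)" by (rule *)
qed

definition active where "active j y <-> (EX x:cylinder. y = Ph j x & abs(snd x) < dl / 2)"

lemma KS_inactive:
 assumes "!!j. j : J ==> ~ active j y" shows "collar_move J Ph (Hm S 1) y = y"
proof (cases rule: collar_cases[of J y Ph])
 case 1
 thus ?thesis by (rule collar_move_out)
next
 case j: (2 j x)
 have "~ abs(snd x) < dl / 2" using assms[OF j(1)] j(2,3) unfolding active_def by blast
 thus ?thesis unfolding j(3) collar_move_in[OF disj collar3D(7)[OF C3[OF j(1)]] j(1,2)] by (simp add: Hm_outer)
qed

lemma KS_active:
 assumes j: "j : J" and x: "x : cylinder" "on1 (Ph j x)" "abs(snd x) < dl / 2"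
 shows "collar_move J Ph (Hm S 1) (Ph j x) = Ph j (Tw x) + (0, if j : S then 0 else gap j x)" "norm (Tw x) < r"
proof -
 have sx: "abs(snd x) <= dl" using x(3) by simp
 have e: "norm (fst x) <= ep" by (rule K1_small[OF j x(1,2) sx])
 have nT: "norm (Tw x) <= dl + dl / 2"
  using norm_prod_bounds(1)[of "Tw x"] norm_Tw[of x] e ep(3) x(3) by simp
 thus T: "norm (Tw x) < r" using dl(1,3) by linarith
 have "norm (Tw x + gap j x *R (u j, sv j)) <= norm (Tw x) + norm (gap j x *R (u j, sv j))" by (rule norm_triangle_ineq)
 also have "... < r" using nT Hm_inner(3)[OF j e sx, of 0] x(3) dl(1,3) by simp
 finally show "collar_move J Ph (Hm S 1) (Ph j x) = Ph j (Tw x) + (0, if j : S then 0 else gap j x)"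
  unfolding collar_move_in[OF disj collar3D(7)[OF C3[OF j]] j x(1)] using vert[OF j T, of "gap j x"]
  by (cases "j : S") (simp_all add: Hm_def flip: zero_prod_def)
qed

lemma KS_local:
 assumes y: "on1 y" and j: "!!i. i : J ==> active i y ==> i = j"
 shows "collar_move J Ph (Hm S 1) y = collar_move J Ph (Hm (S Int {j}) 1) y"
proof (cases "EX i:J. active i y")
 case False
 thus ?thesis using KS_inactive[of y S] KS_inactive[of y "S Int {j}"] by metis
next
 case True
 hence "j : J" "active j y" using j by metis+
 then obtain x where x: "j : J" "x : cylinder" "y = Ph j x" "abs(snd x) < dl / 2" unfolding active_def by blast
 show ?thesis unfolding x(3) KS_active(1)[OF x(1,2) y[unfolded x(3)] x(4)] by simp
qed

lemma KS_fst: "on1 y ==> fst (collar_move J Ph (Hm S 1) y) = fst (collar_move J Ph (Hm T 1) y)"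
proof (cases "EX j:J. active j y")
 case False
 thus ?thesis using KS_inactive[of y S] KS_inactive[of y T] by metis
next
 case True
 assume y: "on1 y"
 obtain j x where x: "j : J" "x : cylinder" "y = Ph j x" "abs(snd x) < dl / 2" using True unfolding active_def by blast
 show ?thesis unfolding x(3) KS_active(1)[OF x(1,2) y[unfolded x(3)] x(4)] by simp
qed

lemma KS_far:
 assumes "on1 y" "on1 y'" "i : J" "j : J" "i ~= j" "active i y" "active j y'"
 shows "norm (fst (collar_move J Ph (Hm S 1) y) - fst (collar_move J Ph (Hm S 1) y')) > rh"
proof -
 obtain x where x: "x : cylinder" "y = Ph i x" "abs(snd x) < dl / 2" using assms(6) unfolding active_def by blast
 obtain x' where x': "x' : cylinder" "y' = Ph j x'" "abs(snd x') < dl / 2" using assms(7) unfolding active_def by blast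
 note a = KS_active[OF assms(3) x(1) assms(1)[unfolded x(2)] x(3)] and a' = KS_active[OF assms(4) x'(1) assms(2)[unfolded x'(2)] x'(3)]
 show ?thesis unfolding x(2) x'(2) a(1) a'(1) using far[OF assms(3-5) a(2) a'(2)] by simp
qed

theorem twist_alternating_sum:
 fixes f :: "link => 'a::ab_group_add"
 assumes f: "link_invariant f" "finite_type m f" and card: "card J = m + 1"
 shows "alternating_sum J (%S. f (twisted n S Ph K)) = 0"
proof -
 define P where "P = map (%ga t. fst (ga t)) (KS J 1)"
 define h where "h = (%S. map (%ga t. snd (ga t)) (KS S 1))"
 have len: "length (KS S 1) = length K1" for S unfolding KS_def by simp
 have lP: "length P = length K1" "length (h S) = length P" for S unfolding P_def h_def using len by simp_all
 have nth: "i < length K1 ==> KS S 1 ! i = (%t. collar_move J Ph (Hm S 1) ((K1 ! i) t))" for S i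
  unfolding KS_def by simp
 have on: "i < length K1 ==> on1 ((K1 ! i) t)" for i t unfolding on1_def by blast
 have g: "lifted P (h S) = KS S 1" for S
 proof (rule nth_equalityI)
  fix i assume "i < length (lifted P (h S))"
  hence i: "i < length K1" using lP by simp
  show "lifted P (h S) ! i = KS S 1 ! i"
  proof
   fix t
   have "(lifted P (h S) ! i) t = (fst ((KS J 1 ! i) t), snd ((KS S 1 ! i) t))"
    using i lP len by (simp add: P_def h_def)
   thus "(lifted P (h S) ! i) t = (KS S 1 ! i) t"
    unfolding nth[OF i] KS_fst[OF on[OF i], of J _ S] by simp
  qed
 qed (use lP len in simp)
 have C1: "closed_C1 (KS S 1 ! i)" if "S <= J" "i < length K1" for S i
  by (rule embedded_C1[OF twist_to_KS(2)[OF f(1) that(1)]]) (use that len in simp)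
 have "alternating_sum J (%S. f (st (lifted P (h S)))) = 0"
 proof (rule local_flips_alternating_sum[OF f J(1) card _ _ lP(2) _ rh])
  show "closed_C1 (P ! i)" if "i < length P" for i
   using closed_C1_bounded_linear[OF bounded_linear_fst C1[OF order_refl, of i]] that lP len unfolding P_def by simp
  show "closed_C1 (h S ! i)" if "S <= J" "i < length P" for S i
   using closed_C1_bounded_linear[OF bounded_linear_snd C1[OF that(1), of i]] that lP len unfolding h_def by simp
  show "embedded (lifted P (h S))" if "S <= J" for S unfolding g by (rule twist_to_KS(2)[OF f(1) that])
  fix p p' assume p: "p : params P" "p' : params P" "norm (pt P p - pt P p') <= rh"
  have i: "fst p < length K1" "fst p' < length K1" using p(1,2) lP unfolding params_def by auto
  define y y' where "y = (K1 ! fst p) (snd p)" and "y' = (K1 ! fst p') (snd p')"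
  have o: "on1 y" "on1 y'" unfolding y_def y'_def using on i by auto
  have P: "pt P p = fst (collar_move J Ph (Hm J 1) y)" "pt P p' = fst (collar_move J Ph (Hm J 1) y')"
   unfolding pt_def P_def y_def y'_def using i len nth by simp_all
  have h: "pt (h S) p = snd (collar_move J Ph (Hm S 1) y)" "pt (h S) p' = snd (collar_move J Ph (Hm S 1) y')" for S
   unfolding pt_def h_def y_def y'_def using i len nth by simp_all
  have "EX j:J. ALL i:J. active i y | active i y' --> i = j"
  proof (rule ccontr)
   assume n: "~ ?thesis"
   obtain j0 where "j0 : J" using J(2) by blast
   have "EX i:J. EX j:J. i ~= j & active i y & active j y'"
   proof -
    have one: "i = j" if "i : J" "j : J" "active i z" "active j z" for i j z
     by (rule disj_cylD[OF disj that(1,2), of z]) (use that(3,4) in "auto simp: active_def")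
    show ?thesis using n one `j0 : J` by metis
   qed
   thus False using KS_far[OF o] p(3) unfolding P by (metis linorder_not_le)
  qed
  then obtain j where j: "j : J" "!!i. i : J ==> active i y ==> i = j" "!!i. i : J ==> active i y' ==> i = j" by blast
  show "EX j:J. ALL S<=J. pt (h S) p = pt (h (S Int {j})) p & pt (h S) p' = pt (h (S Int {j})) p'"
   unfolding h using KS_local[OF o(1) j(2)] KS_local[OF o(2) j(3)] j(1) by metis
 qed
 hence "alternating_sum J (%S. f (st (KS S 1))) = 0" unfolding g .
 moreover have "alternating_sum J (%S. f (twisted n S Ph K)) = alternating_sum J (%S. f (st (KS S 1)))"
  by (rule alt_sum_cong) (rule twist_to_KS(1)[OF f(1)])
 ultimately show ?thesis by (simp only:)
qed

end

end

section \<open>Making collars affine\<close>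

definition lin_isotopic :: "(R3 => R3) => bool" where
 "lin_isotopic G <-> C1_on UNIV G & (ALL s:{0..1}. inj (%x. x + s *R (G x - x)) & (ALL x v. v + s *R (dd G x v - v) = 0 --> v = 0))"

lemma lin_isotopicD:
 assumes "lin_isotopic G" shows "C1_on UNIV G" "inj G" "inj (dd G x)"
proof -
 have h: "inj (%x. x + 1 *R (G x - x))" "v + 1 *R (dd G x v - v) = 0 --> v = 0" for x v
  using assms unfolding lin_isotopic_def by (meson atLeastAtMost_iff order_refl zero_le_one)+
 show "C1_on UNIV G" "inj G" using assms h(1) unfolding lin_isotopic_def by auto
 have "v = 0" if "dd G x v = 0" for v using h(2)[of v x] that by simp
 thus "inj (dd G x)" by (intro injI) (metis blinfun.diff_right eq_iff_diff_eq_0)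
qed

lemma lin_isotopic_invariant:
 assumes G: "lin_isotopic G" and K: "embedded K" and f: "link_invariant f"
 shows "f (st (curve_map G K)) = f (st K)" "embedded (curve_map G K)"
proof -
 define Gs where "Gs = (%s. curve_map (%x. x + s *R (G x - x)) K)"
 note C1G = lin_isotopicD(1)[OF G]
 have C: "closed_C1 (%t. G ((K ! i) t))" "vd (%t. G ((K ! i) t)) t = dd G ((K ! i) t) (vd (K ! i) t)" if i: "i < length K" for i t
 proof -
  note k = embedded_C1[OF K i]
  note c = C1_fam_on_compose[OF C1_fam_on_const[OF k, of UNIV] open_UNIV C1G UNIV_I]
  have "C1_family (%_ t. G ((K ! i) t))" unfolding C1_family_iff using c(1) k unfolding closed_C1_def by simp
  thus "closed_C1 (%t. G ((K ! i) t))" unfolding C1_family_def by force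
  show "vd (%t. G ((K ! i) t)) t = dd G ((K ! i) t) (vd (K ! i) t)" using c(2)[of 0 t] by simp
 qed
 have fam: "C1_family (%s. Gs s ! i)" if i: "i < length K" for i
  using C1_family_linear[OF embedded_C1[OF K i] C(1)[OF i]] i unfolding Gs_def by simp
 have emb: "embedded (Gs s)" if s: "s : {0..1}" for s
 proof (rule embedded_over[OF K])
  fix i assume i: "i < length K"
  show "closed_C1 (Gs s ! i)" using fam[OF i] s unfolding C1_family_def by blast
  fix t
  have "((%t. (K ! i) t + s *R (G ((K ! i) t) - (K ! i) t)) has_vd
    vd (K ! i) t + s *R (dd G ((K ! i) t) (vd (K ! i) t) - vd (K ! i) t)) (at t)"
   using closed_C1_has_vd[OF C(1)[OF i], of t] unfolding C(2)[OF i]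
   by (intro has_vd_add has_vd_diff closed_C1_has_vd embedded_C1[OF K i]
     bl_has_vd[OF bounded_linear_scaleR_right])
  hence "vd (Gs s ! i) t = vd (K ! i) t + s *R (dd G ((K ! i) t) (vd (K ! i) t) - vd (K ! i) t)"
   unfolding Gs_def using i vd_eqI by simp
  moreover have "ALL x v. v + s *R (dd G x v - v) = 0 --> v = 0" using G s unfolding lin_isotopic_def by blast
  ultimately show "vd (Gs s ! i) t ~= 0" using embedded_vd[OF K i, of t] by (metis (no_types))
 next
  fix i j t t' assume a: "i < length K" "j < length K" "(Gs s ! i) t = (Gs s ! j) t'"
  have "inj (%x. x + s *R (G x - x))" using G s unfolding lin_isotopic_def by blast
  from injD[OF this, of "(K ! i) t" "(K ! j) t'"] a show "(K ! i) t = (K ! j) t'" unfolding Gs_def by simp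
 qed (simp add: Gs_def)
 have "f (st (Gs 0)) = f (st (Gs 1))" by (rule invariant_C1_family_R3[OF f _ fam emb]) (auto simp: Gs_def)
 moreover have "Gs 0 = K" "Gs 1 = curve_map G K" unfolding Gs_def curve_map_def by auto
 ultimately show "f (st (curve_map G K)) = f (st K)" "embedded (curve_map G K)" using emb[of 1] by auto
qed

lemma lin_isotopic_small:
 assumes E: "C1_on UNIV E" and le: "!!x v. norm (dd E x v) <= norm v / 2"
 shows "lin_isotopic (%x. x + E x)"
proof -
 have d: "((%x. x + E x) has_derivative (%v. v + dd E x v)) (at x)" for x
  by (intro has_derivative_add has_derivative_ident C1_onD(1)[OF open_UNIV E UNIV_I])
 have C1: "C1_on UNIV (%x. x + E x)"
  by (rule C1_onI(1)[OF open_UNIV d]) (intro cintros C1_onD(3)[OF open_UNIV E])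
 have Lip: "norm (E x - E y) <= 1/2 * norm (x - y)" for x y
 proof (rule differentiable_bound[where S = UNIV and f' = "%x. blinfun_apply (dd E x)"])
  show "(E has_derivative dd E x) (at x within UNIV)" for x by (rule C1_onD(1)[OF open_UNIV E UNIV_I])
  show "onorm (dd E x) <= 1/2" for x by (rule onorm_le) (use le[of x] in simp)
 qed auto
 have half: "v = 0" if "norm (s *R w) >= norm v" "norm w <= norm v / 2" "s : {0..1}" for s :: real and v w :: "R3"
 proof -
  have "abs s * norm w <= 1 * (norm v / 2)" by (rule mult_mono) (use that in auto)
  hence "norm v <= 0" using that(1) unfolding norm_scaleR by linarith
  thus ?thesis by (simp only: norm_le_zero_iff)
 qed
 show ?thesis unfolding lin_isotopic_def
 proof (intro conjI ballI allI impI C1)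
  fix s :: real assume s: "s : {0..1}"
  show "inj (%x. x + s *R (x + E x - x))"
  proof (rule injI)
   fix x y assume "x + s *R (x + E x - x) = y + s *R (y + E y - y)"
   hence "x - y = s *R (E y - E x)" by (simp add: algebra_simps)
   hence "x - y = 0" using Lip[of y x] by (intro half[OF _ _ s, of _ "E y - E x"]) (auto simp: norm_minus_commute)
   thus "x = y" by simp
  qed
  fix x v assume "v + s *R (dd (%x. x + E x) x v - v) = 0"
  hence "v = - (s *R dd E x v)" unfolding dd_eqI[OF d] by (simp add: eq_neg_iff_add_eq_0)
  hence "norm v = norm (s *R dd E x v)" by (metis norm_minus_cancel)
  thus "v = 0" by (intro half[OF _ le[of x] s]) simp
 qed
qed

lemma C1_on_local:
 assumes "!!x. EX N g. open N & x : N & C1_on N g & (ALL y:N. h y = g y) & (ALL v. norm (dd g x v) <= k * norm v)"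
 shows "C1_on UNIV h" "norm (dd h x v) <= k * norm v"
proof -
 have loc: "EX N g. open N & x : N & C1_on N g & (ALL y:N. (h has_derivative dd g y) (at y)) & (ALL v. norm (dd g x v) <= k * norm v)" for x
 proof -
  obtain N g where N: "open N" "x : N" "C1_on N g" "ALL y:N. h y = g y" "ALL v. norm (dd g x v) <= k * norm v" using assms[of x] by blast
  have "(h has_derivative dd g y) (at y)" if "y : N" for y
   using has_derivative_transform_within_open[OF C1_onD(1)[OF N(1,3) that] N(1) that] N(4) by simp
  thus ?thesis using N by blast
 qed
 have eq: "blinfun_apply (dd h y) = dd g y" if "(h has_derivative dd g y) (at y)" for y and g :: "'a => 'b" by (rule dd_eqI[OF that])
 show "norm (dd h x v) <= k * norm v" using loc[of x] eq by metis
 show "C1_on UNIV h"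
 proof (rule C1_onI(1)[OF open_UNIV, of h "%x. blinfun_apply (dd h x)"])
  show "(h has_derivative dd h x) (at x)" for x using loc[of x] eq by metis
  fix v
  show "continuous_on UNIV (%x. dd h x v)" unfolding cont_on_open[OF open_UNIV]
  proof
   fix x
   obtain N g where N: "open N" "x : N" "C1_on N g" "ALL y:N. (h has_derivative dd g y) (at y)" using loc[of x] by blast
   have "continuous_on N (%x. dd h x v) <-> continuous_on N (%x. dd g x v)"
    by (rule continuous_on_cong) (use eq N(4) in auto)
   hence "continuous_on N (%x. dd h x v)" using C1_onD(3)[OF N(1,3)] by (auto intro: cintros)
   thus "isCont (%x. dd h x v) x" using N(1,2) cont_on_open by blast
  qed
 qed
qed

lemma C1_near_affine:
 fixes Ph :: "'a::euclidean_space => 'b::real_normed_vector"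
 assumes W: "open W" "0 : W" "C1_on W Ph" and et: "et > 0"
 obtains r where "r > 0" "cball 0 r <= W" "!!w v. norm w <= r ==> norm (dd Ph w v - dd Ph 0 v) <= et * norm v"
  "!!w. norm w <= r ==> norm (Ph w - Ph 0 - dd Ph 0 w) <= et * norm w"
proof -
 obtain d where d: "d > 0" "cball 0 d <= W" using W(1,2) open_contains_cball by blast
 have "isCont (dd Ph) 0" using C1_onD(3)[OF W(1,3)] W(1,2) cont_on_open by blast
 then obtain e where e: "e > 0" "!!w. dist w 0 < e ==> dist (dd Ph w) (dd Ph 0) < et" unfolding continuous_at_eps_delta using et by blast
 define r where "r = min d (e / 2)"
 have r: "r > 0" "r <= d" "r < e" unfolding r_def using d e by auto
 have D: "norm (dd Ph w v - dd Ph 0 v) <= et * norm v" if "norm w <= r" for w v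
 proof -
  have "norm ((dd Ph w - dd Ph 0) v) <= norm (dd Ph w - dd Ph 0) * norm v" by (rule norm_blinfun)
  also have "... <= et * norm v" using e(2)[of w] that r by (intro mult_right_mono) (auto simp: dist_norm)
  finally show ?thesis by (simp add: blinfun.diff_left)
 qed
 have sub: "cball 0 r <= W" using d(2) r(2) by auto
 have "norm ((Ph w - dd Ph 0 w) - (Ph 0 - dd Ph 0 0)) <= et * norm (w - 0)" if "norm w <= r" for w
 proof (rule differentiable_bound[where S = "cball 0 r" and f' = "%w v. dd Ph w v - dd Ph 0 v"])
  fix x :: 'a assume x: "x : cball 0 r"
  show "((%w. Ph w - dd Ph 0 w) has_derivative (%v. dd Ph x v - dd Ph 0 v)) (at x within cball 0 r)"
   by (intro has_derivative_diff has_derivative_at_withinI[OF C1_onD(1)[OF W(1,3)]] subsetD[OF sub x]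
     bounded_linear_imp_has_derivative blinfun.bounded_linear_right)
  show "onorm (%v. dd Ph x v - dd Ph 0 v) <= et" by (rule onorm_le) (use D x in auto)
 qed (use that r in auto)
 thus thesis using that[OF r(1) sub D] by (simp add: blinfun.zero_right algebra_simps)
qed

text \<open>Add to the identity the second order error of each collar, cut off at radius \<open>r j\<close>. The cut-off
contributes a factor of order \<open>1 / r j\<close> against an error that is small compared with \<open>r
j\<close>.\<close>
lemma affinize_collars:
 assumes J: "finite J" and C: "!!j. j : J ==> collar3 (Ph j) (W j)" and disj: "disj_cyl Ph J"
 obtains G r where "lin_isotopic G" "r > 0" "!!j w. j : J ==> norm w < r ==> G (Ph j w) = Ph j 0 + dd (Ph j) 0 w"
proof -
 let ?v = "%j. inv_into (W j) (Ph j)"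
 have z: "0 : cylinder" by (simp add: zero_prod_def)
 have "EX r m. 0 < r & r <= 1 & m > 0 & (ALL v. m * norm v <= norm (dd (Ph j) 0 v)) &
  (ALL w v. norm w <= r --> norm (dd (Ph j) w v - dd (Ph j) 0 v) <= m / 20 * norm v) &
  (ALL w. norm w <= r --> norm (Ph j w - Ph j 0 - dd (Ph j) 0 w) <= m / 20 * norm w)" if j: "j : J" for j
 proof -
  note c = collar3D[OF C[OF j]]
  have W0: "0 : W j" by (rule subsetD[OF c(2) z])
  obtain m where m: "m > 0" "!!v. m * norm v <= norm (dd (Ph j) 0 v)"
   by (rule linear_inj_bounded_below_pos[OF _ c(5)[OF W0]]) (auto simp: blinfun.bounded_linear_right bounded_linear.linear)
  have "m / 20 > 0" using m(1) by simp
  then obtain r where r: "r > 0" "!!w v. norm w <= r ==> norm (dd (Ph j) w v - dd (Ph j) 0 v) <= m / 20 * norm v"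
   "!!w. norm w <= r ==> norm (Ph j w - Ph j 0 - dd (Ph j) 0 w) <= m / 20 * norm w"
   using C1_near_affine[OF c(1) W0 c(3), of "m / 20"] by metis
  show ?thesis by (rule exI[of _ "min r 1"], rule exI[of _ m]) (use r m in auto)
 qed
 then obtain r m where rm: "!!j. j : J ==> 0 < r j & r j <= 1 & m j > 0"
  "!!j v. j : J ==> m j * norm v <= norm (dd (Ph j) 0 v)"
  "!!j w v. j : J ==> norm w <= r j ==> norm (dd (Ph j) w v - dd (Ph j) 0 v) <= m j / 20 * norm v"
  "!!j w. j : J ==> norm w <= r j ==> norm (Ph j w - Ph j 0 - dd (Ph j) 0 w) <= m j / 20 * norm w" by metis
 define b where "b = (%j (w::R3). stepf (2 - 2 * (w \<bullet> w) / (r j)^2))"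
 define D where "D = (%j w. Ph j 0 + dd (Ph j) 0 w - Ph j w)"
 define F where "F = (%j w. b j w *R D j w)"
 have cyl: "cball 0 (r j) <= cylinder" if "j : J" for j
 proof
  fix w :: "R3" assume "w : cball 0 (r j)"
  hence "norm w <= 1" using rm(1)[OF that] by simp
  hence "norm (fst w) <= 1" "norm (snd w) <= 1" using norm_prod_bounds(2,3)[of w] by linarith+
  thus "w : cylinder" by (auto simp: mem_Times_iff)
 qed
 have F0: "F j w = 0" if "j : J" "norm w >= r j" for j w
 proof -
  have "(r j)^2 <= w \<bullet> w" unfolding dot_square_norm using that rm(1)[OF that(1)] by (intro power_mono) auto
  hence "2 - 2 * (w \<bullet> w) / (r j)^2 <= 0" using rm(1)[OF that(1)] by (simp add: field_simps)
  thus ?thesis unfolding F_def b_def stepf_def by simp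
 qed
 have b1: "b j w = 1" if "j : J" "norm w < r j / 2" for j w
 proof -
  have "w \<bullet> w <= (r j / 2)^2" unfolding dot_square_norm using that by (intro power_mono) auto
  hence "w \<bullet> w <= (r j)^2 / 4" by (simp add: power_divide)
  hence "w \<bullet> w * 2 <= (r j)^2" using inner_ge_zero[of w] by linarith
  hence "2 - 2 * (w \<bullet> w) / (r j)^2 >= 1" using rm(1)[OF that(1)] by (simp add: field_simps)
  thus ?thesis unfolding b_def stepf_def by simp
 qed
 define F' where "F' = (%j w v. b j w *R (dd (Ph j) 0 v - dd (Ph j) w v) + (stepf' (2 - 2 * (w \<bullet> w) / (r j)^2) * (- (4 * (w \<bullet> v)) / (r j)^2)) *R D j w)"
 have dF: "(F j has_derivative F' j w) (at w)" if j: "j : J" "w : W j" for j w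
 proof -
  have "((%w. 2 - 2 * (w \<bullet> w) / (r j)^2) has_derivative (%v. - (4 * (w \<bullet> v)) / (r j)^2)) (at w)"
   using rm(1)[OF j(1)] by (auto intro!: dintros simp: inner_commute field_simps)
  from has_derivative_compose[OF this DERIV_stepf[unfolded has_field_derivative_def]]
  have h: "(b j has_derivative (%v. stepf' (2 - 2 * (w \<bullet> w) / (r j)^2) * (- (4 * (w \<bullet> v)) / (r j)^2))) (at w)"
   unfolding b_def by simp
  have "(D j has_derivative (%v. 0 + dd (Ph j) 0 v - dd (Ph j) w v)) (at w)" unfolding D_def
   by (intro has_derivative_diff has_derivative_add has_derivative_const C1_onD(1)[OF collar3D(1,3)[OF C[OF j(1)]] j(2)]
     bounded_linear_imp_has_derivative blinfun.bounded_linear_right)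
  from has_derivative_scaleR[OF h this] show ?thesis unfolding F_def F'_def by simp
 qed
 have C1F: "C1_on (W j) (F j)" if j: "j : J" for j
 proof (rule C1_onI(1)[OF collar3D(1)[OF C[OF j]] dF[OF j]])
  note c = collar3D(1,3)[OF C[OF j]]
  have cs: "continuous_on (W j) (%w. g (2 - 2 * (w \<bullet> w) / (r j)^2))" if "continuous_on UNIV g" for g :: "real => real"
   by (rule cont_comp[OF that]) (use rm(1)[OF j] in "auto intro!: cintros")
  show "continuous_on (W j) (%w. F' j w v)" for v unfolding F'_def b_def D_def
   by (intro cintros cs C1_onD(3,4)[OF c] continuous_on_stepf' C1_onD(4)[OF open_UNIV C1_on_stepf]) (use rm(1)[OF j] in auto)
 qed
 have bound: "norm (F' j w v) <= 1/2 * norm (dd (Ph j) w v)" if j: "j : J" "w : W j" for j w v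
 proof (cases "norm w <= r j")
  case True
  have r0: "0 < r j" "m j > 0" using rm(1)[OF j(1)] by auto
  have "D j w = - (Ph j w - Ph j 0 - dd (Ph j) 0 w)" unfolding D_def by simp
  hence "norm (D j w) = norm (Ph j w - Ph j 0 - dd (Ph j) 0 w)" by (simp only: norm_minus_cancel)
  also have "... <= m j / 20 * norm w" by (rule rm(4)[OF j(1) True])
  also have "... <= m j / 20 * r j" using True r0 by (intro mult_left_mono) auto
  finally have nD: "norm (D j w) <= m j / 20 * r j" .
  have "norm (F' j w v) <= abs(b j w) * norm (dd (Ph j) 0 v - dd (Ph j) w v) + abs(stepf' (2 - 2 * (w \<bullet> w) / (r j)^2)) * (4 * abs(w \<bullet> v) / (r j)^2) * norm (D j w)"
   unfolding F'_def by (rule order_trans[OF norm_triangle_ineq]) (simp add: abs_mult)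
  also have "... <= 1 * (m j / 20 * norm v) + 2 * (4 * (r j * norm v) / (r j)^2) * (m j / 20 * r j)"
  proof (intro add_mono mult_mono stepf'_bound nD divide_right_mono)
   show "norm (dd (Ph j) 0 v - dd (Ph j) w v) <= m j / 20 * norm v" using rm(3)[OF j(1) True, of v] by (simp add: norm_minus_commute)
   show "abs(b j w) <= 1" unfolding b_def using stepf_bounds by simp
   show "abs(w \<bullet> v) <= r j * norm v" by (rule order_trans[OF Cauchy_Schwarz_ineq2 mult_right_mono[OF True]]) simp
  qed (use r0 in auto)
  also have "... = 9 / 20 * (m j * norm v)" using r0 by (simp add: power2_eq_square field_simps)
  finally have F9: "norm (F' j w v) <= 9 / 20 * (m j * norm v)" .
  have "m j * norm v <= norm (dd (Ph j) w v) + m j / 20 * norm v"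
   using rm(2)[OF j(1), of v] rm(3)[OF j(1) True, of v] norm_triangle_ineq2[of "dd (Ph j) 0 v" "dd (Ph j) w v"]
   by (simp add: norm_minus_commute)
  moreover have "0 <= m j * norm v" using r0 by simp
  ultimately show ?thesis using F9 by linarith
 next
  case False
  define N where "N = W j Int {w. norm w > r j}"
  have "open N" unfolding N_def using collar3D(1)[OF C[OF j(1)]] by (intro open_Int open_Collect_less) (auto intro!: cintros)
  moreover have "w : N" unfolding N_def using False j by simp
  ultimately have "(F j has_derivative (%_. 0)) (at w)"
   by (rule has_derivative_transform_within_open[OF has_derivative_const[of 0]]) (use F0[OF j(1)] in "auto simp: N_def")
  hence "F' j w v = 0" using has_derivative_unique[OF dF[OF j]] by metis
  thus ?thesis by simp
 qed
 define S where "S = (%j. Ph j ` cball 0 (r j))"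
 define E where "E = (%y. SUM j:J. if y : S j then F j (?v j y) else 0)"
 have cS: "closed (S j)" if "j : J" for j unfolding S_def
  by (intro compact_imp_closed compact_continuous_image continuous_on_subset[OF C1_onD(4)[OF collar3D(1,3)[OF C[OF that]]]])
   (use cyl[OF that] collar3D(2)[OF C[OF that]] in auto)
 have Sd: "y ~: S i" if "i : J" "j : J" "i ~= j" "y : S j" for i j y
  using disj that cyl unfolding S_def disjoint_family_on_def by blast
 have E1: "E y = F j (?v j y)" if "j : J" "y : Ph j ` W j" "!!i. i : J ==> i ~= j ==> y ~: S i" for j y
 proof -
  have "E y = (SUM i:{j}. if y : S i then F i (inv_into (W i) (Ph i) y) else 0)"
   unfolding E_def by (rule sum.mono_neutral_right[OF J]) (use that in auto)
  moreover have "F j (?v j y) = 0" if "y ~: S j"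
  proof (rule F0[OF `j : J`])
   have "Ph j (?v j y) = y" using \<open>y : Ph j ` W j\<close> by (rule f_inv_into_f)
   hence "?v j y ~: cball 0 (r j)" using `y ~: S j` unfolding S_def by (metis imageI)
   thus "r j <= norm (?v j y)" by simp
  qed
  ultimately show ?thesis by simp
 qed
 have local: "EX N g. open N & y : N & C1_on N g & (ALL x:N. E x = g x) & (ALL v. norm (dd g y v) <= 1/2 * norm v)" for y
 proof (cases "EX j:J. y : S j")
  case False
  have "open (- (UN j:J. S j))" using cS J by (intro open_Compl closed_UN) auto
  moreover have "ALL x:- (UN j:J. S j). E x = 0" unfolding E_def by (auto intro!: sum.neutral)
  moreover have "C1_on (- (UN j:J. S j)) (%_. 0 :: R3)" by (rule C1_onI(1)[where g' = "%_ _. 0"]) (use calculation in auto)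
  moreover have "blinfun_apply (dd (%_. 0 :: R3) y) = (%_. 0)" by (rule dd_eqI) simp
  ultimately show ?thesis using False by (intro exI[of _ "- (UN j:J. S j)"] exI[of _ "%_. 0"]) auto
 next
  case True
  then obtain j where j: "j : J" "y : S j" by blast
  note c = collar3D[OF C[OF j(1)]]
  have inv: "open (Ph j ` W j)" "C1_on (Ph j ` W j) (?v j)"
    "!!y v. y : Ph j ` W j ==> dd (Ph j) (?v j y) (dd (?v j) y v) = v"
   by (rule C1_inverse[OF c(1,3,4)], (erule c(5) | assumption))+
  define N where "N = Ph j ` W j - (UN i:J - {j}. S i)"
  have N: "open N" unfolding N_def using inv(1) cS J by (intro open_Diff closed_UN) auto
  have sub: "N <= Ph j ` W j" unfolding N_def by blast
  have yN: "y : N" using Sd[OF _ j(1) _ j(2)] j(2) cyl[OF j(1)] c(2) unfolding N_def S_def by blast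
  have g: "C1_on N (%y. F j (?v j y))"
   "blinfun_apply (dd (%y. F j (?v j y)) y) = (%v. dd (F j) (?v j y) (dd (?v j) y v))"
   using C1_on_compose[OF N C1_on_subset[OF inv(1,2) sub] c(1) C1F[OF j(1)]] inv_into_into[OF subsetD[OF sub]] yN by auto
  have wy: "?v j y : W j" using inv_into_into[OF subsetD[OF sub yN]] .
  have "norm (dd (%y. F j (?v j y)) y v) <= 1/2 * norm v" for v
   using bound[OF j(1) wy, of "dd (?v j) y v"] inv(3)[OF subsetD[OF sub yN], of v]
   unfolding g(2) dd_eqI[OF dF[OF j(1) wy]] by simp
  moreover have "ALL x:N. E x = F j (?v j x)" using E1[OF j(1)] unfolding N_def by blast
  ultimately show ?thesis using N yN g(1) by blast
 qed
 have li: "lin_isotopic (%x. x + E x)"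
  by (rule lin_isotopic_small[OF C1_on_local(1)[of E "1/2"]]) (use local C1_on_local(2)[of E "1/2", OF local] in auto)
 obtain r0 where r0: "r0 > 0" "!!j. j : J ==> r0 <= r j / 2"
 proof (rule finite_uniform_bound[OF J, of "%j e. e <= r j / 2"])
  show "EX e>0. e <= r j / 2" if "j : J" for j using rm(1)[OF that] by (intro exI[of _ "r j / 2"]) simp
 qed (auto intro: that)
 show thesis
 proof (rule that[OF li r0(1)])
  fix j and w :: "R3" assume j: "j : J" and w: "norm w < r0"
  have wS: "w : cball 0 (r j)" "norm w < r j / 2" using w r0(2)[OF j] rm(1)[OF j] by auto
  have wW: "w : W j" using wS(1) cyl[OF j] collar3D(2)[OF C[OF j]] by blast
  have "Ph j w : S j" unfolding S_def using wS(1) by blast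
  hence "E (Ph j w) = F j (?v j (Ph j w))" using E1[OF j _ Sd[OF _ j]] wW by blast
  also have "?v j (Ph j w) = w" by (rule inv_into_f_f[OF collar3D(4)[OF C[OF j]] wW])
  finally show "Ph j w + E (Ph j w) = Ph j 0 + dd (Ph j) 0 w" unfolding F_def b1[OF j wS(2)] D_def by simp
 qed
qed

section \<open>Strands in the coordinates of a collar\<close>

lemma strand_coordinates_cases:
 assumes C: "collar3 Ph W" and ga: "closed_C1 ga"
 obtains (away) U e where "open U" "s0 : U" "e > 0" "!!s x. s : U ==> x : cylinder ==> ga s = Ph x ==> abs(snd x) > e"
 | (crossing) U q where "open U" "s0 : U" "!!s x. s : U ==> x : cylinder ==> ga s = Ph x ==> x = q s"
  "!!s. s : U ==> (q has_vd vd q s) (at s)" "continuous_on U (vd q)"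
  "q s0 : cylinder" "snd (q s0) = 0" "ga s0 = Ph (q s0)" "dd Ph (q s0) (vd q s0) = vd ga s0"
proof -
 note c = collar3D[OF C]
 have vim: "open (ga -` U)" if "open U" for U by (rule open_vimage[OF that closed_C1_cont[OF ga]])
 show thesis
 proof (cases "ga s0 : Ph ` cylinder")
  case False
  show thesis
  proof (rule away[of "ga -` (- Ph ` cylinder)" 1])
   show "open (ga -` (- Ph ` cylinder))" by (intro vim open_Compl compact_imp_closed c(6))
   show "s0 : ga -` (- Ph ` cylinder)" using False by simp
   show "abs(snd x) > 1" if "s : ga -` (- Ph ` cylinder)" "x : cylinder" "ga s = Ph x" for s x
    using that(1) imageI[OF that(2), of Ph] that(3) by simp
  qed simp
 next
  case True
  define U where "U = ga -` (Ph ` W)"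
  have "open (Ph ` W)" by (rule C1_inverse(1)[OF c(1,3,4)]) (rule c(5))
  hence U: "open U" "!!s. s : U ==> ga s : Ph ` W" unfolding U_def using vim by auto
  have s0: "s0 : U" unfolding U_def using True image_mono[OF c(2), of Ph] by blast
  obtain q where q: "!!t. t : U ==> q t : W & Ph (q t) = ga t" "C1_fam_on U (%_. q)" "!!t. t : U ==> dd Ph (q t) (vd q t) = vd ga t"
   by (rule collar_coordinates[OF C ga U]) (assumption, (rule that; assumption))
  have eq: "x = q s" if "s : U" "x : cylinder" "ga s = Ph x" for s x
   by (rule inj_onD[OF c(4)]) (use q(1)[OF that(1)] that(3) subsetD[OF c(2) that(2)] in auto)
  have d: "(q has_vd vd q s) (at s)" if "s : U" for s using C1_fam_onD(1)[OF q(2), of 0 s] that by simp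
  have cq: "continuous_on U q" by (intro continuous_at_imp_continuous_on ballI) (rule has_vd_cont, erule d)
  have "continuous_on U (%t. (0::real, t))" by (intro cintros)
  from cont_comp[OF C1_fam_onD(3)[OF q(2)] this] have cv: "continuous_on U (vd q)" by (simp add: image_subset_iff)
  obtain x0 where x0: "x0 : cylinder" "ga s0 = Ph x0" using True by blast
  have q0: "q s0 : cylinder" using eq[OF s0 x0] x0(1) by metis
  show thesis
  proof (cases "snd (q s0) = 0")
   case True
   show thesis by (rule crossing[OF U(1) s0 eq d cv q0 True]) (use q(1,3)[OF s0] in auto)
  next
   case False
   define V where "V = U Int (%s. abs(snd (q s))) -` {(abs(snd (q s0))) / 2<..}"
   have "open V" unfolding V_def by (intro continuous_open_preimage U(1) cintros cq)
   moreover have "s0 : V" unfolding V_def using s0 False by simp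
   moreover have "abs(snd x) > abs(snd (q s0)) / 2" if sx: "s : V" "x : cylinder" "ga s = Ph x" for s x
   proof -
    have "x = q s" by (rule eq) (use sx V_def in auto)
    thus ?thesis using sx(1) unfolding V_def by simp
   qed
   ultimately show thesis using away[of V "abs(snd (q s0)) / 2"] False by simp
  qed
 qed
qed

text \<open>By compactness it suffices to look near one pair of parameters. Distinct points of the disk are separated by
\<open>N\<close>; at one point, transversality bounds the motion along the disk by the motion across it.\<close>
lemma strand_separation:
 fixes N :: "complex => real" and K :: "(real => R3) list"
 defines "on == %y. on_sys K y"
 assumes K: "embedded K" and C: "collar3 Ph W"
  and tr: "!!i t x v. i < length K ==> x : cylinder ==> snd x = 0 ==> (K ! i) t = Ph x ==> dd Ph x v = vd (K ! i) t ==> snd v ~= 0"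
  and N: "continuous_on UNIV N"
  and sep: "!!x x'. x : cylinder ==> x' : cylinder ==> snd x = 0 ==> snd x' = 0 ==> on (Ph x) ==> on (Ph x') ==> x ~= x' ==> N (fst x - fst x') > 0"
 obtains e where "e > 0" "!!x x'. x : cylinder ==> x' : cylinder ==> on (Ph x) ==> on (Ph x') ==> abs(snd x) <= e ==> abs(snd x') <= e ==>
   N (fst x - fst x') >= e | e * norm (fst x - fst x') <= abs(snd x - snd x')"
proof -
 define Q where "Q = (%i i' y e. ALL x x'. x : cylinder --> x' : cylinder --> (K ! i) (fst y) = Ph x --> (K ! i') (snd y) = Ph x' -->
  abs(snd x) <= e --> abs(snd x') <= e --> N (fst x - fst x') >= e | e * norm (fst x - fst x') <= abs(snd x - snd x'))"
 have mono: "Q i i' y d" if "Q i i' y e" "0 < d" "d <= e" for i i' y d e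
  unfolding Q_def
 proof (intro allI impI)
  fix x x' assume x: "x : cylinder" "x' : cylinder" "(K ! i) (fst y) = Ph x" "(K ! i') (snd y) = Ph x'" "abs(snd x) <= d" "abs(snd x') <= d"
  have "N (fst x - fst x') >= e | e * norm (fst x - fst x') <= abs(snd x - snd x')"
   by (rule that(1)[unfolded Q_def, rule_format, OF x(1-4) order_trans[OF x(5) that(3)] order_trans[OF x(6) that(3)]])
  moreover have "d * norm (fst x - fst x') <= e * norm (fst x - fst x')" by (rule mult_right_mono[OF that(3) norm_ge_zero])
  ultimately show "N (fst x - fst x') >= d | d * norm (fst x - fst x') <= abs(snd x - snd x')" using that(3) by linarith
 qed
 have loc: "EX U e. open U & y0 : U & e > 0 & (ALL y:U Int A. Q i i' y e)" if i: "i < length K" "i' < length K" for i i' y0 A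
 proof -
  obtain s0 t0 where y0: "y0 = (s0, t0)" by fastforce
  note ga = embedded_C1[OF K i(1)] and ga' = embedded_C1[OF K i(2)]
  show ?thesis
  proof (rule strand_coordinates_cases[OF C ga, of s0])
   fix U e assume U: "open U" "s0 : U" "e > 0" "!!s x. s : U ==> x : cylinder ==> (K ! i) s = Ph x ==> abs(snd x) > e"
   have "Q i i' y e" if y: "y : U \<times> UNIV" for y unfolding Q_def
   proof (intro allI impI)
    fix x x' assume a: "x : cylinder" "(K ! i) (fst y) = Ph x" "abs(snd x) <= e"
    show "N (fst x - fst x') >= e | e * norm (fst x - fst x') <= abs(snd x - snd x')" using U(4)[OF _ a(1,2)] a(3) y by (simp add: mem_Times_iff)
   qed
   moreover have "open (U \<times> (UNIV :: real set))" "y0 : U \<times> UNIV" using open_Times[OF U(1) open_UNIV] U(2) unfolding y0 by auto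
   ultimately show ?thesis using U(3) by blast
  next
   fix U q assume U: "open U" "s0 : U" "!!s x. s : U ==> x : cylinder ==> (K ! i) s = Ph x ==> x = q s"
    and d: "!!s. s : U ==> (q has_vd vd q s) (at s)" "continuous_on U (vd q)"
    and q0: "q s0 : cylinder" "snd (q s0) = 0" "(K ! i) s0 = Ph (q s0)" "dd Ph (q s0) (vd q s0) = vd (K ! i) s0"
   show ?thesis
   proof (rule strand_coordinates_cases[OF C ga', of t0])
    fix U' e assume U': "open U'" "t0 : U'" "e > 0" "!!s x. s : U' ==> x : cylinder ==> (K ! i') s = Ph x ==> abs(snd x) > e"
    have "Q i i' y e" if y: "y : UNIV \<times> U'" for y unfolding Q_def
    proof (intro allI impI)
     fix x x' assume a: "x' : cylinder" "(K ! i') (snd y) = Ph x'" "abs(snd x') <= e"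
     show "N (fst x - fst x') >= e | e * norm (fst x - fst x') <= abs(snd x - snd x')" using U'(4)[OF _ a(1,2)] a(3) y by (simp add: mem_Times_iff)
    qed
    moreover have "open ((UNIV :: real set) \<times> U')" "y0 : UNIV \<times> U'" using open_Times[OF open_UNIV U'(1)] U'(2) unfolding y0 by auto
    ultimately show ?thesis using U'(3) by blast
   next
    fix U' q' assume U': "open U'" "t0 : U'" "!!s x. s : U' ==> x : cylinder ==> (K ! i') s = Ph x ==> x = q' s"
     and d': "!!s. s : U' ==> (q' has_vd vd q' s) (at s)"
     and q0': "q' t0 : cylinder" "snd (q' t0) = 0" "(K ! i') t0 = Ph (q' t0)"
    have cq: "continuous_on U q" "continuous_on U' q'"
     by (intro continuous_at_imp_continuous_on ballI; rule has_vd_cont, erule d(1) d')+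
    show ?thesis
    proof (cases "q s0 = q' t0")
     case False
     define k where "k = N (fst (q s0) - fst (q' t0)) / 2"
     have k: "k > 0" unfolding k_def using sep[OF q0(1) q0'(1) q0(2) q0'(2) _ _ False] q0(3) q0'(3) i unfolding on_def by (metis half_gt_zero)
     define V where "V = U \<times> U' Int (%y. N (fst (q (fst y)) - fst (q' (snd y)))) -` {k<..}"
     have "open V" unfolding V_def
      by (intro continuous_open_preimage open_Times U(1) U'(1) open_greaterThan cont_comp[OF N] cintros
        cont_comp[OF cq(1)] cont_comp[OF cq(2)]) auto
     moreover have "y0 : V" unfolding V_def y0 using U U' k unfolding k_def by simp
     moreover have "Q i i' y k" if "y : V" for y
     proof -
      have y: "fst y : U" "snd y : U'" "k < N (fst (q (fst y)) - fst (q' (snd y)))" using that unfolding V_def by (auto simp: mem_Times_iff)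
      show ?thesis unfolding Q_def
      proof (intro allI impI disjI1)
       fix x x' assume a: "x : cylinder" "x' : cylinder" "(K ! i) (fst y) = Ph x" "(K ! i') (snd y) = Ph x'"
       show "N (fst x - fst x') >= k" unfolding U(3)[OF y(1) a(1,3)] U'(3)[OF y(2) a(2,4)] using y(3) by simp
      qed
     qed
     ultimately show ?thesis using k by blast
    next
     case True
     hence "(K ! i) s0 = (K ! i') t0" using q0(3) q0'(3) by simp
     from embedded_nth_eq[OF K i this] obtain n where n: "i = i'" "s0 = t0 + of_int n" .
     define v where "v = vd q s0"
     have v: "snd v ~= 0" using tr[OF i(1) q0(1,2,3,4)] unfolding v_def .
     define wc where "wc = abs(snd v) / 2"
     have wc: "wc > 0" using v unfolding wc_def by simp
     obtain r where r: "r > 0" "!!a. abs(a - s0) < r ==> a : U"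
      "!!a b. abs(a - s0) < r ==> abs(b - s0) < r ==> norm (q a - q b - (a - b) *R v) <= wc * abs(a - b)"
      by (rule C1_strict_derivative[OF d(1) d(2) U(1,2) wc, folded v_def]) (assumption, (rule that; assumption))
     define e where "e = wc / (norm v + wc)"
     have nv: "norm v + wc > 0" using wc by (simp add: add_nonneg_pos)
     have e: "e > 0" "e * (norm v + wc) = wc" unfolding e_def using wc nv by auto
     have key: "e * norm (fst (q a) - fst (q b)) <= abs(snd (q a) - snd (q b))" if ab: "abs(a - s0) < r" "abs(b - s0) < r" for a b
     proof -
      note R = r(3)[OF ab]
      have f: "norm (fst (q a) - fst (q b)) <= (norm v + wc) * abs(a - b)"
      proof -
       have "norm (fst (q a) - fst (q b)) <= norm (q a - q b)" using norm_prod_bounds(2)[of "q a - q b"] by simp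
       also have "... <= norm ((a - b) *R v) + norm (q a - q b - (a - b) *R v)" by (rule norm_triangle_sub)
       also have "... <= abs(a - b) * norm v + wc * abs(a - b)" using R by simp
       finally show ?thesis by (simp add: distrib_left mult.commute)
      qed
      have "abs(snd (q a) - snd (q b) - (a - b) * snd v) <= wc * abs(a - b)"
       using order_trans[OF norm_prod_bounds(3) R] by simp
      moreover have "abs((a - b) * snd v) = 2 * (wc * abs(a - b))" unfolding wc_def by (simp add: abs_mult)
      ultimately have "wc * abs(a - b) <= abs(snd (q a) - snd (q b))" by linarith
      moreover have "e * norm (fst (q a) - fst (q b)) <= e * ((norm v + wc) * abs(a - b))" using f e(1) by (intro mult_left_mono) auto
      ultimately show ?thesis using e(2) by (simp add: mult.assoc[symmetric])
     qed
     have "Q i i' y e" if y: "y : ball s0 r \<times> ball t0 r" for y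
     proof -
      have a: "abs(fst y - s0) < r" "abs(snd y + of_int n - s0) < r" using y n(2) by (auto simp: mem_Times_iff dist_real_def)
      have p: "(K ! i') (snd y) = (K ! i) (snd y + of_int n)" using closed_C1_of_int(1)[OF ga] n(1) by simp
      show ?thesis unfolding Q_def p
      proof (intro allI impI disjI2)
       fix x x' assume b: "x : cylinder" "x' : cylinder" "(K ! i) (fst y) = Ph x" "(K ! i) (snd y + of_int n) = Ph x'"
       show "e * norm (fst x - fst x') <= abs(snd x - snd x')"
        unfolding U(3)[OF r(2)[OF a(1)] b(1,3)] U(3)[OF r(2)[OF a(2)] b(2,4)] by (rule key[OF a])
      qed
     qed
     moreover have "open (ball s0 r \<times> ball t0 r)" "y0 : ball s0 r \<times> ball t0 r" using r(1) unfolding y0 by (auto intro: open_Times)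
     ultimately show ?thesis using e(1) by blast
    qed
   qed
  qed
 qed
 have ex: "EX e>0. ALL y:{0..1} \<times> {0..1}. Q (fst k) (snd k) y e" if k: "k : {..<length K} \<times> {..<length K}" for k
 proof (rule compact_uniform_bound[of "{0..1::real} \<times> {0..1::real}" "Q (fst k) (snd k)"])
  show "compact ({0..1::real} \<times> {0..1::real})" by (intro compact_Times compact_Icc)
  show "EX U e. open U & y : U & 0 < e & (ALL y:U Int {0..1} \<times> {0..1}. Q (fst k) (snd k) y e)" for y
   by (rule loc) (use k in "simp_all add: mem_Times_iff")
 qed ((rule mono; assumption), blast)
 obtain e where e: "e > 0" "!!k. k : {..<length K} \<times> {..<length K} ==> ALL y:{0..1} \<times> {0..1}. Q (fst k) (snd k) y e"
 proof (rule finite_uniform_bound[of "{..<length K} \<times> {..<length K}" "%k e. ALL y:{0..1} \<times> {0..1}. Q (fst k) (snd k) y e"])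
  show "ALL y:{0..1} \<times> {0..1}. Q (fst k) (snd k) y d" if "ALL y:{0..1} \<times> {0..1}. Q (fst k) (snd k) y e" "0 < d" "d <= e" for k d e
   using that by (blast intro: mono)
 qed (simp, erule ex, rule that)
 show thesis
 proof (rule that[OF e(1)])
  fix x x' assume x: "x : cylinder" "x' : cylinder" "on (Ph x)" "on (Ph x')" "abs(snd x) <= e" "abs(snd x') <= e"
  obtain i t i' t' where it: "i < length K" "Ph x = (K ! i) t" "i' < length K" "Ph x' = (K ! i') t'" using x(3,4) unfolding on_def by blast
  have "(i, i') : {..<length K} \<times> {..<length K}" "(frac t, frac t') : {0..1} \<times> {0..1}"
   using it(1,3) frac_lt_1[of t] frac_lt_1[of t'] by (simp_all add: less_imp_le)
  hence q: "Q i i' (frac t, frac t') e" using e(2) by fastforce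
  have "(K ! i) (frac t) = Ph x" "(K ! i') (frac t') = Ph x'"
   using it closed_C1_frac(1)[OF embedded_C1[OF K it(1)], of t] closed_C1_frac(1)[OF embedded_C1[OF K it(3)], of t'] by simp_all
  thus "N (fst x - fst x') >= e | e * norm (fst x - fst x') <= abs(snd x - snd x')"
   by (intro q[unfolded Q_def fst_conv snd_conv, rule_format] x)
 qed
qed

section \<open>Collars in 3-space\<close>

lemma finite_strands:
 assumes K: "embedded K" and C: "collar3 Ph W"
  and tr: "!!i t x v. i < length K ==> x : cylinder ==> snd x = 0 ==> (K ! i) t = Ph x ==> dd Ph x v = vd (K ! i) t ==> snd v ~= 0"
 shows "finite {z. (z, 0) : cylinder & (on_sys K (Ph (z, 0)))}" (is "finite ?Z")
proof -
 obtain e where e: "e > 0" "!!x x'. x : cylinder ==> x' : cylinder ==> on_sys K (Ph x) ==> on_sys K (Ph x') ==>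
   abs(snd x) <= e ==> abs(snd x') <= e ==> norm (fst x - fst x') >= e | e * norm (fst x - fst x') <= abs(snd x - snd x')"
 proof (rule strand_separation[where N = norm, OF K C tr])
  show "continuous_on UNIV (norm :: complex => real)" by (intro cintros)
  show "norm (fst x - fst x') > 0" if "x ~= x'" "snd x = 0" "snd x' = 0" for x x' :: "R3"
   using that by (simp add: prod_eq_iff)
 qed (assumption | blast intro: that)+
 have "ALL z:?Z. ALL z':?Z. dist z' z < e --> z' = z"
 proof (intro ballI impI)
  fix z z' assume z: "z : ?Z" "z' : ?Z" "dist z' z < e"
  have "norm (z' - z) >= e | e * norm (z' - z) <= 0" using e(2)[of "(z', 0)" "(z, 0)"] z(1,2) e(1) by simp
  moreover have "norm (z' - z) < e" using z(3) by (simp add: dist_norm)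
  ultimately have "norm (z' - z) <= 0" using e(1) by (simp add: mult_le_0_iff)
  thus "z' = z" by simp
 qed
 hence "~ z islimpt ?Z" for z using discrete_imp_not_islimpt[OF e(1)] by blast
 hence "finite (cball 0 1 Int ?Z)" by (intro finite_not_islimpt_in_compact) auto
 moreover have "?Z <= cball 0 1" by auto
 ultimately show ?thesis by (simp add: Int_absorb1)
qed

definition shear :: "complex => R3 => R3" where "shear a x = (fst x + snd x *R a, snd x)"

lemma bounded_linear_shear: "bounded_linear (shear a)"
 unfolding shear_def[abs_def]
 by (intro bounded_linear_Pair bounded_linear_add bounded_linear_fst bounded_linear_snd bounded_linear_compose[OF bounded_linear_scaleR_left])

lemma lin_isotopic_shear: "lin_isotopic (shear a)"
proof -
 have eq: "x + s *R (shear a x - x) = shear (s *R a) x" for s x unfolding shear_def by (simp add: prod_eq_iff)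
 have inj: "shear b x = shear b y ==> x = y" for b x y unfolding shear_def by (auto simp: prod_eq_iff)
 have "shear b v = 0 ==> v = 0" for b v unfolding shear_def by (auto simp: prod_eq_iff)
 thus ?thesis unfolding lin_isotopic_def C1_on_bounded_linear(2)[OF bounded_linear_shear] eq
  using C1_on_bounded_linear(1)[OF bounded_linear_shear] inj by (auto intro!: injI)
qed

text \<open>Each bad condition confines \<open>a\<close> to a line or a point. The lines express that a difference of
intersection points is orthogonal to the direction that becomes vertical.\<close>
lemma generic_shear:
 fixes A :: "nat => R3 => R3" and Z :: "nat => complex set" and p :: "nat => R3"
 assumes J: "finite J" and A: "!!j. j : J ==> bounded_linear (A j) & inj (A j)" and Z: "!!j. j : J ==> finite (Z j) & 0 ~: Z j" and p: "inj_on p J"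
 obtains a where "!!j d. j : J ==> d : Z j ==> Re (d * cnj (fst (inv (A j) (- a, 1)))) ~= 0"
  "!!i j. i : J ==> j : J ==> i ~= j ==> fst (shear a (p i)) ~= fst (shear a (p j))"
proof -
 have n1: "negligible {a. Re (d * cnj (fst (inv (A j) (- a, 1)))) = 0}" if j: "j : J" "d : Z j" for j d
 proof -
  have Aj: "linear (A j)" "inj (A j)" using A[OF j(1)] bounded_linear.linear by auto
  have surj: "surj (A j)" using linear_injective_imp_surjective Aj by blast
  have lB: "linear (inv (A j))" using inj_linear_imp_inv_linear[OF Aj] .
  define L where "L = (%x. Re (d * cnj (fst (inv (A j) x))))"
  have L: "linear L" unfolding L_def
   by (rule linearI) (simp_all add: linear_add[OF lB] linear_cmul[OF lB] algebra_simps)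
  define w where "w = Complex (- L (1, 0)) (- L (\<i>, 0))"
  have La: "L (- a, 1) = w \<bullet> a + L (0, 1)" for a
  proof -
   have "(- a, 1) = (- Re a) *R (1, 0) + (- Im a) *R (\<i>, 0) + (0, 1::real)" by (simp add: complex_eq_iff)
   hence "L (- a, 1) = (- Re a) *R L (1, 0) + (- Im a) *R L (\<i>, 0) + L (0, 1)"
    by (simp only: linear_add[OF L] linear_cmul[OF L])
   thus ?thesis unfolding w_def inner_complex_def by simp
  qed
  have "w ~= 0 | - L (0, 1) ~= 0"
  proof (rule ccontr)
   assume "~ ?thesis"
   hence z: "L (1, 0) = 0" "L (\<i>, 0) = 0" "L (0, 1) = 0" unfolding w_def by (auto simp: complex_eq_iff)
   have "L x = 0" for x
   proof -
    have "x = Re (fst x) *R (1, 0) + Im (fst x) *R (\<i>, 0) + snd x *R (0, 1::real)" by (simp add: prod_eq_iff complex_eq_iff)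
    thus ?thesis using z linear_add[OF L] linear_cmul[OF L] by (metis add.right_neutral scale_zero_right)
   qed
   from this[of "A j (d, 0)"] have "Re (d * cnj d) = 0" unfolding L_def inv_f_f[OF Aj(2)] by simp
   hence "(norm d)^2 = 0" by (simp add: complex_mult_cnj cmod_power2)
   thus False using Z[OF j(1)] j(2) by auto
  qed
  from negligible_hyperplane[OF this] have "negligible {a. w \<bullet> a = - L (0, 1)}" .
  also have "{a. w \<bullet> a = - L (0, 1)} = {a. L (- a, 1) = 0}" unfolding La by auto
  finally show ?thesis unfolding L_def .
 qed
 have n2: "negligible {a. fst (shear a (p i)) = fst (shear a (p j))}" if ij: "i : J" "j : J" "i ~= j" for i j
 proof -
  have ne: "p i ~= p j" using p ij unfolding inj_on_def by blast
  have "{a. fst (shear a (p i)) = fst (shear a (p j))} <= {- (fst (p i) - fst (p j)) /\<^sub>R (snd (p i) - snd (p j))}"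
  proof
   fix a assume "a : {a. fst (shear a (p i)) = fst (shear a (p j))}"
   hence e: "(snd (p i) - snd (p j)) *R a = - (fst (p i) - fst (p j))" unfolding shear_def by (simp add: algebra_simps)
   hence "snd (p i) ~= snd (p j)" using ne by (auto simp: prod_eq_iff)
   hence "a = inverse (snd (p i) - snd (p j)) *R ((snd (p i) - snd (p j)) *R a)" by simp
   thus "a : {- (fst (p i) - fst (p j)) /\<^sub>R (snd (p i) - snd (p j))}" unfolding e by simp
  qed
  thus ?thesis using finite_subset by (intro negligible_finite) blast
 qed
 have "negligible ((UN y:Sigma J Z. {a. Re (snd y * cnj (fst (inv (A (fst y)) (- a, 1)))) = 0}) Un
   (UN y:{y : J \<times> J. fst y ~= snd y}. {a. fst (shear a (p (fst y))) = fst (shear a (p (snd y)))}))"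
  by (intro negligible_Un negligible_finite_UN) (use J Z n1 n2 in auto)
 then obtain a where a: "a ~: (UN y:Sigma J Z. {a. Re (snd y * cnj (fst (inv (A (fst y)) (- a, 1)))) = 0}) Un
   (UN y:{y : J \<times> J. fst y ~= snd y}. {a. fst (shear a (p (fst y))) = fst (shear a (p (snd y)))})"
  using non_negligible_UNIV by (metis (lifting) UNIV_eq_I)
 show thesis by (rule that[of a]) (use a in auto)
qed

lemma centres_apart:
 fixes Ps :: "nat => R3 => R3"
 assumes J: "finite J" and cont: "!!j. j : J ==> isCont (Ps j) 0" and ne: "!!i j. i : J ==> j : J ==> i ~= j ==> fst (Ps i 0) ~= fst (Ps j 0)"
 obtains e where "e > 0" "!!i j x y. i : J ==> j : J ==> i ~= j ==> norm x < e ==> norm y < e ==> norm (fst (Ps i x) - fst (Ps j y)) > e"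
proof -
 define Q where "Q = (%k e. ALL x y. norm x < e --> norm y < e --> norm (fst (Ps (fst k) x) - fst (Ps (snd k) y)) > e)"
 have "finite {k : J \<times> J. fst k ~= snd k}" using J by simp
 then obtain e where e: "e > 0" "!!k. k : {k : J \<times> J. fst k ~= snd k} ==> Q k e"
 proof (rule finite_uniform_bound[where Q = Q])
  fix k assume k: "k : {k : J \<times> J. fst k ~= snd k}"
  define i j where "i = fst k" and "j = snd k"
  have ij: "i : J" "j : J" "i ~= j" using k unfolding i_def j_def by auto
  define c where "c = norm (fst (Ps i 0) - fst (Ps j 0)) / 4"
  have c: "c > 0" unfolding c_def using ne[OF ij] by simp
  have near: "EX d>0. ALL x. norm x < d --> norm (fst (Ps l x) - fst (Ps l 0)) < c" if l: "l : J" for l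
  proof -
   obtain d where d: "d > 0" "!!x. dist x 0 < d ==> dist (Ps l x) (Ps l 0) < c" using cont[OF l] c unfolding continuous_at_eps_delta by metis
   have "norm (fst (Ps l x) - fst (Ps l 0)) < c" if "norm x < d" for x
    using d(2)[of x] that norm_prod_bounds(2)[of "Ps l x - Ps l 0"] by (simp add: dist_norm)
   thus ?thesis using d(1) by blast
  qed
  obtain d1 where d1: "d1 > 0" "ALL x. norm x < d1 --> norm (fst (Ps i x) - fst (Ps i 0)) < c" using near[OF ij(1)] by blast
  obtain d2 where d2: "d2 > 0" "ALL x. norm x < d2 --> norm (fst (Ps j x) - fst (Ps j 0)) < c" using near[OF ij(2)] by blast
  have tri: "norm (a - b) > c" if "norm (a - a0) < c" "norm (b - b0) < c" "norm (a0 - b0) = 4 * c" for a b a0 b0 :: complex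
  proof -
   have "norm (a0 - b0) <= norm (a0 - a) + (norm (a - b) + norm (b - b0))"
    using norm_triangle_ineq[of "a0 - a" "a - b0"] norm_triangle_ineq[of "a - b" "b - b0"] by simp
   thus ?thesis using that norm_minus_commute[of a0 a] c by linarith
  qed
  have "Q k (min c (min d1 d2))" unfolding Q_def i_def[symmetric] j_def[symmetric]
  proof (intro allI impI)
   fix x y :: "R3" assume "norm x < min c (min d1 d2)" "norm y < min c (min d1 d2)"
   hence xy: "norm x < d1" "norm y < d2" by auto
   have "norm (fst (Ps i x) - fst (Ps j y)) > c"
    by (rule tri[OF d1(2)[rule_format, OF xy(1)] d2(2)[rule_format, OF xy(2)]]) (simp add: c_def)
   thus "norm (fst (Ps i x) - fst (Ps j y)) > min c (min d1 d2)" by simp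
  qed
  thus "EX e>0. Q k e" using c d1 d2 by (intro exI[of _ "min c (min d1 d2)"]) simp
 next
  show "Q k d" if "Q k e" "0 < d" "d <= e" for k d e using that unfolding Q_def by (meson order_le_less_trans order_less_le_trans)
 qed (blast intro: that)
 show thesis by (rule that[OF e(1)]) (use e(2) in "force simp: Q_def")
qed

text \<open>The directions \<open>(u j, sv j)\<close> are the preimages of \<open>(- a, 1)\<close>, which the shear makes
vertical. The set \<open>Dz\<close> of differences of intersection points also contains \<open>1\<close>,
which ensures \<open>u j \<noteq> 0\<close>.\<close>
theorem collars_alternating_sum:
 fixes f :: "link => 'a::ab_group_add"
 assumes f: "link_invariant f" "finite_type m f" and J: "finite J" "card J = m + 1" and K: "embedded K"
  and C: "!!j. j : J ==> collar3 (Ph j) (W j)" and disj: "disj_cyl Ph J"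
  and avoid: "!!i j t. i < length K ==> j : J ==> (K ! i) t ~: Ph j ` lateral"
  and tr: "!!i j t x v. i < length K ==> j : J ==> x : cylinder ==> snd x = 0 ==> (K ! i) t = Ph j x ==> dd (Ph j) x v = vd (K ! i) t ==> snd v ~= 0"
 shows "alternating_sum J (%S. f (twisted n S Ph K)) = 0"
proof -
 define on where "on y <-> (on_sys K y)" for y
 define Z where "Z = (%j. {z. (z, 0) : cylinder & on (Ph j (z, 0))})"
 define Dz where "Dz = (%j. insert 1 ((%y. fst y - snd y) ` (Z j \<times> Z j)) - {0})"
 have finZ: "finite (Z j)" if "j : J" for j unfolding Z_def on_def by (rule finite_strands[OF K C[OF that] tr[OF _ that]])
 have fD: "finite (Dz j) & 0 ~: Dz j" if "j : J" for j unfolding Dz_def using finZ[OF that] by simp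
 have z: "0 : cylinder" by (simp add: zero_prod_def)
 have W0: "0 : W j" if "j : J" for j by (rule subsetD[OF collar3D(2)[OF C[OF that]] z])
 have A: "bounded_linear (dd (Ph j) 0) & inj (dd (Ph j) 0)" if "j : J" for j
  using collar3D(5)[OF C[OF that] W0[OF that]] blinfun.bounded_linear_right by blast
 have p: "inj_on (%j. Ph j 0) J"
  by (rule inj_onI) (metis disj_cylD[OF disj] imageI[OF z])
 obtain a where a: "!!j d. j : J ==> d : Dz j ==> Re (d * cnj (fst (inv (dd (Ph j) 0) (- a, 1)))) ~= 0"
  "!!i j. i : J ==> j : J ==> i ~= j ==> fst (shear a (Ph i 0)) ~= fst (shear a (Ph j 0))"
  by (rule generic_shear[where Z = Dz, OF J(1) A fD p]) (assumption, assumption, (rule that; assumption))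
 define u sv where "u = (%j. fst (inv (dd (Ph j) 0) (- a, 1)))" and "sv = (%j. snd (inv (dd (Ph j) 0) (- a, 1)))"
 have us: "dd (Ph j) 0 (u j, sv j) = (- a, 1)" if "j : J" for j
  unfolding u_def sv_def using inj_blinfun_inverse(2)[OF conjunct2[OF A[OF that]]] by simp
 have Du: "Re (d / u j) ~= 0" if "j : J" "d : Dz j" for j d
 proof -
  have "Re d * Re (u j) + Im d * Im (u j) ~= 0" using a(1)[OF that] unfolding u_def by simp
  thus ?thesis by (auto simp: Re_divide sum_power2_eq_zero_iff)
 qed
 have u0: "u j ~= 0" if "j : J" for j using Du[OF that, of 1] unfolding Dz_def by auto
 obtain G r1 where G: "lin_isotopic G" "r1 > 0" "!!j w. j : J ==> norm w < r1 ==> G (Ph j w) = Ph j 0 + dd (Ph j) 0 w"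
  by (rule affinize_collars[OF J(1) C disj]) (assumption, (rule that; assumption))
 define T where "T = (%x. shear a (G x))"
 note C1T = C1_on_compose[OF open_UNIV lin_isotopicD(1)[OF G(1)] open_UNIV lin_isotopicD(1)[OF lin_isotopic_shear[of a]] UNIV_I, folded T_def]
 have injT: "inj T" unfolding T_def using lin_isotopicD(2)[OF G(1)] lin_isotopicD(2)[OF lin_isotopic_shear[of a]] by (metis (no_types, lifting) injD injI)
 have dinjT: "inj (dd T x)" for x unfolding C1T(2)[OF UNIV_I]
  using lin_isotopicD(3)[OF G(1)] lin_isotopicD(3)[OF lin_isotopic_shear[of a]] by (metis (no_types, lifting) injD injI)
 have fT: "f (st (curve_map T M)) = f (st M)" "embedded (curve_map T M)" if M: "embedded M" for M
 proof -
  have e: "curve_map T M = curve_map (shear a) (curve_map G M)" unfolding T_def curve_map_def by simp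
  note g = lin_isotopic_invariant[OF G(1) M f(1)]
  show "f (st (curve_map T M)) = f (st M)" "embedded (curve_map T M)"
   unfolding e using g lin_isotopic_invariant[OF lin_isotopic_shear[of a] g(2) f(1)] by auto
 qed
 define Ps where "Ps = (%j x. T (Ph j x))"
 have aff: "Ps j w = shear a (Ph j 0) + shear a (dd (Ph j) 0 w)" if "j : J" "norm w < r1" for j w
  unfolding Ps_def T_def G(3)[OF that] by (rule linear_add[OF bounded_linear.linear[OF bounded_linear_shear]])
 have C': "collar3 (Ps j) (W j)" if j: "j : J" for j
 proof -
  note c = collar3D[OF C[OF j]]
  note cc = C1_on_compose[OF c(1,3) open_UNIV C1T(1) UNIV_I]
  have "inj_on (Ps j) (W j)" unfolding Ps_def using c(4) injT unfolding inj_on_def by blast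
  moreover have "inj (dd (Ps j) x)" if "x : W j" for x
   unfolding Ps_def cc(2)[OF that] using c(5)[OF that] dinjT by (metis (no_types, lifting) injD injI)
  ultimately show ?thesis unfolding collar3_def using c(1,2) cc(1) unfolding Ps_def by blast
 qed
 have on': "(on_sys (curve_map T K) (Ps j x)) <-> on (Ph j x)" for j x
  unfolding on_def Ps_def using injD[OF injT] by (metis length_curve_map nth_curve_map)
 have Pim: "Ps j ` B = T ` (Ph j ` B)" for j B unfolding Ps_def by (simp add: image_image)
 have disj': "disj_cyl Ps J" by (rule disj_cyl_image[OF injT _ disj]) (simp add: Ps_def)
 have avoid': "(curve_map T K ! i) t ~: Ps j ` lateral" if "i < length (curve_map T K)" "j : J" for i j t
  unfolding Pim using that avoid[of i j t] by (simp only: length_curve_map nth_curve_map inj_image_mem_iff[OF injT] not_False_eq_True)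
 obtain e1 where e1: "e1 > 0" "!!i j x y. i : J ==> j : J ==> i ~= j ==> norm x < e1 ==> norm y < e1 ==> norm (fst (Ps i x) - fst (Ps j y)) > e1"
 proof (rule centres_apart[OF J(1), of Ps])
  show "isCont (Ps j) 0" if "j : J" for j
   using C1_onD(4)[OF collar3D(1,3)[OF C'[OF that]]] collar3D(1)[OF C'[OF that]] W0[OF that] cont_on_open by blast
  show "fst (Ps i 0) ~= fst (Ps j 0)" if "i : J" "j : J" "i ~= j" for i j
   using a(2)[OF that] aff[OF that(1), of 0] aff[OF that(2), of 0] G(2) by (simp add: blinfun.zero_right shear_def)
 qed (rule that)
 define r where "r = min 1 (min r1 e1)"
 define B where "B = 1 + (SUM j:J. 1 / norm (u j) + norm (u j) + abs(sv j))"
 have B1: "B >= 1" unfolding B_def by (simp add: sum_nonneg)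
 have Bj: "1 <= B * norm (u j) & norm (u j) <= B & abs(sv j) <= B" if j: "j : J" for j
 proof -
  have s: "1 / norm (u j) + norm (u j) + abs(sv j) <= B" unfolding B_def
   using member_le_sum[OF j _ J(1), of "%j. 1 / norm (u j) + norm (u j) + abs(sv j)"] by simp
  have pos: "0 <= 1 / norm (u j)" "0 <= norm (u j)" "0 <= abs(sv j)" by simp_all
  hence "1 / norm (u j) <= B" using s by linarith
  hence "1 <= B * norm (u j)" using u0[OF j] by (simp add: field_simps)
  thus ?thesis using s pos by linarith
 qed
 define Q where "Q = (%j e. ALL x x'. x : cylinder --> x' : cylinder --> on (Ph j x) --> on (Ph j x') --> abs(snd x) <= e --> abs(snd x') <= e -->
  abs(Re ((fst x - fst x') / u j)) >= e | e * norm (fst x - fst x') <= abs(snd x - snd x'))"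
 obtain e2 where e2: "e2 > 0" "!!j. j : J ==> Q j e2"
 proof (rule finite_uniform_bound[OF J(1), of Q])
  fix j assume j: "j : J"
  show "EX e>0. Q j e"
  proof (rule strand_separation[where N = "%d. abs(Re (d / u j))", OF K C[OF j] tr[OF _ j], folded on_def], goal_cases)
   case (7 x x')
   have zx: "x = (fst x, 0)" "x' = (fst x', 0)" using 7 by (simp_all add: prod_eq_iff)
   have "fst x : Z j" "fst x' : Z j" unfolding Z_def using 7 zx by auto
   moreover have "fst x - fst x' ~= 0" using zx 7(7) by auto
   ultimately have "fst x - fst x' : Dz j" unfolding Dz_def by force
   thus ?case using Du[OF j] by simp
  next
   case (8 e)
   thus ?case unfolding Q_def by blast
  qed (assumption | use u0[OF j] in "intro cintros, simp")+
 next
  fix j d e assume Q: "Q j e" "0 < d" "d <= (e::real)"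
  show "Q j d" unfolding Q_def
  proof (intro allI impI)
   fix x x' assume x: "x : cylinder" "x' : cylinder" "on (Ph j x)" "on (Ph j x')" "abs(snd x) <= d" "abs(snd x') <= d"
   have "abs(Re ((fst x - fst x') / u j)) >= e | e * norm (fst x - fst x') <= abs(snd x - snd x')"
    by (rule Q(1)[unfolded Q_def, rule_format, OF x(1-4) order_trans[OF x(5) Q(3)] order_trans[OF x(6) Q(3)]])
   moreover have "d * norm (fst x - fst x') <= e * norm (fst x - fst x')" by (rule mult_right_mono[OF Q(3) norm_ge_zero])
   ultimately show "abs(Re ((fst x - fst x') / u j)) >= d | d * norm (fst x - fst x') <= abs(snd x - snd x')" using Q(3) by linarith
  qed
 qed (rule that)
 interpret V: vertical_collars "curve_map T K" J Ps W u sv r e1 B "1 / e2" e2 e2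
 proof (unfold_locales)
  show "embedded (curve_map T K)" by (rule fT(2)[OF K])
  show "J ~= {}" using J(2) by auto
  show "0 < r" "r <= 1" unfolding r_def using G(2) e1(1) by auto
  show "0 <= 1 / e2" using e2(1) by simp
  fix i j and x y :: "R3"
  show "e1 < norm (fst (Ps i x) - fst (Ps j y))" if "i : J" "j : J" "i ~= j" "norm x < r" "norm y < r"
   by (rule e1(2)[OF that(1-3)]) (use that(4,5) in "auto simp: r_def")
  show "Ps j (x + g *R (u j, sv j)) = Ps j x + (0, g)" if "j : J" "norm x < r" "norm (x + g *R (u j, sv j)) < r" for g
  proof -
   have n: "norm x < r1" "norm (x + g *R (u j, sv j)) < r1" using that(2,3) unfolding r_def by auto
   have "dd (Ph j) 0 (x + g *R (u j, sv j)) = dd (Ph j) 0 x + g *R (- a, 1)"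
    unfolding us[OF that(1), symmetric] by (simp only: blinfun.add_right blinfun.scaleR_right)
   thus ?thesis unfolding aff[OF that(1) n(1)] aff[OF that(1) n(2)] by (simp add: shear_def algebra_simps)
  qed
  show "e2 <= abs(Re (fst x / u j) - Re (fst y / u j)) | norm (fst x - fst y) <= 1 / e2 * abs(snd x - snd y)"
   if "j : J" "x : cylinder" "y : cylinder" "on_sys (curve_map T K) (Ps j x)"
    "on_sys (curve_map T K) (Ps j y)" "abs(snd x) <= e2" "abs(snd y) <= e2"
  proof -
   have "abs(Re ((fst x - fst y) / u j)) >= e2 | e2 * norm (fst x - fst y) <= abs(snd x - snd y)"
    by (rule e2(2)[OF that(1), unfolded Q_def, rule_format, OF that(2,3) that(4,5)[unfolded on'] that(6,7)])
   thus ?thesis using e2(1) by (simp add: diff_divide_distrib field_simps)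
  qed
 qed (rule J C' disj' avoid' e1 B1 Bj e2; assumption?)+
 have "alternating_sum J (%S. f (st (curve_map (twists n S Ps) (curve_map T K)))) = 0"
  by (rule V.twist_alternating_sum[OF f J(2)])
 moreover have "f (st (curve_map (twists n S Ps) (curve_map T K))) = f (twisted n S Ph K)"
  if S: "S <= J" for S
 proof -
  have disjS: "disj_cyl Ph S" by (rule disj_cyl_mono[OF disj S])
  have injJ: "inj_on (Ph j) cylinder" if "j : J" for j by (rule collar3D(7)[OF C[OF that]])
  have "twists n S Ps (T y) = T (twists n S Ph y)" for y
   by (rule collar_mult_transfer[OF disjS _ injT]) (use injJ S in "auto simp: Ps_def")
  hence e: "curve_map (twists n S Ps) (curve_map T K) = curve_map T (curve_map (twists n S Ph) K)"
   unfolding curve_map_def by simp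
  show ?thesis unfolding e by (rule fT(1)[OF embedded_twists[OF f(1) K J(1) C disj avoid S]])
 qed
 ultimately show ?thesis using alt_sum_cong[of J _ "%S. f (twisted n S Ph K)"] by (metis (no_types, lifting))
qed

section \<open>From crossing changes to twists\<close>

definition householder :: "'a::real_inner => 'a => 'a" where "householder v x = x - (2 * (x \<bullet> v) / (v \<bullet> v)) *R v"

lemma bounded_linear_householder: "bounded_linear (householder v)"
 unfolding householder_def[abs_def]
 by (intro bounded_linear_sub bounded_linear_ident bounded_linear_compose[OF bounded_linear_scaleR_left]
   bounded_linear_compose[OF bounded_linear_divide] bounded_linear_compose[OF bounded_linear_mult_right] bounded_linear_inner_left)

lemma householder:
 assumes "v ~= 0" shows "householder v (householder v x) = x" "norm (householder v x) = norm x"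
proof -
 have v: "v \<bullet> v ~= 0" using assms by simp
 show "householder v (householder v x) = x" unfolding householder_def using v by (simp add: inner_diff_left algebra_simps add_divide_distrib)
 have "householder v x \<bullet> householder v x = x \<bullet> x" unfolding householder_def using v
  by (simp add: inner_diff_left inner_diff_right inner_commute)
 thus "norm (householder v x) = norm x" by (simp add: norm_eq_sqrt_inner)
qed

text \<open>The product of the reflections in \<open>a + pole\<close> and \<open>a\<close> sends the pole to
\<open>a\<close>. Moving the first mirror from \<open>a\<close> to \<open>a + pole\<close> joins it to the
identity.\<close>
lemma rotation_to_pole:
 fixes a :: "real^4"
 assumes a: "a : S3" "a ~= - pole" and f: "link_invariant f"
 obtains Q Q' where "bounded_linear Q" "bounded_linear Q'" "!!x. Q (Q' x) = x" "!!x. Q' (Q x) = x" "!!x. norm (Q x) = norm x" "Q pole = a"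
  "!!M. is_link M ==> f (curve_map Q M) = f M"
proof -
 have "(norm pole)^2 = 1^2" using norm4[of pole] unfolding pole_def vec4_nth by simp
 hence np: "norm pole = 1" by (rule power2_eq_imp_eq) simp_all
 have na: "a ~= 0" using a(1) by auto
 have ns: "a + s *R pole ~= 0" if "s : {0..1}" for s
 proof
  assume "a + s *R pole = 0"
  hence e: "a = - s *R pole" by (simp add: eq_neg_iff_add_eq_0)
  hence "norm a = s * 1" using that np by simp
  hence "s = 1" using a(1) by simp
  thus False using e a(2) by simp
 qed
 define Qs where "Qs = (%s x. householder a (householder (a + s *R pole) x))"
 define Q' where "Q' = (%x. householder (a + 1 *R pole) (householder a x))"
 have n1: "norm (Qs s x) = norm x" if "s : {0..1}" for s x unfolding Qs_def using householder(2) na ns[OF that] by metis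
 have bl: "bounded_linear (Qs s)" "bounded_linear Q'" for s unfolding Qs_def Q'_def
  by (intro bounded_linear_compose[OF bounded_linear_householder] bounded_linear_householder)+
 have inv: "Qs 1 (Q' x) = x" "Q' (Qs 1 x) = x" for x unfolding Qs_def Q'_def using householder(1)[OF na] householder(1)[of "a + pole"] ns[of 1] by simp_all
 have pole: "Qs 1 pole = a"
 proof -
  have i: "a \<bullet> a = 1" "pole \<bullet> pole = 1" using a(1) np by (simp_all add: power2_norm_eq_inner[symmetric])
  have d: "(a + pole) \<bullet> (a + pole) = 2 * (pole \<bullet> (a + pole))" using i by (simp add: inner_add_left inner_add_right inner_commute)
  have "(a + pole) \<bullet> (a + pole) ~= 0" using ns[of 1] by simp
  hence e: "2 * (pole \<bullet> (a + pole)) / ((a + pole) \<bullet> (a + pole)) = 1" unfolding d by (rule divide_self)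
  have "householder (a + pole) pole = - a" unfolding householder_def e by simp
  moreover have c: "2 * (- a \<bullet> a) / (a \<bullet> a) = - 2" using i by simp
  have "householder a (- a) = a" unfolding householder_def c by (simp only: scaleR_minus_left scaleR_2) simp
  ultimately show ?thesis unfolding Qs_def by simp
 qed
 have amb: "ambient_isotopy Qs"
  unfolding ambient_isotopy_def
 proof (intro conjI ballI)
  show "continuous_on ({0..1} \<times> S3) (%(s, x). Qs s x)"
   unfolding Qs_def householder_def case_prod_unfold by (intro cintros) (use na ns in auto)
  show "Qs 0 x = x" for x unfolding Qs_def using householder(1)[OF na] by simp
  fix s :: real assume s: "s : {0..1}"
  let ?g = "%x. householder (a + s *R pole) (householder a x)"
  have ng: "norm (?g x) = norm x" for x using householder(2) na ns[OF s] by metis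
  have "bounded_linear ?g" by (intro bounded_linear_compose[OF bounded_linear_householder] bounded_linear_householder)
  hence "homeomorphism S3 S3 (Qs s) ?g"
   by (intro homeomorphismI linear_continuous_on bl) (use n1[OF s] ng householder(1)[OF na] householder(1)[OF ns[OF s]] in "auto simp: Qs_def")
  thus "EX g. homeomorphism S3 S3 (Qs s) g" by blast
 qed
 show thesis
 proof (rule that[OF bl(1)[of 1] bl(2) inv n1 pole])
  fix M assume M: "is_link M"
  have lin: "Qs 1 0 = 0" using linear_0[OF bounded_linear.linear[OF bl(1)]] .
  have Me: "embedded M" using M unfolding is_link_iff by blast
  have "is_link (curve_map (Qs 1) M)" unfolding is_link_iff
  proof
   show "pt (curve_map (Qs 1) M) ` params (curve_map (Qs 1) M) <= S3"
    using link_nth_in_S3[OF M] n1[of 1] unfolding pt_def params_def by (auto simp: mem_Times_iff)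
   show "embedded (curve_map (Qs 1) M)"
   proof (rule embedded_over[OF Me])
    fix i t assume i: "i < length M"
    note c = embedded_C1[OF Me i]
    show "closed_C1 (curve_map (Qs 1) M ! i)" using closed_C1_bounded_linear[OF bl(1) c] i by simp
    have "vd (curve_map (Qs 1) M ! i) t = Qs 1 (vd (M ! i) t)"
     using vd_eqI[OF bl_has_vd[OF bl(1) closed_C1_has_vd[OF c]]] i by simp
    thus "vd (curve_map (Qs 1) M ! i) t ~= 0" using inv(2) embedded_vd[OF Me i, of t] lin by (metis (no_types) inv(2))
   next
    show "(M ! i) s = (M ! j) t" if "i < length M" "j < length M" "(curve_map (Qs 1) M ! i) s = (curve_map (Qs 1) M ! j) t" for i j s t
     using that inv(2) by (metis nth_curve_map)
   qed simp
  qed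
  moreover have "isotopic M (curve_map (Qs 1) M)" by (rule isotopicI_id[OF _ amb]) auto
  ultimately show "f (curve_map (Qs 1) M) = f M" using f M unfolding link_invariant_def by metis
 qed simp
qed

lemma det_vector_independent:
 fixes p a b c :: "real^4"
 assumes d: "det (vector [p, a, b, c]) ~= 0" and z: "x *R a + y *R b + t *R c = 0"
 shows "x = 0" "y = 0" "t = 0"
proof -
 define M where "M = transpose (vector [p, a, b, c] :: real^4^4)"
 define w where "w = (vector [0, x, y, t] :: real^4)"
 have "det M ~= 0" using d unfolding M_def by (simp add: det_transpose)
 then obtain B where "B ** M = mat 1" unfolding invertible_det_nz[symmetric] invertible_left_inverse by blast
 moreover have "M *v w = x *R a + y *R b + t *R c"
  unfolding M_def w_def by (simp add: vec_eq_iff matrix_vector_mult_def transpose_def sum_4 algebra_simps)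
 ultimately have "w = 0" using z matrix_left_invertible_ker[of M] by metis
 hence "w $ 2 = 0" "w $ 3 = 0" "w $ 4 = 0" by simp_all
 thus "x = 0" "y = 0" "t = 0" unfolding w_def by simp_all
qed

text \<open>Just outside the lateral boundary of a collar there are points off all collars and off the link; one of two
such points differs from \<open>b\<close>.\<close>
lemma point_off_collars:
 assumes L: "is_link L" and J: "finite J" "k : J"
  and W: "open W" "cylinder <= W" "continuous_on W (Ph k)" "inj_on (Ph k) W" "Ph k ` W <= S3"
  and comp: "!!j. j : J ==> compact (Ph j ` cylinder)" and disj: "disj_cyl Ph J"
  and lat: "pt L ` params L Int Ph k ` lateral = {}"
 obtains a where "a : S3" "a ~= b" "!!j. j : J ==> a ~: Ph j ` cylinder" "!!i t. i < length L ==> (L ! i) t ~= a"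
proof -
 have C1: "closed_C1 (L ! i)" if "i < length L" for i using embedded_C1 L that unfolding is_link_iff by blast
 define F where "F = (UN j:J - {k}. Ph j ` cylinder) Un (UN i<length L. (L ! i) ` {0..1})"
 have "closed F" unfolding F_def
  by (intro closed_Un closed_UN ballI compact_imp_closed comp compact_continuous_image closed_C1_cont C1 compact_Icc) (use J in auto)
 define h where "h = (%x::real. (of_real (1 + x) :: complex, 0 :: real))"
 have h0: "h 0 : cylinder" "h 0 : lateral" unfolding h_def by auto
 have ch: "continuous_on UNIV h" unfolding h_def by (intro cintros)
 have "Ph k (h 0) ~: F"
 proof
  assume "Ph k (h 0) : F"
  then consider j where "j : J - {k}" "Ph k (h 0) : Ph j ` cylinder" | i t where "i < length L" "Ph k (h 0) = (L ! i) t" unfolding F_def by blast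
  thus False
  proof cases
   case 1
   thus False using disj_cylD[OF disj _ J(2) _ imageI[OF h0(1)], of j] by blast
  next
   case 2
   have "(i, frac t) : params L" "pt L (i, frac t) = Ph k (h 0)"
    using 2 closed_C1_frac(1)[OF C1[OF 2(1)], of t] unfolding params_def pt_def by (auto simp: frac_lt_1)
   thus False using lat imageI[OF h0(2), of "Ph k"] by (metis disjoint_iff imageI)
  qed
 qed
 moreover have "open (W Int Ph k -` (- F))" by (rule continuous_open_preimage[OF W(3,1) open_Compl[OF `closed F`]])
 ultimately have o: "open (h -` (W Int Ph k -` (- F)))" and z0: "0 : h -` (W Int Ph k -` (- F))"
  using open_vimage[OF _ ch, of "W Int Ph k -` (- F)"] subsetD[OF W(2) h0(1)] by (simp_all only: vimage_eq Int_iff Compl_iff simp_thms)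
 obtain d where d0: "d > 0" "ALL x. dist x 0 < d --> x : h -` (W Int Ph k -` (- F))" using bspec[OF o[unfolded open_dist] z0] by (elim exE conjE)
 hence d: "d > 0" "!!x. dist x 0 < d ==> h x : W & Ph k (h x) ~: F" by simp_all
 have ne: "Ph k (h (d / 2)) ~= Ph k (h (d / 3))"
 proof
  assume "Ph k (h (d / 2)) = Ph k (h (d / 3))"
  from inj_onD[OF W(4) this] have "h (d / 2) = h (d / 3)" using d by (simp add: dist_real_def)
  thus False unfolding h_def using d(1) by simp
 qed
 have "EX x. 0 < x & x < d & Ph k (h x) ~= b"
 proof (cases "Ph k (h (d / 2)) = b")
  case True
  thus ?thesis using ne d(1) by (intro exI[of _ "d / 3"]) auto
 next
  case False
  thus ?thesis using d(1) by (intro exI[of _ "d / 2"]) simp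
 qed
 then obtain x where x: "0 < x" "x < d" "Ph k (h x) ~= b" by blast
 have hx: "h x : W" "Ph k (h x) ~: F" using d(2)[of x] x by (auto simp: dist_real_def)
 have out: "h x ~: cylinder"
 proof
  assume "h x : cylinder"
  hence "norm (of_real (1 + x) :: complex) <= 1" unfolding h_def by simp
  thus False using x(1) unfolding norm_of_real by simp
 qed
 show thesis
 proof (rule that[of "Ph k (h x)"])
  show "Ph k (h x) : S3" using hx(1) W(5) by blast
  show "Ph k (h x) ~= b" by (rule x(3))
  show "Ph k (h x) ~: Ph j ` cylinder" if j: "j : J" for j
  proof (cases "j = k")
   case True
   show ?thesis
   proof
    assume "Ph k (h x) : Ph j ` cylinder"
    then obtain y where y: "y : cylinder" "Ph k (h x) = Ph k y" unfolding True by (elim imageE)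
    have "h x = y" by (rule inj_onD[OF W(4) y(2) hx(1) subsetD[OF W(2) y(1)]])
    thus False using out y(1) by metis
   qed
  next
   case False
   thus ?thesis using hx(2) j unfolding F_def by blast
  qed
  show "(L ! i) t ~= Ph k (h x)" if i: "i < length L" for i t
  proof
   assume "(L ! i) t = Ph k (h x)"
   hence e: "Ph k (h x) = (L ! i) (frac t)" using closed_C1_frac(1)[OF C1[OF i], of t] by simp
   have "frac t : {0..1}" using frac_lt_1[of t] by (simp add: less_imp_le)
   hence "Ph k (h x) : F" unfolding F_def e using i by blast
   thus False using hx(2) by blast
  qed
 qed
qed

lemma S3_pole: "x : S3 ==> x $ 4 = 1 ==> x = pole"
proof -
 assume "x : S3" "x $ 4 = 1"
 hence "(x $ 1)^2 + (x $ 2)^2 + (x $ 3)^2 = 0" using norm4[of x] by simp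
 hence "(x $ 1)^2 = 0" "(x $ 2)^2 = 0" "(x $ 3)^2 = 0"
  using zero_le_power2[of "x $ 1"] zero_le_power2[of "x $ 2"] zero_le_power2[of "x $ 3"] by linarith+
 thus "x = pole" using `x $ 4 = 1` unfolding pole_def by (simp add: vec_eq_iff forall_4)
qed

text \<open>Send a point off the link and the collars to the pole and pass to 3-space. Transversality to a disk means that
a strand crosses level \<open>0\<close> of the collar with nonzero speed.\<close>
theorem nq_finite_if_finite_type:
 fixes f :: "link => 'a::ab_group_add"
 assumes f: "link_invariant f" "finite_type m f"
 shows "nq_finite n q m f"
 unfolding nq_finite_def
proof (intro allI impI)
 fix L and e and Ph :: "nat => R3 => real^4"
 assume L: "is_link L" and e: "ALL j:{..m}. embedded_disk (e j) & transverse L (e j) & int q dvd lk L (e j)"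
  and col: "ALL j:{..m}. collar L (e j) (Ph j)" and disj: "disj_cyl Ph {..m}"
 define J where "J = {..m}"
 have J: "finite J" "card J = m + 1" "0 : J" unfolding J_def by auto
 note disj = disj[folded J_def]
 define good where "good j W <-> open W & cylinder <= W & Ph j ` W <= S3 & inj_on (Ph j) W & C1_on W (Ph j) &
    (ALL x:W. frame_det (Ph j) x > 0)" for j W
 have "EX W. good j W" if "j : J" for j using col that unfolding J_def collar_def good_def by blast
 then obtain W where W0: "!!j. j : J ==> good j (W j)" by metis
 have W: "open (W j)" "cylinder <= W j" "Ph j ` W j <= S3" "inj_on (Ph j) (W j)" "C1_on (W j) (Ph j)" if "j : J" for j
  using W0[OF that] unfolding good_def by auto
 have W6: "frame_det (Ph j) x > 0" if "j : J" "x : W j" for j x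
  using W0[OF that(1)] that(2) unfolding good_def by blast
 have lat: "Ph j (z, 0) = e j z" "pt L ` params L Int Ph j ` lateral = {}" if "j : J" "z : cball 0 1" for j z
  using col that unfolding J_def collar_def by blast+
 have cont: "continuous_on (W j) (Ph j)" if "j : J" for j by (rule C1_onD(4)[OF W(1,5)[OF that]])
 have inj4: "inj_on (Ph j) cylinder" if "j : J" for j by (rule inj_on_subset[OF W(4)[OF that] W(2)[OF that]])
 have comp: "compact (Ph j ` cylinder)" if "j : J" for j
  by (rule compact_continuous_image[OF continuous_on_subset[OF cont[OF that] W(2)[OF that]]]) (intro compact_Times compact_cball compact_Icc)
 have Phi_inj: "v = 0" if j: "j : J" "x : W j" and z: "dd (Ph j) x v = 0" for j x v
  using det_vector_independent[of "Ph j x" "dd (Ph j) x (1, 0)" "dd (Ph j) x (\<i>, 0)" "dd (Ph j) x (0, 1)" "Re (fst v)" "Im (fst v)" "snd v"]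
   W6[OF j] z blinfun_coordinates[of "dd (Ph j) x" v] C1_onD(2)[OF W(1,5)[OF j(1)] j(2)] by (simp add: prod_eq_iff complex_eq_iff)
 obtain a where a: "a : S3" "a ~= - pole" "!!j. j : J ==> a ~: Ph j ` cylinder" "!!i t. i < length L ==> (L ! i) t ~= a"
  by (rule point_off_collars[OF L J(1,3) W(1,2)[OF J(3)] cont[OF J(3)] W(4,3)[OF J(3)] comp disj lat(2)[OF J(3)], of 0])
   (assumption, simp, (rule that; assumption))
 obtain R R' where R: "bounded_linear R" "bounded_linear R'" "!!x. R (R' x) = x" "!!x. R' (R x) = x" "!!x. norm (R x) = norm x" "R pole = a"
   "!!M. is_link M ==> f (curve_map R M) = f M"
  by (rule rotation_to_pole[OF a(1,2) f(1)]) (rule that; assumption)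
 define g where "g = (%y. R (stereo y))"
 define gi where "gi = (%y. stinv (R' y))"
 have nR': "norm (R' x) = norm x" for x using R(5)[of "R' x"] R(3) by simp
 define D where "D = {y. R' y $ 4 ~= 1}"
 have D: "open D" unfolding D_def by (intro open_Collect_neq cintros linear_continuous_on R(2))
 have inD: "y : D" if "y : S3" "y ~= a" for y
  using S3_pole[of "R' y"] that R(3)[of y] R(6) nR' unfolding D_def by auto
 have ggi: "g (gi y) = y" if "y : S3" "y ~= a" for y
  unfolding g_def gi_def using stereo_stinv[of "R' y"] inD[OF that] that(1) nR' R(3) unfolding D_def by simp
 have gna: "g y ~= a" for y
 proof
  assume "g y = a"
  hence "stereo y = pole" using R(4,6) unfolding g_def by metis
  thus False using stereo_nth4_neq[of y] unfolding pole_def by simp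
 qed
 have injg: "inj g" unfolding g_def using R(4) stereo_inj by (metis (no_types, lifting) injD injI)
 have C1g: "C1_on UNIV g" unfolding g_def by (rule C1_on_compose(1)[OF open_UNIV C1_on_stereo open_UNIV C1_on_bounded_linear(1)[OF R(1)]]) simp
 have C1gi: "C1_on D gi" unfolding gi_def
  by (rule C1_on_compose(1)[OF D C1_on_subset[OF open_UNIV C1_on_bounded_linear(1)[OF R(2)]] open_stinv_dom C1_on_stinv]) (auto simp: D_def)
 define Ps where "Ps = (%j x. gi (Ph j x))"
 define V where "V = (%j. W j Int Ph j -` D)"
 have V: "open (V j)" "cylinder <= V j" "V j <= W j" if j: "j : J" for j
 proof -
  show "open (V j)" unfolding V_def by (rule continuous_open_preimage[OF cont[OF j] W(1)[OF j] D])
  show "cylinder <= V j"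
  proof
   fix x assume x: "x : cylinder"
   have "Ph j x : D" by (rule inD) (use W(2,3)[OF j] x a(3)[OF j] in "blast, metis imageI")
   thus "x : V j" unfolding V_def using subsetD[OF W(2)[OF j] x] by simp
  qed
  show "V j <= W j" unfolding V_def by blast
 qed
 have gPsi: "g (Ps j x) = Ph j x" if j: "j : J" "x : V j" for j x
 proof -
  have "Ph j x ~= a" using j(2) R(4)[of pole] unfolding V_def D_def R(6)[symmetric] by (auto simp: pole_def)
  moreover have "Ph j x : S3" using W(3)[OF j(1)] V(3)[OF j(1)] j(2) by blast
  ultimately show ?thesis unfolding Ps_def by (intro ggi)
 qed
 have C1Psi: "C1_on (V j) (Ps j)" if j: "j : J" for j
  unfolding Ps_def by (rule C1_on_compose(1)[OF V(1)[OF j] C1_on_subset[OF W(1,5)[OF j] V(3)[OF j]] D C1gi]) (simp add: V_def)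
 have ddPhi: "dd (Ph j) x v = dd g (Ps j x) (dd (Ps j) x v)" if j: "j : J" "x : V j" for j x v
 proof -
  note c = C1_on_compose[OF V(1)[OF j(1)] C1Psi[OF j(1)] open_UNIV C1g UNIV_I]
  have "(Ph j has_derivative dd (%x. g (Ps j x)) x) (at x)"
   by (rule has_derivative_transform_within_open[OF C1_onD(1)[OF V(1)[OF j(1)] c(1) j(2)] V(1)[OF j(1)] j(2)]) (rule gPsi[OF j(1)])
  from dd_eqI[OF this] show ?thesis using c(2)[OF j(2)] by simp
 qed
 have C3: "collar3 (Ps j) (V j)" if j: "j : J" for j
  unfolding collar3_def
 proof (intro conjI ballI V C1Psi j)
  show "inj_on (Ps j) (V j)" by (rule inj_onI) (metis gPsi[OF j] inj_onD[OF W(4)[OF j]] subsetD[OF V(3)[OF j]])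
  fix x assume x: "x : V j"
  show "inj (dd (Ps j) x)"
  proof (rule injI)
   fix v w assume "dd (Ps j) x v = dd (Ps j) x w"
   hence "dd (Ph j) x (v - w) = 0" unfolding ddPhi[OF j x] by (simp add: blinfun.diff_right blinfun.zero_right)
   hence "v - w = 0" by (rule Phi_inj[OF j subsetD[OF V(3)[OF j] x]])
   thus "v = w" by simp
  qed
 qed
 have LS: "(L ! i) t : S3" "(L ! i) t ~= a" if "i < length L" for i t using link_nth_in_S3[OF L that] a(4)[OF that] by auto
 have Le: "embedded L" using L unfolding is_link_iff by blast
 define K where "K = curve_map gi L"
 have Kn: "K ! i = (%t. gi ((L ! i) t))" "g ((K ! i) t) = (L ! i) t" if "i < length L" for i t
  unfolding K_def using that ggi[OF LS[OF that]] by simp_all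
 have KC: "closed_C1 (K ! i)" "vd (L ! i) t = dd g ((K ! i) t) (vd (K ! i) t)" if i: "i < length L" for i t
 proof -
  note l = embedded_C1[OF Le i]
  note c = C1_fam_on_compose(1)[OF C1_fam_on_const[OF l, of UNIV] D C1gi inD[OF LS[OF i]]]
  have "C1_family (%_ t. gi ((L ! i) t))" unfolding C1_family_iff using c l unfolding closed_C1_def by simp
  thus k: "closed_C1 (K ! i)" unfolding C1_family_def Kn(1)[OF i] by force
  show "vd (L ! i) t = dd g ((K ! i) t) (vd (K ! i) t)"
   using C1_fam_on_compose(2)[OF C1_fam_on_const[OF k, of UNIV] open_UNIV C1g UNIV_I, of 0 t] Kn(2)[OF i] by simp
 qed
 have K: "embedded K"
 proof (rule embedded_over[OF Le])
  show "closed_C1 (K ! i)" if "i < length L" for i by (rule KC(1)[OF that])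
  show "vd (K ! i) t ~= 0" if i: "i < length L" for i t
   using KC(2)[OF i, of t] embedded_vd[OF Le i, of t] by (auto simp: blinfun.zero_right)
  show "(L ! i) s = (L ! j) t" if "i < length L" "j < length L" "(K ! i) s = (K ! j) t" for i j s t
   using Kn(2)[OF that(1), of s] Kn(2)[OF that(2), of t] that(3) by simp
 qed (simp add: K_def)
 have gL: "curve_map g K = L" by (rule nth_equalityI) (simp_all add: Kn(2) K_def ggi[OF LS])
 have im: "Ph j ` B = g ` (Ps j ` B)" if "j : J" "B <= cylinder" for j B
  unfolding image_image
 proof (rule image_cong[OF refl])
  show "Ph j x = g (Ps j x)" if "x : B" for x
   using gPsi[OF `j : J` subsetD[OF V(2)[OF `j : J`] subsetD[OF `B <= cylinder` that]]] by simp
 qed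
 have disj3: "disj_cyl Ps J"
  unfolding disjoint_family_on_def
 proof (intro ballI impI)
  fix i j assume ij: "i : J" "j : J" "i ~= j"
  hence "g ` (Ps i ` cylinder Int Ps j ` cylinder) = {}"
   using disj unfolding disjoint_family_on_def image_Int[OF injg] im[OF ij(1) order_refl, symmetric] im[OF ij(2) order_refl, symmetric] by metis
  thus "Ps i ` cylinder Int Ps j ` cylinder = {}" by (simp only: image_is_empty)
 qed
 have latc: "lateral <= cylinder" by auto
 have avoid: "(K ! i) t ~: Ps j ` lateral" if i: "i < length K" "j : J" for i j t
 proof
  assume "(K ! i) t : Ps j ` lateral"
  hence "(L ! i) t : Ph j ` lateral" unfolding im[OF i(2) latc] using Kn(2)[of i t] i(1) unfolding K_def by (metis imageI length_curve_map)
  moreover have "(L ! i) t = pt L (i, frac t)" "(i, frac t) : params L"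
   using closed_C1_frac(1)[OF embedded_C1[OF Le], of i t] i(1) unfolding K_def pt_def params_def by (auto simp: frac_lt_1)
  ultimately show False using lat(2)[OF i(2), of 0] by (metis centre_in_cball disjoint_iff imageI zero_le_one)
 qed
 have tr: "snd v ~= 0" if i: "i < length K" and j: "j : J" and x: "x : cylinder" "snd x = 0" "(K ! i) t = Ps j x" and v: "dd (Ps j) x v = vd (K ! i) t" for i j t x v
 proof
  assume v0: "snd v = 0"
  define z where "z = fst x"
  have xz: "x = (z, 0)" using x(2) unfolding z_def by (simp add: prod_eq_iff)
  have zc: "z : cball 0 1" using x(1) unfolding xz by simp
  have i': "i < length L" using i unfolding K_def by simp
  note xV = subsetD[OF V(2)[OF j] x(1)]
  have Lx: "(L ! i) t = Ph j x" using Kn(2)[OF i', of t] gPsi[OF j xV] x(3) by simp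
  have vL: "vd (L ! i) t = dd (Ph j) x v" unfolding KC(2)[OF i'] ddPhi[OF j xV] v x(3) ..
  have p: "(i, frac t) : params L" "pt L (i, frac t) = e j z" "velocity L (i, frac t) = vd (L ! i) t"
   using closed_C1_frac[OF embedded_C1[OF Le i'], of t] i' Lx lat(1)[OF j zc] xz unfolding params_def pt_def velocity_def by (auto simp: frac_lt_1)
  hence "((i, frac t), z) : intersections L (e j)" unfolding intersections_def using zc by simp
  hence zb: "z : ball 0 1" "intersection_det L (e j) (i, frac t) z ~= 0"
   using e j unfolding J_def transverse_def by fastforce+
  have "((%z. (z, 0::real)) has_derivative (%h. (h, 0))) (at z)" by (intro dintros) auto
  from has_derivative_compose[OF this, of "Ph j"] C1_onD(1)[OF W(1,5)[OF j] subsetD[OF V(3)[OF j] xV]]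
  have "((%z. Ph j (z, 0)) has_derivative (%h. dd (Ph j) x (h, 0))) (at z)" unfolding xz by simp
  hence "(e j has_derivative (%h. dd (Ph j) x (h, 0))) (at z)"
   by (rule has_derivative_transform_within_open[OF _ open_ball zb(1)]) (use lat(1)[OF j] in auto)
  from frechet_derivative_at[OF this] have fe: "frechet_derivative (e j) (at z) = (%h. dd (Ph j) x (h, 0))" by simp
  have c: "Re (fst v) *R dd (Ph j) x (1, 0) + Im (fst v) *R dd (Ph j) x (\<i>, 0) + (- 1) *R vd (L ! i) t = 0"
   unfolding vL using blinfun_coordinates[of "dd (Ph j) x" v] v0 by simp
  show False using det_vector_independent(3)[OF _ c] zb(2) unfolding intersection_det_def fe p(3) by fastforce
 qed
 have "alternating_sum J (%S. f (twisted n S Ps K)) = 0"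
  by (rule collars_alternating_sum[OF f J(1,2) K C3 disj3 avoid tr])
 moreover have "f (t_moves n Ph S L) = f (twisted n S Ps K)" if S: "S <= J" for S
 proof -
  define M where "M = curve_map (twists n S Ps) K"
  have dS: "disj_cyl Ph S" "disj_cyl Ps S"
   by (rule disj_cyl_mono[OF _ S], rule disj disj3)+
  have i3: "inj_on (Ps j) cylinder" if "j : J" for j by (rule collar3D(7)[OF C3[OF that]])
  have tm: "t_moves n Ph S L = curve_map (twists n S Ph) L"
   by (rule t_moves_eq[OF finite_subset[OF S J(1)] dS(1) inj4[OF subsetD[OF S]]])
  have cm: "twists n S Ph (g y) = g (twists n S Ps y)" for y
  proof (rule collar_mult_transfer[OF dS(2) _ injg])
   show "Ph j x = g (Ps j x)" if "j : S" "x : cylinder" for j x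
    using gPsi[OF subsetD[OF S that(1)] subsetD[OF V(2)[OF subsetD[OF S that(1)]] that(2)]] by simp
  qed (use i3 S in auto)
  have cc: "curve_map h (curve_map k K) = curve_map (%x. h (k x)) K" for h :: "'y => 'z" and k :: "R3 => 'y" unfolding curve_map_def by simp
  have "t_moves n Ph S L = curve_map (%x. twists n S Ph (g x)) K" using tm cc[of "twists n S Ph" g] unfolding gL by simp
  also have "... = curve_map g M" unfolding cm M_def cc ..
  finally have "t_moves n Ph S L = curve_map R (st M)" unfolding g_def curve_map_def st_def by simp
  moreover have "embedded M" unfolding M_def by (rule embedded_twists[OF f(1) K J(1) C3 disj3 avoid S])
  ultimately show ?thesis unfolding M_def[symmetric] using R(7)[OF is_link_st] by simp
 qed
 ultimately show "alternating_sum {..m} (%S. f (t_moves n Ph S L)) = 0"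
  unfolding J_def[symmetric] using alt_sum_cong[of J "%S. f (t_moves n Ph S L)"] by (metis (no_types, lifting))
qed

theorem theoremE:
  fixes f :: "link \<Rightarrow> 'a::ab_group_add" and n q m :: nat
  assumes "n \<ge> 1" and "link_invariant f"
  shows "(finite_type m f \<longrightarrow> nq_finite n q m f) \<and> (nq_finite 1 q m f \<longrightarrow> finite_type m f)"
  using nq_finite_if_finite_type[OF assms(2)] finite_type_if_nq_finite[OF assms(2)] by blast

end
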